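(* Let $r>3$ be an integer. There exist constants $c_1,c_2>0$, depending only on $r$ and for which the commutator-type estimate (E) recalled in the context holds, such that the following is true. Let $\alpha>0$, $\sigma\geq 0$, and let $u^{in}\in\mathcal D(A^{(r+1)/2}e^{\sigma A^{1/2}})$. Then there exists a unique solution $u$ of $$(I+\alpha^2A)\frac{du}{dt}+B(u,u)=0,\qquad u(0)=u^{in},$$ on $(-\infty,\infty)$, and there is a constant $C_\alpha>0$, depending only on $\alpha$, $r$ and $\|u^{in}\|_{H^r(\mathbb T^3)}$, such that, setting $$p(r)=5\left(\tfrac32\right)^{r-3}-1,\qquad \kappa(\xi)=C_\alpha(1+|\xi|)^{p(r)},$$ one has $\|A^{r/2}u(t)\|_{L^2(\mathbb T^3)}\le\kappa(t)$ for all $t\in\mathbb R$, and $u$ satisfies, for all $t\in(-\infty,\infty)$, $$\alpha^2\|A^{r/2}e^{\tau(t)A^{1/2}}\nabla u(t)\|^2_{L^2(\mathbb T^3)}+\|A^{r/2}e^{\tau(t)A^{1/2}}u(t)\|^2_{L^2(\mathbb T^3)}$$ $$\leq \alpha^2\|A^{r/2}e^{\sigma A^{1/2}}\nabla u^{in}\|^2_{L^2(\mathbb T^3)}+\|A^{r/2}e^{\sigma A^{1/2}}u^{in}\|^2_{L^2(\mathbb T^3)}+2c_1\int_0^{|t|}\kappa^3(\xi)\,d\xi,$$ where $$\tau(t)=\sigma\exp\left(-c_2\int_0^{|t|}h(\xi)\,d\xi\right)$$ and $h>0$ is defined by $$(h(t))^2=1+\alpha^2\|A^{r/2}e^{\sigma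 A^{1/2}}\nabla u^{in}\|^2_{L^2(\mathbb T^3)}+\|A^{r/2}e^{\sigma A^{1/2}}u^{in}\|^2_{L^2(\mathbb T^3)}+2c_1\int_0^{|t|}\kappa^3(\theta)\,d\theta.$$
   Context: $\mathbb T^3=[0,1]^3$ is the periodic unit torus. $L^p$ and $H^m$ are the usual Lebesgue and Sobolev spaces on $\mathbb T^3$. $\mathcal V$ is the set of $\mathbb R^3$-valued trigonometric polynomials $\varphi$ on $\mathbb T^3$ with $\nabla\cdot\varphi=0$ and $\int_{\mathbb T^3}\varphi\,dx=0$. $H$ and $V$ are the closures of $\mathcal V$ in $L^2$ and $H^1$, respectively, and $V'$ is the dual of $V$. $P_\sigma:L^2\to H$ is the Leray-Helmholtz (orthogonal) projection, and $A=-P_\sigma\triangle$ is the Stokes operator, with domain $H^2\cap V$ (here $A=-\triangle$ because of periodicity); it extends to a bounded operator $V\to V'$. $A$ is positive and self-adjoint on $H$ with compact inverse, and $A^{r}$, $e^{\tau A^{1/2}}$ are defined by functional calculus (Fourier multipliers), acting on each component of $\nabla u$ as Fourier multipliers. $B(w_1,w_2)=P_\sigma((w_1\cdot\nabla)w_2)$ for $w_1,w_2\in\mathcal V$, extended to a continuous bilinear map $B:V\times V\to V'$. For $q\ge0$ and $\tau\ge0$, $\mathcal D(A^{q}e^{\tau A^{1/2}})$ is the Gevrey class of $u\in H^{2q}(\mathbb T^3)\cap V$ such that $\|A^{q}e^{\tau A^{1/2}}u\|_{L^2(\mathbb T^3)}<\infty$. A function $u\in C^1((T_1,T_2),V)$,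 $T_1\le 0<T_2$, is a solution on $(T_1,T_2)$ if it satisfies $(I+\alpha^2A)\frac{du}{dt}+B(u,u)=0$ in the sense of $V'$ and $u(0)=u^{in}$. This is the functional form of the Euler-Voigt system with periodic boundary conditions and zero forcing. Estimate (E): for every $\tau\ge 0$, every $\psi\in\mathcal D(A^{r/2+1/4}e^{\tau A^{1/2}})$ with $\nabla\cdot\psi=0$ and every $\varphi\in\mathcal D(A^{r/2+1/2}e^{\tau A^{1/2}})$, $$\left|\left(A^{r/2}e^{\tau A^{1/2}}B(\psi,\varphi),A^{r/2}e^{\tau A^{1/2}}\varphi\right)\right|\le c_1\|A^{r/2}\psi\|_{L^2}\|A^{r/2}\varphi\|_{L^2}^2$$ $$+\tau c_2\Big(\|A^{r/2}e^{\tau A^{1/2}}\psi\|_{L^2}\|A^{r/2+1/4}e^{\tau A^{1/2}}\varphi\|_{L^2}^2+\|A^{r/2+1/4}e^{\tau A^{1/2}}\psi\|_{L^2}\|A^{r/2}e^{\tau A^{1/2}}\varphi\|_{L^2}\|A^{r/2+1/4}e^{\tau A^{1/2}}\varphi\|_{L^2}\Big),$$ where $(\cdot,\cdot)$ is the $L^2$ inner product. (Known from the literature; it holds with constants depending only on $r$, for $r>3$.) *)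

theory Defs
  imports "HOL-Analysis.Analysis"
begin

(* Fields on the torus are total functions on real^3 of which only the values on the unit cube
   matter, up to null sets.  Operators with values in classes of functions modulo null sets choose
   a representative with SOME; all norms and inner products below are insensitive to the choice. *)

abbreviation T3 :: "(real^3) measure" where
  "T3 \<equiv> lebesgue_on (cbox 0 1)"

definition L2 :: "(real^3 \<Rightarrow> 'a::real_normed_vector) set" where
  "L2 = {f. f \<in> borel_measurable T3 \<and> integrable T3 (\<lambda>x. (norm (f x))\<^sup>2)}"

(* For matrix fields, norm on real^3^3 is the Frobenius norm, so this is the usual norm of grad u. *)
definition L2_norm :: "(real^3 \<Rightarrow> 'a::real_normed_vector) \<Rightarrow> real" where
  "L2_norm f = sqrt (LINT x|T3. (norm (f x))\<^sup>2)"

definition L2_inner :: "(real^3 \<Rightarrow> real^3) \<Rightarrow> (real^3 \<Rightarrow> real^3) \<Rightarrow> real" where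
  "L2_inner f g = (LINT x|T3. f x \<bullet> g x)"

subsection \<open>Fourier coefficients, multipliers and Sobolev spaces\<close>

definition freq :: "int^3 \<Rightarrow> real^3" where
  "freq k = (\<chi> j. 2 * pi * real_of_int (k $ j))"

definition fourier_coeff :: "(real^3 \<Rightarrow> real) \<Rightarrow> int^3 \<Rightarrow> complex" where
  "fourier_coeff g k = (LINT x|T3. complex_of_real (g x) * cis (- (freq k \<bullet> x)))"

definition is_multiplied :: "(int^3 \<Rightarrow> complex) \<Rightarrow> (real^3 \<Rightarrow> real) \<Rightarrow> (real^3 \<Rightarrow> real) \<Rightarrow> bool" where
  "is_multiplied m g h \<longleftrightarrow> h \<in> L2 \<and> (\<forall>k. fourier_coeff h k = m k * fourier_coeff g k)"

(* Meaningful when the multiplied series is in L2; h is real-valued because every symbol used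
   below satisfies m (- k) = cnj (m k). *)
definition fourier_mult :: "(int^3 \<Rightarrow> complex) \<Rightarrow> (real^3 \<Rightarrow> real) \<Rightarrow> (real^3 \<Rightarrow> real)" where
  "fourier_mult m g = (SOME h. is_multiplied m g h)"

definition vec_mult :: "(int^3 \<Rightarrow> complex) \<Rightarrow> (real^3 \<Rightarrow> real^3) \<Rightarrow> (real^3 \<Rightarrow> real^3)" where
  "vec_mult m u = (\<lambda>x. \<chi> i. fourier_mult m (\<lambda>y. u y $ i) x)"

definition mat_mult :: "(int^3 \<Rightarrow> complex) \<Rightarrow> (real^3 \<Rightarrow> real^3^3) \<Rightarrow> (real^3 \<Rightarrow> real^3^3)" where
  "mat_mult m G = (\<lambda>x. \<chi> i. vec_mult m (\<lambda>y. G y $ i) x)"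

(* Row i, column j holds the weak derivative of u_i in direction j. *)
definition grad :: "(real^3 \<Rightarrow> real^3) \<Rightarrow> (real^3 \<Rightarrow> real^3^3)" where
  "grad u = (\<lambda>x. \<chi> i j. fourier_mult (\<lambda>k. \<i> * of_real (freq k $ j)) (\<lambda>y. u y $ i) x)"

definition laplace :: "(real^3 \<Rightarrow> real^3) \<Rightarrow> (real^3 \<Rightarrow> real^3)" where
  "laplace u = vec_mult (\<lambda>k. - of_real ((norm (freq k))\<^sup>2)) u"

definition sobolev_term :: "real \<Rightarrow> (real^3 \<Rightarrow> real^3) \<Rightarrow> int^3 \<Rightarrow> real" where
  "sobolev_term s u k = (1 + (norm (freq k))\<^sup>2) powr s *
     (\<Sum>i\<in>UNIV. (cmod (fourier_coeff (\<lambda>x. u x $ i) k))\<^sup>2)"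

definition sobolev :: "real \<Rightarrow> (real^3 \<Rightarrow> real^3) set" where
  "sobolev s = {u \<in> L2. sobolev_term s u summable_on UNIV}"

definition sobolev_norm :: "real \<Rightarrow> (real^3 \<Rightarrow> real^3) \<Rightarrow> real" where
  "sobolev_norm s u = sqrt (infsum (sobolev_term s u) UNIV)"

subsection \<open>Solenoidal spaces and the Leray projection\<close>

definition trig_polys :: "(real^3 \<Rightarrow> real^3) set" where
  "trig_polys = {\<phi>. \<exists>K a b. finite K \<and>
     (\<forall>x. \<phi> x = (\<Sum>k\<in>K. cos (freq k \<bullet> x) *\<^sub>R a k + sin (freq k \<bullet> x) *\<^sub>R b k))}"

definition solenoidal_polys :: "(real^3 \<Rightarrow> real^3) set" where
  "solenoidal_polys = {\<phi> \<in> trig_polys.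
     (\<forall>x. (\<Sum>j\<in>UNIV. frechet_derivative \<phi> (at x) (axis j 1) $ j) = 0) \<and>
     (LINT x|T3. \<phi> x) = 0}"

definition H_space :: "(real^3 \<Rightarrow> real^3) set" where
  "H_space = {f \<in> L2. \<forall>\<epsilon>>0. \<exists>\<phi>\<in>solenoidal_polys. L2_norm (\<lambda>x. f x - \<phi> x) < \<epsilon>}"

definition V_space :: "(real^3 \<Rightarrow> real^3) set" where
  "V_space = {f \<in> sobolev 1. \<forall>\<epsilon>>0. \<exists>\<phi>\<in>solenoidal_polys. sobolev_norm 1 (\<lambda>x. f x - \<phi> x) < \<epsilon>}"

definition leray :: "(real^3 \<Rightarrow> real^3) \<Rightarrow> (real^3 \<Rightarrow> real^3)" where
  "leray f = (SOME g. g \<in> H_space \<and> (\<forall>h\<in>H_space. L2_inner (\<lambda>x. f x - g x) h = 0))"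

definition H1_tendsto :: "(nat \<Rightarrow> real^3 \<Rightarrow> real^3) \<Rightarrow> (real^3 \<Rightarrow> real^3) \<Rightarrow> bool" where
  "H1_tendsto \<phi> w \<longleftrightarrow> (\<lambda>n. sobolev_norm 1 (\<lambda>x. \<phi> n x - w x)) \<longlonglongrightarrow> 0"

subsection \<open>The Stokes operator and Gevrey classes\<close>

definition stokes_domain :: "(real^3 \<Rightarrow> real^3) set" where
  "stokes_domain = sobolev 2 \<inter> V_space"

definition stokes :: "(real^3 \<Rightarrow> real^3) \<Rightarrow> (real^3 \<Rightarrow> real^3)" where
  "stokes u = leray (\<lambda>x. - laplace u x)"

(* The continuous extension of the Stokes operator to a map from V to its dual, evaluated at v
   (as usual, H is embedded in the dual of V through the L2 inner product). *)
definition stokes_dual :: "(real^3 \<Rightarrow> real^3) \<Rightarrow> (real^3 \<Rightarrow> real^3) \<Rightarrow> real" where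
  "stokes_dual w v = (THE l. \<forall>\<phi>. (\<forall>n. \<phi> n \<in> stokes_domain) \<longrightarrow> H1_tendsto \<phi> w \<longrightarrow>
     (\<lambda>n. L2_inner (stokes (\<phi> n)) v) \<longlonglongrightarrow> l)"

(* Symbol of A^q e^{tau A^(1/2)}: the eigenvalue of A at k is |freq k|^2.  The value at k = 0
   is immaterial, since the operator is only applied to fields of mean zero. *)
definition gevrey_symbol :: "real \<Rightarrow> real \<Rightarrow> int^3 \<Rightarrow> complex" where
  "gevrey_symbol q \<tau> k = of_real (norm (freq k) powr (2 * q) * exp (\<tau> * norm (freq k)))"

abbreviation Aexp :: "real \<Rightarrow> real \<Rightarrow> (real^3 \<Rightarrow> real^3) \<Rightarrow> (real^3 \<Rightarrow> real^3)" where
  "Aexp q \<tau> \<equiv> vec_mult (gevrey_symbol q \<tau>)"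

abbreviation Aexp_mat :: "real \<Rightarrow> real \<Rightarrow> (real^3 \<Rightarrow> real^3^3) \<Rightarrow> (real^3 \<Rightarrow> real^3^3)" where
  "Aexp_mat q \<tau> \<equiv> mat_mult (gevrey_symbol q \<tau>)"

definition gevrey :: "real \<Rightarrow> real \<Rightarrow> (real^3 \<Rightarrow> real^3) set" where
  "gevrey q \<tau> = {u \<in> sobolev (2 * q) \<inter> V_space.
     \<exists>w\<in>L2. \<forall>i. is_multiplied (gevrey_symbol q \<tau>) (\<lambda>x. u x $ i) (\<lambda>x. w x $ i)}"

subsection \<open>The nonlinearity\<close>

(* P_sigma ((w1 . grad) w2), for fields with (w1 . grad) w2 in L2; on such fields in V it
   represents the extension advection_dual below. *)
definition advection :: "(real^3 \<Rightarrow> real^3) \<Rightarrow> (real^3 \<Rightarrow> real^3) \<Rightarrow> (real^3 \<Rightarrow> real^3)" where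
  "advection w1 w2 = leray (\<lambda>x. grad w2 x *v w1 x)"

(* The continuous extension of the above from trigonometric polynomials to a map from V x V to
   the dual of V, evaluated at v. *)
definition advection_dual ::
    "(real^3 \<Rightarrow> real^3) \<Rightarrow> (real^3 \<Rightarrow> real^3) \<Rightarrow> (real^3 \<Rightarrow> real^3) \<Rightarrow> real" where
  "advection_dual w1 w2 v = (THE l. \<forall>\<phi> \<psi>.
     (\<forall>n. \<phi> n \<in> solenoidal_polys) \<longrightarrow> (\<forall>n. \<psi> n \<in> solenoidal_polys) \<longrightarrow>
     H1_tendsto \<phi> w1 \<longrightarrow> H1_tendsto \<psi> w2 \<longrightarrow>
     (\<lambda>n. L2_inner (advection (\<phi> n) (\<psi> n)) v) \<longlonglongrightarrow> l)"

(* The condition on grad \<psi> is implied by \<psi> in V. *)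
definition commutator_estimate :: "real \<Rightarrow> real \<Rightarrow> real \<Rightarrow> bool" where
  "commutator_estimate r c1 c2 \<longleftrightarrow>
     (\<forall>\<tau>\<ge>0. \<forall>\<psi>\<in>gevrey (r/2 + 1/4) \<tau>. \<forall>\<phi>\<in>gevrey (r/2 + 1/2) \<tau>.
       (AE x in T3. trace (grad \<psi> x) = 0) \<longrightarrow>
       \<bar>L2_inner (Aexp (r/2) \<tau> (advection \<psi> \<phi>)) (Aexp (r/2) \<tau> \<phi>)\<bar>
       \<le> c1 * L2_norm (Aexp (r/2) 0 \<psi>) * (L2_norm (Aexp (r/2) 0 \<phi>))\<^sup>2
         + \<tau> * c2 *
           (L2_norm (Aexp (r/2) \<tau> \<psi>) * (L2_norm (Aexp (r/2 + 1/4) \<tau> \<phi>))\<^sup>2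
            + L2_norm (Aexp (r/2 + 1/4) \<tau> \<psi>) * L2_norm (Aexp (r/2) \<tau> \<phi>)
              * L2_norm (Aexp (r/2 + 1/4) \<tau> \<phi>)))"

subsection \<open>Solutions of the Euler--Voigt system\<close>

(* u is of class C^1 on the open set I with values in V and derivative du. *)
definition C1_V ::
    "real set \<Rightarrow> (real \<Rightarrow> real^3 \<Rightarrow> real^3) \<Rightarrow> (real \<Rightarrow> real^3 \<Rightarrow> real^3) \<Rightarrow> bool" where
  "C1_V I u du \<longleftrightarrow> (\<forall>t\<in>I. u t \<in> V_space \<and> du t \<in> V_space \<and>
     ((\<lambda>s. sobolev_norm 1 (\<lambda>x. (u s x - u t x) /\<^sub>R (s - t) - du t x)) \<longlongrightarrow> 0) (at t) \<and>
     ((\<lambda>s. sobolev_norm 1 (\<lambda>x. du s x - du t x)) \<longlongrightarrow> 0) (at t))"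

definition euler_voigt_solution ::
    "real \<Rightarrow> (real^3 \<Rightarrow> real^3) \<Rightarrow> ereal \<Rightarrow> ereal \<Rightarrow> (real \<Rightarrow> real^3 \<Rightarrow> real^3) \<Rightarrow> bool" where
  "euler_voigt_solution \<alpha> u_in T1 T2 u \<longleftrightarrow>
     (\<exists>du. C1_V {t. T1 < ereal t \<and> ereal t < T2} u du \<and>
       (\<forall>t. T1 < ereal t \<and> ereal t < T2 \<longrightarrow>
         (\<forall>v\<in>V_space. L2_inner (du t) v + \<alpha>\<^sup>2 * stokes_dual (du t) v
                         + advection_dual (u t) (u t) v = 0))) \<and>
     (AE x in T3. u 0 x = u_in x)"

definition voigt_energy :: "real \<Rightarrow> real \<Rightarrow> real \<Rightarrow> (real^3 \<Rightarrow> real^3) \<Rightarrow> real" where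
  "voigt_energy \<alpha> r \<tau> u = \<alpha>\<^sup>2 * (L2_norm (Aexp_mat (r/2) \<tau> (grad u)))\<^sup>2
                           + (L2_norm (Aexp (r/2) \<tau> u))\<^sup>2"

end

theory Submission
  imports Defs
begin

text \<open>
  Multiplied by the inverse square root of \<open>I + \<alpha>\<^sup>2 A\<close>, the Euler--Voigt system becomes an ordinary differential
  equation \<open>b' = Q(b, b)\<close> for \<open>b = (I + \<alpha>\<^sup>2 A)\<^sup>1\<^sup>/\<^sup>2 u\<close> in the Hilbert space \<open>H\<close>. The smoothing makes \<open>Q\<close> a bounded
  bilinear map, and the antisymmetry of the transport term gives \<open>b \<bullet> Q(b, b) = 0\<close>. Hence there is a unique global
  flow, which conserves \<open>\<parallel>b\<parallel>\<close> (\<open>quadratic_flow_exists\<close>, \<open>quadratic_flow_unique\<close>). The whole analysis is done on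
  Fourier coefficients, that is, on square-summable families over the integer lattice.

  The quantitative estimates are proved for Galerkin truncations, where all sums are finite and can be differentiated
  in time, and then passed to the limit (\<open>quadratic_flow_limit\<close>). In the time derivative of a weighted norm with weight
  \<open>W\<close>, antisymmetry leaves only the commutator \<open>W\<^sub>k (W\<^sub>k - W\<^sub>m)\<close> of the weight with the transport
  (\<open>trilinear_commutator\<close>).

  For powers of \<open>\<bar>k\<bar>\<close>, interpolation of the commutator between the conserved energy and the top norm gives a
  differential inequality \<open>Z' \<le> K Z\<^bsup>1-\<gamma>\<^esup>\<close> and thus polynomial growth (\<open>galerkin_growth\<close>). A single interpolation at
  the level \<open>r\<close> yields an exponent linear in \<open>r\<close>, which is at most the exponent \<open>5 (3/2)\<^bsup>r-3\<^esup> - 1\<close> of the theorem, with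
  equality for \<open>r = 4\<close>.

  For Gevrey weights \<open>\<bar>k\<bar>\<^sup>r e\<^bsup>\<tau>\<bar>k\<bar>\<^esup>\<close>, the commutator splits into a part without exponentials, bounded by the cube of
  the Sobolev norm just estimated, and a part with a factor \<open>\<tau>\<close> and half a derivative too many
  on each of two factors (\<open>gevrey_commutator_sum\<close>). A radius that decreases at the rate \<open>\<tau>' = - c\<^sub>2 h \<tau>\<close> produces a dissipation of exactly this
  order. It absorbs the second part as long as the Gevrey norm stays below \<open>h\<close>, which a bootstrap argument ensures
  (\<open>galerkin_gevrey\<close>).

  The remaining work identifies the concrete function spaces and operators with their counterparts on Fourier
  coefficients. This needs Parseval's identity and the Riesz--Fischer theorem for Fourier series on the cube. The spaces
  \<open>H\<close> and \<open>V\<close> become weighted sequence spaces, the operators defined by density become the expected sums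
  (\<open>stokes_dual_eq\<close>, \<open>advection_dual_eq\<close>), and solutions of the system become orbits of the flow and vice versa
  (\<open>flow_of_solution\<close>, \<open>solution_of_flow\<close>).
\<close>

section \<open>Conservative quadratic equations in a Hilbert space\<close>

subsection \<open>Global flows of bounded Lipschitz vector fields\<close>

text \<open>One of the two integrals vanishes, so that \<open>primitive f t\<close> is the integral from
  0 to \<open>t\<close> for both signs of \<open>t\<close>.\<close>

definition primitive :: "(real \<Rightarrow> 'a::banach) \<Rightarrow> real \<Rightarrow> 'a" where
  "primitive f t = integral {0..t} f - integral {t..0} f"

lemma primitive_0 [simp]: "primitive f 0 = 0"
  by (simp add: primitive_def)

lemma primitive_has_vector_derivative:
  fixes f :: "real \<Rightarrow> 'a::banach"
  assumes f: "continuous_on UNIV f"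
  shows "(primitive f has_vector_derivative f t) (at t)"
proof -
  define T where "T = \<bar>t\<bar> + 1"
  have T: "-T < t" "t < T" "0 < T" by (auto simp: T_def)
  have int: "f integrable_on {a..b}" for a b
    by (rule integrable_continuous_real) (rule continuous_on_subset[OF f], simp)
  have eq: "integral {-T..s} f - integral {-T..0} f = primitive f s" if "s \<in> {-T<..<T}" for s
  proof (cases "0 \<le> s")
    case True
    have "integral {-T..0} f + integral {0..s} f = integral {-T..s} f"
      using T True by (intro Henstock_Kurzweil_Integration.integral_combine int) auto
    moreover have "integral {s..0} f = 0"
      using True by (cases "s = 0") auto
    ultimately show ?thesis by (simp add: primitive_def algebra_simps)
  next
    case False
    have "integral {-T..s} f + integral {s..0} f = integral {-T..0} f"
      using T False that by (intro Henstock_Kurzweil_Integration.integral_combine int) auto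
    moreover have "integral {0..s} f = 0"
      using False by auto
    ultimately show ?thesis by (simp add: primitive_def algebra_simps)
  qed
  have "((\<lambda>s. integral {-T..s} f) has_vector_derivative f t) (at t within {-T..T})"
    using T by (intro integral_has_vector_derivative continuous_on_subset[OF f]) auto
  then have "((\<lambda>s. integral {-T..s} f) has_vector_derivative f t) (at t)"
    using T at_within_Icc_at[of "-T" t T] by simp
  then have "((\<lambda>s. integral {-T..s} f - integral {-T..0} f) has_vector_derivative (f t - 0)) (at t)"
    by (intro has_vector_derivative_diff has_vector_derivative_const)
  then have "((\<lambda>s. integral {-T..s} f - integral {-T..0} f) has_vector_derivative f t) (at t)"
    by simp
  then show ?thesis
    by (rule has_vector_derivative_transform_within_open[where S = "{-T<..<T}"])
       (use T eq in auto)
qed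

lemma norm_primitive_le_exp:
  fixes f :: "real \<Rightarrow> 'a::banach"
  assumes f: "continuous_on UNIV f" and L: "L > 0"
    and bd: "\<And>s. norm (f s) \<le> B * exp (L * \<bar>s\<bar>)"
  shows "norm (primitive f t) \<le> B / L * exp (L * \<bar>t\<bar>)"
proof -
  have "0 \<le> norm (f 0)" by simp
  also have "\<dots> \<le> B" using bd[of 0] by simp
  finally have B: "B \<ge> 0" .
  have cont: "continuous_on S (primitive f)" for S
    using primitive_has_vector_derivative[OF f]
    by (intro continuous_at_imp_continuous_on ballI has_vector_derivative_continuous) blast
  consider "t = 0" | "t > 0" | "t < 0" by linarith
  then show ?thesis
  proof cases
    case 1 then show ?thesis using B L by simp
  next
    case 2
    have "norm (primitive f t - primitive f 0) \<le> B / L * exp (L * t) - B / L * exp (L * 0)"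
    proof (rule differentiable_bound_general[OF 2 cont])
      show "continuous_on {0..t} (\<lambda>s. B / L * exp (L * s))" by (intro continuous_intros)
      fix x assume x: "0 < x" "x < t"
      show "(primitive f has_vector_derivative f x) (at x)"
        by (rule primitive_has_vector_derivative[OF f])
      show "((\<lambda>s. B / L * exp (L * s)) has_vector_derivative B * exp (L * x)) (at x)"
        using L by (auto intro!: derivative_eq_intros simp: has_real_derivative_iff_has_vector_derivative[symmetric])
      show "norm (f x) \<le> B * exp (L * x)" using bd[of x] x by simp
    qed
    also have "\<dots> \<le> B / L * exp (L * t)" using B L by simp
    finally show ?thesis using 2 by simp
  next
    case 3
    have "norm (primitive f 0 - primitive f t) \<le> (- (B / L) * exp (- L * 0)) - (- (B / L) * exp (- L * t))"
    proof (rule differentiable_bound_general[OF 3 cont])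
      show "continuous_on {t..0} (\<lambda>s. - (B / L) * exp (- L * s))" by (intro continuous_intros)
      fix x assume x: "t < x" "x < 0"
      show "(primitive f has_vector_derivative f x) (at x)"
        by (rule primitive_has_vector_derivative[OF f])
      show "((\<lambda>s. - (B / L) * exp (- L * s)) has_vector_derivative B * exp (- L * x)) (at x)"
        using L by (auto intro!: derivative_eq_intros simp: has_real_derivative_iff_has_vector_derivative[symmetric])
      show "norm (f x) \<le> B * exp (- L * x)" using bd[of x] x by simp
    qed
    also have "\<dots> \<le> B / L * exp (- L * t)" using B L by simp
    finally show ?thesis using 3 by simp
  qed
qed

text \<open>Picard iteration is a contraction on the whole real line at once when the curves are
  measured with the weight \<open>exp (- 2 L \<bar>t\<bar>)\<close>: integrating \<open>exp (2 L \<bar>t\<bar>)\<close> gains the factor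
  \<open>1 / (2 L)\<close>, which beats the Lipschitz constant.\<close>

lemma bounded_lipschitz_flow_exists:
  fixes F :: "'a::banach \<Rightarrow> 'a"
  assumes L: "L > 0" and lip: "\<And>x y. norm (F x - F y) \<le> L * norm (x - y)"
    and M: "\<And>x. norm (F x) \<le> M"
  obtains u where "u 0 = x0" "\<And>t. (u has_vector_derivative F (u t)) (at t)"
proof -
  define W where "W t = exp (2 * L * \<bar>t\<bar>)" for t :: real
  have W: "W t \<ge> 1" "W t > 0" for t using L by (auto simp: W_def)
  have contW: "continuous_on UNIV W" unfolding W_def by (intro continuous_intros)
  have contF: "continuous_on UNIV F"
  proof (rule lipschitz_on_continuous_on)
    show "L-lipschitz_on UNIV F" using lip L by (intro lipschitz_onI) (auto simp: dist_norm)
  qed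
  define G where "G v s = F (W s *\<^sub>R apply_bcontfun v s)" for v :: "real \<Rightarrow>\<^sub>C 'a" and s
  have contG: "continuous_on UNIV (G v)" for v
    unfolding G_def
    by (intro continuous_on_compose2[OF contF] continuous_intros contW) auto
  define \<Phi> where "\<Phi> v t = (1 / W t) *\<^sub>R (x0 + primitive (G v) t)" for v t
  have contP: "continuous_on UNIV (primitive (G v))" for v
    using primitive_has_vector_derivative[OF contG]
    by (intro continuous_at_imp_continuous_on ballI has_vector_derivative_continuous) blast
  have in_bc: "\<Phi> v \<in> bcontfun" for v
  proof (rule bcontfun_normI)
    show "continuous_on UNIV (\<Phi> v)" unfolding \<Phi>_def
      using W(2) by (intro continuous_intros contW contP) (auto simp: less_imp_neq[symmetric])
    fix t
    have "0 \<le> M" using M[of 0] norm_ge_zero order_trans by blast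
    then have "norm (G v s) \<le> M * exp (2 * L * \<bar>s\<bar>)" for s
      using M[of "W s *\<^sub>R apply_bcontfun v s"] L mult_left_mono[of 1 "exp (2 * L * \<bar>s\<bar>)" M]
      unfolding G_def by (smt (verit) mult_nonneg_nonneg one_le_exp_iff)
    then have p: "norm (primitive (G v) t) \<le> M / (2 * L) * W t"
      unfolding W_def using L by (intro norm_primitive_le_exp contG) auto
    have "norm (\<Phi> v t) = norm (x0 + primitive (G v) t) / W t"
      using W(2)[of t] by (simp add: \<Phi>_def)
    also have "\<dots> \<le> (norm x0 + M / (2 * L) * W t) / W t"
      using p W(2)[of t] by (intro divide_right_mono norm_triangle_le) auto
    also have "\<dots> \<le> norm x0 + M / (2 * L)"
      using W[of t] by (simp add: add_divide_distrib) (simp add: divide_le_eq mult_left_mono mult_le_cancel_left1)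
    finally show "norm (\<Phi> v t) \<le> norm x0 + M / (2 * L)" .
  qed
  define \<Psi> where "\<Psi> v = Bcontfun (\<Phi> v)" for v
  have app: "apply_bcontfun (\<Psi> v) t = \<Phi> v t" for v t
    using Bcontfun_inverse[OF in_bc[of v]] by (simp add: \<Psi>_def)
  have "\<exists>!v. \<Psi> v = v"
  proof (rule banach_fix_type)
    show "(0::real) \<le> 1/2" "(1/2::real) < 1" by auto
    show "\<forall>v w. dist (\<Psi> v) (\<Psi> w) \<le> 1/2 * dist v w"
    proof (intro allI dist_bound)
      fix v w :: "real \<Rightarrow>\<^sub>C 'a" and t
      define D where "D s = G v s - G w s" for s
      have cD: "continuous_on UNIV D" unfolding D_def by (intro continuous_intros contG)
      have "norm (D s) \<le> (L * dist v w) * exp (2 * L * \<bar>s\<bar>)" for s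
      proof -
        have "norm (D s) \<le> L * norm (W s *\<^sub>R apply_bcontfun v s - W s *\<^sub>R apply_bcontfun w s)"
          unfolding D_def G_def by (rule lip)
        also have "\<dots> = L * (W s * dist (apply_bcontfun v s) (apply_bcontfun w s))"
          using W(2)[of s] by (simp add: scaleR_diff_right[symmetric] dist_norm)
        also have "\<dots> \<le> L * (W s * dist v w)"
          using L W(2)[of s] by (intro mult_left_mono dist_bounded) auto
        finally show ?thesis by (simp add: W_def mult_ac)
      qed
      then have "norm (primitive D t) \<le> (L * dist v w) / (2 * L) * W t"
        unfolding W_def using L by (intro norm_primitive_le_exp cD) auto
      moreover have "primitive D t = primitive (G v) t - primitive (G w) t"
      proof -
        have "G z integrable_on {a..b}" for z a b
          by (rule integrable_continuous_real) (rule continuous_on_subset[OF contG], simp)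
        then show ?thesis
          unfolding primitive_def D_def
          by (subst (1 2) Henstock_Kurzweil_Integration.integral_diff) auto
      qed
      ultimately have "norm (primitive (G v) t - primitive (G w) t) \<le> dist v w / 2 * W t"
        using L by simp
      then have "norm ((1 / W t) *\<^sub>R (primitive (G v) t - primitive (G w) t)) \<le> dist v w / 2"
        using W(2)[of t] by (simp add: divide_le_eq)
      then show "dist (apply_bcontfun (\<Psi> v) t) (apply_bcontfun (\<Psi> w) t) \<le> 1/2 * dist v w"
        by (simp add: app \<Phi>_def dist_norm scaleR_diff_right[symmetric])
    qed
  qed
  then obtain v where v: "\<Psi> v = v" by blast
  define u where "u t = W t *\<^sub>R apply_bcontfun v t" for t
  have u: "u t = x0 + primitive (G v) t" for t
    using app[of v t] W(2)[of t] unfolding v by (simp add: u_def \<Phi>_def)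
  show thesis
  proof
    show "u 0 = x0" by (simp add: u)
    fix t
    have "((\<lambda>t. x0 + primitive (G v) t) has_vector_derivative 0 + G v t) (at t)"
      by (intro has_vector_derivative_add has_vector_derivative_const
          primitive_has_vector_derivative contG)
    moreover have "(\<lambda>t. x0 + primitive (G v) t) = u" using u by auto
    ultimately show "(u has_vector_derivative F (u t)) (at t)"
      by (simp add: G_def u_def)
  qed
qed

subsection \<open>Radial truncation\<close>

definition radial :: "real \<Rightarrow> 'a::real_normed_vector \<Rightarrow> 'a" where
  "radial R x = min 1 (R / norm x) *\<^sub>R x"

lemma norm_radial_le: "R \<ge> 0 \<Longrightarrow> norm (radial R x) \<le> R"
  by (cases "x = 0") (auto simp: radial_def min_def divide_le_eq)

lemma radial_eq: "norm x \<le> R \<Longrightarrow> radial R x = x"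
  by (cases "x = 0") (auto simp: radial_def min_def)

lemma radial_lipschitz:
  assumes R: "R \<ge> 0"
  shows "norm (radial R x - radial R y) \<le> 2 * norm (x - y)"
proof -
  have main: "norm (radial R x - radial R y) \<le> 2 * norm (x - y)" if le: "norm y \<le> norm x"
    for x y :: 'a
  proof -
    define lx ly where "lx = min 1 (R / norm x)" and "ly = min 1 (R / norm y)"
    have lx: "0 \<le> lx" "lx \<le> 1" using R by (auto simp: lx_def)
    have "\<bar>lx - ly\<bar> * norm y \<le> norm (x - y)"
    proof (cases "norm x \<le> R \<or> y = 0")
      case True
      moreover have "lx = 1" if "norm x \<le> R" "y \<noteq> 0"
        using that le by (auto simp: lx_def min_def) (metis div_by_0 dual_order.trans eq_iff le_divide_eq_1_pos norm_le_zero_iff norm_zero zero_less_norm_iff)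
      moreover have "ly = 1" if "norm x \<le> R" "y \<noteq> 0"
        using that le by (auto simp: ly_def min_def)
      ultimately show ?thesis by (cases "y = 0") auto
    next
      case False
      then have x: "norm x > R" and y: "norm y > 0" by auto
      then have x0: "norm x > 0" using R by linarith
      have lxe: "lx = R / norm x" using x x0 R by (auto simp: lx_def min_def divide_le_eq)
      have ly: "lx \<le> ly" "ly * norm y \<le> R"
        using x x0 y R le mult_left_mono[OF le R]
        by (auto simp: lxe ly_def min_def divide_le_eq le_divide_eq frac_le)
      have "\<bar>lx - ly\<bar> * norm y = ly * norm y - lx * norm y" using ly by (simp add: algebra_simps)
      also have "\<dots> \<le> lx * norm x - lx * norm y" using ly x0 by (simp add: lxe)
      also have "\<dots> = lx * (norm x - norm y)" by (simp add: algebra_simps)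
      also have "\<dots> \<le> 1 * (norm x - norm y)" using lx le by (intro mult_right_mono) auto
      also have "\<dots> \<le> norm (x - y)" by (simp add: norm_triangle_ineq2)
      finally show ?thesis .
    qed
    moreover have "norm (lx *\<^sub>R (x - y)) \<le> norm (x - y)"
      using lx by (simp add: mult_left_le_one_le)
    moreover have "radial R x - radial R y = lx *\<^sub>R (x - y) + (lx - ly) *\<^sub>R y"
      by (simp add: radial_def lx_def ly_def algebra_simps)
    ultimately show ?thesis
      using norm_triangle_ineq[of "lx *\<^sub>R (x - y)" "(lx - ly) *\<^sub>R y"] by simp
  qed
  show ?thesis
    using main[of y x] main[of x y] by (metis linear norm_minus_commute)
qed

subsection \<open>Quadratic flows that conserve the norm\<close>

definition quadratic_flow :: "('a \<Rightarrow> 'a \<Rightarrow> 'a::real_normed_vector) \<Rightarrow> (real \<Rightarrow> 'a) \<Rightarrow> bool" where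
  "quadratic_flow Q u \<longleftrightarrow> (\<forall>t. (u has_vector_derivative Q (u t) (u t)) (at t))"

lemma quadratic_flow_reverse:
  assumes "bounded_bilinear Q" "quadratic_flow Q u"
  shows "quadratic_flow Q (\<lambda>t. - u (- t))"
  unfolding quadratic_flow_def
proof
  fix t
  interpret bounded_bilinear Q by fact
  have "(u has_vector_derivative Q (u (-t)) (u (-t))) (at (- t))"
    using assms(2) by (simp add: quadratic_flow_def)
  then have "((u \<circ> uminus) has_vector_derivative (-1) *\<^sub>R Q (u (-t)) (u (-t))) (at t)"
    by (intro vector_diff_chain_at) (auto intro!: derivative_eq_intros)
  then have "((\<lambda>t. - u (-t)) has_vector_derivative - ((-1) *\<^sub>R Q (u (-t)) (u (-t)))) (at t)"
    by (intro has_vector_derivative_minus) (simp add: o_def)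
  then show "((\<lambda>t. - u (-t)) has_vector_derivative Q (- u (-t)) (- u (-t))) (at t)"
    by (simp add: minus_left minus_right)
qed

lemma has_real_derivative_inner:
  fixes u v :: "real \<Rightarrow> 'a::real_inner"
  assumes "(u has_vector_derivative u') (at t)" "(v has_vector_derivative v') (at t)"
  shows "((\<lambda>t. u t \<bullet> v t) has_real_derivative u t \<bullet> v' + u' \<bullet> v t) (at t)"
  using bounded_bilinear.has_vector_derivative[OF bounded_bilinear_inner assms]
  by (simp add: has_real_derivative_iff_has_vector_derivative)

lemma has_real_derivative_norm_square:
  fixes u :: "real \<Rightarrow> 'a::real_inner"
  assumes "(u has_vector_derivative u') (at t)"
  shows "((\<lambda>t. (norm (u t))^2) has_real_derivative 2 * (u t \<bullet> u')) (at t)"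
  using has_real_derivative_inner[OF assms assms]
  by (simp add: power2_norm_eq_inner inner_commute)

lemma quadratic_flow_norm:
  fixes Q :: "'a \<Rightarrow> 'a \<Rightarrow> 'a::real_inner"
  assumes "quadratic_flow Q u" "\<And>x. x \<bullet> Q x x = 0"
  shows "norm (u t) = norm (u s)"
proof -
  have "((\<lambda>t. (norm (u t))^2) has_real_derivative 0) (at t)" for t
    using has_real_derivative_norm_square[of u "Q (u t) (u t)" t] assms
    by (simp add: quadratic_flow_def)
  then have "(norm (u t))^2 = (norm (u s))^2"
    using DERIV_isconst_all[of "\<lambda>t. (norm (u t))^2" t s] by blast
  then show ?thesis by simp
qed

text \<open>Cutting the quadratic field off outside the ball of radius \<open>\<parallel>x0\<parallel>\<close> makes it bounded and
  Lipschitz. The cut-off field is still orthogonal to its argument, so its flow never leaves the ball,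
  and there the cut-off is invisible.\<close>

lemma quadratic_flow_exists:
  fixes Q :: "'a \<Rightarrow> 'a \<Rightarrow> 'a::{real_inner,banach}"
  assumes Q: "bounded_bilinear Q" and ort: "\<And>x. x \<bullet> Q x x = 0"
  obtains u where "quadratic_flow Q u" "u 0 = x0"
proof -
  interpret bounded_bilinear Q by fact
  obtain K where K: "K > 0" "\<And>a b. norm (Q a b) \<le> norm a * norm b * K" using pos_bounded by blast
  define R where "R = norm x0"
  have R: "R \<ge> 0" by (simp add: R_def)
  define F where "F x = Q (radial R x) (radial R x)" for x
  have lip: "norm (F x - F y) \<le> (4 * K * (R + 1)) * norm (x - y)" for x y
  proof -
    let ?x = "radial R x" and ?y = "radial R y"
    have "F x - F y = Q (?x - ?y) ?x + Q ?y (?x - ?y)"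
      by (simp add: F_def diff_left diff_right)
    then have "norm (F x - F y) \<le> norm (Q (?x - ?y) ?x) + norm (Q ?y (?x - ?y))"
      by (simp add: norm_triangle_ineq)
    also have "\<dots> \<le> norm (?x - ?y) * norm ?x * K + norm ?y * norm (?x - ?y) * K"
      by (intro add_mono K)
    also have "\<dots> = (norm ?x + norm ?y) * norm (?x - ?y) * K" by (simp add: algebra_simps)
    also have "\<dots> \<le> (R + R) * (2 * norm (x - y)) * K"
      using K(1) R by (intro mult_right_mono mult_mono add_mono norm_radial_le radial_lipschitz) auto
    also have "\<dots> \<le> (4 * K * (R + 1)) * norm (x - y)" using K(1) by (simp add: algebra_simps)
    finally show ?thesis .
  qed
  have bd: "norm (F x) \<le> R * R * K" for x
  proof -
    have "norm (F x) \<le> norm (radial R x) * norm (radial R x) * K" unfolding F_def by (rule K)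
    also have "\<dots> \<le> R * R * K" using K(1) R by (intro mult_right_mono mult_mono norm_radial_le) auto
    finally show ?thesis .
  qed
  have Lpos: "4 * K * (R + 1) > 0" using K(1) R by simp
  obtain u where u0: "u 0 = x0" and u: "\<And>t. (u has_vector_derivative F (u t)) (at t)"
    using bounded_lipschitz_flow_exists[OF Lpos lip bd, of x0] by blast
  have "x \<bullet> F x = 0" for x
    using ort[of x] by (simp add: F_def radial_def scaleR_left scaleR_right)
  then have "((\<lambda>t. (norm (u t))^2) has_real_derivative 0) (at t)" for t
    using has_real_derivative_norm_square[OF u, of t] by simp
  then have "(norm (u t))^2 = (norm (u 0))^2" for t
    using DERIV_isconst_all[of "\<lambda>t. (norm (u t))^2" t 0] by blast
  then have "norm (u t) \<le> R" for t by (simp add: u0 R_def)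
  then have "F (u t) = Q (u t) (u t)" for t by (simp add: F_def radial_eq)
  with u u0 that show thesis unfolding quadratic_flow_def by metis
qed

lemma gronwall:
  fixes g :: "real \<Rightarrow> real"
  assumes "\<And>s. 0 \<le> s \<Longrightarrow> s \<le> t \<Longrightarrow> (g has_real_derivative g' s) (at s)"
    and "\<And>s. 0 \<le> s \<Longrightarrow> s \<le> t \<Longrightarrow> g' s \<le> C * g s + e"
    and "0 \<le> t" "0 \<le> C" "0 \<le> e"
  shows "g t \<le> (g 0 + e * t) * exp (C * t)"
proof -
  define f where "f s = exp (- C * s) * g s - e * s" for s
  have "f t \<le> f 0"
  proof (rule DERIV_nonpos_imp_nonincreasing[OF assms(3)])
    fix s assume s: "0 \<le> s" "s \<le> t"
    have "(f has_real_derivative exp (- C * s) * (g' s - C * g s) - e) (at s)"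
      unfolding f_def using assms(1)[OF s]
      by (auto intro!: derivative_eq_intros simp: algebra_simps)
    moreover have "exp (- C * s) * (g' s - C * g s) \<le> 1 * e"
    proof (cases "g' s - C * g s \<le> 0")
      case True
      then have "exp (- C * s) * (g' s - C * g s) \<le> 0" by (simp add: mult_nonneg_nonpos)
      then show ?thesis using assms(5) by linarith
    next
      case False
      then show ?thesis using assms(2)[OF s] assms(4,5) s by (intro mult_mono) auto
    qed
    ultimately show "\<exists>y. (f has_real_derivative y) (at s) \<and> y \<le> 0"
      by (intro exI[of _ "exp (- C * s) * (g' s - C * g s) - e"]) auto
  qed
  then have "exp (- C * t) * g t \<le> g 0 + e * t" by (simp add: f_def)
  then show ?thesis by (simp add: exp_minus field_simps)
qed

text \<open>Both continuous dependence on the equation and uniqueness are Gronwall's inequality for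
  \<open>\<parallel>v - u\<parallel>\<^sup>2\<close>; the defect \<open>Q' (u t) (u t) - Q (u t) (u t)\<close> of the second equation along the
  first flow acts as a forcing term.\<close>

lemma quadratic_flow_gronwall:
  fixes Q Q' :: "'a \<Rightarrow> 'a \<Rightarrow> 'a::real_inner"
  assumes Q': "bounded_bilinear Q'" and K: "\<And>a b. norm (Q' a b) \<le> K * norm a * norm b" "K \<ge> 0"
    and u: "quadratic_flow Q u" and v: "quadratic_flow Q' v"
    and R: "\<And>t. norm (u t) \<le> R" "\<And>t. norm (v t) \<le> R"
    and e: "\<And>s. 0 \<le> s \<Longrightarrow> s \<le> t \<Longrightarrow> norm (Q' (u s) (u s) - Q (u s) (u s)) \<le> e"
    and t: "0 \<le> t"
  shows "(norm (v t - u t))^2 \<le> ((norm (v 0 - u 0))^2 + e^2 * t) * exp ((4 * K * R + 1) * t)"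
proof (rule gronwall[OF _ _ t])
  interpret Q': bounded_bilinear Q' by fact
  have R0: "R \<ge> 0" using R(1)[of 0] norm_ge_zero order_trans by blast
  show "0 \<le> 4 * K * R + 1" "0 \<le> e^2" using R0 K by auto
  fix s assume s: "0 \<le> s" "s \<le> t"
  let ?d = "v s - u s"
  have "((\<lambda>s. v s - u s) has_vector_derivative Q' (v s) (v s) - Q (u s) (u s)) (at s)"
    using u v by (intro has_vector_derivative_diff) (auto simp: quadratic_flow_def)
  then show "((\<lambda>s. (norm (v s - u s))^2) has_real_derivative
      2 * (?d \<bullet> (Q' (v s) (v s) - Q (u s) (u s)))) (at s)"
    by (rule has_real_derivative_norm_square)
  have eq: "Q' (v s) (v s) - Q (u s) (u s) =
      Q' ?d (v s) + Q' (u s) ?d + (Q' (u s) (u s) - Q (u s) (u s))"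
    by (simp add: Q'.diff_left Q'.diff_right)
  have "?d \<bullet> (Q' (v s) (v s) - Q (u s) (u s)) \<le>
      norm ?d * norm (Q' ?d (v s) + Q' (u s) ?d + (Q' (u s) (u s) - Q (u s) (u s)))"
    unfolding eq by (rule norm_cauchy_schwarz)
  also have "\<dots> \<le> norm ?d * (K * norm ?d * R + K * R * norm ?d + e)"
  proof (intro mult_left_mono norm_triangle_le add_mono e s)
    show "norm (Q' ?d (v s)) \<le> K * norm ?d * R"
      using K(1)[of ?d "v s"] R(2)[of s] K(2) by (smt (verit) mult_left_mono mult_nonneg_nonneg norm_ge_zero)
    show "norm (Q' (u s) ?d) \<le> K * R * norm ?d"
      using K(1)[of "u s" ?d] R(1)[of s] K(2) by (smt (verit) mult_left_mono mult_right_mono norm_ge_zero)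
  qed auto
  also have "\<dots> = 2 * K * R * (norm ?d)^2 + norm ?d * e"
    by (simp add: algebra_simps power2_eq_square)
  also have "\<dots> \<le> 2 * K * R * (norm ?d)^2 + ((norm ?d)^2 + e^2) / 2"
    using sum_squares_bound[of "norm ?d" e] by simp
  finally have "2 * (?d \<bullet> (Q' (v s) (v s) - Q (u s) (u s))) \<le>
      2 * (2 * K * R * (norm ?d)^2 + ((norm ?d)^2 + e^2) / 2)" by (rule mult_left_mono) simp
  also have "\<dots> = (4 * K * R + 1) * (norm ?d)^2 + e^2"
    by (simp add: field_simps)
  finally show "2 * (?d \<bullet> (Q' (v s) (v s) - Q (u s) (u s))) \<le>
      (4 * K * R + 1) * (norm ?d)^2 + e^2" .
qed

lemma quadratic_flow_unique:
  fixes Q :: "'a \<Rightarrow> 'a \<Rightarrow> 'a::real_inner"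
  assumes Q: "bounded_bilinear Q" and ort: "\<And>x. x \<bullet> Q x x = 0"
    and u: "quadratic_flow Q u" and v: "quadratic_flow Q v" and eq: "v 0 = u 0"
  shows "v t = u t"
proof -
  interpret bounded_bilinear Q by fact
  obtain K where K: "K > 0" "\<And>a b. norm (Q a b) \<le> norm a * norm b * K" using pos_bounded by blast
  have pos: "v t = u t" if "quadratic_flow Q u" "quadratic_flow Q v" "v 0 = u 0" "t \<ge> 0" for u v t
  proof -
    have n: "norm (u s) \<le> norm (u 0)" "norm (v s) \<le> norm (u 0)" for s
      using quadratic_flow_norm[OF that(1) ort, of s 0] quadratic_flow_norm[OF that(2) ort, of s 0] that(3)
      by auto
    have "(norm (v t - u t))^2 \<le> ((norm (v 0 - u 0))^2 + 0^2 * t) * exp ((4 * K * norm (u 0) + 1) * t)"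
      using K that(4) by (intro quadratic_flow_gronwall[OF Q _ _ that(1,2) n]) (auto simp: mult_ac)
    then show ?thesis by (simp add: that(3))
  qed
  show ?thesis
  proof (cases "t \<ge> 0")
    case False
    have "- v (- (- t)) = - u (- (- t))"
      using pos[OF quadratic_flow_reverse[OF Q u] quadratic_flow_reverse[OF Q v], of "-t"] eq False
      by simp
    then show ?thesis by simp
  qed (use pos[OF u v eq] in auto)
qed

text \<open>Pointwise convergence of the quadratic fields is uniform on the compact orbit piece because
  the fields are equi-Lipschitz on balls; hence the defect in the previous estimate vanishes in the limit.\<close>

lemma quadratic_flow_limit:
  fixes Q :: "'a \<Rightarrow> 'a \<Rightarrow> 'a::real_inner" and Qn :: "nat \<Rightarrow> 'a \<Rightarrow> 'a \<Rightarrow> 'a"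
  assumes Q: "bounded_bilinear Q" "\<And>x. x \<bullet> Q x x = 0" "\<And>a b. norm (Q a b) \<le> K * norm a * norm b"
    and Qn: "\<And>n. bounded_bilinear (Qn n)" "\<And>n x. x \<bullet> Qn n x x = 0"
      "\<And>n a b. norm (Qn n a b) \<le> K * norm a * norm b"
    and lim: "\<And>x. (\<lambda>n. Qn n x x) \<longlonglongrightarrow> Q x x"
    and u: "quadratic_flow Q u" and un: "\<And>n. quadratic_flow (Qn n) (un n)"
    and lim0: "(\<lambda>n. un n 0) \<longlonglongrightarrow> u 0" and t: "t \<ge> 0"
  shows "(\<lambda>n. un n t) \<longlonglongrightarrow> u t"
proof -
  obtain R where R: "R > 0" "\<And>n. norm (un n 0) \<le> R"
    using convergent_imp_bounded[OF lim0] unfolding bounded_pos by auto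
  have u0: "norm (u 0) \<le> R"
    using R(2) by (intro Lim_norm_ubound[OF _ lim0]) auto
  have nu: "norm (u s) \<le> R" for s using quadratic_flow_norm[OF u Q(2), of s 0] u0 by simp
  have nun: "norm (un n s) \<le> R" for n s
    using quadratic_flow_norm[OF un Qn(2), of n s 0] R(2)[of n] by simp
  define K' where "K' = max K 0"
  have K': "K' \<ge> 0" "norm (Q a b) \<le> K' * norm a * norm b" "norm (Qn n a b) \<le> K' * norm a * norm b" for a b n
  proof -
    have "K * norm a * norm b \<le> K' * norm a * norm b" unfolding K'_def by (intro mult_right_mono) auto
    then show "norm (Q a b) \<le> K' * norm a * norm b" "norm (Qn n a b) \<le> K' * norm a * norm b"
      using Q(3)[of a b] Qn(3)[of n a b] by linarith+
  qed (simp add: K'_def)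
  have lipB: "norm (B x x - B y y) \<le> 2 * K' * R * norm (x - y)"
    if B: "bounded_bilinear B" "\<And>a b. norm (B a b) \<le> K' * norm a * norm b" and "norm x \<le> R" "norm y \<le> R"
    for B :: "'a \<Rightarrow> 'a \<Rightarrow> 'a" and x y
  proof -
    interpret B: bounded_bilinear B by fact
    have "B x x - B y y = B (x - y) x + B y (x - y)" by (simp add: B.diff_left B.diff_right)
    then have "norm (B x x - B y y) \<le> norm (B (x - y) x) + norm (B y (x - y))"
      by (simp add: norm_triangle_ineq)
    also have "\<dots> \<le> K' * norm (x - y) * norm x + K' * norm y * norm (x - y)" by (intro add_mono B)
    also have "\<dots> \<le> K' * norm (x - y) * R + K' * R * norm (x - y)"
      using that K'(1) R(1) by (intro add_mono mult_mono mult_left_mono mult_nonneg_nonneg) auto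
    finally show ?thesis by (simp add: algebra_simps)
  qed
  have ucont: "continuous_on {0..t} u"
    using u unfolding quadratic_flow_def
    by (intro continuous_at_imp_continuous_on ballI has_vector_derivative_continuous) blast
  have cpt: "compact (u ` {0..t})" by (rule compact_continuous_image[OF ucont]) simp
  have unif: "\<forall>\<^sub>F n in sequentially. \<forall>s\<in>{0..t}. norm (Qn n (u s) (u s) - Q (u s) (u s)) \<le> e" if e: "e > 0" for e
  proof -
    define c where "c = 2 * (K' + 1) * R"
    define d where "d = (e / 4) / c"
    have c: "c > 0" using R(1) K'(1) by (simp add: c_def)
    have d: "d > 0" using e c by (simp add: d_def)
    have d2: "2 * K' * R * d \<le> e / 4"
    proof -
      have "2 * K' * R * d \<le> c * d" unfolding c_def using R(1) d by (intro mult_right_mono) auto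
      also have "\<dots> = e / 4" unfolding d_def using c by simp
      finally show ?thesis .
    qed
    obtain k where k: "finite k" "k \<subseteq> u ` {0..t}" "u ` {0..t} \<subseteq> (\<Union>x\<in>k. ball x d)"
      by (rule compactE_image[OF cpt, of "u ` {0..t}" "\<lambda>x. ball x d"]) (use d in auto)
    have "\<forall>\<^sub>F n in sequentially. \<forall>x\<in>k. norm (Qn n x x - Q x x) < e / 4"
    proof (intro eventually_ball_finite k ballI)
      fix x assume "x \<in> k"
      show "\<forall>\<^sub>F n in sequentially. norm (Qn n x x - Q x x) < e / 4"
        using tendstoD[OF lim[of x], of "e / 4"] e by (simp add: dist_norm)
    qed
    then show ?thesis
    proof (rule eventually_mono, intro ballI)
      fix n s assume *: "\<forall>x\<in>k. norm (Qn n x x - Q x x) < e / 4" and s: "s \<in> {0..t}"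
      obtain x where x: "x \<in> k" "dist x (u s) < d" using k(3) s by force
      have nx: "norm x \<le> R" using x(1) k(2) nu by auto
      have xs: "norm (u s - x) \<le> d" using x(2) by (simp add: dist_norm norm_minus_commute)
      have "norm (Qn n (u s) (u s) - Qn n x x) \<le> 2 * K' * R * norm (u s - x)"
           "norm (Q (u s) (u s) - Q x x) \<le> 2 * K' * R * norm (u s - x)"
        using lipB[OF Qn(1) K'(3) nu nx] lipB[OF Q(1) K'(2) nu nx] by auto
      moreover have "2 * K' * R * norm (u s - x) \<le> 2 * K' * R * d"
        using xs K'(1) R(1) by (intro mult_left_mono) auto
      ultimately have 1: "norm (Qn n (u s) (u s) - Qn n x x) \<le> e / 4" "norm (Q (u s) (u s) - Q x x) \<le> e / 4"
        using d2 by linarith+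
      have 2: "norm (Qn n x x - Q x x) < e / 4" using * x(1) by blast
      have "Qn n (u s) (u s) - Q (u s) (u s) =
          (Qn n (u s) (u s) - Qn n x x) + (Qn n x x - Q x x) - (Q (u s) (u s) - Q x x)" by simp
      also have "norm \<dots> \<le> norm (Qn n (u s) (u s) - Qn n x x) + norm (Qn n x x - Q x x) + norm (Q (u s) (u s) - Q x x)"
        by (intro norm_triangle_le_diff add_mono norm_triangle_ineq order_refl)
      finally show "norm (Qn n (u s) (u s) - Q (u s) (u s)) \<le> e" using 1 2 e by linarith
    qed
  qed
  have "(\<lambda>n. (norm (un n t - u t))^2) \<longlonglongrightarrow> 0"
  proof (rule LIMSEQ_I)
    fix r :: real assume r: "r > 0"
    define E where "E = exp ((4 * K' * R + 1) * t)"
    have E: "E > 0" by (simp add: E_def)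
    define c where "c = 4 * (E * (t + 1))"
    have c: "c > 0" using E t by (simp add: c_def)
    define e where "e = sqrt (r / c)"
    have e: "e > 0" using r c by (simp add: e_def)
    have e2: "e^2 * t * E \<le> r / 4"
    proof -
      have "e^2 = r / c" using r c by (simp add: e_def)
      then have "e^2 * t * E = (r / c) * (E * t)" by simp
      also have "\<dots> \<le> (r / c) * (c / 4)"
        unfolding c_def using r c E t by (intro mult_left_mono) auto
      also have "\<dots> = r / 4" using c by simp
      finally show ?thesis .
    qed
    have "(\<lambda>n. (norm (un n 0 - u 0))^2 * E) \<longlonglongrightarrow> (norm (u 0 - u 0))^2 * E"
      by (intro tendsto_intros lim0)
    then have "\<forall>\<^sub>F n in sequentially. (norm (un n 0 - u 0))^2 * E < r / 2"
      using r by (intro order_tendstoD(2)) auto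
    with unif[OF e] have "\<forall>\<^sub>F n in sequentially. (norm (un n t - u t))^2 < r"
    proof eventually_elim
      case (elim n)
      have "(norm (un n t - u t))^2 \<le> ((norm (un n 0 - u 0))^2 + e^2 * t) * E"
        unfolding E_def using elim(1) t
        by (intro quadratic_flow_gronwall[OF Qn(1) K'(3) K'(1) u un nu nun]) auto
      also have "\<dots> = (norm (un n 0 - u 0))^2 * E + e^2 * t * E" by (simp add: algebra_simps)
      finally show ?case using elim(2) e2 r by linarith
    qed
    then show "\<exists>no. \<forall>n\<ge>no. norm ((norm (un n t - u t))^2 - 0) < r"
      by (auto simp: eventually_sequentially)
  qed
  then have "(\<lambda>n. norm (un n t - u t)) \<longlonglongrightarrow> 0"
    using tendsto_real_sqrt[of "\<lambda>n. (norm (un n t - u t))^2" 0] by simp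
  then show ?thesis by (simp add: LIM_zero_iff tendsto_norm_zero_iff)
qed

section \<open>Sums over the integer lattice\<close>

subsection \<open>Square-summable families\<close>

lemma nonneg_sums_bounded:
  fixes f :: "'a \<Rightarrow> real"
  assumes "\<And>x. 0 \<le> f x" "\<And>F. finite F \<Longrightarrow> sum f F \<le> B"
  shows "f summable_on UNIV" "infsum f UNIV \<le> B"
proof -
  show "f summable_on UNIV"
    using assms by (intro nonneg_bdd_above_summable_on) (auto intro!: bdd_aboveI2)
  then show "infsum f UNIV \<le> B"
    using assms(2) by (intro infsum_le_finite_sums) auto
qed

definition is_l2 :: "('a \<Rightarrow> real) \<Rightarrow> bool" where
  "is_l2 f \<longleftrightarrow> (\<lambda>x. (f x)^2) summable_on UNIV"

definition l2 :: "('a \<Rightarrow> real) \<Rightarrow> real" where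
  "l2 f = sqrt (infsum (\<lambda>x. (f x)^2) UNIV)"

lemma l2_nonneg [simp]: "0 \<le> l2 f"
  by (simp add: l2_def infsum_nonneg)

lemma l2_square: "(l2 f)^2 = infsum (\<lambda>x. (f x)^2) UNIV"
  by (simp add: l2_def infsum_nonneg)

lemma sum_squares_le_l2:
  assumes "is_l2 f" "finite F"
  shows "(\<Sum>x\<in>F. (f x)^2) \<le> (l2 f)^2"
  unfolding l2_square using assms
  by (intro finite_sum_le_infsum) (auto simp: is_l2_def)

lemma is_l2I:
  assumes "\<And>F. finite F \<Longrightarrow> (\<Sum>x\<in>F. (f x)^2) \<le> B^2" "0 \<le> B"
  shows "is_l2 f" "l2 f \<le> B"
proof -
  show "is_l2 f"
    unfolding is_l2_def by (rule nonneg_sums_bounded[OF _ assms(1)]) auto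
  have "(l2 f)^2 \<le> B^2"
    unfolding l2_square by (rule nonneg_sums_bounded[OF _ assms(1)]) auto
  then show "l2 f \<le> B" using assms(2) by (rule power2_le_imp_le)
qed

lemma is_l2_comparison:
  assumes g: "is_l2 g" and le: "\<And>x. \<bar>f x\<bar> \<le> g x"
  shows "is_l2 f" "l2 f \<le> l2 g"
proof -
  have "(\<Sum>x\<in>F. (f x)^2) \<le> (l2 g)^2" if "finite F" for F
  proof -
    have "(\<Sum>x\<in>F. (f x)^2) \<le> (\<Sum>x\<in>F. (g x)^2)"
      using power_mono[OF le, of _ 2] by (intro sum_mono) simp
    with sum_squares_le_l2[OF g that] show ?thesis by linarith
  qed
  then show "is_l2 f" "l2 f \<le> l2 g"
    by (rule is_l2I; simp)+
qed

lemma is_l2_cmult: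
  assumes "is_l2 f"
  shows "is_l2 (\<lambda>x. c * f x)" "l2 (\<lambda>x. c * f x) = \<bar>c\<bar> * l2 f"
proof -
  show "is_l2 (\<lambda>x. c * f x)"
    using assms unfolding is_l2_def power_mult_distrib
    by (intro summable_on_cmult_right)
  show "l2 (\<lambda>x. c * f x) = \<bar>c\<bar> * l2 f"
    unfolding l2_def power_mult_distrib by (simp add: infsum_cmult_right' real_sqrt_mult)
qed

lemma l2_mult:
  assumes f: "is_l2 f" and g: "is_l2 g"
  shows "(\<lambda>x. \<bar>f x * g x\<bar>) summable_on UNIV" "(\<lambda>x. f x * g x) summable_on UNIV"
    "infsum (\<lambda>x. \<bar>f x * g x\<bar>) UNIV \<le> l2 f * l2 g" "infsum (\<lambda>x. f x * g x) UNIV \<le> l2 f * l2 g"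
proof -
  have le: "(\<Sum>x\<in>F. \<bar>f x * g x\<bar>) \<le> l2 f * l2 g" if F: "finite F" for F
  proof (rule power2_le_imp_le)
    have "(\<Sum>x\<in>F. \<bar>f x * g x\<bar>)^2 \<le> (\<Sum>x\<in>F. \<bar>f x\<bar>^2) * (\<Sum>x\<in>F. \<bar>g x\<bar>^2)"
      unfolding abs_mult by (rule Cauchy_Schwarz_ineq_sum)
    also have "\<dots> \<le> (l2 f)^2 * (l2 g)^2"
      using sum_squares_le_l2[OF f F] sum_squares_le_l2[OF g F]
      by (intro mult_mono) (auto intro: sum_nonneg)
    finally show "(\<Sum>x\<in>F. \<bar>f x * g x\<bar>)^2 \<le> (l2 f * l2 g)^2" by (simp add: power_mult_distrib)
  qed simp
  show s: "(\<lambda>x. \<bar>f x * g x\<bar>) summable_on UNIV" and b: "infsum (\<lambda>x. \<bar>f x * g x\<bar>) UNIV \<le> l2 f * l2 g"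
    by (rule nonneg_sums_bounded[OF _ le]; simp)+
  then show s': "(\<lambda>x. f x * g x) summable_on UNIV"
    using summable_on_iff_abs_summable_on_real by force
  have "infsum (\<lambda>x. f x * g x) UNIV \<le> infsum (\<lambda>x. \<bar>f x * g x\<bar>) UNIV"
    by (rule infsum_mono[OF s' s]) simp
  with b show "infsum (\<lambda>x. f x * g x) UNIV \<le> l2 f * l2 g" by linarith
qed

lemma has_sum_product:
  fixes f :: "'a \<Rightarrow> real" and g :: "'b \<Rightarrow> real"
  assumes f: "f summable_on UNIV" "\<And>x. 0 \<le> f x" and g: "g summable_on UNIV" "\<And>x. 0 \<le> g x"
  shows "(\<lambda>(x, y). f x * g y) summable_on UNIV"
    "infsum (\<lambda>(x, y). f x * g y) UNIV = infsum f UNIV * infsum g UNIV"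
proof -
  have le: "sum (\<lambda>(x, y). f x * g y) F \<le> infsum f UNIV * infsum g UNIV" if F: "finite F" for F
  proof -
    have "sum (\<lambda>(x, y). f x * g y) F \<le> sum (\<lambda>(x, y). f x * g y) (fst ` F \<times> snd ` F)"
      using F f g by (intro sum_mono2) (auto simp: subset_fst_snd split: prod.splits)
    also have "\<dots> = sum f (fst ` F) * sum g (snd ` F)"
      by (simp add: sum_product sum.cartesian_product)
    also have "\<dots> \<le> infsum f UNIV * infsum g UNIV"
      using F f g by (intro mult_mono finite_sum_le_infsum sum_nonneg infsum_nonneg) auto
    finally show ?thesis .
  qed
  show s: "(\<lambda>(x, y). f x * g y) summable_on UNIV"
    by (rule nonneg_sums_bounded[OF _ le]) (use f g in auto)
  have "infsum (\<lambda>(x, y). f x * g y) (UNIV \<times> UNIV) = infsum (\<lambda>x. infsum (\<lambda>y. f x * g y) UNIV) UNIV"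
    using s by (intro infsum_Sigma'_banach[symmetric]) simp
  then show "infsum (\<lambda>(x, y). f x * g y) UNIV = infsum f UNIV * infsum g UNIV"
    by (simp add: infsum_cmult_right' infsum_cmult_left')
qed

subsection \<open>Frequencies\<close>

abbreviation kn :: "int^3 \<Rightarrow> real" where "kn k \<equiv> norm (freq k)"

lemma freq_add: "freq (j + k) = freq j + freq k"
  by (simp add: freq_def vec_eq_iff algebra_simps)

lemma freq_diff: "freq (j - k) = freq j - freq k"
  by (simp add: freq_def vec_eq_iff algebra_simps)

lemma freq_minus: "freq (- k) = - freq k"
  by (simp add: freq_def vec_eq_iff)

lemma freq_0 [simp]: "freq 0 = 0"
  by (simp add: freq_def vec_eq_iff)

lemma kn_minus [simp]: "kn (- k) = kn k"
  by (simp add: freq_minus)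

lemma abs_component_le_kn: "\<bar>real_of_int (k $ i)\<bar> \<le> kn k"
proof -
  have "\<bar>real_of_int (k $ i)\<bar> * 1 \<le> \<bar>real_of_int (k $ i)\<bar> * (2 * pi)"
    using pi_gt3 by (intro mult_left_mono) auto
  also have "\<dots> = \<bar>freq k $ i\<bar>" by (simp add: freq_def abs_mult)
  also have "\<dots> \<le> kn k" by (rule component_le_norm_cart)
  finally show ?thesis by simp
qed

lemma kn_ge_1: "k \<noteq> 0 \<Longrightarrow> 1 \<le> kn k"
proof -
  assume "k \<noteq> 0"
  then obtain i where "k $ i \<noteq> 0" by (auto simp: vec_eq_iff)
  then have "1 \<le> \<bar>real_of_int (k $ i)\<bar>" by linarith
  with abs_component_le_kn[of k i] show ?thesis by linarith
qed

lemma freq_eq_0_iff [simp]: "freq k = 0 \<longleftrightarrow> k = 0"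
  using kn_ge_1[of k] by force

lemma kn_triangle:
  "kn k \<le> kn j + kn (k - j)" "kn j \<le> kn k + kn (k - j)" "kn (k - j) \<le> kn k + kn j"
  using norm_triangle_ineq[of "freq j" "freq (k - j)"] norm_triangle_ineq4[of "freq k" "freq (k - j)"]
    norm_triangle_ineq4[of "freq k" "freq j"]
  by (simp_all add: freq_diff)

subsection \<open>Summable powers of the frequency\<close>

lemma int3_cases_bij: "bij (\<lambda>k::int^3. (k $ 1, k $ 2, k $ 3))"
proof (rule bijI)
  show "inj (\<lambda>k::int^3. (k $ 1, k $ 2, k $ 3))"
    by (rule injI) (simp add: vec_eq_iff forall_3)
  show "surj (\<lambda>k::int^3. (k $ 1, k $ 2, k $ 3))"
  proof (rule surjI)
    fix x :: "int \<times> int \<times> int"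
    show "(\<lambda>k::int^3. (k $ 1, k $ 2, k $ 3)) ((\<lambda>(a, b, c). vector [a, b, c]) x) = x"
      by (cases x) simp
  qed
qed

lemma summable_on_int_powr:
  assumes "q > 1"
  shows "(\<lambda>n::int. (1 + real_of_int \<bar>n\<bar>) powr (- q)) summable_on UNIV"
proof -
  have "summable (\<lambda>n::nat. real (Suc n) powr (- q))"
    using assms summable_Suc_iff[of "\<lambda>n. real n powr (- q)"] by (simp add: summable_real_powr_iff)
  then have nat: "(\<lambda>n::nat. (1 + real n) powr (- q)) summable_on UNIV"
    by (subst summable_on_UNIV_nonneg_real_iff) (auto simp: add.commute)
  have "(\<lambda>n::int. (1 + real_of_int \<bar>n\<bar>) powr (- q)) summable_on range int"
    using nat by (subst summable_on_reindex) (auto simp: o_def)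
  moreover have "(\<lambda>n::int. (1 + real_of_int \<bar>n\<bar>) powr (- q)) summable_on range (\<lambda>n. - int n)"
    using nat by (subst summable_on_reindex) (auto simp: o_def inj_on_def)
  ultimately have "(\<lambda>n::int. (1 + real_of_int \<bar>n\<bar>) powr (- q)) summable_on (range int \<union> range (\<lambda>n. - int n))"
    by (rule summable_on_union)
  moreover have "range int \<union> range (\<lambda>n. - int n) = UNIV"
  proof (intro equalityI subsetI UNIV_I)
    fix x :: int
    show "x \<in> range int \<union> range (\<lambda>n. - int n)" by (cases x rule: int_cases2) auto
  qed
  ultimately show ?thesis by simp
qed

text \<open>The exponent 3 is the dimension: \<open>(1 + \<bar>k\<bar>) powr (- p)\<close> is dominated by the product over
  the three coordinates of \<open>(1 + \<bar>k\<^sub>i\<bar>) powr (- p / 3)\<close>.\<close>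

lemma summable_on_lattice_powr:
  assumes "p > 3"
  shows "(\<lambda>k. (1 + kn k) powr (- p)) summable_on UNIV"
proof -
  define g where "g n = (1 + real_of_int \<bar>n\<bar>) powr (- (p / 3))" for n
  have g: "g summable_on UNIV" "\<And>n. 0 \<le> g n"
    using summable_on_int_powr[of "p / 3"] assms unfolding g_def by auto
  have "(\<lambda>(b, c). g b * g c) summable_on UNIV" by (rule has_sum_product[OF g g])
  then have "(\<lambda>(a, y). g a * (case y of (b, c) \<Rightarrow> g b * g c)) summable_on UNIV"
    using g by (intro has_sum_product(1)) (auto split: prod.splits)
  then have "(\<lambda>k::int^3. g (k $ 1) * (g (k $ 2) * g (k $ 3))) summable_on UNIV"
    using summable_on_reindex_bij_betw[OF int3_cases_bij,
        of "\<lambda>(a, y). g a * (case y of (b, c) \<Rightarrow> g b * g c)"] by simp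
  then show ?thesis
  proof (rule summable_on_comparison_test)
    fix k :: "int^3"
    have "(1 + kn k) powr (- (p / 3)) \<le> g (k $ i)" for i
      unfolding g_def using assms abs_component_le_kn[of k i] by (intro powr_mono2') auto
    then have "(1 + kn k) powr (- (p / 3)) * ((1 + kn k) powr (- (p / 3)) * (1 + kn k) powr (- (p / 3)))
        \<le> g (k $ 1) * (g (k $ 2) * g (k $ 3))"
      using g(2) by (intro mult_mono) auto
    then show "(1 + kn k) powr (- p) \<le> g (k $ 1) * (g (k $ 2) * g (k $ 3))"
      by (simp add: powr_add[symmetric])
  qed auto
qed

text \<open>The factor \<open>2 powr \<beta>\<close> is the cost of replacing \<open>1 +
  \<bar>k\<bar>\<close> by \<open>\<bar>k\<bar>\<close> at nonzero frequencies, where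
  \<open>\<bar>k\<bar> \<ge> 1\<close>.\<close>

definition lattice_const :: "real \<Rightarrow> real" where
  "lattice_const \<beta> = 2 powr \<beta> * l2 (\<lambda>k. (1 + kn k) powr (- \<beta>))"

lemma lattice_const_nonneg [simp]: "0 \<le> lattice_const \<beta>"
  by (simp add: lattice_const_def)

text \<open>Cauchy--Schwarz against \<open>\<bar>k\<bar> powr (- \<beta>)\<close>, which is square
  summable away from the origin because \<open>2 \<beta> > 3\<close>.\<close>

lemma summable_if_weighted_is_l2:
  assumes \<beta>: "\<beta> > 3/2" and a: "\<And>k. 0 \<le> a k" "a 0 = 0"
    and s: "is_l2 (\<lambda>k. kn k powr \<beta> * a k)"
  shows "a summable_on UNIV" "infsum a UNIV \<le> lattice_const \<beta> * l2 (\<lambda>k. kn k powr \<beta> * a k)"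
proof -
  define w where "w k = 2 powr \<beta> * (1 + kn k) powr (- \<beta>)" for k
  have w: "is_l2 w" "l2 w = lattice_const \<beta>"
  proof -
    have sq: "((1 + kn k) powr (- \<beta>))^2 = (1 + kn k) powr (- (2 * \<beta>))" for k
    proof -
      have "0 < 1 + kn k" by (rule add_pos_nonneg) auto
      then show ?thesis by (simp add: power2_eq_square powr_add[symmetric])
    qed
    have "is_l2 (\<lambda>k. (1 + kn k) powr (- \<beta>))"
      unfolding is_l2_def sq using \<beta> by (intro summable_on_lattice_powr) auto
    from is_l2_cmult[OF this, of "2 powr \<beta>"]
    show "is_l2 w" "l2 w = lattice_const \<beta>" by (auto simp: w_def[abs_def] lattice_const_def)
  qed
  have le: "a k \<le> w k * (kn k powr \<beta> * a k)" for k
  proof (cases "k = 0")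
    case False
    then have k: "1 \<le> kn k" by (rule kn_ge_1)
    have "(1 + kn k) powr \<beta> \<le> (2 * kn k) powr \<beta>" using k \<beta> by (intro powr_mono2) auto
    also have "\<dots> = 2 powr \<beta> * kn k powr \<beta>" by (simp add: powr_mult)
    finally have "(1 + kn k) powr \<beta> * (1 + kn k) powr (- \<beta>)
        \<le> 2 powr \<beta> * kn k powr \<beta> * (1 + kn k) powr (- \<beta>)"
      by (rule mult_right_mono) simp
    moreover have "(1 + kn k) powr \<beta> * (1 + kn k) powr (- \<beta>) = 1"
      using k by (simp add: powr_add[symmetric])
    ultimately have "1 \<le> w k * kn k powr \<beta>" by (simp add: w_def mult_ac)
    then have "1 * a k \<le> w k * kn k powr \<beta> * a k" using a by (intro mult_right_mono) auto
    then show ?thesis by (simp add: mult_ac)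
  qed (simp add: a)
  show "a summable_on UNIV"
    by (rule summable_on_comparison_test[OF l2_mult(2)[OF w(1) s]]) (use le a in auto)
  then have "infsum a UNIV \<le> infsum (\<lambda>k. w k * (kn k powr \<beta> * a k)) UNIV"
    using le by (intro infsum_mono l2_mult(2)[OF w(1) s])
  also have "\<dots> \<le> l2 w * l2 (\<lambda>k. kn k powr \<beta> * a k)" by (rule l2_mult(4)[OF w(1) s])
  finally show "infsum a UNIV \<le> lattice_const \<beta> * l2 (\<lambda>k. kn k powr \<beta> * a k)" by (simp add: w)
qed

text \<open>Cubes exhaust the lattice and are symmetric, so that truncation to them maps real fields to
  real fields.\<close>

definition cube :: "nat \<Rightarrow> (int^3) set" where
  "cube N = {k. \<forall>i. \<bar>k $ i\<bar> \<le> int N}"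

lemma finite_cube [simp]: "finite (cube N)"
proof -
  have "(\<lambda>k::int^3. (k $ 1, k $ 2, k $ 3)) ` cube N \<subseteq> {- int N..int N} \<times> {- int N..int N} \<times> {- int N..int N}"
    by (auto simp: cube_def abs_le_iff forall_3 minus_le_iff)
  then have "finite ((\<lambda>k::int^3. (k $ 1, k $ 2, k $ 3)) ` cube N)"
    by (rule finite_subset) auto
  then show ?thesis
    by (rule finite_imageD) (rule inj_on_subset[OF bij_is_inj[OF int3_cases_bij]], simp)
qed

lemma minus_mem_cube [simp]: "- k \<in> cube N \<longleftrightarrow> k \<in> cube N"
  by (simp add: cube_def)

lemma cube_mono: "m \<le> n \<Longrightarrow> cube m \<subseteq> cube n"
  unfolding cube_def by (auto intro: order_trans)

lemma finite_subset_cube: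
  assumes "finite F"
  shows "\<exists>N. \<forall>n\<ge>N. F \<subseteq> cube n"
proof -
  have "\<exists>N. k \<in> cube N" for k
  proof -
    have "k \<in> cube (nat (\<bar>k $ 1\<bar> + \<bar>k $ 2\<bar> + \<bar>k $ 3\<bar>))"
      by (auto simp: cube_def forall_3)
    then show ?thesis by blast
  qed
  then obtain N where N: "\<And>k. k \<in> cube (N k)" by metis
  have "F \<subseteq> cube n" if "n \<ge> Max (insert 0 (N ` F))" for n
  proof
    fix k assume "k \<in> F"
    then have "N k \<le> n" using that assms by (auto simp: Max_ge_iff)
    then show "k \<in> cube n" using N[of k] cube_mono by blast
  qed
  then show ?thesis by blast
qed

lemma filterlim_cube: "filterlim cube (finite_subsets_at_top UNIV) sequentially"
  unfolding filterlim_finite_subsets_at_top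
  using finite_subset_cube by (auto simp: eventually_sequentially)

lemma has_sum_cube_LIMSEQ:
  "(f has_sum s) UNIV \<Longrightarrow> (\<lambda>N. sum f (cube N)) \<longlonglongrightarrow> s"
  unfolding has_sum_def by (rule filterlim_compose[OF _ filterlim_cube])

section \<open>Trilinear sums\<close>

text \<open>The trilinear forms below are sums over \<open>(k, j)\<close> where \<open>j\<close> and \<open>k - j\<close> are the interacting
  frequencies and \<open>k\<close> is the resulting one.\<close>

lemma summable_on_pairs_reindex:
  fixes g :: "(int^3) \<times> (int^3) \<Rightarrow> 'b::{comm_monoid_add,t2_space}"
  shows "(\<lambda>(k, j). g (k - j, j)) summable_on UNIV \<longleftrightarrow> g summable_on UNIV"
    "infsum (\<lambda>(k, j). g (k - j, j)) UNIV = infsum g UNIV"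
    "(\<lambda>(k, j). g (k - j, k)) summable_on UNIV \<longleftrightarrow> g summable_on UNIV"
    "infsum (\<lambda>(k, j). g (k - j, k)) UNIV = infsum g UNIV"
    "(\<lambda>(k, j). g (k, k - j)) summable_on UNIV \<longleftrightarrow> g summable_on UNIV"
    "infsum (\<lambda>(k, j). g (k, k - j)) UNIV = infsum g UNIV"
    "infsum (\<lambda>(k, j). g (j - k, j)) UNIV = infsum g UNIV"
proof -
  show "(\<lambda>(k, j). g (k - j, j)) summable_on UNIV \<longleftrightarrow> g summable_on UNIV"
    by (rule summable_on_reindex_bij_witness[where i = "\<lambda>(m, j). (m + j, j)" and j = "\<lambda>(k, j). (k - j, j)"]) auto
  show "infsum (\<lambda>(k, j). g (k - j, j)) UNIV = infsum g UNIV"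
    by (rule infsum_reindex_bij_witness[where i = "\<lambda>(m, j). (m + j, j)" and j = "\<lambda>(k, j). (k - j, j)"]) auto
  show "(\<lambda>(k, j). g (k - j, k)) summable_on UNIV \<longleftrightarrow> g summable_on UNIV"
    by (rule summable_on_reindex_bij_witness[where i = "\<lambda>(m, k). (k, k - m)" and j = "\<lambda>(k, j). (k - j, k)"]) auto
  show "infsum (\<lambda>(k, j). g (k - j, k)) UNIV = infsum g UNIV"
    by (rule infsum_reindex_bij_witness[where i = "\<lambda>(m, k). (k, k - m)" and j = "\<lambda>(k, j). (k - j, k)"]) auto
  show "(\<lambda>(k, j). g (k, k - j)) summable_on UNIV \<longleftrightarrow> g summable_on UNIV"
    by (rule summable_on_reindex_bij_witness[where i = "\<lambda>(k, m). (k, k - m)" and j = "\<lambda>(k, j). (k, k - j)"]) auto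
  show "infsum (\<lambda>(k, j). g (k, k - j)) UNIV = infsum g UNIV"
    by (rule infsum_reindex_bij_witness[where i = "\<lambda>(k, m). (k, k - m)" and j = "\<lambda>(k, j). (k, k - j)"]) auto
  show "infsum (\<lambda>(k, j). g (j - k, j)) UNIV = infsum g UNIV"
    by (rule infsum_reindex_bij_witness[where i = "\<lambda>(k, j). (j - k, j)" and j = "\<lambda>(k, j). (j - k, j)"]) auto
qed

lemma l2_mult_pairs:
  fixes f g :: "'a \<times> 'b \<Rightarrow> real"
  assumes f: "f2 summable_on UNIV" "\<And>k j. (f (k, j))^2 = f2 (k, j)" "infsum f2 UNIV \<le> A^2" "0 \<le> A"
    and g: "g2 summable_on UNIV" "\<And>k j. (g (k, j))^2 \<le> g2 (k, j)" "infsum g2 UNIV \<le> B^2" "0 \<le> B"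
  shows "(\<lambda>x. f x * g x) summable_on UNIV" "infsum (\<lambda>x. f x * g x) UNIV \<le> A * B"
proof -
  have f2: "(\<lambda>x. (f x)^2) = f2" using f(2) by auto
  have f': "is_l2 f" unfolding is_l2_def f2 by (rule f(1))
  have fe: "(l2 f)^2 \<le> A^2" unfolding l2_square f2 by (rule f(3))
  have g': "is_l2 g" unfolding is_l2_def
    by (rule summable_on_comparison_test[OF g(1)]) (use g(2) in auto)
  have "(l2 g)^2 \<le> infsum g2 UNIV" unfolding l2_square
    by (rule infsum_mono) (use g(1,2) g' in \<open>auto simp: is_l2_def\<close>)
  then have ge: "l2 g \<le> B" using g(3,4) by (metis order_trans power2_le_imp_le)
  have "l2 f \<le> A" using fe f(4) by (rule power2_le_imp_le)
  then have "l2 f * l2 g \<le> A * B" using ge f(4) by (intro mult_mono) auto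
  then show "infsum (\<lambda>x. f x * g x) UNIV \<le> A * B" using l2_mult(4)[OF f' g'] by linarith
  show "(\<lambda>x. f x * g x) summable_on UNIV" by (rule l2_mult(2)[OF f' g'])
qed

text \<open>For fixed \<open>j\<close> the sum over \<open>k\<close> is at most \<open>a j * l2 b * l2
  c\<close> by Cauchy--Schwarz and translation invariance.\<close>

lemma trilinear_l1_l2_l2:
  fixes a b c :: "int^3 \<Rightarrow> real"
  assumes a: "a summable_on UNIV" "\<And>k. 0 \<le> a k" and b: "is_l2 b" and c: "is_l2 c"
  shows "(\<lambda>(k, j). a j * b (k - j) * c k) summable_on UNIV"
    "infsum (\<lambda>(k, j). a j * b (k - j) * c k) UNIV \<le> infsum a UNIV * l2 b * l2 c"
proof -
  have a0: "0 \<le> infsum a UNIV" by (rule infsum_nonneg) (use a in auto)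
  have 1: "(\<lambda>(k, j). (c k)^2 * a j) summable_on UNIV"
    "infsum (\<lambda>(k, j). (c k)^2 * a j) UNIV = infsum (\<lambda>k. (c k)^2) UNIV * infsum a UNIV"
    using c by (intro has_sum_product a; simp add: is_l2_def)+
  have 2: "(\<lambda>(m, j). (b m)^2 * a j) summable_on UNIV"
    "infsum (\<lambda>(m, j). (b m)^2 * a j) UNIV = infsum (\<lambda>m. (b m)^2) UNIV * infsum a UNIV"
    using b by (intro has_sum_product a; simp add: is_l2_def)+
  have 3: "(\<lambda>(k, j). (b (k - j))^2 * a j) summable_on UNIV"
    "infsum (\<lambda>(k, j). (b (k - j))^2 * a j) UNIV = infsum (\<lambda>m. (b m)^2) UNIV * infsum a UNIV"
    using 2 summable_on_pairs_reindex(1,2)[of "\<lambda>(m, j). (b m)^2 * a j"] by auto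
  define f g where "f = (\<lambda>(k, j). c k * sqrt (a j))" and "g = (\<lambda>(k, j). b (k - j) * sqrt (a j))"
  have "(\<lambda>x. f x * g x) summable_on UNIV"
    "infsum (\<lambda>x. f x * g x) UNIV \<le> (l2 c * sqrt (infsum a UNIV)) * (l2 b * sqrt (infsum a UNIV))"
    by (rule l2_mult_pairs[of "\<lambda>(k, j). (c k)^2 * a j" _ "l2 c * sqrt (infsum a UNIV)"
          "\<lambda>(k, j). (b (k - j))^2 * a j" _ "l2 b * sqrt (infsum a UNIV)"];
        use 1 3 a a0 in \<open>simp add: f_def g_def power_mult_distrib l2_square\<close>)+
  moreover have "(\<lambda>x. f x * g x) = (\<lambda>(k, j). a j * b (k - j) * c k)"
  proof
    fix x :: "(int^3) \<times> (int^3)"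
    obtain k j where x: "x = (k, j)" by (cases x)
    have "sqrt (a j) * sqrt (a j) = a j" using a(2) by simp
    then show "f x * g x = (case x of (k, j) \<Rightarrow> a j * b (k - j) * c k)"
      by (simp add: x f_def g_def)
  qed
  moreover have "(l2 c * sqrt (infsum a UNIV)) * (l2 b * sqrt (infsum a UNIV)) = infsum a UNIV * l2 b * l2 c"
  proof -
    have "sqrt (infsum a UNIV) * sqrt (infsum a UNIV) = infsum a UNIV" using a0 by simp
    then show ?thesis by (simp add: mult_ac)
  qed
  ultimately show "(\<lambda>(k, j). a j * b (k - j) * c k) summable_on UNIV"
    "infsum (\<lambda>(k, j). a j * b (k - j) * c k) UNIV \<le> infsum a UNIV * l2 b * l2 c" by simp_all
qed

lemma trilinear_l2_l1_l2:
  fixes a b c :: "int^3 \<Rightarrow> real"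
  assumes b: "b summable_on UNIV" "\<And>k. 0 \<le> b k" and a: "is_l2 a" and c: "is_l2 c"
  shows "(\<lambda>(k, j). a j * b (k - j) * c k) summable_on UNIV"
    "infsum (\<lambda>(k, j). a j * b (k - j) * c k) UNIV \<le> infsum b UNIV * l2 a * l2 c"
proof -
  have eq: "(\<lambda>(k, j). a j * b (k - j) * c k) = (\<lambda>(k, j). (\<lambda>(k, j). b j * a (k - j) * c k) (k, k - j))"
    by (auto simp: mult_ac)
  show "(\<lambda>(k, j). a j * b (k - j) * c k) summable_on UNIV"
    "infsum (\<lambda>(k, j). a j * b (k - j) * c k) UNIV \<le> infsum b UNIV * l2 a * l2 c"
    unfolding eq summable_on_pairs_reindex using trilinear_l1_l2_l2[OF b a c] by auto
qed

text \<open>The three-dimensional product estimate \<open>H\<^sup>1 \<times> H\<^sup>1 \<rightarrow> L\<^sup>2\<close> on the Fourier side. After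
  Cauchy--Schwarz over all pairs, the factor \<open>\<kappa>\<^sub>j\<^sup>-\<^sup>2 \<kappa>\<^sub>k\<^sup>-\<^sup>2\<close> is split by Young's inequality, and
  \<open>\<Sum> \<kappa>\<^sub>k\<^sup>-\<^sup>4\<close> converges for \<open>\<kappa>\<^sub>k \<sim> \<bar>k\<bar>\<close> in three dimensions.\<close>

lemma trilinear_weighted:
  fixes a c d \<kappa> :: "int^3 \<Rightarrow> real"
  assumes \<kappa>: "(\<lambda>k. 1 / \<kappa> k ^ 4) summable_on UNIV" "\<And>k. 0 < \<kappa> k"
    and a: "is_l2 (\<lambda>k. \<kappa> k * a k)" and c: "is_l2 (\<lambda>k. \<kappa> k * c k)"
    and d: "is_l2 d"
  shows "(\<lambda>(k, j). a j * d (k - j) * c k) summable_on UNIV"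
    "infsum (\<lambda>(k, j). a j * d (k - j) * c k) UNIV \<le>
      sqrt (infsum (\<lambda>k. 1 / \<kappa> k ^ 4) UNIV) * l2 (\<lambda>k. \<kappa> k * a k) * l2 d * l2 (\<lambda>k. \<kappa> k * c k)"
proof -
  define S where "S = infsum (\<lambda>k. 1 / \<kappa> k ^ 4) UNIV"
  have S: "0 \<le> S" unfolding S_def by (rule infsum_nonneg) (simp add: \<kappa>(2) less_imp_le)
  have 1: "(\<lambda>(k, j). (\<kappa> k * c k)^2 * (\<kappa> j * a j)^2) summable_on UNIV"
    "infsum (\<lambda>(k, j). (\<kappa> k * c k)^2 * (\<kappa> j * a j)^2) UNIV = (l2 (\<lambda>k. \<kappa> k * c k))^2 * (l2 (\<lambda>k. \<kappa> k * a k))^2"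
    using c a unfolding l2_square is_l2_def by (intro has_sum_product; simp)+
  have 2: "(\<lambda>(m, j). (d m)^2 * (1 / \<kappa> j ^ 4)) summable_on UNIV"
    "infsum (\<lambda>(m, j). (d m)^2 * (1 / \<kappa> j ^ 4)) UNIV = (l2 d)^2 * S"
    using d \<kappa> unfolding l2_square is_l2_def S_def
    by (intro has_sum_product; simp add: less_imp_le)+
  define h where "h = (\<lambda>(m, j). (d m)^2 * (1 / \<kappa> j ^ 4))"
  define g2 where "g2 = (\<lambda>(k, j). (1/2) * h (k - j, j) + (1/2) * h (k - j, k))"
  have s1: "(\<lambda>(k, j). h (k - j, j)) summable_on UNIV" "infsum (\<lambda>(k, j). h (k - j, j)) UNIV = (l2 d)^2 * S"
    and s2: "(\<lambda>(k, j). h (k - j, k)) summable_on UNIV" "infsum (\<lambda>(k, j). h (k - j, k)) UNIV = (l2 d)^2 * S"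
    unfolding summable_on_pairs_reindex using 2 unfolding h_def by auto
  have g2e: "g2 = (\<lambda>x. (1/2) * (case x of (k, j) \<Rightarrow> h (k - j, j)) + (1/2) * (case x of (k, j) \<Rightarrow> h (k - j, k)))"
    by (auto simp: g2_def)
  have g2: "g2 summable_on UNIV" "infsum g2 UNIV \<le> (l2 d * sqrt S)^2"
  proof -
    show "g2 summable_on UNIV" unfolding g2e
      by (intro summable_on_add summable_on_cmult_right s1 s2)
    have "infsum g2 UNIV = (1/2) * ((l2 d)^2 * S) + (1/2) * ((l2 d)^2 * S)" unfolding g2e
      by (subst infsum_add) (simp_all add: summable_on_cmult_right s1 s2 infsum_cmult_right' del: times_divide_eq_left)
    then show "infsum g2 UNIV \<le> (l2 d * sqrt S)^2" using S by (simp add: power_mult_distrib)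
  qed
  define f g where "f = (\<lambda>(k, j). (\<kappa> k * c k) * (\<kappa> j * a j))" and "g = (\<lambda>(k, j). d (k - j) * (1 / \<kappa> j * (1 / \<kappa> k)))"
  have gle: "(g (k, j))^2 \<le> g2 (k, j)" for k j
  proof -
    have "(1 / \<kappa> j)^2 * (1 / \<kappa> k)^2 \<le> (1/2) * (((1 / \<kappa> j)^2)^2 + ((1 / \<kappa> k)^2)^2)"
      using sum_squares_bound[of "(1 / \<kappa> j)^2" "(1 / \<kappa> k)^2"] by simp
    then have "(d (k - j))^2 * ((1 / \<kappa> j)^2 * (1 / \<kappa> k)^2)
        \<le> (d (k - j))^2 * ((1/2) * (((1 / \<kappa> j)^2)^2 + ((1 / \<kappa> k)^2)^2))"
      by (rule mult_left_mono) simp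
    then show ?thesis
      by (simp add: g_def g2_def h_def power_mult_distrib power_divide field_simps)
  qed
  have "(\<lambda>x. f x * g x) summable_on UNIV"
    "infsum (\<lambda>x. f x * g x) UNIV \<le> (l2 (\<lambda>k. \<kappa> k * c k) * l2 (\<lambda>k. \<kappa> k * a k)) * (l2 d * sqrt S)"
    by (rule l2_mult_pairs[of "\<lambda>(k, j). (\<kappa> k * c k)^2 * (\<kappa> j * a j)^2" _
          "l2 (\<lambda>k. \<kappa> k * c k) * l2 (\<lambda>k. \<kappa> k * a k)" g2 _ "l2 d * sqrt S"];
        use 1 g2 gle S in \<open>simp add: f_def power_mult_distrib\<close>)+
  moreover have "(\<lambda>x. f x * g x) = (\<lambda>(k, j). a j * d (k - j) * c k)"
  proof
    fix x :: "(int^3) \<times> (int^3)"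
    obtain k j where x: "x = (k, j)" by (cases x)
    have "\<kappa> j \<noteq> 0" "\<kappa> k \<noteq> 0" using \<kappa>(2) less_imp_neq by metis+
    then show "f x * g x = (case x of (k, j) \<Rightarrow> a j * d (k - j) * c k)"
      by (simp add: x f_def g_def)
  qed
  ultimately show "(\<lambda>(k, j). a j * d (k - j) * c k) summable_on UNIV"
    "infsum (\<lambda>(k, j). a j * d (k - j) * c k) UNIV \<le>
      sqrt (infsum (\<lambda>k. 1 / \<kappa> k ^ 4) UNIV) * l2 (\<lambda>k. \<kappa> k * a k) * l2 d * l2 (\<lambda>k. \<kappa> k * c k)"
    by (simp_all add: S_def[symmetric] mult_ac)
qed

section \<open>Commutator estimates for Fourier weights\<close>

subsection \<open>Pointwise estimates\<close>

lemma power_diff_le: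
  fixes x y :: real
  assumes "0 \<le> x" "x \<le> y"
  shows "y ^ Suc n - x ^ Suc n \<le> real (Suc n) * (y - x) * y ^ n"
proof (induction n)
  case (Suc n)
  have "y ^ Suc (Suc n) - x ^ Suc (Suc n) = y * (y ^ Suc n - x ^ Suc n) + (y - x) * x ^ Suc n"
    by (simp add: algebra_simps)
  also have "\<dots> \<le> y * (real (Suc n) * (y - x) * y ^ n) + (y - x) * y ^ Suc n"
    using assms Suc by (intro add_mono mult_left_mono power_mono) auto
  also have "\<dots> = real (Suc (Suc n)) * (y - x) * y ^ Suc n" by (simp add: algebra_simps)
  finally show ?case .
qed simp

lemma power_sum_le:
  fixes x y :: real
  assumes "0 \<le> x" "0 \<le> y"
  shows "(x + y) ^ n \<le> 2 ^ n * (x ^ n + y ^ n)"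
proof -
  have "(x + y) ^ n \<le> (2 * max x y) ^ n" using assms by (intro power_mono) auto
  also have "\<dots> = 2 ^ n * (max x y) ^ n" by (simp add: power_mult_distrib)
  also have "\<dots> \<le> 2 ^ n * (x ^ n + y ^ n)"
    using assms by (intro mult_left_mono) (auto simp: max_def)
  finally show ?thesis .
qed

lemma abs_power_diff_le:
  fixes J M K :: real
  assumes "0 \<le> J" "0 \<le> M" "0 \<le> K" "\<bar>K - M\<bar> \<le> J" "K \<le> J + M"
  shows "\<bar>K ^ Suc n - M ^ Suc n\<bar> \<le> real (Suc n) * 2 ^ n * J * (J ^ n + M ^ n)"
proof -
  have "\<bar>K ^ Suc n - M ^ Suc n\<bar> \<le> real (Suc n) * \<bar>K - M\<bar> * (max K M) ^ n"
  proof (cases "M \<le> K")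
    case True
    then have "M ^ Suc n \<le> K ^ Suc n" using assms by (intro power_mono) auto
    with True show ?thesis using power_diff_le[of M K n] assms by (simp add: max_def del: power_Suc)
  next
    case False
    then have "K ^ Suc n \<le> M ^ Suc n" using assms by (intro power_mono) auto
    with False show ?thesis using power_diff_le[of K M n] assms
      by (simp add: max_def abs_minus_commute del: power_Suc)
  qed
  also have "\<dots> \<le> real (Suc n) * J * (J + M) ^ n"
    using assms by (intro mult_mono power_mono) auto
  also have "\<dots> \<le> real (Suc n) * J * (2 ^ n * (J ^ n + M ^ n))"
    using assms by (intro mult_left_mono power_sum_le) auto
  finally show ?thesis by (simp add: mult_ac)
qed

lemma exp_minus_one_le:
  fixes x :: real
  assumes "0 \<le> x"
  shows "exp x - 1 \<le> x * exp x" "0 \<le> exp x - 1"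
proof -
  have "(1 - x) * exp x \<le> exp (- x) * exp x"
    using exp_ge_add_one_self[of "- x"] by (intro mult_right_mono) auto
  then show "exp x - 1 \<le> x * exp x" by (simp add: exp_minus algebra_simps)
qed (use assms in auto)

text \<open>Each of the factors \<open>y ^ Suc n\<close> and \<open>exp (\<tau> * y) - 1\<close>
  contributes to the difference in turn; \<open>exp x - 1 \<le> x * exp x\<close> turns the small factor
  into \<open>\<tau> y\<close>, so that no power of \<open>y\<close> is lost.\<close>

lemma gevrey_remainder_diff_le:
  fixes x y \<tau> :: real
  assumes "0 \<le> x" "x \<le> y" "0 \<le> \<tau>"
  shows "\<bar>y ^ Suc n * (exp (\<tau> * y) - 1) - x ^ Suc n * (exp (\<tau> * x) - 1)\<bar>
    \<le> real (n + 2) * \<tau> * (y - x) * y ^ Suc n * exp (\<tau> * y)"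
proof -
  have mono: "x ^ Suc n * (exp (\<tau> * x) - 1) \<le> y ^ Suc n * (exp (\<tau> * y) - 1)"
    using assms by (intro mult_mono power_mono) (auto intro!: mult_left_mono)
  have y: "exp (\<tau> * y) - 1 \<le> \<tau> * y * exp (\<tau> * y)" "0 \<le> exp (\<tau> * y) - 1"
    using exp_minus_one_le[of "\<tau> * y"] assms by auto
  have d: "exp (\<tau> * y) - exp (\<tau> * x) \<le> \<tau> * (y - x) * exp (\<tau> * y)"
  proof -
    have "exp (\<tau> * (y - x)) - 1 \<le> \<tau> * (y - x) * exp (\<tau> * (y - x))"
      using exp_minus_one_le[of "\<tau> * (y - x)"] assms by auto
    then have "(exp (\<tau> * (y - x)) - 1) * exp (\<tau> * x) \<le> \<tau> * (y - x) * exp (\<tau> * (y - x)) * exp (\<tau> * x)"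
      by (rule mult_right_mono) simp
    then show ?thesis by (simp add: left_diff_distrib mult_exp_exp mult.assoc right_diff_distrib)
  qed
  have "y ^ Suc n * (exp (\<tau> * y) - 1) - x ^ Suc n * (exp (\<tau> * x) - 1)
      = (y ^ Suc n - x ^ Suc n) * (exp (\<tau> * y) - 1) + x ^ Suc n * (exp (\<tau> * y) - exp (\<tau> * x))"
    by (simp add: algebra_simps)
  also have "\<dots> \<le> (real (Suc n) * (y - x) * y ^ n) * (\<tau> * y * exp (\<tau> * y))
      + y ^ Suc n * (\<tau> * (y - x) * exp (\<tau> * y))"
    using assms y d
    by (intro add_mono mult_mono power_mono power_diff_le) (auto intro!: mult_nonneg_nonneg mult_left_mono)
  also have "\<dots> = real (n + 2) * \<tau> * (y - x) * y ^ Suc n * exp (\<tau> * y)"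
    by (simp add: algebra_simps)
  finally show ?thesis using mono by simp
qed

text \<open>The variables stand for \<open>J = \<bar>j\<bar>\<close>, \<open>M = \<bar>k -
  j\<bar>\<close>, \<open>K = \<bar>k\<bar>\<close>. The difference of weights gains a factor
  \<open>J\<close>, which pays for the derivative \<open>M\<close> on the transported field.\<close>

lemma sobolev_weight_commutator:
  fixes J M K :: real
  assumes "0 \<le> J" "0 \<le> M" "0 \<le> K" "\<bar>K - M\<bar> \<le> J" "K \<le> J + M"
  shows "M * (K ^ Suc n * \<bar>K ^ Suc n - M ^ Suc n\<bar>)
    \<le> real (Suc n) * 2 ^ n * (J ^ Suc n * M * K ^ Suc n + J * M ^ Suc n * K ^ Suc n)"
proof -
  have "M * (K ^ Suc n * \<bar>K ^ Suc n - M ^ Suc n\<bar>)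
      \<le> M * (K ^ Suc n * (real (Suc n) * 2 ^ n * J * (J ^ n + M ^ n)))"
    using assms by (intro mult_left_mono abs_power_diff_le) auto
  then show ?thesis by (simp add: algebra_simps)
qed

definition gevrey_weight :: "nat \<Rightarrow> real \<Rightarrow> real \<Rightarrow> real" where
  "gevrey_weight r \<tau> x = x ^ r * exp (\<tau> * x)"

definition commutator_const :: "nat \<Rightarrow> real" where
  "commutator_const r = real (r + 1) * 2 ^ r"

text \<open>Expanding \<open>e\<^bsup>\<tau>x\<^esup> = 1 + (e\<^bsup>\<tau>x\<^esup> - 1)\<close> with \<open>0 \<le> e\<^bsup>\<tau>x\<^esup> - 1 \<le> \<tau>xe\<^bsup>\<tau>x\<^esup>\<close> separates a part without
  exponentials from a part with a factor \<open>\<tau>\<close>. The latter has one derivative too many; the triangle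
  inequality \<open>\<surd>K \<le> \<surd>J + \<surd>M\<close> distributes it as two half derivatives over two different factors.\<close>

lemma gevrey_weight_commutator:
  fixes J M K \<tau> :: real
  assumes J: "1 \<le> J" and M: "1 \<le> M" and K: "1 \<le> K" and \<tau>: "0 \<le> \<tau>"
    and tri: "\<bar>K - M\<bar> \<le> J" "K \<le> J + M" "J \<le> K + M" "M \<le> K + J" and r: "r = Suc n"
  shows "M * (gevrey_weight r \<tau> K * \<bar>gevrey_weight r \<tau> K - gevrey_weight r \<tau> M\<bar>)
    \<le> commutator_const r * (J ^ r * (M * sqrt M) * K ^ r + (J * sqrt J) * M ^ r * K ^ r)
     + 4 * \<tau> * commutator_const r * (exp (\<tau> * J) * exp (\<tau> * M) * exp (\<tau> * K)) *
       ((J ^ r * sqrt J) * (M * sqrt M) * (K ^ r * sqrt K) + (J * sqrt J) * (M ^ r * sqrt M) * (K ^ r * sqrt K))"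
proof -
  define C where "C = commutator_const r"
  define eJ eM eK where "eJ = exp (\<tau> * J)" and "eM = exp (\<tau> * M)" and "eK = exp (\<tau> * K)"
  have e: "1 \<le> eJ" "1 \<le> eM" "1 \<le> eK" using J M K \<tau> by (auto simp: eJ_def eM_def eK_def)
  define E where "E = eJ * eM * eK"
  have Kk: "eK - 1 \<le> \<tau> * K * eK" "0 \<le> eK - 1"
    using exp_minus_one_le[of "\<tau> * K"] \<tau> K by (auto simp: eK_def)
  have eKE: "eK \<le> E"
  proof -
    have "1 * 1 * eK \<le> eJ * eM * eK" using e by (intro mult_mono) auto
    then show ?thesis by (simp add: E_def)
  qed
  have pd: "\<bar>K ^ r - M ^ r\<bar> \<le> C * J * (J ^ n + M ^ n)"
  proof -
    have "\<bar>K ^ r - M ^ r\<bar> \<le> real (Suc n) * 2 ^ n * J * (J ^ n + M ^ n)"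
      unfolding r using J M K tri by (intro abs_power_diff_le) auto
    also have "\<dots> \<le> C * J * (J ^ n + M ^ n)"
    proof -
      have "real (Suc n) * 2 ^ n \<le> C" unfolding C_def commutator_const_def r
        by (intro mult_mono power_increasing) auto
      then show ?thesis using J M by (intro mult_right_mono) auto
    qed
    finally show ?thesis .
  qed
  have rem: "\<bar>K ^ r * (eK - 1) - M ^ r * (eM - 1)\<bar> \<le> C * \<tau> * J * (J ^ r + M ^ r) * (eJ * eM)"
  proof -
    define y where "y = max K M"
    have y: "0 \<le> y" "y \<le> J + M" "1 \<le> y" using J M K tri by (auto simp: y_def)
    have "\<bar>K ^ r * (eK - 1) - M ^ r * (eM - 1)\<bar> \<le> real (n + 2) * \<tau> * \<bar>K - M\<bar> * y ^ r * exp (\<tau> * y)"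
    proof (cases "M \<le> K")
      case True
      then show ?thesis using gevrey_remainder_diff_le[of M K \<tau> n] M \<tau>
        by (simp add: y_def max_def r eK_def eM_def del: power_Suc)
    next
      case False
      then show ?thesis using gevrey_remainder_diff_le[of K M \<tau> n] K \<tau>
        by (simp add: y_def max_def r eK_def eM_def abs_minus_commute del: power_Suc)
    qed
    also have "\<dots> \<le> real (n + 2) * \<tau> * J * (2 ^ r * (J ^ r + M ^ r)) * (eJ * eM)"
    proof -
      have "y ^ r \<le> (J + M) ^ r" using y by (intro power_mono) auto
      also have "\<dots> \<le> 2 ^ r * (J ^ r + M ^ r)" using J M by (intro power_sum_le) auto
      finally have 1: "y ^ r \<le> 2 ^ r * (J ^ r + M ^ r)" .
      have "exp (\<tau> * y) \<le> exp (\<tau> * (J + M))" using y \<tau> by (auto intro!: mult_left_mono)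
      then have 2: "exp (\<tau> * y) \<le> eJ * eM" by (simp add: eJ_def eM_def mult_exp_exp distrib_left)
      show ?thesis
        using J M \<tau> y tri by (intro mult_mono 1 2) (auto intro!: mult_nonneg_nonneg)
    qed
    also have "\<dots> = C * \<tau> * J * (J ^ r + M ^ r) * (eJ * eM)"
      by (simp add: C_def commutator_const_def r algebra_simps)
    finally show ?thesis .
  qed
  have C: "0 \<le> C" by (simp add: C_def commutator_const_def)
  have W: "gevrey_weight r \<tau> x = x ^ r + x ^ r * (exp (\<tau> * x) - 1)" for x
    by (simp add: gevrey_weight_def algebra_simps)
  have WK: "gevrey_weight r \<tau> K = K ^ r * eK" by (simp add: gevrey_weight_def eK_def)
  have "\<bar>gevrey_weight r \<tau> K - gevrey_weight r \<tau> M\<bar>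
      \<le> \<bar>K ^ r - M ^ r\<bar> + \<bar>K ^ r * (eK - 1) - M ^ r * (eM - 1)\<bar>"
    unfolding W eK_def eM_def by linarith
  also have "\<dots> \<le> C * J * (J ^ n + M ^ n) + C * \<tau> * J * (J ^ r + M ^ r) * (eJ * eM)"
    by (intro add_mono pd rem)
  finally have "K ^ r * eK * \<bar>gevrey_weight r \<tau> K - gevrey_weight r \<tau> M\<bar>
      \<le> K ^ r * eK * (C * J * (J ^ n + M ^ n) + C * \<tau> * J * (J ^ r + M ^ r) * (eJ * eM))"
    using K e by (intro mult_left_mono) auto
  also have "\<dots> = K ^ r * (1 + (eK - 1)) * (C * J * (J ^ n + M ^ n)) + \<tau> * C * E * K ^ r * (J * (J ^ r + M ^ r))"
    by (simp add: E_def algebra_simps)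
  also have "\<dots> \<le> K ^ r * (1 + \<tau> * K * E) * (C * J * (J ^ n + M ^ n)) + \<tau> * C * E * K ^ r * (J * (J ^ r + M ^ r))"
  proof -
    have "\<tau> * K * eK \<le> \<tau> * K * E" using eKE \<tau> K by (intro mult_left_mono) auto
    then have "eK - 1 \<le> \<tau> * K * E" using Kk by linarith
    moreover have "0 \<le> E" using e by (simp add: E_def)
    ultimately show ?thesis using K C J M \<tau> by (intro add_mono mult_right_mono mult_left_mono) auto
  qed
  finally have "M * (gevrey_weight r \<tau> K * \<bar>gevrey_weight r \<tau> K - gevrey_weight r \<tau> M\<bar>)
      \<le> M * (K ^ r * (1 + \<tau> * K * E) * (C * J * (J ^ n + M ^ n)) + \<tau> * C * E * K ^ r * (J * (J ^ r + M ^ r)))"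
    unfolding WK using M by (intro mult_left_mono) auto
  also have "\<dots> = C * (J ^ r * M * K ^ r + J * M ^ r * K ^ r) + \<tau> * C * E *
      (K * K ^ r * (J ^ r * M) + K * K ^ r * (J * M ^ r) + K ^ r * (J * J ^ r * M) + K ^ r * (J * (M * M ^ r)))"
    by (simp add: r algebra_simps)
  also have "\<dots> \<le> C * (J ^ r * (M * sqrt M) * K ^ r + (J * sqrt J) * M ^ r * K ^ r)
     + \<tau> * C * E * (4 * ((J ^ r * sqrt J) * (M * sqrt M) * (K ^ r * sqrt K) + (J * sqrt J) * (M ^ r * sqrt M) * (K ^ r * sqrt K)))"
  proof (rule add_mono)
    (* Every term that carries one full derivative too many is split by the triangle inequality for square roots. *)
    define a b c where "a = sqrt J" and "b = sqrt M" and "c = sqrt K"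
    have abc: "1 \<le> a" "1 \<le> b" "1 \<le> c" "a * a = J" "b * b = M" "c * c = K"
      using J M K by (auto simp: a_def b_def c_def)
    have sq: "sqrt (x + y) \<le> sqrt x + sqrt y" if "0 \<le> x" "0 \<le> y" for x y :: real
      using that by (rule sqrt_add_le_add_sqrt)
    have tri': "c \<le> a + b" "a \<le> c + b" "b \<le> c + a"
      using sq[of J M] sq[of K M] sq[of K J] tri J M K real_sqrt_le_mono[OF tri(2)]
        real_sqrt_le_mono[OF tri(3)] real_sqrt_le_mono[OF tri(4)] unfolding a_def b_def c_def by linarith+
    have Ma: "M \<le> M * b" "J \<le> J * a" "K ^ r \<le> K ^ r * c"
      using abc J M K by (simp_all add: mult_le_cancel_left1)
    show "C * (J ^ r * M * K ^ r + J * M ^ r * K ^ r) \<le> C * (J ^ r * (M * sqrt M) * K ^ r + (J * sqrt J) * M ^ r * K ^ r)"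
      unfolding a_def[symmetric] b_def[symmetric]
      using Ma J M K C by (intro mult_left_mono add_mono mult_right_mono) auto
    define P Q where "P = (J ^ r * a) * (M * b) * (K ^ r * c)" and "Q = (J * a) * (M ^ r * b) * (K ^ r * c)"
    have 1: "K * K ^ r * (J ^ r * M) \<le> P + P"
    proof -
      have "K * K ^ r * (J ^ r * M) = c * (c * K ^ r * (J ^ r * M))" by (simp add: abc(6)[symmetric])
      also have "\<dots> \<le> (a + b) * (c * K ^ r * (J ^ r * M))"
        using tri' abc J M K by (intro mult_right_mono) auto
      also have "\<dots> = (J ^ r * a) * M * (K ^ r * c) + (J ^ r * 1) * (M * b) * (K ^ r * c)"
        by (simp add: algebra_simps)
      also have "\<dots> \<le> P + P" unfolding P_def
        using abc J M K Ma by (intro add_mono mult_right_mono mult_left_mono) auto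
      finally show ?thesis .
    qed
    have 2: "K * K ^ r * (J * M ^ r) \<le> Q + Q"
    proof -
      have "K * K ^ r * (J * M ^ r) = c * (c * K ^ r * (J * M ^ r))" by (simp add: abc(6)[symmetric])
      also have "\<dots> \<le> (a + b) * (c * K ^ r * (J * M ^ r))"
        using tri' abc J M K by (intro mult_right_mono) auto
      also have "\<dots> = (J * a) * (M ^ r * 1) * (K ^ r * c) + J * (M ^ r * b) * (K ^ r * c)"
        by (simp add: algebra_simps)
      also have "\<dots> \<le> Q + Q" unfolding Q_def
        using abc J M K Ma by (intro add_mono mult_right_mono mult_left_mono) auto
      finally show ?thesis .
    qed
    have 3: "K ^ r * (J * J ^ r * M) \<le> P + P"
    proof -
      have "K ^ r * (J * J ^ r * M) = a * (a * J ^ r * M * K ^ r)" by (simp add: abc(4)[symmetric])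
      also have "\<dots> \<le> (c + b) * (a * J ^ r * M * K ^ r)"
        using tri' abc J M K by (intro mult_right_mono) auto
      also have "\<dots> = (J ^ r * a) * M * (K ^ r * c) + (J ^ r * a) * (M * b) * K ^ r"
        by (simp add: algebra_simps)
      also have "\<dots> \<le> P + P" unfolding P_def
        using abc J M K Ma by (intro add_mono mult_right_mono mult_left_mono) auto
      finally show ?thesis .
    qed
    have 4: "K ^ r * (J * (M * M ^ r)) \<le> Q + Q"
    proof -
      have "K ^ r * (J * (M * M ^ r)) = b * (b * J * M ^ r * K ^ r)" by (simp add: abc(5)[symmetric])
      also have "\<dots> \<le> (c + a) * (b * J * M ^ r * K ^ r)"
        using tri' abc J M K by (intro mult_right_mono) auto
      also have "\<dots> = J * (M ^ r * b) * (K ^ r * c) + (J * a) * (M ^ r * b) * K ^ r"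
        by (simp add: algebra_simps)
      also have "\<dots> \<le> Q + Q" unfolding Q_def
        using abc J M K Ma by (intro add_mono mult_right_mono mult_left_mono) auto
      finally show ?thesis .
    qed
    have "K * K ^ r * (J ^ r * M) + K * K ^ r * (J * M ^ r) + K ^ r * (J * J ^ r * M) + K ^ r * (J * (M * M ^ r)) \<le> 4 * (P + Q)"
    proof -
      have "K * K ^ r * (J ^ r * M) + K * K ^ r * (J * M ^ r) + K ^ r * (J * J ^ r * M) + K ^ r * (J * (M * M ^ r))
          \<le> (P + P) + (Q + Q) + (P + P) + (Q + Q)"
        by (intro add_mono 1 2 3 4)
      then show ?thesis by simp
    qed
    moreover have "0 \<le> \<tau> * C * E" using \<tau> C e by (auto simp: E_def)
    ultimately show "\<tau> * C * E * (K * K ^ r * (J ^ r * M) + K * K ^ r * (J * M ^ r) + K ^ r * (J * J ^ r * M) + K ^ r * (J * (M * M ^ r)))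
      \<le> \<tau> * C * E * (4 * ((J ^ r * sqrt J) * (M * sqrt M) * (K ^ r * sqrt K) + (J * sqrt J) * (M ^ r * sqrt M) * (K ^ r * sqrt K)))"
      unfolding P_def Q_def a_def b_def c_def by (rule mult_left_mono)
  qed
  finally show ?thesis by (simp add: C_def E_def eJ_def eM_def eK_def algebra_simps)
qed

subsection \<open>Summed estimates\<close>

definition gnorm :: "nat \<Rightarrow> real \<Rightarrow> (int^3 \<Rightarrow> real) \<Rightarrow> real" where
  "gnorm r \<tau> f = l2 (\<lambda>k. kn k ^ r * exp (\<tau> * kn k) * f k)"

definition gnorm_half :: "nat \<Rightarrow> real \<Rightarrow> (int^3 \<Rightarrow> real) \<Rightarrow> real" where
  "gnorm_half r \<tau> f = l2 (\<lambda>k. kn k ^ r * sqrt (kn k) * exp (\<tau> * kn k) * f k)"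

lemma kn_power_mono:
  assumes "f 0 = (0::real)" "\<And>k. 0 \<le> f k" "m \<le> n"
  shows "kn k ^ m * f k \<le> kn k ^ n * f k"
proof (cases "k = 0")
  case False
  then show ?thesis using assms kn_ge_1[of k] by (intro mult_right_mono power_increasing) auto
qed (simp add: assms)

text \<open>The threshold on \<open>r\<close> comes from here: the weighted Cauchy--Schwarz bound is used
  with exponent \<open>5/2 > 3/2\<close>, and \<open>3/2 + 5/2 = 4 \<le> r\<close>.\<close>

lemma gevrey_l1_bound:
  fixes f :: "int^3 \<Rightarrow> real"
  assumes f: "\<And>k. 0 \<le> f k" "f 0 = 0" and r: "4 \<le> r"
    and s: "is_l2 (\<lambda>k. kn k ^ r * exp (\<tau> * kn k) * f k)"
  shows "(\<lambda>k. kn k * sqrt (kn k) * (exp (\<tau> * kn k) * f k)) summable_on UNIV"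
    "infsum (\<lambda>k. kn k * sqrt (kn k) * (exp (\<tau> * kn k) * f k)) UNIV \<le> lattice_const (5/2) * gnorm r \<tau> f"
proof -
  let ?a = "\<lambda>k. kn k * sqrt (kn k) * (exp (\<tau> * kn k) * f k)"
  have eq: "kn k powr (5/2) * ?a k = kn k ^ 4 * (exp (\<tau> * kn k) * f k)" for k
  proof (cases "k = 0")
    case False
    then have k: "0 < kn k" using kn_ge_1[of k] by linarith
    have "kn k powr (5/2) * (kn k * sqrt (kn k)) = kn k powr (5/2) * (kn k powr 1 * kn k powr (1/2))"
      using k by (simp only: powr_half_sqrt powr_one norm_ge_zero)
    also have "\<dots> = kn k powr 4" by (simp only: powr_add[symmetric]) simp
    also have "\<dots> = kn k ^ 4" using k by (simp add: powr_numeral)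
    finally show ?thesis by (simp add: mult.assoc[symmetric])
  qed (simp add: f)
  have le: "\<bar>kn k powr (5/2) * ?a k\<bar> \<le> kn k ^ r * exp (\<tau> * kn k) * f k" for k
    using kn_power_mono[of "\<lambda>k. exp (\<tau> * kn k) * f k" 4 r k] f r
    unfolding eq by (simp add: mult.assoc)
  note sq = is_l2_comparison[OF s le]
  show "?a summable_on UNIV"
    by (rule summable_if_weighted_is_l2(1)[of "5/2"]) (use f sq(1) in auto)
  have "infsum ?a UNIV \<le> lattice_const (5/2) * l2 (\<lambda>k. kn k powr (5/2) * ?a k)"
    by (rule summable_if_weighted_is_l2(2)) (use f sq(1) in auto)
  also have "\<dots> \<le> lattice_const (5/2) * gnorm r \<tau> f"
    unfolding gnorm_def by (intro mult_left_mono sq(2)) auto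
  finally show "infsum ?a UNIV \<le> lattice_const (5/2) * gnorm r \<tau> f" .
qed

text \<open>In each term of the pointwise commutator bound one of the factors with frequencies
  \<open>j\<close> and \<open>k - j\<close> carries only \<open>3/2\<close> derivatives. It is summed in
  \<open>\<ell>\<^sup>1\<close> and the other two in \<open>\<ell>\<^sup>2\<close>.\<close>

lemma gevrey_commutator_sum:
  fixes p q :: "int^3 \<Rightarrow> real"
  assumes p: "\<And>k. 0 \<le> p k" "p 0 = 0" and q: "\<And>k. 0 \<le> q k" "q 0 = 0"
    and r: "4 \<le> r" and \<tau>: "0 \<le> \<tau>"
    and sp: "is_l2 (\<lambda>k. kn k ^ r * sqrt (kn k) * exp (\<tau> * kn k) * p k)"
    and sq: "is_l2 (\<lambda>k. kn k ^ r * sqrt (kn k) * exp (\<tau> * kn k) * q k)"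
  defines "c \<equiv> commutator_const r * lattice_const (5/2)"
    and "F \<equiv> \<lambda>(k, j). p j * (kn (k - j) * q (k - j)) * q k *
          (gevrey_weight r \<tau> (kn k) * \<bar>gevrey_weight r \<tau> (kn k) - gevrey_weight r \<tau> (kn (k - j))\<bar>)"
  shows "F summable_on UNIV"
    "infsum F UNIV \<le> (2 * c) * gnorm r 0 p * (gnorm r 0 q)^2
      + \<tau> * (4 * c) * (gnorm r \<tau> p * (gnorm_half r \<tau> q)^2
                     + gnorm_half r \<tau> p * gnorm r \<tau> q * gnorm_half r \<tau> q)"
proof -
  define C where "C = commutator_const r"
  have C: "0 \<le> C" by (simp add: C_def commutator_const_def)
  define L where "L = lattice_const (5/2)"
  have L: "0 \<le> L" by (simp add: L_def)
  have full: "is_l2 (\<lambda>k. kn k ^ r * exp (\<tau> * kn k) * f k)"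
    and zero: "is_l2 (\<lambda>k. kn k ^ r * exp (0 * kn k) * f k)"
    if f: "\<And>k. 0 \<le> f k" "f 0 = 0" and s: "is_l2 (\<lambda>k. kn k ^ r * sqrt (kn k) * exp (\<tau> * kn k) * f k)"
    for f :: "int^3 \<Rightarrow> real"
  proof -
    have "\<bar>kn k ^ r * exp (\<tau> * kn k) * f k\<bar> \<le> kn k ^ r * sqrt (kn k) * exp (\<tau> * kn k) * f k" for k
    proof (cases "k = 0")
      case False
      then have k: "1 \<le> sqrt (kn k)" using kn_ge_1[of k] by simp
      have "(kn k ^ r * exp (\<tau> * kn k) * f k) * 1 \<le> (kn k ^ r * exp (\<tau> * kn k) * f k) * sqrt (kn k)"
        using f k by (intro mult_left_mono) auto
      then show ?thesis using f by (simp add: mult_ac)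
    qed (simp add: f)
    then show 1: "is_l2 (\<lambda>k. kn k ^ r * exp (\<tau> * kn k) * f k)"
      by (rule is_l2_comparison(1)[OF s])
    have "\<bar>kn k ^ r * exp (0 * kn k) * f k\<bar> \<le> kn k ^ r * exp (\<tau> * kn k) * f k" for k
    proof -
      have "kn k ^ r * f k * 1 \<le> kn k ^ r * f k * exp (\<tau> * kn k)"
        using f \<tau> by (intro mult_left_mono) auto
      then show ?thesis using f by (simp add: mult_ac)
    qed
    then show "is_l2 (\<lambda>k. kn k ^ r * exp (0 * kn k) * f k)"
      by (rule is_l2_comparison(1)[OF 1])
  qed
  note fp = full[OF p sp] and fq = full[OF q sq] and zp = zero[OF p sp] and zq = zero[OF q sq]
  define l where "l \<tau> f k = kn k * sqrt (kn k) * (exp (\<tau> * kn k) * f k)" for \<tau> and f :: "int^3 \<Rightarrow> real" and k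
  have l0: "0 \<le> l \<tau> f k" if "\<And>k. 0 \<le> f k" for \<tau> f k using that by (simp add: l_def)
  have lp: "l \<tau> p summable_on UNIV" "infsum (l \<tau> p) UNIV \<le> L * gnorm r \<tau> p"
    and lq: "l \<tau> q summable_on UNIV" "infsum (l \<tau> q) UNIV \<le> L * gnorm r \<tau> q"
    and lp0: "l 0 p summable_on UNIV" "infsum (l 0 p) UNIV \<le> L * gnorm r 0 p"
    and lq0: "l 0 q summable_on UNIV" "infsum (l 0 q) UNIV \<le> L * gnorm r 0 q"
    using gevrey_l1_bound[OF p r fp] gevrey_l1_bound[OF q r fq] gevrey_l1_bound[OF p r zp] gevrey_l1_bound[OF q r zq]
    by (simp_all add: l_def[abs_def] L_def)
  define w where "w \<tau> f k = kn k ^ r * exp (\<tau> * kn k) * f k" for \<tau> and f :: "int^3 \<Rightarrow> real" and k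
  define h where "h f k = kn k ^ r * sqrt (kn k) * exp (\<tau> * kn k) * f k" for f :: "int^3 \<Rightarrow> real" and k
  have ss: "is_l2 (w 0 p)" "is_l2 (w 0 q)" "is_l2 (w \<tau> p)" "is_l2 (w \<tau> q)"
    "is_l2 (h p)" "is_l2 (h q)"
    using fp fq zp zq sp sq by (simp_all add: w_def[abs_def] h_def[abs_def])
  have ln: "l2 (w 0 p) = gnorm r 0 p" "l2 (w 0 q) = gnorm r 0 q" "l2 (w \<tau> p) = gnorm r \<tau> p" "l2 (w \<tau> q) = gnorm r \<tau> q"
    "l2 (h p) = gnorm_half r \<tau> p" "l2 (h q) = gnorm_half r \<tau> q"
    by (simp_all add: w_def[abs_def] h_def[abs_def] gnorm_def gnorm_half_def)
  define A where "A = (\<lambda>(k, j). w 0 p j * l 0 q (k - j) * w 0 q k)"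
  define B where "B = (\<lambda>(k, j). l 0 p j * w 0 q (k - j) * w 0 q k)"
  define A' where "A' = (\<lambda>(k, j). h p j * l \<tau> q (k - j) * h q k)"
  define B' where "B' = (\<lambda>(k, j). l \<tau> p j * h q (k - j) * h q k)"
  have A: "A summable_on UNIV" "infsum A UNIV \<le> L * gnorm r 0 p * (gnorm r 0 q)^2"
  proof -
    show "A summable_on UNIV" unfolding A_def using lq0 l0[OF q(1)] ss by (intro trilinear_l2_l1_l2)
    have "infsum A UNIV \<le> infsum (l 0 q) UNIV * l2 (w 0 p) * l2 (w 0 q)"
      unfolding A_def using lq0 l0[OF q(1)] ss by (intro trilinear_l2_l1_l2)
    also have "\<dots> \<le> (L * gnorm r 0 q) * l2 (w 0 p) * l2 (w 0 q)"
      using lq0 by (intro mult_right_mono) auto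
    finally show "infsum A UNIV \<le> L * gnorm r 0 p * (gnorm r 0 q)^2"
      by (simp add: ln power2_eq_square mult_ac)
  qed
  have B: "B summable_on UNIV" "infsum B UNIV \<le> L * gnorm r 0 p * (gnorm r 0 q)^2"
  proof -
    show "B summable_on UNIV" unfolding B_def using lp0 l0[OF p(1)] ss by (intro trilinear_l1_l2_l2)
    have "infsum B UNIV \<le> infsum (l 0 p) UNIV * l2 (w 0 q) * l2 (w 0 q)"
      unfolding B_def using lp0 l0[OF p(1)] ss by (intro trilinear_l1_l2_l2)
    also have "\<dots> \<le> (L * gnorm r 0 p) * l2 (w 0 q) * l2 (w 0 q)"
      using lp0 by (intro mult_right_mono) auto
    finally show "infsum B UNIV \<le> L * gnorm r 0 p * (gnorm r 0 q)^2"
      by (simp add: ln power2_eq_square mult_ac)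
  qed
  have A': "A' summable_on UNIV" "infsum A' UNIV \<le> L * (gnorm_half r \<tau> p * gnorm r \<tau> q * gnorm_half r \<tau> q)"
  proof -
    show "A' summable_on UNIV" unfolding A'_def using lq l0[OF q(1)] ss by (intro trilinear_l2_l1_l2)
    have "infsum A' UNIV \<le> infsum (l \<tau> q) UNIV * l2 (h p) * l2 (h q)"
      unfolding A'_def using lq l0[OF q(1)] ss by (intro trilinear_l2_l1_l2)
    also have "\<dots> \<le> (L * gnorm r \<tau> q) * l2 (h p) * l2 (h q)"
      using lq by (intro mult_right_mono) auto
    finally show "infsum A' UNIV \<le> L * (gnorm_half r \<tau> p * gnorm r \<tau> q * gnorm_half r \<tau> q)"
      by (simp add: ln mult_ac)
  qed
  have B': "B' summable_on UNIV" "infsum B' UNIV \<le> L * (gnorm r \<tau> p * (gnorm_half r \<tau> q)^2)"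
  proof -
    show "B' summable_on UNIV" unfolding B'_def using lp l0[OF p(1)] ss by (intro trilinear_l1_l2_l2)
    have "infsum B' UNIV \<le> infsum (l \<tau> p) UNIV * l2 (h q) * l2 (h q)"
      unfolding B'_def using lp l0[OF p(1)] ss by (intro trilinear_l1_l2_l2)
    also have "\<dots> \<le> (L * gnorm r \<tau> p) * l2 (h q) * l2 (h q)"
      using lp by (intro mult_right_mono) auto
    finally show "infsum B' UNIV \<le> L * (gnorm r \<tau> p * (gnorm_half r \<tau> q)^2)"
      by (simp add: ln power2_eq_square mult_ac)
  qed
  define G where "G x = C * A x + C * B x + (4 * \<tau> * C) * A' x + (4 * \<tau> * C) * B' x" for x
  have G: "G summable_on UNIV" "infsum G UNIV = C * infsum A UNIV + C * infsum B UNIV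
      + (4 * \<tau> * C) * infsum A' UNIV + (4 * \<tau> * C) * infsum B' UNIV"
  proof -
    have "(G has_sum (C * infsum A UNIV + C * infsum B UNIV
      + (4 * \<tau> * C) * infsum A' UNIV + (4 * \<tau> * C) * infsum B' UNIV)) UNIV"
      unfolding G_def[abs_def]
      by (intro has_sum_add has_sum_cmult_right has_sum_infsum A B A' B')
    then show "G summable_on UNIV" "infsum G UNIV = C * infsum A UNIV + C * infsum B UNIV
      + (4 * \<tau> * C) * infsum A' UNIV + (4 * \<tau> * C) * infsum B' UNIV"
      by (auto simp: has_sum_iff)
  qed
  have nonneg: "0 \<le> F x" for x
    by (cases x) (simp add: F_def p q gevrey_weight_def)
  have le: "F x \<le> G x" for x
  proof -
    obtain k j where x: "x = (k, j)" by (cases x)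
    show ?thesis
    proof (cases "j = 0 \<or> k = 0 \<or> k - j = 0")
      case True
      then have "F x = 0" by (auto simp: x F_def p q)
      moreover have "0 \<le> A x" "0 \<le> B x" "0 \<le> A' x" "0 \<le> B' x"
        by (simp_all add: x A_def B_def A'_def B'_def l_def w_def h_def p q)
      ultimately show ?thesis using C \<tau> by (simp add: G_def)
    next
      case False
      obtain n where n: "r = Suc n" using r by (cases r) auto
      let ?J = "kn j" and ?M = "kn (k - j)" and ?K = "kn k"
      have tri: "?K \<le> ?J + ?M" "?J \<le> ?K + ?M" "?M \<le> ?K + ?J"
        by (rule kn_triangle)+
      then have "\<bar>?K - ?M\<bar> \<le> ?J" by linarith
      with False tri have *: "?M * (gevrey_weight r \<tau> ?K * \<bar>gevrey_weight r \<tau> ?K - gevrey_weight r \<tau> ?M\<bar>)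
        \<le> C * (?J ^ r * (?M * sqrt ?M) * ?K ^ r + (?J * sqrt ?J) * ?M ^ r * ?K ^ r)
         + 4 * \<tau> * C * (exp (\<tau> * ?J) * exp (\<tau> * ?M) * exp (\<tau> * ?K)) *
         ((?J ^ r * sqrt ?J) * (?M * sqrt ?M) * (?K ^ r * sqrt ?K) + (?J * sqrt ?J) * (?M ^ r * sqrt ?M) * (?K ^ r * sqrt ?K))"
        unfolding C_def by (intro gevrey_weight_commutator[OF _ _ _ \<tau> _ _ _ _ n] kn_ge_1) auto
      have "F x = (p j * q (k - j) * q k) * (?M * (gevrey_weight r \<tau> ?K * \<bar>gevrey_weight r \<tau> ?K - gevrey_weight r \<tau> ?M\<bar>))"
        by (simp add: F_def x mult_ac)
      also have "\<dots> \<le> (p j * q (k - j) * q k) * (C * (?J ^ r * (?M * sqrt ?M) * ?K ^ r + (?J * sqrt ?J) * ?M ^ r * ?K ^ r)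
         + 4 * \<tau> * C * (exp (\<tau> * ?J) * exp (\<tau> * ?M) * exp (\<tau> * ?K)) *
         ((?J ^ r * sqrt ?J) * (?M * sqrt ?M) * (?K ^ r * sqrt ?K) + (?J * sqrt ?J) * (?M ^ r * sqrt ?M) * (?K ^ r * sqrt ?K)))"
        using p q by (intro mult_left_mono *) auto
      also have "\<dots> = G x"
        by (simp add: G_def x A_def B_def A'_def B'_def l_def w_def h_def algebra_simps)
      finally show ?thesis .
    qed
  qed
  show F: "F summable_on UNIV" by (rule summable_on_comparison_test[OF G(1)]) (use le nonneg in auto)
  have "infsum F UNIV \<le> infsum G UNIV" by (rule infsum_mono[OF F G(1)]) (rule le)
  also have "\<dots> \<le> C * (L * gnorm r 0 p * (gnorm r 0 q)^2) + C * (L * gnorm r 0 p * (gnorm r 0 q)^2)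
      + (4 * \<tau> * C) * (L * (gnorm_half r \<tau> p * gnorm r \<tau> q * gnorm_half r \<tau> q))
      + (4 * \<tau> * C) * (L * (gnorm r \<tau> p * (gnorm_half r \<tau> q)^2))"
    unfolding G(2) using C \<tau> by (intro add_mono mult_left_mono A B A' B') auto
  also have "\<dots> = (2 * c) * gnorm r 0 p * (gnorm r 0 q)^2
      + \<tau> * (4 * c) * (gnorm r \<tau> p * (gnorm_half r \<tau> q)^2
                     + gnorm_half r \<tau> p * gnorm r \<tau> q * gnorm_half r \<tau> q)"
    by (simp add: c_def C_def L_def algebra_simps)
  finally show "infsum F UNIV \<le> (2 * c) * gnorm r 0 p * (gnorm r 0 q)^2
      + \<tau> * (4 * c) * (gnorm r \<tau> p * (gnorm_half r \<tau> q)^2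
                     + gnorm_half r \<tau> p * gnorm r \<tau> q * gnorm_half r \<tau> q)" .
qed

text \<open>The case of equal fields and pure powers. The factor with one derivative is kept in
  \<open>\<ell>\<^sup>1\<close> instead of being bounded by the top norm, because the growth estimate
  interpolates it.\<close>

lemma sobolev_commutator_sum:
  fixes p :: "int^3 \<Rightarrow> real"
  assumes p: "\<And>k. 0 \<le> p k" "p 0 = 0" and l1: "(\<lambda>k. kn k * p k) summable_on UNIV"
    and s: "is_l2 (\<lambda>k. kn k ^ Suc n * p k)"
  defines "F \<equiv> \<lambda>(k, j). p j * (kn (k - j) * p (k - j)) * p k *
          (kn k ^ Suc n * \<bar>kn k ^ Suc n - kn (k - j) ^ Suc n\<bar>)"
  shows "F summable_on UNIV"
    "infsum F UNIV \<le> 2 * (real (Suc n) * 2 ^ n) * infsum (\<lambda>k. kn k * p k) UNIV * (l2 (\<lambda>k. kn k ^ Suc n * p k))^2"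
proof -
  define C where "C = real (Suc n) * 2 ^ n"
  have C: "0 \<le> C" by (simp add: C_def)
  define A B where "A = (\<lambda>(k, j). (kn j ^ Suc n * p j) * (kn (k - j) * p (k - j)) * (kn k ^ Suc n * p k))"
    and "B = (\<lambda>(k, j). (kn j * p j) * (kn (k - j) ^ Suc n * p (k - j)) * (kn k ^ Suc n * p k))"
  have A: "A summable_on UNIV"
    "infsum A UNIV \<le> infsum (\<lambda>k. kn k * p k) UNIV * l2 (\<lambda>k. kn k ^ Suc n * p k) * l2 (\<lambda>k. kn k ^ Suc n * p k)"
    unfolding A_def using p by (intro trilinear_l2_l1_l2 l1 s; simp)+
  have B: "B summable_on UNIV"
    "infsum B UNIV \<le> infsum (\<lambda>k. kn k * p k) UNIV * l2 (\<lambda>k. kn k ^ Suc n * p k) * l2 (\<lambda>k. kn k ^ Suc n * p k)"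
    unfolding B_def using p by (intro trilinear_l1_l2_l2 l1 s; simp)+
  have G: "((\<lambda>x. C * A x + C * B x) has_sum (C * infsum A UNIV + C * infsum B UNIV)) UNIV"
    by (intro has_sum_add has_sum_cmult_right has_sum_infsum A B)
  have nonneg: "0 \<le> F x" for x by (cases x) (simp add: F_def p)
  have le: "F x \<le> C * A x + C * B x" for x
  proof -
    obtain k j where x: "x = (k, j)" by (cases x)
    let ?J = "kn j" and ?M = "kn (k - j)" and ?K = "kn k"
    have tri: "?K \<le> ?J + ?M" "\<bar>?K - ?M\<bar> \<le> ?J" using kn_triangle[of k j] by linarith+
    have "F x = (p j * p (k - j) * p k) * (?M * (?K ^ Suc n * \<bar>?K ^ Suc n - ?M ^ Suc n\<bar>))"
      by (simp add: F_def x mult_ac del: power_Suc)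
    also have "\<dots> \<le> (p j * p (k - j) * p k) * (C * (?J ^ Suc n * ?M * ?K ^ Suc n + ?J * ?M ^ Suc n * ?K ^ Suc n))"
      unfolding C_def using p tri by (intro mult_left_mono sobolev_weight_commutator) auto
    also have "\<dots> = C * A x + C * B x"
      by (simp add: x A_def B_def algebra_simps del: power_Suc)
    finally show ?thesis .
  qed
  show F: "F summable_on UNIV"
    by (rule summable_on_comparison_test[OF has_sum_imp_summable[OF G]]) (use le nonneg in auto)
  have "infsum F UNIV \<le> infsum (\<lambda>x. C * A x + C * B x) UNIV"
    by (rule infsum_mono[OF F has_sum_imp_summable[OF G]]) (rule le)
  also have "\<dots> = C * infsum A UNIV + C * infsum B UNIV" using G by (rule infsumI)
  also have "\<dots> \<le> C * (infsum (\<lambda>k. kn k * p k) UNIV * l2 (\<lambda>k. kn k ^ Suc n * p k) * l2 (\<lambda>k. kn k ^ Suc n * p k))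
     + C * (infsum (\<lambda>k. kn k * p k) UNIV * l2 (\<lambda>k. kn k ^ Suc n * p k) * l2 (\<lambda>k. kn k ^ Suc n * p k))"
    using C by (intro add_mono mult_left_mono A B)
  finally show "infsum F UNIV \<le> 2 * (real (Suc n) * 2 ^ n) * infsum (\<lambda>k. kn k * p k) UNIV * (l2 (\<lambda>k. kn k ^ Suc n * p k))^2"
    by (simp add: C_def power2_eq_square algebra_simps)
qed

section \<open>The transport term on the Fourier side\<close>

subsection \<open>Complex vectors\<close>

definition cdot :: "real^3 \<Rightarrow> complex^3 \<Rightarrow> complex" where
  "cdot x a = (\<Sum>i\<in>UNIV. of_real (x $ i) * a $ i)"

definition vcnj :: "complex^3 \<Rightarrow> complex^3" where
  "vcnj a = (\<chi> i. cnj (a $ i))"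

definition cvec :: "real^3 \<Rightarrow> complex^3" where
  "cvec x = (\<chi> i. of_real (x $ i))"

lemma cdot_simps [simp]:
  "cdot 0 a = 0" "cdot x 0 = 0" "cdot (- x) a = - cdot x a" "cdot x (- a) = - cdot x a"
  "cdot x (c *s a) = c * cdot x a" "cdot x (t *\<^sub>R a) = of_real t * cdot x a"
  by (simp_all add: cdot_def sum_negf sum_distrib_left mult_ac) (simp add: scaleR_conv_of_real[where 'a = complex] mult_ac)

lemma cdot_add: "cdot (x + y) a = cdot x a + cdot y a" "cdot x (a + b) = cdot x a + cdot x b"
  by (simp_all add: cdot_def sum.distrib algebra_simps)

lemma cdot_diff: "cdot (x - y) a = cdot x a - cdot y a" "cdot x (a - b) = cdot x a - cdot x b"
  by (simp_all add: cdot_def sum_subtractf algebra_simps)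

lemma vcnj_simps [simp]:
  "vcnj 0 = 0" "vcnj (a + b) = vcnj a + vcnj b" "vcnj (a - b) = vcnj a - vcnj b" "vcnj (- a) = - vcnj a"
  "vcnj (t *\<^sub>R a) = t *\<^sub>R vcnj a" "vcnj (c *s a) = cnj c *s vcnj a" "vcnj (vcnj a) = a"
  "vcnj (cvec x) = cvec x" "cdot x (vcnj a) = cnj (cdot x a)"
  by (simp_all add: vcnj_def cdot_def cvec_def vec_eq_iff)

lemma cvec_minus [simp]: "cvec (- x) = - cvec x"
  by (simp add: cvec_def vec_eq_iff)

lemma norm_vcnj [simp]: "norm (vcnj a) = norm a"
  by (simp add: norm_vec_def vcnj_def)

lemma bounded_linear_vcnj: "bounded_linear vcnj"
  by (rule bounded_linear_intro[where K = 1]) auto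

lemma norm_cscale: "norm (c *s (a::complex^3)) = cmod c * norm a"
  by (simp add: norm_vec_def norm_mult L2_set_right_distrib)

lemma inner_complex: "inner x y = Re (x * cnj y)" for x y :: complex
  by (simp add: inner_complex_def)

lemma inner_cscale_vcnj: "(z *s vcnj a) \<bullet> vcnj b = (z *s b) \<bullet> a"
  by (simp add: inner_vec_def vcnj_def inner_complex_def algebra_simps)

lemma cdot_cvec [simp]: "cdot x (cvec x) = of_real ((norm x)^2)"
  by (simp add: cdot_def cvec_def power2_norm_eq_inner inner_vec_def)

lemma inner_cvec: "(c *s cvec x) \<bullet> b = Re (c * cnj (cdot x b))"
  by (simp add: inner_vec_def cvec_def inner_complex cdot_def sum_distrib_left algebra_simps)

lemma norm_cdot_le: "norm (cdot x a) \<le> norm x * norm a"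
proof -
  have "norm (cdot x a) \<le> (\<Sum>i\<in>UNIV. norm (of_real (x $ i) * a $ i))"
    unfolding cdot_def by (rule norm_sum)
  also have "\<dots> = (\<Sum>i\<in>UNIV. \<bar>x $ i\<bar> * norm (a $ i))" by (simp add: norm_mult)
  also have "\<dots> \<le> L2_set (\<lambda>i. x $ i) UNIV * L2_set (\<lambda>i. norm (a $ i)) UNIV"
    using L2_set_mult_ineq[of "\<lambda>i. x $ i" "\<lambda>i. norm (a $ i)" UNIV] by simp
  also have "\<dots> = norm x * norm a" by (simp add: norm_vec_def L2_set_def)
  finally show ?thesis .
qed

lemma bounded_linear_cdot: "bounded_linear (cdot x)"
  by (rule bounded_linear_intro[where K = "norm x"])
     (auto simp: cdot_add scaleR_conv_of_real[where 'a = complex] mult.commute[of _ "norm x"] norm_cdot_le)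

text \<open>The orthogonal projection onto the complex vectors orthogonal to the frequency: the symbol of
  the Leray projection, which also removes the mean.\<close>

definition lproj :: "int^3 \<Rightarrow> complex^3 \<Rightarrow> complex^3" where
  "lproj k a = (if k = 0 then 0 else a - (cdot (freq k) a / of_real ((kn k)^2)) *s cvec (freq k))"

lemma lproj_0 [simp]: "lproj 0 a = 0" "lproj k 0 = 0"
  by (simp_all add: lproj_def)

lemma cdot_lproj [simp]: "cdot (freq k) (lproj k a) = 0"
  by (simp add: lproj_def cdot_diff)

lemma inner_lproj:
  assumes "cdot (freq k) b = 0" "k = 0 \<Longrightarrow> b = 0"
  shows "lproj k a \<bullet> b = a \<bullet> b"
  using assms by (auto simp: lproj_def inner_diff_left inner_cvec)

lemma lproj_id: "k \<noteq> 0 \<Longrightarrow> cdot (freq k) a = 0 \<Longrightarrow> lproj k a = a"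
  by (simp add: lproj_def)

lemma norm_lproj_le: "norm (lproj k a) \<le> norm a"
proof -
  have "norm (lproj k a) * norm (lproj k a) = lproj k a \<bullet> lproj k a"
    by (simp add: power2_norm_eq_inner[symmetric] power2_eq_square)
  also have "\<dots> = a \<bullet> lproj k a"
    by (rule inner_lproj) auto
  also have "\<dots> \<le> norm a * norm (lproj k a)" by (rule norm_cauchy_schwarz)
  finally show ?thesis by (cases "lproj k a = 0") auto
qed

lemma lproj_linear:
  "lproj k (a + b) = lproj k a + lproj k b" "lproj k (t *\<^sub>R a) = t *\<^sub>R lproj k a"
  by (auto simp: lproj_def cdot_add vec_eq_iff algebra_simps add_divide_distrib scaleR_conv_of_real[where 'a = complex])

lemma lproj_vcnj: "lproj (- k) (vcnj a) = vcnj (lproj k a)"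
  by (simp add: lproj_def freq_minus)

subsection \<open>Transport\<close>

text \<open>The Fourier coefficients of a real, divergence-free field of mean zero.\<close>

definition solenoidal_seq :: "(int^3 \<Rightarrow> complex^3) \<Rightarrow> bool" where
  "solenoidal_seq a \<longleftrightarrow> a 0 = 0 \<and> (\<forall>k. cdot (freq k) (a k) = 0) \<and> (\<forall>k. a (- k) = vcnj (a k))"

lemma solenoidal_seqD:
  assumes "solenoidal_seq a"
  shows "a 0 = 0" "cdot (freq k) (a k) = 0" "a (- k) = vcnj (a k)"
  using assms by (auto simp: solenoidal_seq_def)

text \<open>\<open>transport \<psi> \<phi> k j\<close> is the contribution of the frequencies \<open>j\<close> and \<open>k - j\<close> to the
  \<open>k\<close>-th Fourier coefficient of \<open>(\<psi> \<cdot> \<nabla>) \<phi>\<close>.\<close>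

definition transport :: "(int^3 \<Rightarrow> complex^3) \<Rightarrow> (int^3 \<Rightarrow> complex^3) \<Rightarrow> int^3 \<Rightarrow> int^3 \<Rightarrow> complex^3" where
  "transport \<psi> \<phi> k j = (\<i> * cdot (freq (k - j)) (\<psi> j)) *s \<phi> (k - j)"

definition advec :: "(int^3 \<Rightarrow> complex^3) \<Rightarrow> (int^3 \<Rightarrow> complex^3) \<Rightarrow> int^3 \<Rightarrow> complex^3" where
  "advec \<psi> \<phi> k = infsum (transport \<psi> \<phi> k) UNIV"

definition trilinear :: "(int^3 \<Rightarrow> complex^3) \<Rightarrow> (int^3 \<Rightarrow> complex^3) \<Rightarrow> (int^3 \<Rightarrow> complex^3) \<Rightarrow> real" where
  "trilinear \<psi> \<phi> \<eta> = infsum (\<lambda>(k, j). transport \<psi> \<phi> k j \<bullet> \<eta> k) UNIV"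

abbreviation transport_bound :: "(int^3 \<Rightarrow> complex^3) \<Rightarrow> (int^3 \<Rightarrow> complex^3) \<Rightarrow> int^3 \<Rightarrow> int^3 \<Rightarrow> real" where
  "transport_bound \<psi> \<phi> k j \<equiv> norm (\<psi> j) * (kn (k - j) * norm (\<phi> (k - j)))"

lemma norm_transport_le: "norm (transport \<psi> \<phi> k j) \<le> transport_bound \<psi> \<phi> k j"
proof -
  have "norm (transport \<psi> \<phi> k j) = cmod (cdot (freq (k - j)) (\<psi> j)) * norm (\<phi> (k - j))"
    by (simp add: transport_def norm_cscale norm_mult)
  also have "\<dots> \<le> (kn (k - j) * norm (\<psi> j)) * norm (\<phi> (k - j))"
    by (intro mult_right_mono norm_cdot_le) auto
  finally show ?thesis by (simp add: mult_ac)
qed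

lemma bij_reflect: "bij (\<lambda>j::int^3. k - j)"
  by (rule bij_betw_byWitness[where f' = "\<lambda>j. k - j"]) auto

lemma is_l2_reflect:
  fixes f :: "int^3 \<Rightarrow> real"
  shows "is_l2 (\<lambda>j. f (k - j)) \<longleftrightarrow> is_l2 f"
  unfolding is_l2_def
  using summable_on_reindex_bij_betw[OF bij_reflect, of "\<lambda>j. (f j)^2"] by simp

lemma transport_summable:
  assumes \<psi>: "is_l2 (\<lambda>k. norm (\<psi> k))" and \<phi>: "is_l2 (\<lambda>k. kn k * norm (\<phi> k))"
  shows "transport_bound \<psi> \<phi> k summable_on UNIV" "transport \<psi> \<phi> k summable_on UNIV"
    "(\<lambda>j. norm (transport \<psi> \<phi> k j)) summable_on UNIV"
proof -
  have "is_l2 (\<lambda>j. kn (k - j) * norm (\<phi> (k - j)))"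
    using \<phi> is_l2_reflect[of "\<lambda>k. kn k * norm (\<phi> k)" k] by simp
  from l2_mult(2)[OF \<psi> this] show b: "transport_bound \<psi> \<phi> k summable_on UNIV" .
  show n: "(\<lambda>j. norm (transport \<psi> \<phi> k j)) summable_on UNIV"
    by (rule summable_on_comparison_test[OF b]) (use norm_transport_le in auto)
  then show "transport \<psi> \<phi> k summable_on UNIV" by (rule abs_summable_summable)
qed

lemma norm_advec_le:
  assumes \<psi>: "is_l2 (\<lambda>k. norm (\<psi> k))" and \<phi>: "is_l2 (\<lambda>k. kn k * norm (\<phi> k))"
  shows "norm (advec \<psi> \<phi> k) \<le> infsum (transport_bound \<psi> \<phi> k) UNIV"
proof -
  have "norm (advec \<psi> \<phi> k) \<le> infsum (\<lambda>j. norm (transport \<psi> \<phi> k j)) UNIV"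
    unfolding advec_def by (rule norm_infsum_bound) (rule transport_summable[OF assms])
  also have "\<dots> \<le> infsum (transport_bound \<psi> \<phi> k) UNIV"
    by (intro infsum_mono transport_summable assms norm_transport_le)
  finally show ?thesis .
qed

lemma advec_add_left:
  assumes "is_l2 (\<lambda>k. norm (\<psi> k))" "is_l2 (\<lambda>k. norm (\<psi>' k))" "is_l2 (\<lambda>k. kn k * norm (\<phi> k))"
  shows "advec (\<lambda>k. \<psi> k + \<psi>' k) \<phi> k = advec \<psi> \<phi> k + advec \<psi>' \<phi> k"
proof -
  have eq: "transport (\<lambda>k. \<psi> k + \<psi>' k) \<phi> k = (\<lambda>j. transport \<psi> \<phi> k j + transport \<psi>' \<phi> k j)"
    by (simp add: transport_def cdot_add fun_eq_iff vec_eq_iff algebra_simps)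
  show ?thesis unfolding advec_def eq
    by (intro infsum_add transport_summable assms)
qed

lemma advec_add_right:
  assumes "is_l2 (\<lambda>k. norm (\<psi> k))" "is_l2 (\<lambda>k. kn k * norm (\<phi> k))" "is_l2 (\<lambda>k. kn k * norm (\<phi>' k))"
  shows "advec \<psi> (\<lambda>k. \<phi> k + \<phi>' k) k = advec \<psi> \<phi> k + advec \<psi> \<phi>' k"
proof -
  have eq: "transport \<psi> (\<lambda>k. \<phi> k + \<phi>' k) k = (\<lambda>j. transport \<psi> \<phi> k j + transport \<psi> \<phi>' k j)"
    by (simp add: transport_def fun_eq_iff vec_eq_iff algebra_simps)
  show ?thesis unfolding advec_def eq
    by (intro infsum_add transport_summable assms)
qed

lemma advec_scaleR:
  "advec (\<lambda>k. t *\<^sub>R \<psi> k) \<phi> k = t *\<^sub>R advec \<psi> \<phi> k" "advec \<psi> (\<lambda>k. t *\<^sub>R \<phi> k) k = t *\<^sub>R advec \<psi> \<phi> k"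
proof -
  have "transport (\<lambda>k. t *\<^sub>R \<psi> k) \<phi> k = (\<lambda>j. t *\<^sub>R transport \<psi> \<phi> k j)"
    "transport \<psi> (\<lambda>k. t *\<^sub>R \<phi> k) k = (\<lambda>j. t *\<^sub>R transport \<psi> \<phi> k j)"
    by (simp_all add: transport_def fun_eq_iff vec_eq_iff scaleR_conv_of_real[where 'a = complex] mult_ac)
  then show "advec (\<lambda>k. t *\<^sub>R \<psi> k) \<phi> k = t *\<^sub>R advec \<psi> \<phi> k" "advec \<psi> (\<lambda>k. t *\<^sub>R \<phi> k) k = t *\<^sub>R advec \<psi> \<phi> k"
    by (simp_all add: advec_def infsum_scaleR_right)
qed

lemma advec_real:
  assumes "\<And>k. \<psi> (- k) = vcnj (\<psi> k)" "\<And>k. \<phi> (- k) = vcnj (\<phi> k)"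
    and s: "transport \<psi> \<phi> k summable_on UNIV"
  shows "advec \<psi> \<phi> (- k) = vcnj (advec \<psi> \<phi> k)"
proof -
  have "transport \<psi> \<phi> (- k) (- j) = vcnj (transport \<psi> \<phi> k j)" for j
  proof -
    have "- k - - j = - (k - j)" by simp
    then have "\<phi> (- k - - j) = vcnj (\<phi> (k - j))" "freq (- k - - j) = - freq (k - j)"
      using assms(2) by (simp_all only: freq_minus)
    then show ?thesis by (simp add: transport_def assms(1))
  qed
  moreover have "infsum (\<lambda>j. transport \<psi> \<phi> (- k) (- j)) UNIV = advec \<psi> \<phi> (- k)"
    unfolding advec_def by (rule infsum_reindex_bij_witness[where i = uminus and j = uminus]) auto
  moreover have "infsum (\<lambda>j. vcnj (transport \<psi> \<phi> k j)) UNIV = vcnj (advec \<psi> \<phi> k)"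
    unfolding advec_def by (intro infsumI has_sum_bounded_linear[OF bounded_linear_vcnj] has_sum_infsum s)
  ultimately show ?thesis by simp
qed

lemma trilinear_summable:
  assumes "(\<lambda>(k, j). transport_bound \<psi> \<phi> k j * norm (\<eta> k)) summable_on UNIV"
  shows "(\<lambda>(k, j). transport \<psi> \<phi> k j \<bullet> \<eta> k) summable_on UNIV"
    "(\<lambda>(k, j). \<bar>transport \<psi> \<phi> k j \<bullet> \<eta> k\<bar>) summable_on UNIV"
    "\<bar>trilinear \<psi> \<phi> \<eta>\<bar> \<le> infsum (\<lambda>(k, j). transport_bound \<psi> \<phi> k j * norm (\<eta> k)) UNIV"
proof -
  have le: "\<bar>transport \<psi> \<phi> k j \<bullet> \<eta> k\<bar> \<le> transport_bound \<psi> \<phi> k j * norm (\<eta> k)" for k j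
    by (rule order_trans[OF Cauchy_Schwarz_ineq2]) (intro mult_right_mono norm_transport_le norm_ge_zero)
  show s: "(\<lambda>(k, j). \<bar>transport \<psi> \<phi> k j \<bullet> \<eta> k\<bar>) summable_on UNIV"
    by (rule summable_on_comparison_test[OF assms]) (use le in auto)
  then have s': "(\<lambda>x. norm (case x of (k, j) \<Rightarrow> transport \<psi> \<phi> k j \<bullet> \<eta> k)) summable_on UNIV"
    by (simp add: case_prod_unfold)
  then show "(\<lambda>(k, j). transport \<psi> \<phi> k j \<bullet> \<eta> k) summable_on UNIV" by (rule abs_summable_summable)
  have "\<bar>trilinear \<psi> \<phi> \<eta>\<bar> \<le> infsum (\<lambda>x. norm (case x of (k, j) \<Rightarrow> transport \<psi> \<phi> k j \<bullet> \<eta> k)) UNIV"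
    unfolding trilinear_def using norm_infsum_bound[OF s'] by simp
  also have "\<dots> \<le> infsum (\<lambda>(k, j). transport_bound \<psi> \<phi> k j * norm (\<eta> k)) UNIV"
    by (rule infsum_mono[OF s' assms]) (use le in auto)
  finally show "\<bar>trilinear \<psi> \<phi> \<eta>\<bar> \<le> infsum (\<lambda>(k, j). transport_bound \<psi> \<phi> k j * norm (\<eta> k)) UNIV" .
qed

lemma trilinear_eq_advec:
  assumes \<psi>: "is_l2 (\<lambda>k. norm (\<psi> k))" and \<phi>: "is_l2 (\<lambda>k. kn k * norm (\<phi> k))"
    and s: "(\<lambda>(k, j). transport_bound \<psi> \<phi> k j * norm (\<eta> k)) summable_on UNIV"
  shows "infsum (\<lambda>k. advec \<psi> \<phi> k \<bullet> \<eta> k) UNIV = trilinear \<psi> \<phi> \<eta>"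
    "(\<lambda>k. advec \<psi> \<phi> k \<bullet> \<eta> k) summable_on UNIV"
proof -
  have eq: "advec \<psi> \<phi> k \<bullet> \<eta> k = infsum (\<lambda>j. transport \<psi> \<phi> k j \<bullet> \<eta> k) UNIV" for k
    unfolding advec_def
    by (intro infsumI[symmetric] has_sum_bounded_linear[OF bounded_linear_inner_left] has_sum_infsum
        transport_summable[OF \<psi> \<phi>])
  have s': "(\<lambda>(k, j). transport \<psi> \<phi> k j \<bullet> \<eta> k) summable_on (UNIV \<times> UNIV)"
    using trilinear_summable(1)[OF s] by simp
  show "infsum (\<lambda>k. advec \<psi> \<phi> k \<bullet> \<eta> k) UNIV = trilinear \<psi> \<phi> \<eta>"
    unfolding eq trilinear_def infsum_Sigma'_banach[OF s'] by simp
  show "(\<lambda>k. advec \<psi> \<phi> k \<bullet> \<eta> k) summable_on UNIV"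
    unfolding eq by (rule summable_on_Sigma_banach[OF s'])
qed

text \<open>The frequency-side form of \<open>\<integral> (\<psi> \<cdot> \<nabla>) \<phi> \<cdot> \<phi> = 0\<close>: the involution
  \<open>(k, j) \<mapsto> (j - k, j)\<close> exchanges the two frequencies of \<open>\<phi>\<close> and reverses the sign of each term.\<close>

lemma transport_antisymmetric:
  assumes \<psi>: "solenoidal_seq \<psi>" and \<phi>: "\<And>k. \<phi> (- k) = vcnj (\<phi> k)"
  shows "transport \<psi> \<phi> (j - k) j \<bullet> \<phi> (j - k) = - (transport \<psi> \<phi> k j \<bullet> \<phi> k)"
proof -
  define z where "z = \<i> * cdot (freq (k - j)) (\<psi> j)"
  have m: "j - k = - (k - j)" "j - k - j = - k" by simp_all
  have "cdot (freq (- k)) (\<psi> j) = - cdot (freq (k - j)) (\<psi> j)"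
    using solenoidal_seqD(2)[OF \<psi>, of j] by (simp add: freq_minus freq_diff cdot_diff)
  then have "transport \<psi> \<phi> (j - k) j = - z *s vcnj (\<phi> k)"
    by (simp add: transport_def z_def m(2) \<phi>)
  then have "transport \<psi> \<phi> (j - k) j \<bullet> \<phi> (j - k) = (- z *s vcnj (\<phi> k)) \<bullet> vcnj (\<phi> (k - j))"
    by (simp only: m(1) \<phi>)
  also have "\<dots> = - ((z *s \<phi> (k - j)) \<bullet> \<phi> k)"
    unfolding inner_cscale_vcnj by (simp add: inner_vec_def sum_negf)
  finally show ?thesis by (simp add: transport_def z_def)
qed

lemma trilinear_self:
  assumes "solenoidal_seq \<psi>" "\<And>k. \<phi> (- k) = vcnj (\<phi> k)"
  shows "trilinear \<psi> \<phi> \<phi> = 0"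
proof -
  have "trilinear \<psi> \<phi> \<phi> = infsum (\<lambda>(k, j). transport \<psi> \<phi> (j - k) j \<bullet> \<phi> (j - k)) UNIV"
    unfolding trilinear_def
    using summable_on_pairs_reindex(7)[of "\<lambda>(k, j). transport \<psi> \<phi> k j \<bullet> \<phi> k"] by simp
  also have "\<dots> = infsum (\<lambda>x. - (case x of (k, j) \<Rightarrow> transport \<psi> \<phi> k j \<bullet> \<phi> k)) UNIV"
    by (intro infsum_cong) (auto simp: transport_antisymmetric[where \<phi> = \<phi>, OF assms])
  also have "\<dots> = - trilinear \<psi> \<phi> \<phi>" unfolding trilinear_def by (rule infsum_uminus)
  finally show ?thesis by simp
qed

lemma transport_scale_right:
  "transport \<psi> (\<lambda>k. W k *\<^sub>R \<phi> k) k j = W (k - j) *\<^sub>R transport \<psi> \<phi> k j"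
  by (simp add: transport_def vec_eq_iff scaleR_conv_of_real[where 'a = complex] mult_ac)

text \<open>Subtracting the vanishing form of the weighted field \<open>W \<phi>\<close> replaces the weight \<open>W\<^sub>k\<^sup>2\<close> by
  \<open>W\<^sub>k (W\<^sub>k - W\<^sub>m)\<close>, where \<open>m = k - j\<close>; the commutator estimates apply to this.\<close>

lemma trilinear_commutator:
  assumes \<psi>: "solenoidal_seq \<psi>" and \<phi>: "\<And>k. \<phi> (- k) = vcnj (\<phi> k)" and W: "\<And>k. W (- k) = W k"
    and s1: "(\<lambda>(k, j). transport_bound \<psi> \<phi> k j * norm ((W k)^2 *\<^sub>R \<phi> k)) summable_on UNIV"
    and s2: "(\<lambda>(k, j). transport_bound \<psi> \<phi> k j * norm (\<phi> k) * \<bar>W k * (W k - W (k - j))\<bar>) summable_on UNIV"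
  shows "\<bar>trilinear \<psi> \<phi> (\<lambda>k. (W k)^2 *\<^sub>R \<phi> k)\<bar> \<le>
    infsum (\<lambda>(k, j). transport_bound \<psi> \<phi> k j * norm (\<phi> k) * \<bar>W k * (W k - W (k - j))\<bar>) UNIV"
proof -
  define T where "T = (\<lambda>(k, j). transport \<psi> \<phi> k j \<bullet> \<phi> k)"
  define D where "D = (\<lambda>(k, j). W k * (W k - W (k - j)) * T (k, j))"
  define B where "B = (\<lambda>(k, j). transport_bound \<psi> \<phi> k j * norm (\<phi> k) * \<bar>W k * (W k - W (k - j))\<bar>)"
  have le: "norm (D x) \<le> B x" for x
  proof -
    obtain k j where x: "x = (k, j)" by (cases x)
    have "\<bar>T (k, j)\<bar> \<le> transport_bound \<psi> \<phi> k j * norm (\<phi> k)"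
      unfolding T_def by (simp, rule order_trans[OF Cauchy_Schwarz_ineq2]) (intro mult_right_mono norm_transport_le norm_ge_zero)
    then have "\<bar>W k * (W k - W (k - j))\<bar> * \<bar>T (k, j)\<bar>
        \<le> \<bar>W k * (W k - W (k - j))\<bar> * (transport_bound \<psi> \<phi> k j * norm (\<phi> k))"
      by (rule mult_left_mono) simp
    then show ?thesis by (simp add: x D_def B_def abs_mult mult_ac)
  qed
  have Dn: "(\<lambda>x. norm (D x)) summable_on UNIV"
    by (rule summable_on_comparison_test[OF s2[folded B_def]]) (use le in auto)
  then have D: "D summable_on UNIV" by (rule abs_summable_summable)
  have A: "(\<lambda>(k, j). (W k)^2 * T (k, j)) summable_on UNIV"
    using trilinear_summable(1)[OF s1] by (simp add: T_def case_prod_unfold)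
  have Aeq: "infsum (\<lambda>(k, j). (W k)^2 * T (k, j)) UNIV = trilinear \<psi> \<phi> (\<lambda>k. (W k)^2 *\<^sub>R \<phi> k)"
    by (simp add: trilinear_def T_def case_prod_unfold)
  have "trilinear \<psi> (\<lambda>k. W k *\<^sub>R \<phi> k) (\<lambda>k. W k *\<^sub>R \<phi> k) = 0"
    by (rule trilinear_self[OF \<psi>]) (simp add: W \<phi>)
  moreover have "trilinear \<psi> (\<lambda>k. W k *\<^sub>R \<phi> k) (\<lambda>k. W k *\<^sub>R \<phi> k)
      = infsum (\<lambda>x. (case x of (k, j) \<Rightarrow> (W k)^2 * T (k, j)) - D x) UNIV"
    unfolding trilinear_def transport_scale_right
    by (rule infsum_cong) (auto simp: D_def T_def power2_eq_square algebra_simps)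
  moreover have "\<dots> = trilinear \<psi> \<phi> (\<lambda>k. (W k)^2 *\<^sub>R \<phi> k) - infsum D UNIV"
  proof -
    have "((\<lambda>x. (case x of (k, j) \<Rightarrow> (W k)^2 * T (k, j)) + - D x) has_sum
        (infsum (\<lambda>(k, j). (W k)^2 * T (k, j)) UNIV + - infsum D UNIV)) UNIV"
      by (intro has_sum_add has_sum_uminusI has_sum_infsum A D)
    then show ?thesis unfolding Aeq by (intro infsumI) simp
  qed
  ultimately have "trilinear \<psi> \<phi> (\<lambda>k. (W k)^2 *\<^sub>R \<phi> k) = infsum D UNIV" by simp
  also have "\<bar>\<dots>\<bar> \<le> infsum (\<lambda>x. norm (D x)) UNIV" using norm_infsum_bound[OF Dn] by simp
  also have "\<dots> \<le> infsum B UNIV" by (rule infsum_mono[OF Dn s2[folded B_def]]) (rule le)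
  finally show ?thesis by (simp add: B_def)
qed

text \<open>Test with \<open>c = g\<close> on \<open>F\<close> and divide by the norm.\<close>

lemma is_l2_by_duality:
  fixes g :: "'a \<Rightarrow> real"
  assumes B: "0 \<le> B" and g: "\<And>k. 0 \<le> g k"
    and dual: "\<And>F c. finite F \<Longrightarrow> (\<And>k. 0 \<le> c k) \<Longrightarrow> (\<And>k. k \<notin> F \<Longrightarrow> c k = 0) \<Longrightarrow> is_l2 c \<Longrightarrow>
      (\<Sum>k\<in>F. g k * c k) \<le> B * l2 c"
  shows "is_l2 g" "l2 g \<le> B"
proof -
  have "(\<Sum>k\<in>F. (g k)^2) \<le> B^2" if F: "finite F" for F
  proof -
    define c where "c k = (if k \<in> F then g k else 0)" for k
    have ce: "(\<lambda>k. (c k)^2) = (\<lambda>k. if k \<in> F then (g k)^2 else 0)" by (auto simp: c_def)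
    have hs: "((\<lambda>k. (c k)^2) has_sum (\<Sum>k\<in>F. (g k)^2)) UNIV"
      unfolding ce by (rule has_sum_finite_neutralI[OF F]) auto
    have c: "is_l2 c" unfolding is_l2_def using hs by (rule has_sum_imp_summable)
    have l: "(l2 c)^2 = (\<Sum>k\<in>F. (g k)^2)" unfolding l2_square using hs by (rule infsumI)
    have "(l2 c)^2 = (\<Sum>k\<in>F. g k * c k)" unfolding l by (intro sum.cong) (auto simp: c_def power2_eq_square)
    also have "\<dots> \<le> B * l2 c" by (rule dual[OF F _ _ c]) (auto simp: c_def g)
    finally have "l2 c \<le> B" using l2_nonneg[of c] B by (cases "l2 c = 0") (auto simp: power2_eq_square)
    then show ?thesis using l power_mono[of "l2 c" B 2] by simp
  qed
  then show "is_l2 g" "l2 g \<le> B" by (rule is_l2I[OF _ B]; simp)+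
qed

text \<open>To bound a weighted \<open>\<ell>\<^sup>2\<close> norm of \<open>(\<psi> \<cdot> \<nabla>) \<phi>\<close> it suffices to bound the trilinear sum
  against finitely supported sequences.\<close>

lemma advec_is_l2:
  assumes \<psi>: "is_l2 (\<lambda>k. norm (\<psi> k))" and \<phi>: "is_l2 (\<lambda>k. kn k * norm (\<phi> k))"
    and B: "0 \<le> B" and W: "\<And>k. 0 \<le> W k"
    and dual: "\<And>c. (\<And>k. 0 \<le> c k) \<Longrightarrow> finite {k. c k \<noteq> 0} \<Longrightarrow> is_l2 c \<Longrightarrow>
      (\<lambda>(k, j). transport_bound \<psi> \<phi> k j * (W k * c k)) summable_on UNIV \<and>
      infsum (\<lambda>(k, j). transport_bound \<psi> \<phi> k j * (W k * c k)) UNIV \<le> B * l2 c"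
  shows "is_l2 (\<lambda>k. W k * norm (advec \<psi> \<phi> k))" "l2 (\<lambda>k. W k * norm (advec \<psi> \<phi> k)) \<le> B"
proof -
  have "(\<Sum>k\<in>F. W k * norm (advec \<psi> \<phi> k) * c k) \<le> B * l2 c"
    if F: "finite F" and c: "\<And>k. 0 \<le> c k" "\<And>k. k \<notin> F \<Longrightarrow> c k = 0" "is_l2 c" for F c
  proof -
    have fin: "finite {k. c k \<noteq> 0}" by (rule finite_subset[OF _ F]) (use c in auto)
    note d = dual[OF c(1) fin c(3)]
    have s: "(\<lambda>(k, j). transport_bound \<psi> \<phi> k j * (W k * c k)) summable_on (UNIV \<times> UNIV)" using d by simp
    have "(\<Sum>k\<in>F. W k * norm (advec \<psi> \<phi> k) * c k) \<le> (\<Sum>k\<in>F. infsum (\<lambda>j. transport_bound \<psi> \<phi> k j * (W k * c k)) UNIV)"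
    proof (rule sum_mono)
      fix k
      have "W k * norm (advec \<psi> \<phi> k) * c k = norm (advec \<psi> \<phi> k) * (W k * c k)" by simp
      also have "\<dots> \<le> infsum (transport_bound \<psi> \<phi> k) UNIV * (W k * c k)"
        using W c by (intro mult_right_mono norm_advec_le[OF \<psi> \<phi>]) auto
      also have "\<dots> = infsum (\<lambda>j. transport_bound \<psi> \<phi> k j * (W k * c k)) UNIV"
        by (simp add: infsum_cmult_left')
      finally show "W k * norm (advec \<psi> \<phi> k) * c k \<le> infsum (\<lambda>j. transport_bound \<psi> \<phi> k j * (W k * c k)) UNIV" .
    qed
    also have "\<dots> \<le> infsum (\<lambda>k. infsum (\<lambda>j. transport_bound \<psi> \<phi> k j * (W k * c k)) UNIV) UNIV"
      using W c F by (intro finite_sum_le_infsum summable_on_Sigma_banach[OF s] infsum_nonneg) auto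
    also have "\<dots> = infsum (\<lambda>(k, j). transport_bound \<psi> \<phi> k j * (W k * c k)) UNIV"
      unfolding infsum_Sigma'_banach[OF s] by simp
    also have "\<dots> \<le> B * l2 c" using d by simp
    finally show ?thesis .
  qed
  then show "is_l2 (\<lambda>k. W k * norm (advec \<psi> \<phi> k))" "l2 (\<lambda>k. W k * norm (advec \<psi> \<phi> k)) \<le> B"
    by (intro is_l2_by_duality[OF B]; use W in simp)+
qed

section \<open>The phase space and the Voigt nonlinearity\<close>

subsection \<open>Square-summable solenoidal coefficient families\<close>

lemma is_l2_add:
  assumes "is_l2 f" "is_l2 g"
  shows "is_l2 (\<lambda>x. f x + g x)"
  unfolding is_l2_def
proof (rule summable_on_comparison_test)
  show "(\<lambda>x. 2 * (f x)^2 + 2 * (g x)^2) summable_on UNIV"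
    using assms unfolding is_l2_def by (intro summable_on_add summable_on_cmult_right)
  fix x
  have "2 * (f x)^2 + 2 * (g x)^2 - (f x + g x)^2 = (f x - g x)^2"
    by (simp add: power2_eq_square algebra_simps)
  then show "(f x + g x)^2 \<le> 2 * (f x)^2 + 2 * (g x)^2"
    using zero_le_power2[of "f x - g x"] by linarith
qed auto

typedef sfield = "{a :: int^3 \<Rightarrow> complex^3. solenoidal_seq a \<and> is_l2 (\<lambda>k. norm (a k))}"
  morphisms coeffs Abs_sfield
  by (rule exI[of _ "\<lambda>_. 0"]) (simp add: solenoidal_seq_def is_l2_def)

lemma solenoidal_coeffs: "solenoidal_seq (coeffs a)"
  and is_l2_coeffs: "is_l2 (\<lambda>k. norm (coeffs a k))"
  using coeffs[of a] by auto

lemma coeffs_Abs: "solenoidal_seq a \<Longrightarrow> is_l2 (\<lambda>k. norm (a k)) \<Longrightarrow> coeffs (Abs_sfield a) = a"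
  by (rule Abs_sfield_inverse) simp

lemma sfield_eqI: "(\<And>k. coeffs a k = coeffs b k) \<Longrightarrow> a = b"
  using coeffs_inject[of a b] by auto

lemma inner_coeffs_summable:
  "(\<lambda>k. coeffs a k \<bullet> coeffs b k) summable_on UNIV"
proof -
  have "(\<lambda>k. norm (coeffs a k \<bullet> coeffs b k)) summable_on UNIV"
    by (rule summable_on_comparison_test[OF l2_mult(2)[OF is_l2_coeffs[of a] is_l2_coeffs[of b]]])
       (auto intro: Cauchy_Schwarz_ineq2)
  then show ?thesis by (rule abs_summable_summable)
qed

instantiation sfield :: real_inner
begin

definition zero_sfield :: sfield where "0 = Abs_sfield (\<lambda>_. 0)"
definition plus_sfield :: "sfield \<Rightarrow> sfield \<Rightarrow> sfield" where "a + b = Abs_sfield (\<lambda>k. coeffs a k + coeffs b k)"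
definition uminus_sfield :: "sfield \<Rightarrow> sfield" where "- a = Abs_sfield (\<lambda>k. - coeffs a k)"
definition minus_sfield :: "sfield \<Rightarrow> sfield \<Rightarrow> sfield" where "a - b = Abs_sfield (\<lambda>k. coeffs a k - coeffs b k)"
definition scaleR_sfield :: "real \<Rightarrow> sfield \<Rightarrow> sfield" where "t *\<^sub>R a = Abs_sfield (\<lambda>k. t *\<^sub>R coeffs a k)"
definition inner_sfield :: "sfield \<Rightarrow> sfield \<Rightarrow> real" where
  "inner_sfield a b = infsum (\<lambda>k. coeffs a k \<bullet> coeffs b k) UNIV"
definition norm_sfield :: "sfield \<Rightarrow> real" where "norm_sfield a = sqrt (a \<bullet> a)"
definition dist_sfield :: "sfield \<Rightarrow> sfield \<Rightarrow> real" where "dist_sfield a b = norm (a - b)"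
definition sgn_sfield :: "sfield \<Rightarrow> sfield" where "sgn a = inverse (norm a) *\<^sub>R a" for a :: sfield
definition uniformity_sfield :: "(sfield \<times> sfield) filter" where
  "uniformity_sfield = (INF e\<in>{0<..}. principal {(x, y). dist x y < e})"
definition open_sfield :: "sfield set \<Rightarrow> bool" where
  "open_sfield U \<longleftrightarrow> (\<forall>x\<in>U. eventually (\<lambda>(x', y). x' = x \<longrightarrow> y \<in> U) uniformity)"

lemma coeffs_plus: "coeffs (a + b) = (\<lambda>k. coeffs a k + coeffs b k)"
  unfolding plus_sfield_def
proof (rule coeffs_Abs)
  show "solenoidal_seq (\<lambda>k. coeffs a k + coeffs b k)"
    using solenoidal_coeffs[of a] solenoidal_coeffs[of b] by (simp add: solenoidal_seq_def cdot_add)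
  show "is_l2 (\<lambda>k. norm (coeffs a k + coeffs b k))"
    by (rule is_l2_comparison(1)[OF is_l2_add[OF is_l2_coeffs[of a] is_l2_coeffs[of b]]])
       (simp add: norm_triangle_ineq)
qed

lemma coeffs_scaleR: "coeffs (t *\<^sub>R a) = (\<lambda>k. t *\<^sub>R coeffs a k)"
  unfolding scaleR_sfield_def
proof (rule coeffs_Abs)
  show "solenoidal_seq (\<lambda>k. t *\<^sub>R coeffs a k)"
    using solenoidal_coeffs[of a] by (simp add: solenoidal_seq_def)
  show "is_l2 (\<lambda>k. norm (t *\<^sub>R coeffs a k))"
    using is_l2_cmult(1)[OF is_l2_coeffs[of a], of "\<bar>t\<bar>"] by simp
qed

lemma coeffs_uminus: "coeffs (- a) = (\<lambda>k. - coeffs a k)"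
  unfolding uminus_sfield_def
  by (rule coeffs_Abs)
     (use solenoidal_coeffs[of a] is_l2_coeffs[of a] in \<open>simp_all add: solenoidal_seq_def\<close>)

lemma coeffs_zero: "coeffs 0 = (\<lambda>_. 0)"
  unfolding zero_sfield_def by (rule coeffs_Abs) (simp_all add: solenoidal_seq_def is_l2_def)

lemma coeffs_minus: "coeffs (a - b) = (\<lambda>k. coeffs a k - coeffs b k)"
proof -
  have "a - b = a + - b"
    by (simp add: minus_sfield_def plus_sfield_def coeffs_uminus)
  then show ?thesis by (simp add: coeffs_plus coeffs_uminus)
qed

lemmas coeffs_simps = coeffs_plus coeffs_scaleR coeffs_uminus coeffs_zero coeffs_minus

instance
proof
  fix a b c :: sfield and s t :: real
  show "a + b + c = a + (b + c)" "a + b = b + a" "0 + a = a" "- a + a = 0" "a - b = a + - b"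
    "s *\<^sub>R (a + b) = s *\<^sub>R a + s *\<^sub>R b" "(s + t) *\<^sub>R a = s *\<^sub>R a + t *\<^sub>R a"
    "s *\<^sub>R t *\<^sub>R a = (s * t) *\<^sub>R a" "1 *\<^sub>R a = a"
    by (rule sfield_eqI; simp add: coeffs_simps algebra_simps)+
  show "dist a b = norm (a - b)" by (simp add: dist_sfield_def)
  show "sgn a = inverse (norm a) *\<^sub>R a" by (simp add: sgn_sfield_def)
  show "norm a = sqrt (a \<bullet> a)" by (simp add: norm_sfield_def)
  show "a \<bullet> b = b \<bullet> a" by (simp add: inner_sfield_def inner_commute)
  show "(a + b) \<bullet> c = a \<bullet> c + b \<bullet> c"
    unfolding inner_sfield_def coeffs_plus inner_add_left by (intro infsum_add inner_coeffs_summable)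
  show "(s *\<^sub>R a) \<bullet> b = s * (a \<bullet> b)"
    by (simp add: inner_sfield_def coeffs_scaleR infsum_cmult_right')
  show "0 \<le> a \<bullet> a" by (simp add: inner_sfield_def infsum_nonneg)
  show "(a \<bullet> a = 0) = (a = 0)"
  proof
    assume 0: "a \<bullet> a = 0"
    have "coeffs a k \<bullet> coeffs a k = 0" for k
      using nonneg_infsum_le_0D[of "\<lambda>k. coeffs a k \<bullet> coeffs a k" UNIV k] 0 inner_coeffs_summable[of a a]
      by (simp add: inner_sfield_def)
    then show "a = 0" by (intro sfield_eqI) (simp add: coeffs_zero)
  qed (simp add: inner_sfield_def coeffs_zero)
qed (rule uniformity_sfield_def open_sfield_def)+

end

lemma norm_sfield_l2: "norm (a::sfield) = l2 (\<lambda>k. norm (coeffs a k))"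
  by (simp add: norm_eq_sqrt_inner inner_sfield_def l2_def power2_norm_eq_inner)

lemma norm_sfield_square: "(norm (a::sfield))^2 = infsum (\<lambda>k. (norm (coeffs a k))^2) UNIV"
  by (simp add: norm_sfield_l2 l2_square)

lemma sum_coeffs_le_norm: "finite F \<Longrightarrow> (\<Sum>k\<in>F. (norm (coeffs a k))^2) \<le> (norm a)^2"
  unfolding norm_sfield_l2 by (rule sum_squares_le_l2[OF is_l2_coeffs])

lemma norm_coeffs_le: "norm (coeffs a k) \<le> norm a"
  by (rule power2_le_imp_le) (use sum_coeffs_le_norm[of "{k}" a] in auto)

lemma bounded_linear_coeffs: "bounded_linear (\<lambda>a. coeffs a k)"
  by (rule bounded_linear_intro[where K = 1]) (auto simp: coeffs_simps norm_coeffs_le)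

text \<open>Cauchy sequences converge in each coefficient, and the linear constraints on the coefficients
  are closed. Bounds on sums over finite sets of frequencies pass to the limit and give convergence in
  norm.\<close>

instance sfield :: banach
proof
  fix X :: "nat \<Rightarrow> sfield"
  assume X: "Cauchy X"
  have "convergent (\<lambda>n. coeffs (X n) k)" for k
    using bounded_linear.Cauchy[OF bounded_linear_coeffs X] by (rule Cauchy_convergent)
  then obtain a where a: "\<And>k. (\<lambda>n. coeffs (X n) k) \<longlonglongrightarrow> a k"
    unfolding convergent_def by metis
  have tail: "\<exists>M. \<forall>n\<ge>M. \<forall>F. finite F \<longrightarrow> (\<Sum>k\<in>F. (norm (coeffs (X n) k - a k))^2) \<le> e^2" if e: "e > 0" for e
  proof -
    obtain M where M: "\<And>m n. m \<ge> M \<Longrightarrow> n \<ge> M \<Longrightarrow> norm (X m - X n) < e"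
      using CauchyD[OF X e] by blast
    have "(\<Sum>k\<in>F. (norm (coeffs (X n) k - a k))^2) \<le> e^2" if n: "n \<ge> M" and F: "finite F" for n F
    proof (rule LIMSEQ_le_const2)
      show "(\<lambda>m. \<Sum>k\<in>F. (norm (coeffs (X n) k - coeffs (X m) k))^2) \<longlonglongrightarrow> (\<Sum>k\<in>F. (norm (coeffs (X n) k - a k))^2)"
        by (intro tendsto_intros a)
      show "\<exists>N. \<forall>m\<ge>N. (\<Sum>k\<in>F. (norm (coeffs (X n) k - coeffs (X m) k))^2) \<le> e^2"
      proof (intro exI allI impI)
        fix m assume m: "m \<ge> M"
        have "(\<Sum>k\<in>F. (norm (coeffs (X n) k - coeffs (X m) k))^2) \<le> (norm (X n - X m))^2"
          using sum_coeffs_le_norm[OF F, of "X n - X m"] by (simp add: coeffs_minus)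
        also have "\<dots> \<le> e^2" using M[OF n m] by (intro power_mono) auto
        finally show "(\<Sum>k\<in>F. (norm (coeffs (X n) k - coeffs (X m) k))^2) \<le> e^2" .
      qed
    qed
    then show ?thesis by blast
  qed
  obtain M where M: "\<And>F. finite F \<Longrightarrow> (\<Sum>k\<in>F. (norm (coeffs (X M) k - a k))^2) \<le> 1^2"
    using tail[of 1] by auto
  have "is_l2 (\<lambda>k. norm (coeffs (X M) k - a k))" by (rule is_l2I(1)[OF M]) auto
  from is_l2_add[OF this is_l2_coeffs[of "X M"]]
  have ss: "is_l2 (\<lambda>k. norm (a k))"
  proof (rule is_l2_comparison(1))
    fix k show "\<bar>norm (a k)\<bar> \<le> norm (coeffs (X M) k - a k) + norm (coeffs (X M) k)"
      using norm_triangle_ineq3[of "a k" "coeffs (X M) k"] by (simp add: norm_minus_commute)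
  qed
  have "solenoidal_seq a"
    unfolding solenoidal_seq_def
  proof (intro conjI allI)
    note s = solenoidal_seqD[OF solenoidal_coeffs]
    show "a 0 = 0" using a[of 0] by (simp add: s(1) LIMSEQ_const_iff)
    fix k
    have "(\<lambda>n. cdot (freq k) (coeffs (X n) k)) \<longlonglongrightarrow> cdot (freq k) (a k)"
      by (rule bounded_linear.tendsto[OF bounded_linear_cdot a])
    then show "cdot (freq k) (a k) = 0" by (simp add: s(2) LIMSEQ_const_iff)
    have "(\<lambda>n. vcnj (coeffs (X n) k)) \<longlonglongrightarrow> vcnj (a k)"
      by (rule bounded_linear.tendsto[OF bounded_linear_vcnj a])
    with a[of "- k"] show "a (- k) = vcnj (a k)" unfolding s(3) by (rule LIMSEQ_unique)
  qed
  with ss have A: "coeffs (Abs_sfield a) = a" by (intro coeffs_Abs)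
  have "X \<longlonglongrightarrow> Abs_sfield a"
  proof (rule metric_LIMSEQ_I)
    fix r :: real assume r: "r > 0"
    then obtain M where M: "\<And>n F. n \<ge> M \<Longrightarrow> finite F \<Longrightarrow> (\<Sum>k\<in>F. (norm (coeffs (X n) k - a k))^2) \<le> (r / 2)^2"
      using tail[of "r / 2"] by auto
    have "dist (X n) (Abs_sfield a) < r" if "n \<ge> M" for n
    proof -
      have "norm (X n - Abs_sfield a) \<le> r / 2"
        unfolding norm_sfield_l2 coeffs_minus A
        by (rule is_l2I(2)) (use M[OF that] r in auto)
      then show ?thesis using r by (simp add: dist_norm)
    qed
    then show "\<exists>no. \<forall>n\<ge>no. dist (X n) (Abs_sfield a) < r" by blast
  qed
  then show "convergent X" by (auto simp: convergent_def)
qed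

subsection \<open>The Voigt weight\<close>

definition vweight :: "real \<Rightarrow> int^3 \<Rightarrow> real" where
  "vweight \<alpha> k = sqrt (1 + \<alpha>^2 * (kn k)^2)"

lemma vweight_square: "(vweight \<alpha> k)^2 = 1 + \<alpha>^2 * (kn k)^2"
  by (simp add: vweight_def)

lemma vweight_ge_1: "1 \<le> vweight \<alpha> k" and vweight_pos: "0 < vweight \<alpha> k" and vweight_neq_0 [simp]: "vweight \<alpha> k \<noteq> 0"
proof -
  show "1 \<le> vweight \<alpha> k" by (simp add: vweight_def)
  then show "0 < vweight \<alpha> k" by linarith
  then show "vweight \<alpha> k \<noteq> 0" by simp
qed

lemma vweight_minus [simp]: "vweight \<alpha> (- k) = vweight \<alpha> k"
  by (simp add: vweight_def)

lemma kn_le_vweight: "0 < \<alpha> \<Longrightarrow> kn k \<le> vweight \<alpha> k / \<alpha>"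
proof -
  assume \<alpha>: "0 < \<alpha>"
  have "\<alpha> * kn k \<le> vweight \<alpha> k"
    unfolding vweight_def by (rule real_le_rsqrt) (simp add: power_mult_distrib)
  then show ?thesis using \<alpha> by (simp add: le_divide_eq mult.commute)
qed

lemma summable_on_vweight:
  assumes \<alpha>: "0 < \<alpha>"
  shows "(\<lambda>k. 1 / vweight \<alpha> k ^ 4) summable_on UNIV"
proof (rule summable_on_comparison_test)
  define m where "m = 2 * max 1 (1 / \<alpha>^2)"
  have m: "1 \<le> m / 2" "1 / \<alpha>^2 \<le> m / 2" "0 < m" by (auto simp: m_def)
  show "(\<lambda>k. m^2 * (1 + kn k) powr (- 4)) summable_on UNIV"
    by (intro summable_on_cmult_right summable_on_lattice_powr) simp
  fix k :: "int^3"
  have k1: "0 < 1 + kn k" by (rule add_pos_nonneg) auto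
  have "(1 + kn k)^2 \<le> 2 * (1 + (kn k)^2)"
    using sum_squares_bound[of 1 "kn k"] by (simp add: power2_eq_square algebra_simps)
  also have "\<dots> \<le> 2 * ((m / 2) * 1 + (m / 2) * (\<alpha>^2 * (kn k)^2))"
  proof -
    have "1 = (1 / \<alpha>^2) * \<alpha>^2" using \<alpha> by simp
    also have "\<dots> \<le> (m / 2) * \<alpha>^2" by (intro mult_right_mono m) auto
    finally have "1 * (kn k)^2 \<le> (m / 2) * \<alpha>^2 * (kn k)^2" by (rule mult_right_mono) simp
    then show ?thesis using m by (simp add: mult.assoc)
  qed
  also have "\<dots> = m * (vweight \<alpha> k)^2" by (simp add: vweight_square algebra_simps)
  finally have "((1 + kn k)^2)^2 \<le> (m * (vweight \<alpha> k)^2)^2" by (intro power_mono) auto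
  then have le: "(1 + kn k) ^ 4 \<le> m^2 * vweight \<alpha> k ^ 4" by (simp add: power_mult_distrib)
  have "(1 + kn k) powr (- 4) = 1 / (1 + kn k) ^ 4"
    using k1 powr_realpow[OF k1, of 4] by (simp add: powr_minus divide_inverse)
  then show "1 / vweight \<alpha> k ^ 4 \<le> m^2 * (1 + kn k) powr (- 4)"
    using le k1 vweight_pos[of \<alpha> k] by (simp add: divide_le_eq le_divide_eq mult.commute)
qed (simp add: vweight_pos less_imp_le)

definition tconst :: "real \<Rightarrow> real" where
  "tconst \<alpha> = sqrt (infsum (\<lambda>k. 1 / vweight \<alpha> k ^ 4) UNIV)"

lemma tconst_nonneg: "0 \<le> tconst \<alpha>"
  unfolding tconst_def by (intro real_sqrt_ge_zero infsum_nonneg) (simp add: vweight_pos less_imp_le)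

lemma is_l2_of_vweight:
  assumes "is_l2 (\<lambda>k. vweight \<alpha> k * norm (\<psi> k))"
  shows "is_l2 (\<lambda>k. norm (\<psi> k))"
proof (rule is_l2_comparison(1)[OF assms])
  fix k
  have "1 * norm (\<psi> k) \<le> vweight \<alpha> k * norm (\<psi> k)" by (intro mult_right_mono vweight_ge_1) auto
  then show "\<bar>norm (\<psi> k)\<bar> \<le> vweight \<alpha> k * norm (\<psi> k)" by simp
qed

lemma kn_is_l2_of_vweight:
  assumes \<alpha>: "0 < \<alpha>" and s: "is_l2 (\<lambda>k. vweight \<alpha> k * norm (\<phi> k))"
  shows "is_l2 (\<lambda>k. kn k * norm (\<phi> k))"
    "l2 (\<lambda>k. kn k * norm (\<phi> k)) \<le> l2 (\<lambda>k. vweight \<alpha> k * norm (\<phi> k)) / \<alpha>"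
proof -
  have le: "\<bar>kn k * norm (\<phi> k)\<bar> \<le> (1 / \<alpha>) * (vweight \<alpha> k * norm (\<phi> k))" for k
    using mult_right_mono[OF kn_le_vweight[OF \<alpha>], of "norm (\<phi> k)" k] by simp
  note c = is_l2_cmult[OF s, of "1 / \<alpha>"]
  from is_l2_comparison[OF c(1) le] c(2) \<alpha>
  show "is_l2 (\<lambda>k. kn k * norm (\<phi> k))"
    "l2 (\<lambda>k. kn k * norm (\<phi> k)) \<le> l2 (\<lambda>k. vweight \<alpha> k * norm (\<phi> k)) / \<alpha>" by auto
qed

lemma transport_bound_summable:
  assumes \<alpha>: "0 < \<alpha>"
    and \<psi>: "is_l2 (\<lambda>k. vweight \<alpha> k * norm (\<psi> k))"
    and \<phi>: "is_l2 (\<lambda>k. vweight \<alpha> k * norm (\<phi> k))"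
    and \<eta>: "is_l2 (\<lambda>k. vweight \<alpha> k * \<eta> k)"
  shows "(\<lambda>(k, j). transport_bound \<psi> \<phi> k j * \<eta> k) summable_on UNIV"
    "infsum (\<lambda>(k, j). transport_bound \<psi> \<phi> k j * \<eta> k) UNIV \<le>
      tconst \<alpha> / \<alpha> * l2 (\<lambda>k. vweight \<alpha> k * norm (\<psi> k)) * l2 (\<lambda>k. vweight \<alpha> k * norm (\<phi> k)) * l2 (\<lambda>k. vweight \<alpha> k * \<eta> k)"
proof -
  note d = kn_is_l2_of_vweight[OF \<alpha> \<phi>]
  note t = trilinear_weighted[OF summable_on_vweight[OF \<alpha>] vweight_pos \<psi> \<eta> d(1), folded tconst_def]
  show "(\<lambda>(k, j). transport_bound \<psi> \<phi> k j * \<eta> k) summable_on UNIV" by (rule t(1))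
  have "infsum (\<lambda>(k, j). transport_bound \<psi> \<phi> k j * \<eta> k) UNIV \<le>
      tconst \<alpha> * l2 (\<lambda>k. vweight \<alpha> k * norm (\<psi> k)) * (l2 (\<lambda>k. vweight \<alpha> k * norm (\<phi> k)) / \<alpha>) * l2 (\<lambda>k. vweight \<alpha> k * \<eta> k)"
    by (rule order_trans[OF t(2)]) (intro mult_right_mono mult_left_mono d(2) mult_nonneg_nonneg tconst_nonneg l2_nonneg)
  then show "infsum (\<lambda>(k, j). transport_bound \<psi> \<phi> k j * \<eta> k) UNIV \<le>
      tconst \<alpha> / \<alpha> * l2 (\<lambda>k. vweight \<alpha> k * norm (\<psi> k)) * l2 (\<lambda>k. vweight \<alpha> k * norm (\<phi> k)) * l2 (\<lambda>k. vweight \<alpha> k * \<eta> k)"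
    by (simp add: mult_ac)
qed

subsection \<open>The Voigt nonlinearity\<close>

text \<open>An element \<open>b\<close> of the phase space stands for the velocity field with Fourier coefficients
  \<open>b\<^sub>k / vweight \<alpha> k\<close>, so that \<open>\<parallel>b\<parallel>\<^sup>2\<close> is the conserved energy \<open>\<parallel>u\<parallel>\<^sup>2 + \<alpha>\<^sup>2 \<parallel>\<nabla>u\<parallel>\<^sup>2\<close>.\<close>

definition vfield :: "real \<Rightarrow> sfield \<Rightarrow> int^3 \<Rightarrow> complex^3" where
  "vfield \<alpha> b k = (1 / vweight \<alpha> k) *\<^sub>R coeffs b k"

lemma solenoidal_vfield: "solenoidal_seq (vfield \<alpha> b)"
  using solenoidal_coeffs[of b] by (simp add: solenoidal_seq_def vfield_def)

lemma vweight_vfield: "vweight \<alpha> k *\<^sub>R vfield \<alpha> b k = coeffs b k"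
  by (simp add: vfield_def)

lemma norm_vfield: "vweight \<alpha> k * norm (vfield \<alpha> b k) = norm (coeffs b k)"
  using vweight_pos[of \<alpha> k] by (simp add: vfield_def)

lemma is_l2_vfield:
  "is_l2 (\<lambda>k. vweight \<alpha> k * norm (vfield \<alpha> b k))" "l2 (\<lambda>k. vweight \<alpha> k * norm (vfield \<alpha> b k)) = norm b"
  by (simp_all add: norm_vfield is_l2_coeffs norm_sfield_l2)

lemma vfield_linear:
  "vfield \<alpha> (b + c) = (\<lambda>k. vfield \<alpha> b k + vfield \<alpha> c k)" "vfield \<alpha> (t *\<^sub>R b) = (\<lambda>k. t *\<^sub>R vfield \<alpha> b k)"
  by (simp_all add: fun_eq_iff vfield_def coeffs_simps algebra_simps)

definition voigt_coeffs :: "real \<Rightarrow> sfield \<Rightarrow> sfield \<Rightarrow> int^3 \<Rightarrow> complex^3" where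
  "voigt_coeffs \<alpha> b c k = - (1 / vweight \<alpha> k) *\<^sub>R lproj k (advec (vfield \<alpha> b) (vfield \<alpha> c) k)"

text \<open>\<open>voigt_op \<alpha> b b\<close> is \<open>- (I + \<alpha>\<^sup>2
  A)\<^sup>-\<^sup>1\<^sup>/\<^sup>2 B(u, u)\<close> for the velocity field \<open>u\<close> of \<open>b\<close>. In terms of
  \<open>b = (I + \<alpha>\<^sup>2 A)\<^sup>1\<^sup>/\<^sup>2 u\<close> the Euler--Voigt equation reads \<open>b' = voigt_op \<alpha> b b\<close>.\<close>

definition voigt_op :: "real \<Rightarrow> sfield \<Rightarrow> sfield \<Rightarrow> sfield" where
  "voigt_op \<alpha> b c = Abs_sfield (voigt_coeffs \<alpha> b c)"

context
  fixes \<alpha> :: real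
  assumes \<alpha>: "0 < \<alpha>"
begin

lemma vfield_summable:
  "is_l2 (\<lambda>k. norm (vfield \<alpha> b k))" "is_l2 (\<lambda>k. kn k * norm (vfield \<alpha> b k))"
  using is_l2_of_vweight[OF is_l2_vfield(1)]
    kn_is_l2_of_vweight(1)[OF \<alpha> is_l2_vfield(1)] by auto

lemma voigt_coeffs_bounds:
  "is_l2 (\<lambda>k. norm (voigt_coeffs \<alpha> b c k))"
  "l2 (\<lambda>k. norm (voigt_coeffs \<alpha> b c k)) \<le> tconst \<alpha> / \<alpha> * norm b * norm c"
proof -
  have B: "0 \<le> tconst \<alpha> / \<alpha> * norm b * norm c" using \<alpha> tconst_nonneg by auto
  have W: "0 \<le> 1 / vweight \<alpha> k" for k using vweight_pos[of \<alpha> k] by simp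
  have dual: "(\<lambda>(k, j). transport_bound (vfield \<alpha> b) (vfield \<alpha> c) k j * (1 / vweight \<alpha> k * d k)) summable_on UNIV \<and>
      infsum (\<lambda>(k, j). transport_bound (vfield \<alpha> b) (vfield \<alpha> c) k j * (1 / vweight \<alpha> k * d k)) UNIV
        \<le> tconst \<alpha> / \<alpha> * norm b * norm c * l2 d"
    if "is_l2 d" for d
  proof -
    have e: "(\<lambda>k. vweight \<alpha> k * (1 / vweight \<alpha> k * d k)) = d" by auto
    have "is_l2 (\<lambda>k. vweight \<alpha> k * (1 / vweight \<alpha> k * d k))" unfolding e by (rule that)
    from transport_bound_summable[OF \<alpha> is_l2_vfield(1)[of \<alpha> b] is_l2_vfield(1)[of \<alpha> c] this]
    show ?thesis unfolding e is_l2_vfield(2) by auto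
  qed
  note a = advec_is_l2[OF vfield_summable B W, OF dual]
  have le: "\<bar>norm (voigt_coeffs \<alpha> b c k)\<bar> \<le> 1 / vweight \<alpha> k * norm (advec (vfield \<alpha> b) (vfield \<alpha> c) k)" for k
    using vweight_pos[of \<alpha> k] norm_lproj_le[of k "advec (vfield \<alpha> b) (vfield \<alpha> c) k"]
    by (simp add: voigt_coeffs_def divide_right_mono)
  from is_l2_comparison[OF a(1) le] a(2)
  show "is_l2 (\<lambda>k. norm (voigt_coeffs \<alpha> b c k))"
    "l2 (\<lambda>k. norm (voigt_coeffs \<alpha> b c k)) \<le> tconst \<alpha> / \<alpha> * norm b * norm c" by auto
qed

lemma advec_vfield_minus: "advec (vfield \<alpha> b) (vfield \<alpha> c) (- k) = vcnj (advec (vfield \<alpha> b) (vfield \<alpha> c) k)"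
  by (rule advec_real) (auto simp: solenoidal_seqD(3)[OF solenoidal_vfield] intro: transport_summable vfield_summable)

lemma coeffs_voigt_op: "coeffs (voigt_op \<alpha> b c) = voigt_coeffs \<alpha> b c"
  unfolding voigt_op_def
proof (rule coeffs_Abs[OF _ voigt_coeffs_bounds(1)])
  show "solenoidal_seq (voigt_coeffs \<alpha> b c)"
    by (simp add: solenoidal_seq_def voigt_coeffs_def advec_vfield_minus lproj_vcnj)
qed

lemma norm_voigt_op_le: "norm (voigt_op \<alpha> b c) \<le> tconst \<alpha> / \<alpha> * norm b * norm c"
  unfolding norm_sfield_l2[of "voigt_op \<alpha> b c"] coeffs_voigt_op by (rule voigt_coeffs_bounds)

text \<open>Unlike in the Euler equations, the nonlinearity loses no derivative: it is bounded on the
  phase space, and the equation is an ordinary differential equation in a Hilbert space.\<close>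

lemma bounded_bilinear_voigt_op: "bounded_bilinear (voigt_op \<alpha>)"
proof
  fix a b c :: sfield and t :: real
  show "voigt_op \<alpha> (a + b) c = voigt_op \<alpha> a c + voigt_op \<alpha> b c"
    by (rule sfield_eqI)
       (simp add: coeffs_simps coeffs_voigt_op voigt_coeffs_def vfield_linear advec_add_left vfield_summable lproj_linear algebra_simps)
  show "voigt_op \<alpha> a (b + c) = voigt_op \<alpha> a b + voigt_op \<alpha> a c"
    by (rule sfield_eqI)
       (simp add: coeffs_simps coeffs_voigt_op voigt_coeffs_def vfield_linear advec_add_right vfield_summable lproj_linear algebra_simps)
  show "voigt_op \<alpha> (t *\<^sub>R a) b = t *\<^sub>R voigt_op \<alpha> a b" "voigt_op \<alpha> a (t *\<^sub>R b) = t *\<^sub>R voigt_op \<alpha> a b"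
    by (rule sfield_eqI;
        simp add: coeffs_simps coeffs_voigt_op voigt_coeffs_def vfield_linear advec_scaleR lproj_linear)+
  show "\<exists>K. \<forall>a b. norm (voigt_op \<alpha> a b) \<le> norm a * norm b * K"
    by (rule exI[of _ "tconst \<alpha> / \<alpha>"]) (use norm_voigt_op_le in \<open>simp add: mult_ac\<close>)
qed

lemma inner_voigt_op: "voigt_op \<alpha> b c \<bullet> d = - trilinear (vfield \<alpha> b) (vfield \<alpha> c) (vfield \<alpha> d)"
proof -
  have "coeffs (voigt_op \<alpha> b c) k \<bullet> coeffs d k = - (advec (vfield \<alpha> b) (vfield \<alpha> c) k \<bullet> vfield \<alpha> d k)" for k
    using inner_lproj[of k "vfield \<alpha> d k" "advec (vfield \<alpha> b) (vfield \<alpha> c) k"] solenoidal_seqD[OF solenoidal_vfield[of \<alpha> d]]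
    by (auto simp: coeffs_voigt_op voigt_coeffs_def vfield_def)
  then have "voigt_op \<alpha> b c \<bullet> d = - infsum (\<lambda>k. advec (vfield \<alpha> b) (vfield \<alpha> c) k \<bullet> vfield \<alpha> d k) UNIV"
    by (simp add: inner_sfield_def infsum_uminus)
  also have "infsum (\<lambda>k. advec (vfield \<alpha> b) (vfield \<alpha> c) k \<bullet> vfield \<alpha> d k) UNIV
      = trilinear (vfield \<alpha> b) (vfield \<alpha> c) (vfield \<alpha> d)"
    by (intro trilinear_eq_advec vfield_summable transport_bound_summable[OF \<alpha>] is_l2_vfield)
  finally show ?thesis .
qed

lemma voigt_op_conservative: "b \<bullet> voigt_op \<alpha> b b = 0"
  using inner_voigt_op[of b b b] trilinear_self[OF solenoidal_vfield[of \<alpha> b], of "vfield \<alpha> b"]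
    solenoidal_seqD(3)[OF solenoidal_vfield[of \<alpha> b]] by (simp add: inner_commute)

end

subsection \<open>Galerkin truncation\<close>

definition galerkin :: "nat \<Rightarrow> sfield \<Rightarrow> sfield" where
  "galerkin N b = Abs_sfield (\<lambda>k. if k \<in> cube N then coeffs b k else 0)"

lemma coeffs_galerkin: "coeffs (galerkin N b) = (\<lambda>k. if k \<in> cube N then coeffs b k else 0)"
  unfolding galerkin_def
proof (rule coeffs_Abs)
  show "solenoidal_seq (\<lambda>k. if k \<in> cube N then coeffs b k else 0)"
    using solenoidal_coeffs[of b] by (simp add: solenoidal_seq_def)
  show "is_l2 (\<lambda>k. norm (if k \<in> cube N then coeffs b k else 0))"
    by (rule is_l2_comparison(1)[OF is_l2_coeffs[of b]]) simp
qed

lemma galerkin_linear: "galerkin N (a + b) = galerkin N a + galerkin N b" "galerkin N (t *\<^sub>R a) = t *\<^sub>R galerkin N a"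
  "galerkin N (galerkin N a) = galerkin N a"
  by (rule sfield_eqI; simp add: coeffs_simps coeffs_galerkin)+

lemma inner_galerkin: "galerkin N a \<bullet> b = a \<bullet> galerkin N b"
  unfolding inner_sfield_def by (intro infsum_cong) (simp add: coeffs_galerkin)

lemma norm_galerkin_le: "norm (galerkin N a) \<le> norm a"
  unfolding norm_sfield_l2
  by (rule is_l2_comparison(2)[OF is_l2_coeffs[of a]]) (simp add: coeffs_galerkin)

lemma bounded_linear_galerkin: "bounded_linear (galerkin N)"
  by (rule bounded_linear_intro[where K = 1]) (auto simp: galerkin_linear norm_galerkin_le)

lemma norm_galerkin_square: "(norm (galerkin N a))^2 = (\<Sum>k\<in>cube N. (norm (coeffs a k))^2)"
  unfolding norm_sfield_square
  by (intro infsumI has_sum_finite_neutralI[OF finite_cube[of N]] sum.cong) (auto simp: coeffs_galerkin)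

lemma galerkin_LIMSEQ: "(\<lambda>N. galerkin N a) \<longlonglongrightarrow> a"
proof -
  have eq: "(norm (galerkin N a - a))^2 = (norm a)^2 - (norm (galerkin N a))^2" for N
  proof -
    have "galerkin N a \<bullet> a = galerkin N a \<bullet> galerkin N a"
      using inner_galerkin[of N a "galerkin N a"] inner_galerkin[of N "galerkin N a" a] by (simp add: galerkin_linear inner_commute)
    then show ?thesis by (simp add: power2_norm_eq_inner inner_diff_left inner_diff_right inner_commute)
  qed
  have "(\<lambda>N. (norm (galerkin N a))^2) \<longlonglongrightarrow> (norm a)^2"
    unfolding norm_galerkin_square norm_sfield_square[of a]
    using is_l2_coeffs[of a] unfolding is_l2_def
    by (intro has_sum_cube_LIMSEQ has_sum_infsum)
  then have "(\<lambda>N. (norm (galerkin N a - a))^2) \<longlonglongrightarrow> (norm a)^2 - (norm a)^2"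
    unfolding eq by (intro tendsto_diff tendsto_const)
  then have "(\<lambda>N. norm (galerkin N a - a)) \<longlonglongrightarrow> 0"
    using tendsto_real_sqrt[of "\<lambda>N. (norm (galerkin N a - a))^2" 0] by simp
  then show ?thesis by (simp add: LIM_zero_iff tendsto_norm_zero_iff)
qed

text \<open>Truncation on both sides preserves the conservation law and makes all weighted norms finite,
  so that they may be differentiated in time.\<close>

definition galerkin_op :: "real \<Rightarrow> nat \<Rightarrow> sfield \<Rightarrow> sfield \<Rightarrow> sfield" where
  "galerkin_op \<alpha> N b c = galerkin N (voigt_op \<alpha> (galerkin N b) (galerkin N c))"

context
  fixes \<alpha> :: real
  assumes \<alpha>: "0 < \<alpha>"
begin

lemma norm_galerkin_op_le: "norm (galerkin_op \<alpha> N b c) \<le> tconst \<alpha> / \<alpha> * norm b * norm c"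
proof -
  have "norm (galerkin_op \<alpha> N b c) \<le> norm (voigt_op \<alpha> (galerkin N b) (galerkin N c))"
    unfolding galerkin_op_def by (rule norm_galerkin_le)
  also have "\<dots> \<le> tconst \<alpha> / \<alpha> * norm (galerkin N b) * norm (galerkin N c)" by (rule norm_voigt_op_le[OF \<alpha>])
  also have "\<dots> \<le> tconst \<alpha> / \<alpha> * norm b * norm c"
    using \<alpha> tconst_nonneg by (intro mult_mono mult_left_mono norm_galerkin_le) auto
  finally show ?thesis .
qed

lemma bounded_bilinear_galerkin_op: "bounded_bilinear (galerkin_op \<alpha> N)"
proof -
  interpret v: bounded_bilinear "voigt_op \<alpha>" by (rule bounded_bilinear_voigt_op[OF \<alpha>])
  show ?thesis
  proof
    show "\<exists>K. \<forall>a b. norm (galerkin_op \<alpha> N a b) \<le> norm a * norm b * K"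
      by (rule exI[of _ "tconst \<alpha> / \<alpha>"]) (use norm_galerkin_op_le in \<open>simp add: mult_ac\<close>)
  qed (simp_all add: galerkin_op_def galerkin_linear v.add_left v.add_right v.scaleR_left v.scaleR_right)
qed

lemma galerkin_op_conservative: "b \<bullet> galerkin_op \<alpha> N b b = 0"
  using voigt_op_conservative[OF \<alpha>, of "galerkin N b"] by (simp add: galerkin_op_def inner_galerkin[symmetric])

lemma galerkin_op_LIMSEQ: "(\<lambda>N. galerkin_op \<alpha> N b b) \<longlonglongrightarrow> voigt_op \<alpha> b b"
proof -
  interpret v: bounded_bilinear "voigt_op \<alpha>" by (rule bounded_bilinear_voigt_op[OF \<alpha>])
  let ?v = "voigt_op \<alpha> b b"
  have "(\<lambda>N. voigt_op \<alpha> (galerkin N b) (galerkin N b) - ?v) \<longlonglongrightarrow> ?v - ?v"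
    by (intro tendsto_diff v.tendsto galerkin_LIMSEQ tendsto_const)
  then have 0: "(\<lambda>N. norm (voigt_op \<alpha> (galerkin N b) (galerkin N b) - ?v)) \<longlonglongrightarrow> 0"
    by (simp add: tendsto_norm_zero)
  have "(\<lambda>N. galerkin_op \<alpha> N b b - galerkin N ?v) \<longlonglongrightarrow> 0"
  proof (rule tendsto_norm_zero_cancel, rule tendsto_sandwich[OF _ _ tendsto_const 0])
    show "\<forall>\<^sub>F N in sequentially. norm (galerkin_op \<alpha> N b b - galerkin N ?v)
        \<le> norm (voigt_op \<alpha> (galerkin N b) (galerkin N b) - ?v)"
      unfolding galerkin_op_def bounded_linear.linear[OF bounded_linear_galerkin, THEN linear_diff, symmetric]
      by (intro always_eventually allI norm_galerkin_le)
  qed auto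
  from tendsto_add[OF this galerkin_LIMSEQ[of ?v]] show ?thesis by simp
qed

end

section \<open>A priori estimates\<close>

subsection \<open>Weighted energies of Galerkin solutions\<close>

lemma finite_support_is_l2:
  fixes f :: "'a \<Rightarrow> real"
  assumes F: "finite F" "\<And>k. k \<notin> F \<Longrightarrow> f k = 0"
  shows "is_l2 f" "(l2 f)^2 = (\<Sum>k\<in>F. (f k)^2)"
proof -
  have "((\<lambda>k. (f k)^2) has_sum (\<Sum>k\<in>F. (f k)^2)) UNIV"
    by (rule has_sum_finite_neutralI[OF F(1)]) (use F(2) in auto)
  then show "is_l2 f" "(l2 f)^2 = (\<Sum>k\<in>F. (f k)^2)"
    unfolding is_l2_def l2_square by (auto simp: has_sum_iff)
qed

definition wenergy :: "nat \<Rightarrow> (int^3 \<Rightarrow> real) \<Rightarrow> sfield \<Rightarrow> real" where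
  "wenergy N W b = (\<Sum>k\<in>cube N. (W k)^2 * (norm (coeffs b k))^2)"

lemma wenergy_nonneg: "0 \<le> wenergy N W b"
  unfolding wenergy_def by (intro sum_nonneg) auto

context
  fixes \<alpha> :: real and N :: nat and b :: sfield
  assumes \<alpha>: "0 < \<alpha>" and supp: "galerkin N b = b"
begin

lemma support_outside: "k \<notin> cube N \<Longrightarrow> coeffs b k = 0" "k \<notin> cube N \<Longrightarrow> vfield \<alpha> b k = 0"
proof -
  have "coeffs b k = (if k \<in> cube N then coeffs b k else 0)" for k
    using coeffs_galerkin[of N b] by (metis supp)
  from this[of k] show "k \<notin> cube N \<Longrightarrow> coeffs b k = 0" "k \<notin> cube N \<Longrightarrow> vfield \<alpha> b k = 0"
    by (simp_all add: vfield_def)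
qed

text \<open>Both sums are finite because of the frequency support, and the outer truncation disappears
  since the test field has the same support.\<close>

lemma weighted_galerkin_identity:
  assumes W: "\<And>k. W (- k) = W k"
  shows "(\<Sum>k\<in>cube N. (W k)^2 * (coeffs b k \<bullet> coeffs (galerkin_op \<alpha> N b b) k))
    = - trilinear (vfield \<alpha> b) (vfield \<alpha> b) (\<lambda>k. (W k)^2 *\<^sub>R vfield \<alpha> b k)"
proof -
  define D where "D = Abs_sfield (\<lambda>k. (W k)^2 *\<^sub>R coeffs b k)"
  have D: "coeffs D = (\<lambda>k. (W k)^2 *\<^sub>R coeffs b k)"
    unfolding D_def
  proof (rule coeffs_Abs)
    show "solenoidal_seq (\<lambda>k. (W k)^2 *\<^sub>R coeffs b k)"
      using solenoidal_coeffs[of b] by (simp add: solenoidal_seq_def W)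
    show "is_l2 (\<lambda>k. norm ((W k)^2 *\<^sub>R coeffs b k))"
      by (rule finite_support_is_l2(1)[OF finite_cube]) (use support_outside in auto)
  qed
  have vD: "vfield \<alpha> D = (\<lambda>k. (W k)^2 *\<^sub>R vfield \<alpha> b k)"
    by (simp add: fun_eq_iff vfield_def D)
  have "galerkin_op \<alpha> N b b \<bullet> D = galerkin N (galerkin_op \<alpha> N b b) \<bullet> D"
    by (simp add: galerkin_op_def galerkin_linear)
  have gD: "galerkin N D = D"
    by (rule sfield_eqI) (simp add: coeffs_galerkin D support_outside)
  have "(\<Sum>k\<in>cube N. (W k)^2 * (coeffs b k \<bullet> coeffs (galerkin_op \<alpha> N b b) k)) = galerkin_op \<alpha> N b b \<bullet> D"
    unfolding inner_sfield_def
    by (rule infsumI[symmetric], rule has_sum_finite_neutralI[OF finite_cube])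
       (auto simp: D support_outside inner_commute)
  also have "\<dots> = voigt_op \<alpha> b b \<bullet> D"
    by (simp add: galerkin_op_def inner_galerkin supp gD)
  also have "\<dots> = - trilinear (vfield \<alpha> b) (vfield \<alpha> b) (vfield \<alpha> D)"
    by (rule inner_voigt_op[OF \<alpha>])
  finally show ?thesis unfolding vD .
qed

lemma trilinear_support_bound:
  assumes W: "\<And>k. W (- k) = W k" "\<And>k. 0 \<le> W k"
  defines "F \<equiv> \<lambda>(k, j). norm (vfield \<alpha> b j) * (kn (k - j) * norm (vfield \<alpha> b (k - j))) * norm (vfield \<alpha> b k) *
          (W k * \<bar>W k - W (k - j)\<bar>)"
  assumes F: "F summable_on UNIV"
  shows "\<bar>trilinear (vfield \<alpha> b) (vfield \<alpha> b) (\<lambda>k. (W k)^2 *\<^sub>R vfield \<alpha> b k)\<bar> \<le> infsum F UNIV"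
proof -
  have eq: "F = (\<lambda>(k, j). transport_bound (vfield \<alpha> b) (vfield \<alpha> b) k j * norm (vfield \<alpha> b k) * \<bar>W k * (W k - W (k - j))\<bar>)"
    using W(2) by (simp add: F_def abs_mult fun_eq_iff)
  show ?thesis unfolding eq
  proof (rule trilinear_commutator[where W = W])
    show "solenoidal_seq (vfield \<alpha> b)" by (rule solenoidal_vfield)
    then show "vfield \<alpha> b (- k) = vcnj (vfield \<alpha> b k)" for k by (rule solenoidal_seqD)
    show "W (- k) = W k" for k by (rule W)
    show "(\<lambda>(k, j). transport_bound (vfield \<alpha> b) (vfield \<alpha> b) k j * norm (vfield \<alpha> b k) * \<bar>W k * (W k - W (k - j))\<bar>) summable_on UNIV"
      using F unfolding eq .
    show "(\<lambda>(k, j). transport_bound (vfield \<alpha> b) (vfield \<alpha> b) k j * norm ((W k)^2 *\<^sub>R vfield \<alpha> b k)) summable_on UNIV"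
      by (intro transport_bound_summable[OF \<alpha>] is_l2_vfield
          finite_support_is_l2(1)[OF finite_cube]) (use support_outside in auto)
  qed
qed

end

lemma galerkin_flow_support:
  assumes \<alpha>: "0 < \<alpha>" and b: "quadratic_flow (galerkin_op \<alpha> N) b" and b0: "galerkin N (b 0) = b 0"
  shows "galerkin N (b t) = b t"
proof -
  define d where "d t = b t - galerkin N (b t)" for t
  have "(d has_vector_derivative 0) (at t within UNIV)" for t
  proof -
    have "(d has_vector_derivative galerkin_op \<alpha> N (b t) (b t) - galerkin N (galerkin_op \<alpha> N (b t) (b t))) (at t)"
      unfolding d_def using b unfolding quadratic_flow_def
      by (intro has_vector_derivative_diff bounded_linear.has_vector_derivative[OF bounded_linear_galerkin]) auto
    then show ?thesis by (simp add: galerkin_op_def galerkin_linear)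
  qed
  then obtain c where "\<And>t. d t = c"
    using has_vector_derivative_zero_constant[of UNIV d] by auto
  then have "d t = d 0" by simp
  then show ?thesis using b0 by (simp add: d_def)
qed

lemma wenergy_has_derivative:
  assumes b: "(b has_vector_derivative b') (at t)"
    and W: "\<And>k. ((\<lambda>s. W s k) has_real_derivative W' k) (at t)"
  shows "((\<lambda>s. wenergy N (W s) (b s)) has_real_derivative
    2 * (\<Sum>k\<in>cube N. W t k * W' k * (norm (coeffs (b t) k))^2)
    + 2 * (\<Sum>k\<in>cube N. (W t k)^2 * (coeffs (b t) k \<bullet> coeffs b' k))) (at t)"
proof -
  have "((\<lambda>s. coeffs (b s) k) has_vector_derivative coeffs b' k) (at t)" for k
    by (rule bounded_linear.has_vector_derivative[OF bounded_linear_coeffs b])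
  note n = has_real_derivative_norm_square[OF this]
  have "((\<lambda>s. (W s k)^2 * (norm (coeffs (b s) k))^2) has_real_derivative
     2 * (W t k * W' k * (norm (coeffs (b t) k))^2) + 2 * ((W t k)^2 * (coeffs (b t) k \<bullet> coeffs b' k))) (at t)" for k
    by (rule DERIV_cong[OF DERIV_mult[OF DERIV_power[OF W] n]]) (simp add: algebra_simps)
  from DERIV_sum[of "cube N", OF this] show ?thesis
    unfolding wenergy_def by (simp add: sum.distrib sum_distrib_left)
qed

subsection \<open>Polynomial growth of Sobolev norms\<close>

text \<open>The two summands dominate the left side for \<open>x \<le> R\<close> and for \<open>x \<ge>
  R\<close>, respectively.\<close>

lemma interpolation_power:
  fixes R x :: real
  assumes R: "1 \<le> R" and x: "0 \<le> x"
  shows "x ^ (2 * Suc n) \<le> R ^ (2 * n) * x^2 + R ^ (2 * n) / R ^ (2 * Suc n) * x ^ (2 * Suc (Suc n))"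
proof (cases "x \<le> R")
  case True
  have "x ^ (2 * n) * x^2 \<le> R ^ (2 * n) * x^2" using True x by (intro mult_right_mono power_mono) auto
  moreover have "0 \<le> R ^ (2 * n) / R ^ (2 * Suc n) * x ^ (2 * Suc (Suc n))" using R x by auto
  moreover have "x ^ (2 * Suc n) = x ^ (2 * n) * x^2" by (simp add: power2_eq_square)
  ultimately show ?thesis by linarith
next
  case False
  have e: "R ^ (2 * n) / R ^ (2 * Suc n) = 1 / R^2" using R by (simp add: power2_eq_square field_simps)
  have "1 \<le> x^2 / R^2" using False R by (simp add: le_divide_eq power_mono)
  then have "x ^ (2 * Suc n) * 1 \<le> x ^ (2 * Suc n) * (x^2 / R^2)" using x by (intro mult_left_mono) auto
  also have "\<dots> = 1 / R^2 * x ^ (2 * Suc (Suc n))" by (simp add: power2_eq_square)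
  finally show ?thesis unfolding e using R x by (intro order_trans[OF _ add_increasing[OF _ order_refl]]) auto
qed

lemma interpolation_powr:
  fixes R x \<beta> :: real
  assumes R: "1 \<le> R" and x: "0 \<le> x" and \<beta>: "0 < \<beta>" "\<beta> \<le> real (Suc n)"
  shows "(x powr \<beta> * x)^2 \<le> (R powr \<beta>)^2 * x^2 + (R powr \<beta>)^2 / R ^ (2 * Suc n) * x ^ (2 * Suc (Suc n))"
proof (cases "x \<le> R")
  case True
  have "(x powr \<beta>)^2 * x^2 \<le> (R powr \<beta>)^2 * x^2"
    using True x \<beta> by (intro mult_right_mono power_mono powr_mono2) auto
  moreover have "0 \<le> (R powr \<beta>)^2 / R ^ (2 * Suc n) * x ^ (2 * Suc (Suc n))" using R x by auto
  ultimately show ?thesis by (simp add: power_mult_distrib)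
next
  case False
  then have x0: "0 < x" and xR: "1 \<le> x / R" using R by auto
  have "(x / R) powr \<beta> \<le> (x / R) powr real (Suc n)" using xR \<beta> by (intro powr_mono) auto
  also have "\<dots> = (x / R) ^ Suc n" using xR by (subst powr_realpow) auto
  finally have "x powr \<beta> / R powr \<beta> \<le> x ^ Suc n / R ^ Suc n"
    using x0 R by (simp add: powr_divide power_divide del: power_Suc)
  then have "x powr \<beta> \<le> R powr \<beta> * (x ^ Suc n / R ^ Suc n)"
    using R by (simp add: pos_divide_le_eq mult.commute del: power_Suc)
  then have "(x powr \<beta>)^2 \<le> (R powr \<beta> * (x ^ Suc n / R ^ Suc n))^2" by (intro power_mono) auto
  then have "(x powr \<beta>)^2 * x^2 \<le> (R powr \<beta> * (x ^ Suc n / R ^ Suc n))^2 * x^2" by (rule mult_right_mono) simp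
  also have "\<dots> = (R powr \<beta>)^2 / R ^ (2 * Suc n) * x ^ (2 * Suc (Suc n))"
  proof -
    have "(R ^ Suc n)^2 = R ^ (2 * Suc n)" "(x ^ Suc n)^2 * x^2 = x ^ (2 * Suc (Suc n))"
      by (simp_all add: power_mult[symmetric] power_add[symmetric] mult.commute del: power_Suc)
    then show ?thesis by (simp add: power_mult_distrib power_divide mult.assoc del: power_Suc)
  qed
  finally show ?thesis using x by (simp add: power_mult_distrib add_increasing del: power_Suc)
qed

definition growth_rate :: "nat \<Rightarrow> real" where
  "growth_rate s = 3 / (13 * real s)"

definition growth_slope :: "real \<Rightarrow> nat \<Rightarrow> real \<Rightarrow> real" where
  "growth_slope \<alpha> n M = 4 * (real (Suc n) * 2 ^ n) * lattice_const (20/13) * (sqrt (M + 1)) ^ 3 / \<alpha> ^ 3"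

text \<open>With \<open>Z = 1 + \<Sum> \<bar>k\<bar>\<^bsup>2s\<^esup> \<bar>b\<^sub>k\<bar>\<^sup>2\<close>, the factors in the Sobolev commutator
  estimate are interpolated between the conserved energy and \<open>Z\<close>, splitting frequencies at
  \<open>\<bar>k\<bar> = Z powr (1 / (2 s))\<close>. The exponent \<open>20/13 > 3/2\<close> makes the \<open>\<ell>\<^sup>1\<close> norm of
  \<open>\<bar>k\<bar> \<bar>u\<^sub>k\<bar>\<close> controllable and is the largest one for which the resulting growth
  exponent \<open>13 s / 6\<close> with \<open>s = 3\<close> stays within \<open>5 (3/2) - 1\<close>.\<close>

lemma galerkin_growth_rate:
  assumes \<alpha>: "0 < \<alpha>" and supp: "galerkin N b = b" and n: "2 \<le> n"
    and M: "(norm b)^2 \<le> M"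
  defines "Z \<equiv> 1 + wenergy N (\<lambda>k. kn k ^ Suc n) b"
  shows "2 * \<bar>trilinear (vfield \<alpha> b) (vfield \<alpha> b) (\<lambda>k. (kn k ^ Suc n)^2 *\<^sub>R vfield \<alpha> b k)\<bar>
    \<le> growth_slope \<alpha> n M * Z powr (1 - growth_rate (Suc n))"
proof -
  define u where "u k = norm (vfield \<alpha> b k)" for k
  define \<beta> :: real where "\<beta> = 20/13"
  have u0: "u 0 = 0" "\<And>k. 0 \<le> u k"
    using solenoidal_seqD(1)[OF solenoidal_vfield[of \<alpha> b]] by (auto simp: u_def)
  have out: "u k = 0" if "k \<notin> cube N" for k
    using support_outside[OF \<alpha> supp] that by (simp add: u_def)
  have bu: "norm (coeffs b k) = vweight \<alpha> k * u k" for k by (simp add: u_def norm_vfield)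
  have M0: "0 \<le> M" using M zero_le_power2[of "norm b"] by linarith
  have Z1: "1 \<le> Z" unfolding Z_def using wenergy_nonneg by simp
  (* the cut between low and high frequencies that balances the two sums of the interpolation *)
  define R where "R = Z powr (1 / (2 * real (Suc n)))"
  have R: "1 \<le> R" unfolding R_def using Z1 by (simp add: ge_one_powr_ge_zero)
  have RZ: "R ^ (2 * Suc n) = Z"
  proof -
    have "R ^ (2 * Suc n) = R powr real (2 * Suc n)" using R by (subst powr_realpow) auto
    also have "\<dots> = Z powr 1" unfolding R_def powr_powr by simp
    finally show ?thesis using Z1 by simp
  qed
  have low: "(kn k)^2 * (u k)^2 \<le> (norm (coeffs b k))^2 / \<alpha>^2" for k
  proof -
    have "(\<alpha> * kn k)^2 * (u k)^2 \<le> (vweight \<alpha> k)^2 * (u k)^2"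
      by (intro mult_right_mono) (simp_all add: vweight_square power_mult_distrib)
    then show ?thesis using \<alpha> by (simp add: bu power_mult_distrib le_divide_eq mult_ac)
  qed
  have sum1: "(\<Sum>k\<in>cube N. (kn k)^2 * (u k)^2) \<le> M / \<alpha>^2"
  proof -
    have "(\<Sum>k\<in>cube N. (kn k)^2 * (u k)^2) \<le> (\<Sum>k\<in>cube N. (norm (coeffs b k))^2 / \<alpha>^2)"
      by (intro sum_mono low)
    also have "\<dots> = (\<Sum>k\<in>cube N. (norm (coeffs b k))^2) / \<alpha>^2" by (simp add: sum_divide_distrib)
    also have "\<dots> \<le> M / \<alpha>^2"
      using order_trans[OF sum_coeffs_le_norm[OF finite_cube] M] by (intro divide_right_mono) auto
    finally show ?thesis .
  qed
  have sum2: "(\<Sum>k\<in>cube N. kn k ^ (2 * Suc (Suc n)) * (u k)^2) \<le> Z / \<alpha>^2"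
  proof -
    have "(\<Sum>k\<in>cube N. kn k ^ (2 * Suc (Suc n)) * (u k)^2) \<le> (\<Sum>k\<in>cube N. (kn k ^ Suc n)^2 * (norm (coeffs b k))^2 / \<alpha>^2)"
    proof (rule sum_mono)
      fix k
      have "kn k ^ (2 * Suc (Suc n)) = (kn k ^ Suc n)^2 * (kn k)^2"
        by (simp add: power_mult[symmetric] power_add[symmetric] mult.commute del: power_Suc)
      then show "kn k ^ (2 * Suc (Suc n)) * (u k)^2 \<le> (kn k ^ Suc n)^2 * (norm (coeffs b k))^2 / \<alpha>^2"
        using mult_left_mono[OF low[of k], of "(kn k ^ Suc n)^2"] by (simp add: mult.assoc del: power_Suc)
    qed
    also have "\<dots> = wenergy N (\<lambda>k. kn k ^ Suc n) b / \<alpha>^2" by (simp add: wenergy_def sum_divide_distrib del: power_Suc)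
    also have "\<dots> \<le> Z / \<alpha>^2" by (intro divide_right_mono) (auto simp: Z_def)
    finally show ?thesis .
  qed
  have interp: "(l2 f)^2 \<le> A * (M + 1) / \<alpha>^2"
    if A: "0 \<le> A" and f: "\<And>k. (f k)^2 \<le> (A * (kn k)^2 + A / R ^ (2 * Suc n) * kn k ^ (2 * Suc (Suc n))) * (u k)^2"
      and f0: "\<And>k. k \<notin> cube N \<Longrightarrow> f k = 0" for A and f :: "int^3 \<Rightarrow> real"
  proof -
    have "(l2 f)^2 = (\<Sum>k\<in>cube N. (f k)^2)" by (rule finite_support_is_l2(2)[OF finite_cube f0])
    also have "\<dots> \<le> (\<Sum>k\<in>cube N. A * ((kn k)^2 * (u k)^2) + A / Z * (kn k ^ (2 * Suc (Suc n)) * (u k)^2))"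
      using f unfolding RZ by (intro sum_mono) (simp add: algebra_simps)
    also have "\<dots> = A * (\<Sum>k\<in>cube N. (kn k)^2 * (u k)^2) + A / Z * (\<Sum>k\<in>cube N. kn k ^ (2 * Suc (Suc n)) * (u k)^2)"
      by (simp add: sum.distrib sum_distrib_left)
    also have "\<dots> \<le> A * (M / \<alpha>^2) + A / Z * (Z / \<alpha>^2)"
      using A Z1 by (intro add_mono mult_left_mono sum1 sum2) auto
    also have "\<dots> = A * (M + 1) / \<alpha>^2" using Z1 by (simp add: algebra_simps add_divide_distrib)
    finally show ?thesis .
  qed
  have s: "is_l2 (\<lambda>k. kn k ^ Suc n * u k)" "is_l2 (\<lambda>k. kn k powr \<beta> * (kn k * u k))"
    by (rule finite_support_is_l2(1)[OF finite_cube[of N]]; use out in simp)+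
  have H: "(l2 (\<lambda>k. kn k ^ Suc n * u k))^2 \<le> R ^ (2 * n) * (M + 1) / \<alpha>^2"
  proof (rule interp)
    fix k
    have "(kn k ^ Suc n * u k)^2 = kn k ^ (2 * Suc n) * (u k)^2"
      by (simp add: power_mult_distrib power_mult[symmetric] mult.commute del: power_Suc)
    also have "\<dots> \<le> (R ^ (2 * n) * (kn k)^2 + R ^ (2 * n) / R ^ (2 * Suc n) * kn k ^ (2 * Suc (Suc n))) * (u k)^2"
      by (intro mult_right_mono interpolation_power R) auto
    finally show "(kn k ^ Suc n * u k)^2 \<le> (R ^ (2 * n) * (kn k)^2 + R ^ (2 * n) / R ^ (2 * Suc n) * kn k ^ (2 * Suc (Suc n))) * (u k)^2" .
  qed (use R out in auto)
  have "(l2 (\<lambda>k. kn k powr \<beta> * (kn k * u k)))^2 \<le> (R powr \<beta>)^2 * (M + 1) / \<alpha>^2"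
  proof (rule interp)
    fix k
    have "(kn k powr \<beta> * (kn k * u k))^2 = (kn k powr \<beta> * kn k)^2 * (u k)^2" by (simp add: power_mult_distrib)
    also have "\<dots> \<le> ((R powr \<beta>)^2 * (kn k)^2 + (R powr \<beta>)^2 / R ^ (2 * Suc n) * kn k ^ (2 * Suc (Suc n))) * (u k)^2"
      using n by (intro mult_right_mono interpolation_powr R) (auto simp: \<beta>_def)
    finally show "(kn k powr \<beta> * (kn k * u k))^2 \<le> ((R powr \<beta>)^2 * (kn k)^2 + (R powr \<beta>)^2 / R ^ (2 * Suc n) * kn k ^ (2 * Suc (Suc n))) * (u k)^2" .
  qed (use out in auto)
  also have "\<dots> = (R powr \<beta> * sqrt (M + 1) / \<alpha>)^2" using M0 by (simp add: power_mult_distrib power_divide)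
  finally have P: "l2 (\<lambda>k. kn k powr \<beta> * (kn k * u k)) \<le> R powr \<beta> * sqrt (M + 1) / \<alpha>"
    using M0 \<alpha> by (intro power2_le_imp_le[OF _ divide_nonneg_pos]) auto
  have S: "(\<lambda>k. kn k * u k) summable_on UNIV"
    "infsum (\<lambda>k. kn k * u k) UNIV \<le> lattice_const \<beta> * (R powr \<beta> * sqrt (M + 1) / \<alpha>)"
  proof -
    note l = summable_if_weighted_is_l2[of \<beta> "\<lambda>k. kn k * u k", OF _ _ _ s(2)]
    show "(\<lambda>k. kn k * u k) summable_on UNIV" by (rule l(1)) (use u0 in \<open>auto simp: \<beta>_def\<close>)
    have "infsum (\<lambda>k. kn k * u k) UNIV \<le> lattice_const \<beta> * l2 (\<lambda>k. kn k powr \<beta> * (kn k * u k))"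
      by (rule l(2)) (use u0 in \<open>auto simp: \<beta>_def\<close>)
    also have "\<dots> \<le> lattice_const \<beta> * (R powr \<beta> * sqrt (M + 1) / \<alpha>)" by (intro mult_left_mono P) auto
    finally show "infsum (\<lambda>k. kn k * u k) UNIV \<le> lattice_const \<beta> * (R powr \<beta> * sqrt (M + 1) / \<alpha>)" .
  qed
  note com = sobolev_commutator_sum[OF u0(2,1) S(1) s(1)]
  have "\<bar>trilinear (vfield \<alpha> b) (vfield \<alpha> b) (\<lambda>k. (kn k ^ Suc n)^2 *\<^sub>R vfield \<alpha> b k)\<bar>
      \<le> 2 * (real (Suc n) * 2 ^ n) * infsum (\<lambda>k. kn k * u k) UNIV * (l2 (\<lambda>k. kn k ^ Suc n * u k))^2"
    by (rule order_trans[OF trilinear_support_bound[OF \<alpha> supp] com(2)[unfolded u_def], folded u_def])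
       (use com(1) in \<open>auto simp: u_def simp del: power_Suc\<close>)
  also have "\<dots> \<le> 2 * (real (Suc n) * 2 ^ n) * (lattice_const \<beta> * (R powr \<beta> * sqrt (M + 1) / \<alpha>)) * (R ^ (2 * n) * (M + 1) / \<alpha>^2)"
    using M0 \<alpha> by (intro mult_mono mult_left_mono S(2) H) (auto intro!: infsum_nonneg mult_nonneg_nonneg u0)
  finally have "2 * \<bar>trilinear (vfield \<alpha> b) (vfield \<alpha> b) (\<lambda>k. (kn k ^ Suc n)^2 *\<^sub>R vfield \<alpha> b k)\<bar>
      \<le> 2 * (2 * (real (Suc n) * 2 ^ n) * (lattice_const \<beta> * (R powr \<beta> * sqrt (M + 1) / \<alpha>)) * (R ^ (2 * n) * (M + 1) / \<alpha>^2))"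
    by (rule mult_left_mono) simp
  also have "\<dots> = growth_slope \<alpha> n M * (R powr \<beta> * R ^ (2 * n))"
  proof -
    have "sqrt (M + 1) ^ 3 = sqrt (M + 1) * (M + 1)" using M0 by (simp add: power3_eq_cube)
    moreover have "\<alpha> ^ 3 = \<alpha> * \<alpha>^2" by (simp add: power3_eq_cube power2_eq_square)
    ultimately show ?thesis unfolding growth_slope_def \<beta>_def using \<alpha> by (simp only:) (simp add: field_simps)
  qed
  also have "R powr \<beta> * R ^ (2 * n) = Z powr (1 - growth_rate (Suc n))"
  proof -
    have "R powr \<beta> * R ^ (2 * n) = R powr \<beta> * R powr real (2 * n)" using R by (subst powr_realpow) auto
    also have "\<dots> = Z powr ((1 / (2 * real (Suc n))) * (\<beta> + real (2 * n)))"
      unfolding powr_add[symmetric] R_def powr_powr by (simp only: distrib_left)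
    also have "(1 / (2 * real (Suc n))) * (\<beta> + real (2 * n)) = 1 - growth_rate (Suc n)"
      by (simp add: growth_rate_def \<beta>_def field_simps)
    finally show ?thesis .
  qed
  finally show ?thesis .
qed

definition growth_const :: "real \<Rightarrow> nat \<Rightarrow> real \<Rightarrow> real" where
  "growth_const \<alpha> n M = (1 / \<alpha>) *
    ((1 + M) powr growth_rate (Suc n) + growth_rate (Suc n) * growth_slope \<alpha> n M) powr (1 / (2 * growth_rate (Suc n)))"

text \<open>The differential inequality \<open>\<bar>Z'\<bar> \<le> K Z\<^bsup>1-\<gamma>\<^esup>\<close>
  makes \<open>Z\<^sup>\<gamma>\<close> grow at most linearly. The velocity has one derivative
  more than its phase space element, which raises the Sobolev exponent from \<open>n + 1\<close> to
  \<open>n + 2\<close> for the velocity.\<close>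

lemma galerkin_growth:
  assumes \<alpha>: "0 < \<alpha>" and n: "2 \<le> n" and flow: "quadratic_flow (galerkin_op \<alpha> N) b"
    and b0: "b 0 = galerkin N c" and M: "(norm c)^2 \<le> M"
    and ss: "is_l2 (\<lambda>k. kn k ^ Suc n * norm (coeffs c k))" and Ms: "(l2 (\<lambda>k. kn k ^ Suc n * norm (coeffs c k)))^2 \<le> M"
    and t: "0 \<le> t"
  shows "gnorm (Suc (Suc n)) 0 (\<lambda>k. norm (vfield \<alpha> (b t) k)) \<le> growth_const \<alpha> n M * (1 + t) powr (13 * real (Suc n) / 6)"
proof -
  define \<gamma> where "\<gamma> = growth_rate (Suc n)"
  define K where "K = growth_slope \<alpha> n M"
  have M0: "0 \<le> M" using M zero_le_power2[of "norm c"] by linarith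
  have \<gamma>: "0 < \<gamma>" by (simp add: \<gamma>_def growth_rate_def)
  have K: "0 \<le> K" using \<alpha> M0 by (simp add: K_def growth_slope_def)
  have supp: "galerkin N (b s) = b s" for s
    by (rule galerkin_flow_support[OF \<alpha> flow]) (simp add: b0 galerkin_linear)
  have nb: "(norm (b s))^2 \<le> M" for s
  proof -
    have "norm (b s) = norm (b 0)"
      by (rule quadratic_flow_norm[OF flow galerkin_op_conservative[OF \<alpha>]])
    also have "\<dots> \<le> norm c" unfolding b0 by (rule norm_galerkin_le)
    finally show ?thesis using M by (meson norm_ge_zero order_trans power_mono)
  qed
  define Z where "Z s = 1 + wenergy N (\<lambda>k. kn k ^ Suc n) (b s)" for s
  have Z1: "1 \<le> Z s" for s unfolding Z_def using wenergy_nonneg by simp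
  define T where "T s = trilinear (vfield \<alpha> (b s)) (vfield \<alpha> (b s)) (\<lambda>k. (kn k ^ Suc n)^2 *\<^sub>R vfield \<alpha> (b s) k)" for s
  have dZ: "(Z has_real_derivative - 2 * T s) (at s)" for s
  proof -
    have "((\<lambda>s. wenergy N (\<lambda>k. kn k ^ Suc n) (b s)) has_real_derivative
      2 * (\<Sum>k\<in>cube N. kn k ^ Suc n * 0 * (norm (coeffs (b s) k))^2)
      + 2 * (\<Sum>k\<in>cube N. (kn k ^ Suc n)^2 * (coeffs (b s) k \<bullet> coeffs (galerkin_op \<alpha> N (b s) (b s)) k))) (at s)"
      using flow unfolding quadratic_flow_def by (intro wenergy_has_derivative) auto
    also have "(\<Sum>k\<in>cube N. (kn k ^ Suc n)^2 * (coeffs (b s) k \<bullet> coeffs (galerkin_op \<alpha> N (b s) (b s)) k)) = - T s"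
      unfolding T_def by (rule weighted_galerkin_identity[OF \<alpha> supp]) simp
    finally show ?thesis unfolding Z_def by (auto intro!: derivative_eq_intros)
  qed
  define f where "f s = Z s powr \<gamma> - \<gamma> * K * s" for s
  have "f t \<le> f 0"
  proof (rule DERIV_nonpos_imp_nonincreasing[OF t])
    fix s assume "0 \<le> s" "s \<le> t"
    have Zs: "0 < Z s" using Z1[of s] by linarith
    have "(f has_real_derivative \<gamma> * Z s powr (\<gamma> - 1) * (- 2 * T s) - \<gamma> * K) (at s)"
      unfolding f_def using dZ[of s] Zs by (auto intro!: derivative_eq_intros)
    moreover have "\<gamma> * Z s powr (\<gamma> - 1) * (- 2 * T s) \<le> \<gamma> * K"
    proof -
      have "- 2 * T s \<le> 2 * \<bar>T s\<bar>" by linarith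
      also have "\<dots> \<le> K * Z s powr (1 - \<gamma>)"
        unfolding T_def K_def \<gamma>_def Z_def by (rule galerkin_growth_rate[OF \<alpha> supp n nb])
      finally have "\<gamma> * Z s powr (\<gamma> - 1) * (- 2 * T s) \<le> \<gamma> * Z s powr (\<gamma> - 1) * (K * Z s powr (1 - \<gamma>))"
        using \<gamma> by (intro mult_left_mono) auto
      also have "\<dots> = \<gamma> * K * (Z s powr (\<gamma> - 1) * Z s powr (1 - \<gamma>))" by simp
      also have "\<dots> = \<gamma> * K" using Zs by (simp add: powr_add[symmetric])
      finally show ?thesis .
    qed
    ultimately show "\<exists>y. (f has_real_derivative y) (at s) \<and> y \<le> 0"
      by (intro exI[of _ "\<gamma> * Z s powr (\<gamma> - 1) * (- 2 * T s) - \<gamma> * K"]) auto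
  qed
  then have "Z t powr \<gamma> \<le> Z 0 powr \<gamma> + \<gamma> * K * t" by (simp add: f_def)
  also have "\<dots> \<le> (1 + M) powr \<gamma> + \<gamma> * K * t"
  proof -
    have "wenergy N (\<lambda>k. kn k ^ Suc n) (b 0) = (\<Sum>k\<in>cube N. (kn k ^ Suc n * norm (coeffs c k))^2)"
      unfolding wenergy_def b0 coeffs_galerkin by (intro sum.cong) (auto simp: power_mult_distrib)
    also have "\<dots> \<le> M" using sum_squares_le_l2[OF ss finite_cube[of N]] Ms by linarith
    finally have "Z 0 \<le> 1 + M" by (simp add: Z_def)
    then show ?thesis using Z1[of 0] \<gamma> by (intro add_right_mono powr_mono2) auto
  qed
  also have "\<dots> \<le> ((1 + M) powr \<gamma> + \<gamma> * K) * (1 + t)"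
  proof -
    have "0 \<le> (1 + M) powr \<gamma> * t + \<gamma> * K" using t \<gamma> K by (intro add_nonneg_nonneg mult_nonneg_nonneg) auto
    then show ?thesis by (simp add: algebra_simps)
  qed
  finally have "(Z t powr \<gamma>) powr (1 / (2 * \<gamma>)) \<le> (((1 + M) powr \<gamma> + \<gamma> * K) * (1 + t)) powr (1 / (2 * \<gamma>))"
    using \<gamma> by (intro powr_mono2) auto
  moreover have "(Z t powr \<gamma>) powr (1 / (2 * \<gamma>)) = sqrt (Z t)"
    using \<gamma> Z1[of t] by (simp add: powr_powr powr_half_sqrt)
  moreover have "(((1 + M) powr \<gamma> + \<gamma> * K) * (1 + t)) powr (1 / (2 * \<gamma>))
      = ((1 + M) powr \<gamma> + \<gamma> * K) powr (1 / (2 * \<gamma>)) * (1 + t) powr (13 * real (Suc n) / 6)"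
  proof -
    have "1 / (2 * \<gamma>) = 13 * real (Suc n) / 6" by (simp add: \<gamma>_def growth_rate_def)
    then show ?thesis using \<gamma> K t by (simp only:) (simp add: powr_mult)
  qed
  ultimately have Zt: "sqrt (Z t) \<le> ((1 + M) powr \<gamma> + \<gamma> * K) powr (1 / (2 * \<gamma>)) * (1 + t) powr (13 * real (Suc n) / 6)"
    by simp
  have "(gnorm (Suc (Suc n)) 0 (\<lambda>k. norm (vfield \<alpha> (b t) k)))^2 = (\<Sum>k\<in>cube N. (kn k ^ Suc (Suc n) * norm (vfield \<alpha> (b t) k))^2)"
    unfolding gnorm_def
    by (subst finite_support_is_l2(2)[OF finite_cube[of N]]) (use support_outside[OF \<alpha> supp] in auto)
  also have "\<dots> \<le> (\<Sum>k\<in>cube N. (kn k ^ Suc n)^2 * (norm (coeffs (b t) k))^2 / \<alpha>^2)"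
  proof (rule sum_mono)
    fix k
    have "kn k * norm (vfield \<alpha> (b t) k) \<le> norm (coeffs (b t) k) / \<alpha>"
      using mult_right_mono[OF kn_le_vweight[OF \<alpha>, of k], of "norm (vfield \<alpha> (b t) k)"] by (simp add: norm_vfield)
    then have "kn k ^ Suc n * (kn k * norm (vfield \<alpha> (b t) k)) \<le> kn k ^ Suc n * (norm (coeffs (b t) k) / \<alpha>)"
      by (rule mult_left_mono) simp
    then have "(kn k ^ Suc n * (kn k * norm (vfield \<alpha> (b t) k)))^2 \<le> (kn k ^ Suc n * (norm (coeffs (b t) k) / \<alpha>))^2"
      by (rule power_mono) simp
    then show "(kn k ^ Suc (Suc n) * norm (vfield \<alpha> (b t) k))^2 \<le> (kn k ^ Suc n)^2 * (norm (coeffs (b t) k))^2 / \<alpha>^2"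
      by (simp add: power_mult_distrib power_divide mult_ac)
  qed
  also have "\<dots> = wenergy N (\<lambda>k. kn k ^ Suc n) (b t) / \<alpha>^2" by (simp add: wenergy_def sum_divide_distrib del: power_Suc)
  also have "\<dots> \<le> Z t / \<alpha>^2" by (intro divide_right_mono) (auto simp: Z_def)
  also have "\<dots> = (sqrt (Z t) / \<alpha>)^2" using Z1[of t] by (simp add: power_divide)
  finally have "gnorm (Suc (Suc n)) 0 (\<lambda>k. norm (vfield \<alpha> (b t) k)) \<le> sqrt (Z t) / \<alpha>"
    by (rule power2_le_imp_le) (use Z1[of t] \<alpha> in auto)
  also have "\<dots> \<le> ((1 + M) powr \<gamma> + \<gamma> * K) powr (1 / (2 * \<gamma>)) * (1 + t) powr (13 * real (Suc n) / 6) / \<alpha>"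
    using Zt \<alpha> by (intro divide_right_mono) auto
  finally show ?thesis by (simp add: growth_const_def \<gamma>_def K_def)
qed

subsection \<open>Gevrey estimates with shrinking radius\<close>

lemma primitive_nonneg_eq: "0 \<le> t \<Longrightarrow> primitive f t = integral {0..t} f"
  by (cases "t = 0") (auto simp: primitive_def)

lemma primitive_nonneg:
  fixes f :: "real \<Rightarrow> real"
  assumes "0 \<le> t" "\<And>s. 0 \<le> f s"
  shows "0 \<le> primitive f t"
proof (cases "f integrable_on {0..t}")
  case True
  then show ?thesis unfolding primitive_nonneg_eq[OF assms(1)]
    using assms by (intro Henstock_Kurzweil_Integration.integral_nonneg) auto
qed (simp add: primitive_nonneg_eq[OF assms(1)] not_integrable_integral)

text \<open>At the last time with \<open>f \<le> 0\<close> continuity gives \<open>f \<le> 1\<close> for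
  a little longer, so \<open>f\<close> cannot increase there and stays nonpositive, a
  contradiction.\<close>

lemma bootstrap_nonpos:
  fixes f :: "real \<Rightarrow> real"
  assumes d: "\<And>t. (f has_real_derivative f' t) (at t)" and f0: "f 0 \<le> 0"
    and le: "\<And>t. 0 \<le> t \<Longrightarrow> f t \<le> 1 \<Longrightarrow> f' t \<le> 0" and t: "0 \<le> t"
  shows "f t \<le> 0"
proof (rule ccontr)
  assume "\<not> f t \<le> 0"
  then have ft: "f t > 0" by simp
  have cont: "isCont f s" for s using d DERIV_isCont by blast
  define S where "S = {s \<in> {0..t}. f s \<le> 0}"
  have "compact S"
  proof -
    have "closed ({0..t} \<inter> f -` {..0})"
      using cont by (intro continuous_closed_preimage continuous_at_imp_continuous_on) auto
    moreover have "S = {0..t} \<inter> f -` {..0}" by (auto simp: S_def)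
    ultimately show ?thesis by (simp add: compact_eq_bounded_closed bounded_Int)
  qed
  moreover have "S \<noteq> {}" using f0 t by (auto simp: S_def)
  ultimately obtain t0 where t0: "t0 \<in> S" "\<And>s. s \<in> S \<Longrightarrow> s \<le> t0"
    using compact_attains_sup by metis
  have t0': "0 \<le> t0" "f t0 \<le> 0" "t0 < t" using t0 ft by (auto simp: S_def less_le)
  obtain \<delta> where \<delta>: "\<delta> > 0" "\<And>s. dist s t0 < \<delta> \<Longrightarrow> dist (f s) (f t0) < 1"
    using cont[of t0] unfolding continuous_at_eps_delta by (metis zero_less_one dist_commute)
  define t2 where "t2 = min t (t0 + \<delta> / 2)"
  have t2: "t0 < t2" "t2 \<le> t" "t2 - t0 < \<delta>" using t0' \<delta> by (auto simp: t2_def)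
  have "f t2 \<le> f t0"
  proof (rule DERIV_nonpos_imp_nonincreasing[where f = f and a = t0 and b = t2])
    show "t0 \<le> t2" using t2 by simp
    fix s assume s: "t0 \<le> s" "s \<le> t2"
    have "dist (f s) (f t0) < 1" using s t2 by (intro \<delta>(2)) (auto simp: dist_real_def)
    then have "f s \<le> 1" using t0' by (auto simp: dist_real_def)
    with s t0' have "f' s \<le> 0" by (intro le) auto
    with d[of s] show "\<exists>y. (f has_real_derivative y) (at s) \<and> y \<le> 0" by blast
  qed
  then have "t2 \<in> S" using t0' t2 by (auto simp: S_def)
  with t0(2)[of t2] t2 show False by simp
qed

definition commutator_const1 :: "nat \<Rightarrow> real" where
  "commutator_const1 r = 2 * (commutator_const r * lattice_const (5/2)) + 1"

text \<open>For a single field the two terms of the commutator estimate coincide, which turns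
  \<open>4\<close> into \<open>8\<close>. The summand 1 makes the constant positive.\<close>

definition commutator_const2 :: "nat \<Rightarrow> real" where
  "commutator_const2 r = 8 * (commutator_const r * lattice_const (5/2)) + 1"

definition gevrey_budget :: "nat \<Rightarrow> (real \<Rightarrow> real) \<Rightarrow> real \<Rightarrow> real \<Rightarrow> real" where
  "gevrey_budget r \<kappa> E0 t = E0 + 2 * commutator_const1 r * primitive (\<lambda>s. \<kappa> s ^ 3) t"

text \<open>With these parameters, \<open>gevrey_budget\<close> is the right side of the energy
  inequality and the radius solves \<open>\<tau>' = - c\<^sub>2 h \<tau>\<close>, where
  \<open>h\<^sup>2\<close> is 1 plus the budget.\<close>

definition gevrey_radius :: "nat \<Rightarrow> (real \<Rightarrow> real) \<Rightarrow> real \<Rightarrow> real \<Rightarrow> real \<Rightarrow> real" where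
  "gevrey_radius r \<kappa> \<sigma> E0 t = \<sigma> * exp (- commutator_const2 r * primitive (\<lambda>s. sqrt (1 + gevrey_budget r \<kappa> E0 s)) t)"

lemma commutator_consts:
  "0 \<le> commutator_const r * lattice_const (5/2)" "0 < commutator_const1 r" "0 < commutator_const2 r"
proof -
  show "0 \<le> commutator_const r * lattice_const (5/2)" by (simp add: commutator_const_def)
  then show "0 < commutator_const1 r" "0 < commutator_const2 r"
    by (simp_all add: commutator_const1_def commutator_const2_def)
qed

text \<open>Shrinking the radius at the rate \<open>\<tau>' = - c\<^sub>2 h \<tau>\<close> produces the dissipation
  \<open>- 2 c\<^sub>2 h \<tau> \<Sum> \<bar>k\<bar> W\<^sub>k\<^sup>2 \<bar>b\<^sub>k\<bar>\<^sup>2\<close>. It absorbs the part of the commutator estimate that carries the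
  factor \<open>\<tau>\<close> as long as the Gevrey norm is below \<open>h\<close>, which the bootstrap argument guarantees.\<close>

lemma galerkin_gevrey:
  assumes \<alpha>: "0 < \<alpha>" and r: "4 \<le> r" and flow: "quadratic_flow (galerkin_op \<alpha> N) b"
    and b0: "b 0 = galerkin N c" and \<kappa>: "continuous_on UNIV \<kappa>" "\<And>s. 0 \<le> \<kappa> s"
    and bound: "\<And>s. 0 \<le> s \<Longrightarrow> gnorm r 0 (\<lambda>k. norm (vfield \<alpha> (b s) k)) \<le> \<kappa> s"
    and \<sigma>: "0 \<le> \<sigma>" and ss: "is_l2 (\<lambda>k. gevrey_weight r \<sigma> (kn k) * norm (coeffs c k))"
    and E0: "(l2 (\<lambda>k. gevrey_weight r \<sigma> (kn k) * norm (coeffs c k)))^2 \<le> E0" and t: "0 \<le> t"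
  shows "wenergy N (\<lambda>k. gevrey_weight r (gevrey_radius r \<kappa> \<sigma> E0 t) (kn k)) (b t) \<le> gevrey_budget r \<kappa> E0 t"
proof -
  define c0 where "c0 = commutator_const r * lattice_const (5/2)"
  have c0: "0 \<le> c0" unfolding c0_def by (rule commutator_consts)
  define K where "K = gevrey_budget r \<kappa> E0"
  define h where "h s = sqrt (1 + K s)" for s
  define \<tau> where "\<tau> = gevrey_radius r \<kappa> \<sigma> E0"
  define W where "W s k = gevrey_weight r (\<tau> s) (kn k)" for s k
  have E00: "0 \<le> E0" using E0 zero_le_power2 order_trans by blast
  have \<tau>0: "0 \<le> \<tau> s" for s using \<sigma> by (simp add: \<tau>_def gevrey_radius_def)
  have supp: "galerkin N (b s) = b s" for s
    by (rule galerkin_flow_support[OF \<alpha> flow]) (simp add: b0 galerkin_linear)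
  have dK: "(K has_real_derivative 2 * commutator_const1 r * \<kappa> s ^ 3) (at s)" for s
  proof -
    have "(primitive (\<lambda>s. \<kappa> s ^ 3) has_real_derivative \<kappa> s ^ 3) (at s)"
      unfolding has_real_derivative_iff_has_vector_derivative
      by (intro primitive_has_vector_derivative continuous_intros \<kappa>)
    then show ?thesis unfolding K_def gevrey_budget_def[abs_def] by (auto intro!: derivative_eq_intros)
  qed
  have K0: "0 \<le> K s" if "0 \<le> s" for s
    unfolding K_def gevrey_budget_def using E00 \<kappa>(2) commutator_consts(2)[of r] that
    by (intro add_nonneg_nonneg mult_nonneg_nonneg primitive_nonneg) auto
  have conth: "continuous_on UNIV h"
    unfolding h_def using DERIV_isCont[OF dK] by (intro continuous_intros continuous_at_imp_continuous_on) auto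
  have d\<tau>: "(\<tau> has_real_derivative - commutator_const2 r * h s * \<tau> s) (at s)" for s
  proof -
    have "(primitive h has_real_derivative h s) (at s)"
      unfolding has_real_derivative_iff_has_vector_derivative
      by (intro primitive_has_vector_derivative conth)
    then show ?thesis unfolding \<tau>_def gevrey_radius_def[abs_def] K_def[symmetric] h_def[symmetric]
      by (auto intro!: derivative_eq_intros)
  qed
  have dW: "((\<lambda>s. W s k) has_real_derivative W s k * kn k * (- commutator_const2 r * h s * \<tau> s)) (at s)" for s k
    unfolding W_def gevrey_weight_def using d\<tau>[of s] by (auto intro!: derivative_eq_intros)
  (* the dissipation that the shrinking radius produces *)
  define Y where "Y s = (\<Sum>k\<in>cube N. kn k * (W s k)^2 * (norm (coeffs (b s) k))^2)" for s
  define T where "T s = trilinear (vfield \<alpha> (b s)) (vfield \<alpha> (b s)) (\<lambda>k. (W s k)^2 *\<^sub>R vfield \<alpha> (b s) k)" for s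
  define f where "f s = wenergy N (W s) (b s) - K s" for s
  define f' where "f' s = 2 * (- commutator_const2 r * h s * \<tau> s * Y s) - 2 * T s - 2 * commutator_const1 r * \<kappa> s ^ 3" for s
  have df: "(f has_real_derivative f' s) (at s)" for s
  proof -
    have "((\<lambda>s. wenergy N (W s) (b s)) has_real_derivative
      2 * (\<Sum>k\<in>cube N. W s k * (W s k * kn k * (- commutator_const2 r * h s * \<tau> s)) * (norm (coeffs (b s) k))^2)
      + 2 * (\<Sum>k\<in>cube N. (W s k)^2 * (coeffs (b s) k \<bullet> coeffs (galerkin_op \<alpha> N (b s) (b s)) k))) (at s)"
      using flow unfolding quadratic_flow_def by (intro wenergy_has_derivative dW) auto
    also have "(\<Sum>k\<in>cube N. W s k * (W s k * kn k * (- commutator_const2 r * h s * \<tau> s)) * (norm (coeffs (b s) k))^2)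
        = - commutator_const2 r * h s * \<tau> s * Y s"
      unfolding Y_def sum_distrib_left by (intro sum.cong) (simp_all add: power2_eq_square mult_ac)
    also have "(\<Sum>k\<in>cube N. (W s k)^2 * (coeffs (b s) k \<bullet> coeffs (galerkin_op \<alpha> N (b s) (b s)) k)) = - T s"
      unfolding T_def by (rule weighted_galerkin_identity[OF \<alpha> supp]) (simp add: W_def)
    finally show ?thesis unfolding f_def[abs_def] f'_def
      using dK[of s] by (auto intro!: derivative_eq_intros)
  qed
  have "f t \<le> 0"
  proof (rule bootstrap_nonpos[OF df _ _ t])
    have "wenergy N (W 0) (b 0) = (\<Sum>k\<in>cube N. (gevrey_weight r \<sigma> (kn k) * norm (coeffs c k))^2)"
      unfolding wenergy_def W_def b0 coeffs_galerkin
      by (intro sum.cong) (auto simp: power_mult_distrib \<tau>_def gevrey_radius_def)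
    also have "\<dots> \<le> E0" using sum_squares_le_l2[OF ss finite_cube[of N]] E0 by linarith
    finally show "f 0 \<le> 0" by (simp add: f_def K_def gevrey_budget_def)
  next
    (* The bound f s <= 1 keeps the Gevrey norm below h s; the summand 1 in the square of h makes room for it. *)
    fix s :: real assume s: "0 \<le> s" and fs: "f s \<le> 1"
    define u where "u k = norm (vfield \<alpha> (b s) k)" for k
    have u0: "u 0 = 0" "\<And>k. 0 \<le> u k"
      using solenoidal_seqD(1)[OF solenoidal_vfield[of \<alpha> "b s"]] by (auto simp: u_def)
    have out: "u k = 0" if "k \<notin> cube N" for k
      using support_outside[OF \<alpha> supp[of s]] that by (simp add: u_def)
    have ub: "(u k)^2 \<le> (norm (coeffs (b s) k))^2" for k
    proof -
      have "1 * u k \<le> vweight \<alpha> k * u k" using u0(2) by (intro mult_right_mono vweight_ge_1) auto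
      then show ?thesis using u0(2)[of k] by (intro power_mono) (auto simp: u_def norm_vfield)
    qed
    define G H where "G = gnorm r (\<tau> s) u" and "H = gnorm_half r (\<tau> s) u"
    have hs: "0 \<le> h s" "(h s)^2 = 1 + K s" using K0[OF s] by (auto simp: h_def)
    have "G^2 = (\<Sum>k\<in>cube N. (kn k ^ r * exp (\<tau> s * kn k) * u k)^2)"
      unfolding G_def gnorm_def by (rule finite_support_is_l2(2)[OF finite_cube]) (use out in auto)
    also have "\<dots> \<le> wenergy N (W s) (b s)"
      unfolding wenergy_def W_def gevrey_weight_def by (subst power_mult_distrib) (intro sum_mono mult_left_mono ub zero_le_power2)
    also have "\<dots> \<le> (h s)^2" using fs by (simp add: hs f_def)
    finally have G: "G \<le> h s" using hs by (rule_tac power2_le_imp_le)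
    have "H^2 = (\<Sum>k\<in>cube N. (kn k ^ r * sqrt (kn k) * exp (\<tau> s * kn k) * u k)^2)"
      unfolding H_def gnorm_half_def by (rule finite_support_is_l2(2)[OF finite_cube]) (use out in auto)
    also have "\<dots> = (\<Sum>k\<in>cube N. kn k * (W s k)^2 * (u k)^2)"
      by (intro sum.cong) (simp_all add: W_def gevrey_weight_def power_mult_distrib)
    also have "\<dots> \<le> Y s" unfolding Y_def by (intro sum_mono mult_left_mono ub) auto
    finally have HY: "H^2 \<le> Y s" .
    have sH: "is_l2 (\<lambda>k. kn k ^ r * sqrt (kn k) * exp (\<tau> s * kn k) * u k)"
      by (rule finite_support_is_l2(1)[OF finite_cube[of N]]) (use out in auto)
    note com = gevrey_commutator_sum[OF u0(2,1) u0(2,1) r \<tau>0 sH sH, folded c0_def]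
    have "\<bar>T s\<bar> \<le> (2 * c0) * gnorm r 0 u * (gnorm r 0 u)^2 + \<tau> s * (4 * c0) * (G * H^2 + H * G * H)"
    proof -
      define F where "F = (\<lambda>(k, j). u j * (kn (k - j) * u (k - j)) * u k * (W s k * \<bar>W s k - W s (k - j)\<bar>))"
      have Fs: "F summable_on UNIV"
        using com(1) by (simp add: F_def W_def)
      have "\<bar>T s\<bar> \<le> infsum F UNIV"
        unfolding T_def F_def u_def
        by (rule trilinear_support_bound[OF \<alpha> supp])
           (use Fs in \<open>simp_all add: F_def u_def, simp_all add: W_def gevrey_weight_def\<close>)
      also have "\<dots> \<le> (2 * c0) * gnorm r 0 u * (gnorm r 0 u)^2 + \<tau> s * (4 * c0) * (G * H^2 + H * G * H)"
        using com(2) by (simp add: F_def W_def G_def H_def)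
      finally show ?thesis .
    qed
    also have "\<dots> \<le> (2 * c0) * \<kappa> s ^ 3 + \<tau> s * (8 * c0) * (h s * Y s)"
    proof (rule add_mono)
      have "gnorm r 0 u ^ 3 \<le> \<kappa> s ^ 3"
        using bound[OF s] by (intro power_mono) (auto simp: u_def gnorm_def)
      then have "(2 * c0) * gnorm r 0 u ^ 3 \<le> (2 * c0) * \<kappa> s ^ 3" using c0 by (intro mult_left_mono) auto
      then show "(2 * c0) * gnorm r 0 u * (gnorm r 0 u)^2 \<le> (2 * c0) * \<kappa> s ^ 3"
        by (simp add: power3_eq_cube power2_eq_square mult.assoc)
      have "G * H^2 \<le> h s * Y s" using G HY hs by (intro mult_mono) auto
      then have "\<tau> s * (8 * c0) * (G * H^2) \<le> \<tau> s * (8 * c0) * (h s * Y s)"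
        using c0 \<tau>0 by (intro mult_left_mono) auto
      then show "\<tau> s * (4 * c0) * (G * H^2 + H * G * H) \<le> \<tau> s * (8 * c0) * (h s * Y s)"
        by (simp add: power2_eq_square algebra_simps)
    qed
    finally have "- T s \<le> (2 * c0) * \<kappa> s ^ 3 + \<tau> s * (8 * c0) * (h s * Y s)" by linarith
    moreover have lin: "A - 2 * x - D \<le> A + 2 * B - D" if "- x \<le> B" for A B D x :: real
      using that by linarith
    ultimately have "f' s \<le> 2 * (- commutator_const2 r * h s * \<tau> s * Y s) + 2 * ((2 * c0) * \<kappa> s ^ 3 + \<tau> s * (8 * c0) * (h s * Y s))
        - 2 * commutator_const1 r * \<kappa> s ^ 3"
      unfolding f'_def using lin by blast
    also have "\<dots> = - 2 * (h s * \<tau> s * Y s) - 2 * \<kappa> s ^ 3"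
      by (simp add: commutator_const1_def commutator_const2_def c0_def[symmetric] algebra_simps)
    also have "\<dots> \<le> 0"
    proof -
      have "0 \<le> Y s" unfolding Y_def by (intro sum_nonneg) auto
      then have "0 \<le> h s * \<tau> s * Y s" "0 \<le> \<kappa> s ^ 3" using hs \<tau>0 \<kappa>(2) by auto
      then show ?thesis by linarith
    qed
    finally show "f' s \<le> 0" .
  qed
  then show ?thesis by (simp add: f_def K_def W_def[abs_def] \<tau>_def)
qed

subsection \<open>Passage to the limit\<close>

text \<open>There is equality for \<open>m = 0\<close>, and the right side grows faster.\<close>

lemma growth_exponent_le: "13 * real (m + 3) / 6 \<le> 5 * (3/2) ^ (m + 1) - (1::real)"
proof (induction m)
  case (Suc m)
  define P :: real where "P = 5 * (3/2) ^ (m + 1) - 1"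
  have "(5::real) * (3/2) ^ (Suc m + 1) - 1 = 3/2 * P + 1/2" by (simp add: P_def field_simps)
  moreover have "13 * real (m + 3) / 6 \<le> P" using Suc by (simp add: P_def)
  ultimately show ?case by simp
qed simp

definition bound_const :: "real \<Rightarrow> nat \<Rightarrow> real \<Rightarrow> real" where
  "bound_const \<alpha> r M = 1 + growth_const \<alpha> (r - 2) M"

definition bound_exponent :: "nat \<Rightarrow> real" where
  "bound_exponent r = 5 * (3/2) ^ (r - 3) - 1"

lemma growth_const_nonneg: "0 < \<alpha> \<Longrightarrow> 0 \<le> growth_const \<alpha> n M"
  by (simp add: growth_const_def)

lemma bound_const_pos: "0 < \<alpha> \<Longrightarrow> 0 < bound_const \<alpha> r M"
  using growth_const_nonneg[of \<alpha> "r - 2" M] by (simp add: bound_const_def)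

text \<open>The bounds for Galerkin solutions do not depend on the truncation. On each finite set of
  frequencies they pass to the limit, because the Galerkin solutions converge in the phase space.\<close>

lemma voigt_flow_estimates_forward:
  assumes \<alpha>: "0 < \<alpha>" and r: "4 \<le> r" and flow: "quadratic_flow (voigt_op \<alpha>) b"
    and M: "(norm (b 0))^2 \<le> M"
    and sM: "is_l2 (\<lambda>k. kn k ^ (r - 1) * norm (coeffs (b 0) k))"
    and Ms: "(l2 (\<lambda>k. kn k ^ (r - 1) * norm (coeffs (b 0) k)))^2 \<le> M"
    and \<sigma>: "0 \<le> \<sigma>" and ss: "is_l2 (\<lambda>k. gevrey_weight r \<sigma> (kn k) * norm (coeffs (b 0) k))"
    and E0: "(l2 (\<lambda>k. gevrey_weight r \<sigma> (kn k) * norm (coeffs (b 0) k)))^2 = E0" and t: "0 \<le> t"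
  defines "\<kappa> \<equiv> \<lambda>\<xi>. bound_const \<alpha> r M * (1 + \<bar>\<xi>\<bar>) powr bound_exponent r"
  shows "l2 (\<lambda>k. kn k ^ r * norm (vfield \<alpha> (b t) k)) \<le> \<kappa> t"
    "is_l2 (\<lambda>k. gevrey_weight r (gevrey_radius r \<kappa> \<sigma> E0 t) (kn k) * norm (coeffs (b t) k))"
    "(l2 (\<lambda>k. gevrey_weight r (gevrey_radius r \<kappa> \<sigma> E0 t) (kn k) * norm (coeffs (b t) k)))^2 \<le> gevrey_budget r \<kappa> E0 t"
proof -
  have "\<exists>u. quadratic_flow (galerkin_op \<alpha> N) u \<and> u 0 = galerkin N (b 0)" for N
    using quadratic_flow_exists[OF bounded_bilinear_galerkin_op[OF \<alpha>, of N] galerkin_op_conservative[OF \<alpha>, of _ N]] by blast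
  then obtain g where g: "\<And>N. quadratic_flow (galerkin_op \<alpha> N) (g N)" "\<And>N. g N 0 = galerkin N (b 0)" by metis
  have lim: "(\<lambda>N. g N t) \<longlonglongrightarrow> b t"
  proof (rule quadratic_flow_limit[OF _ _ _ _ _ _ _ flow g(1) _ t])
    show "bounded_bilinear (voigt_op \<alpha>)" by (rule bounded_bilinear_voigt_op[OF \<alpha>])
    show "\<And>x. x \<bullet> voigt_op \<alpha> x x = 0" by (rule voigt_op_conservative[OF \<alpha>])
    show "norm (voigt_op \<alpha> a c) \<le> tconst \<alpha> / \<alpha> * norm a * norm c" for a c by (rule norm_voigt_op_le[OF \<alpha>])
    show "bounded_bilinear (galerkin_op \<alpha> N)" for N by (rule bounded_bilinear_galerkin_op[OF \<alpha>])
    show "x \<bullet> galerkin_op \<alpha> N x x = 0" for N x by (rule galerkin_op_conservative[OF \<alpha>])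
    show "norm (galerkin_op \<alpha> N a c) \<le> tconst \<alpha> / \<alpha> * norm a * norm c" for N a c by (rule norm_galerkin_op_le[OF \<alpha>])
    show "(\<lambda>N. galerkin_op \<alpha> N x x) \<longlonglongrightarrow> voigt_op \<alpha> x x" for x by (rule galerkin_op_LIMSEQ[OF \<alpha>])
    show "(\<lambda>N. g N 0) \<longlonglongrightarrow> b 0" unfolding g by (rule galerkin_LIMSEQ)
  qed
  have limk: "(\<lambda>N. coeffs (g N t) k) \<longlonglongrightarrow> coeffs (b t) k" for k
    by (rule bounded_linear.tendsto[OF bounded_linear_coeffs lim])
  have limv: "(\<lambda>N. vfield \<alpha> (g N t) k) \<longlonglongrightarrow> vfield \<alpha> (b t) k" for k
    unfolding vfield_def by (intro tendsto_intros limk)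
  obtain m where m: "r = m + 4" using r by (metis add.commute le_Suc_ex)
  have rm: "r - 1 = Suc (m + 2)" by (simp add: m)
  have \<kappa>0: "0 \<le> \<kappa> s" for s using bound_const_pos[OF \<alpha>, of r M] by (simp add: \<kappa>_def)
  have \<kappa>c: "continuous_on UNIV \<kappa>"
    unfolding \<kappa>_def by (intro continuous_intros) auto
  have growth: "gnorm r 0 (\<lambda>k. norm (vfield \<alpha> (g N s) k)) \<le> \<kappa> s" if s: "0 \<le> s" for N s
  proof -
    have "gnorm (Suc (Suc (m + 2))) 0 (\<lambda>k. norm (vfield \<alpha> (g N s) k))
        \<le> growth_const \<alpha> (m + 2) M * (1 + s) powr (13 * real (Suc (m + 2)) / 6)"
      by (rule galerkin_growth[OF \<alpha> _ g M _ _ s]) (use sM[unfolded rm] Ms[unfolded rm] in \<open>simp_all del: power_Suc add_2_eq_Suc'\<close>)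
    also have "\<dots> \<le> bound_const \<alpha> r M * (1 + s) powr bound_exponent r"
    proof (intro mult_mono powr_mono)
      show "growth_const \<alpha> (m + 2) M \<le> bound_const \<alpha> r M" by (simp add: bound_const_def m)
      show "13 * real (Suc (m + 2)) / 6 \<le> bound_exponent r"
        using growth_exponent_le[of m] by (simp add: bound_exponent_def m)
    qed (use s bound_const_pos[OF \<alpha>, of r M] in \<open>auto simp: less_imp_le\<close>)
    also have "Suc (Suc (m + 2)) = r" by (simp add: m)
    finally show ?thesis using s by (simp add: \<kappa>_def)
  qed
  have suppg: "galerkin N (g N s) = g N s" for N s
    by (rule galerkin_flow_support[OF \<alpha> g(1)]) (simp add: g galerkin_linear)
  have A: "(\<Sum>k\<in>F. (kn k ^ r * norm (vfield \<alpha> (b t) k))^2) \<le> (\<kappa> t)^2" if F: "finite F" for F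
  proof (rule LIMSEQ_le_const2)
    show "(\<lambda>N. \<Sum>k\<in>F. (kn k ^ r * norm (vfield \<alpha> (g N t) k))^2) \<longlonglongrightarrow> (\<Sum>k\<in>F. (kn k ^ r * norm (vfield \<alpha> (b t) k))^2)"
      by (intro tendsto_intros limv)
    have "(\<Sum>k\<in>F. (kn k ^ r * norm (vfield \<alpha> (g N t) k))^2) \<le> (\<kappa> t)^2" for N
    proof -
      have "is_l2 (\<lambda>k. kn k ^ r * norm (vfield \<alpha> (g N t) k))"
        by (rule finite_support_is_l2(1)[OF finite_cube[of N]]) (use support_outside[OF \<alpha> suppg] in auto)
      from sum_squares_le_l2[OF this F]
      have "(\<Sum>k\<in>F. (kn k ^ r * norm (vfield \<alpha> (g N t) k))^2) \<le> (gnorm r 0 (\<lambda>k. norm (vfield \<alpha> (g N t) k)))^2"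
        by (simp add: gnorm_def)
      also have "\<dots> \<le> (\<kappa> t)^2" using growth[OF t] by (intro power_mono) (auto simp: gnorm_def)
      finally show ?thesis .
    qed
    then show "\<exists>n0. \<forall>N\<ge>n0. (\<Sum>k\<in>F. (kn k ^ r * norm (vfield \<alpha> (g N t) k))^2) \<le> (\<kappa> t)^2" by blast
  qed
  show "l2 (\<lambda>k. kn k ^ r * norm (vfield \<alpha> (b t) k)) \<le> \<kappa> t" by (rule is_l2I(2)[OF A \<kappa>0])
  define W where "W k = gevrey_weight r (gevrey_radius r \<kappa> \<sigma> E0 t) (kn k)" for k
  define K where "K = gevrey_budget r \<kappa> E0 t"
  have wen: "wenergy N W (g N t) \<le> K" for N
    unfolding W_def K_def
    by (rule galerkin_gevrey[OF \<alpha> r g \<kappa>c \<kappa>0 growth \<sigma> ss _ t]) (simp_all add: E0)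
  have K0: "0 \<le> K" using order_trans[OF wenergy_nonneg wen] .
  have B: "(\<Sum>k\<in>F. (W k * norm (coeffs (b t) k))^2) \<le> (sqrt K)^2" if F: "finite F" for F
  proof (rule LIMSEQ_le_const2)
    show "(\<lambda>N. \<Sum>k\<in>F. (W k * norm (coeffs (g N t) k))^2) \<longlonglongrightarrow> (\<Sum>k\<in>F. (W k * norm (coeffs (b t) k))^2)"
      by (intro tendsto_intros limk)
    have "(\<Sum>k\<in>F. (W k * norm (coeffs (g N t) k))^2) \<le> (sqrt K)^2" for N
    proof -
      note f = finite_support_is_l2[OF finite_cube[of N], of "\<lambda>k. W k * norm (coeffs (g N t) k)"]
      have "(\<Sum>k\<in>F. (W k * norm (coeffs (g N t) k))^2) \<le> (l2 (\<lambda>k. W k * norm (coeffs (g N t) k)))^2"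
        by (rule sum_squares_le_l2[OF f(1) F]) (use support_outside[OF \<alpha> suppg] in auto)
      also have "\<dots> = wenergy N W (g N t)"
        by (subst f(2)) (use support_outside[OF \<alpha> suppg] in \<open>auto simp: wenergy_def power_mult_distrib\<close>)
      finally show ?thesis using wen[of N] K0 by simp
    qed
    then show "\<exists>n0. \<forall>N\<ge>n0. (\<Sum>k\<in>F. (W k * norm (coeffs (g N t) k))^2) \<le> (sqrt K)^2" by blast
  qed
  have "is_l2 (\<lambda>k. W k * norm (coeffs (b t) k))" "l2 (\<lambda>k. W k * norm (coeffs (b t) k)) \<le> sqrt K"
    using is_l2I[OF B] K0 by auto
  moreover have "(l2 (\<lambda>k. W k * norm (coeffs (b t) k)))^2 \<le> (sqrt K)^2"
    using calculation(2) by (intro power_mono) auto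
  ultimately show "is_l2 (\<lambda>k. gevrey_weight r (gevrey_radius r \<kappa> \<sigma> E0 t) (kn k) * norm (coeffs (b t) k))"
    "(l2 (\<lambda>k. gevrey_weight r (gevrey_radius r \<kappa> \<sigma> E0 t) (kn k) * norm (coeffs (b t) k)))^2 \<le> gevrey_budget r \<kappa> E0 t"
    using K0 by (simp_all add: W_def K_def)
qed

lemma norm_coeffs_minus [simp]: "norm (coeffs (- b) k) = norm (coeffs b k)"
  "norm (vfield \<alpha> (- b) k) = norm (vfield \<alpha> b k)"
  by (simp_all add: vfield_def coeffs_simps)

text \<open>Time reversal \<open>b \<mapsto> - b (- t)\<close> maps solutions to solutions, so negative times reduce to
  positive ones.\<close>

theorem voigt_flow_estimates:
  assumes \<alpha>: "0 < \<alpha>" and r: "4 \<le> r" and flow: "quadratic_flow (voigt_op \<alpha>) b"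
    and M: "(norm (b 0))^2 \<le> M"
    and sM: "is_l2 (\<lambda>k. kn k ^ (r - 1) * norm (coeffs (b 0) k))"
    and Ms: "(l2 (\<lambda>k. kn k ^ (r - 1) * norm (coeffs (b 0) k)))^2 \<le> M"
    and \<sigma>: "0 \<le> \<sigma>" and ss: "is_l2 (\<lambda>k. gevrey_weight r \<sigma> (kn k) * norm (coeffs (b 0) k))"
    and E0: "(l2 (\<lambda>k. gevrey_weight r \<sigma> (kn k) * norm (coeffs (b 0) k)))^2 = E0"
  defines "\<kappa> \<equiv> \<lambda>\<xi>. bound_const \<alpha> r M * (1 + \<bar>\<xi>\<bar>) powr bound_exponent r"
  shows "l2 (\<lambda>k. kn k ^ r * norm (vfield \<alpha> (b t) k)) \<le> \<kappa> t"
    "is_l2 (\<lambda>k. gevrey_weight r (gevrey_radius r \<kappa> \<sigma> E0 \<bar>t\<bar>) (kn k) * norm (coeffs (b t) k))"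
    "(l2 (\<lambda>k. gevrey_weight r (gevrey_radius r \<kappa> \<sigma> E0 \<bar>t\<bar>) (kn k) * norm (coeffs (b t) k)))^2 \<le> gevrey_budget r \<kappa> E0 \<bar>t\<bar>"
proof -
  define b' where "b' = (if 0 \<le> t then b else (\<lambda>t. - b (- t)))"
  have flow': "quadratic_flow (voigt_op \<alpha>) b'"
    using flow quadratic_flow_reverse[OF bounded_bilinear_voigt_op[OF \<alpha>] flow] by (simp add: b'_def)
  have n0: "norm (b' 0) = norm (b 0)" "\<And>k. norm (coeffs (b' 0) k) = norm (coeffs (b 0) k)"
    and nt: "\<And>k. norm (coeffs (b' \<bar>t\<bar>) k) = norm (coeffs (b t) k)"
      "\<And>k. norm (vfield \<alpha> (b' \<bar>t\<bar>) k) = norm (vfield \<alpha> (b t) k)"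
    by (auto simp: b'_def)
  note e = voigt_flow_estimates_forward[OF \<alpha> r flow', of M \<sigma> E0 "\<bar>t\<bar>", unfolded n0 nt, folded \<kappa>_def,
      OF M sM Ms \<sigma> ss E0 abs_ge_zero]
  show "is_l2 (\<lambda>k. gevrey_weight r (gevrey_radius r \<kappa> \<sigma> E0 \<bar>t\<bar>) (kn k) * norm (coeffs (b t) k))"
    "(l2 (\<lambda>k. gevrey_weight r (gevrey_radius r \<kappa> \<sigma> E0 \<bar>t\<bar>) (kn k) * norm (coeffs (b t) k)))^2 \<le> gevrey_budget r \<kappa> E0 \<bar>t\<bar>"
    by (rule e(2), rule e(3))
  show "l2 (\<lambda>k. kn k ^ r * norm (vfield \<alpha> (b t) k)) \<le> \<kappa> t"
    using e(1) by (simp add: \<kappa>_def)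
qed

section \<open>Fourier series on the torus\<close>

subsection \<open>Square-integrable functions on the unit cube\<close>

lemma emeasure_T3: "emeasure T3 (space T3) = 1"
proof -
  have "\<forall>b\<in>Basis. (0::real^3) \<bullet> b \<le> 1 \<bullet> b" by (auto simp: Basis_vec_def inner_axis)
  then have "emeasure lborel (cbox (0::real^3) 1) = ennreal (\<Prod>b\<in>Basis. (1 - 0 :: real^3) \<bullet> b)"
    by (subst emeasure_lborel_cbox) auto
  also have "(\<Prod>b\<in>Basis. (1 - 0 :: real^3) \<bullet> b) = 1"
    by (rule prod.neutral) (auto simp: Basis_vec_def inner_axis)
  finally show ?thesis by (simp add: emeasure_restrict_space)
qed

lemma finite_measure_T3: "finite_measure T3"
  by (rule finite_measureI) (simp only: emeasure_T3, simp)

lemma measure_T3 [simp]: "measure T3 (cbox 0 1) = 1"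
  using emeasure_T3 by (simp add: measure_def)

lemma borel_measurable_T3I: "continuous_on (cbox 0 1) f \<Longrightarrow> f \<in> borel_measurable T3"
  by (rule continuous_imp_measurable_on_sets_lebesgue) auto

lemma integrable_T3_bounded:
  fixes f :: "real^3 \<Rightarrow> 'a::{banach, second_countable_topology}"
  assumes "f \<in> borel_measurable T3" "\<And>x. norm (f x) \<le> B"
  shows "integrable T3 f"
  by (rule finite_measure.integrable_const_bound[OF finite_measure_T3 _ assms(1)]) (use assms(2) in auto)

lemma L2D:
  assumes "f \<in> L2"
  shows "f \<in> borel_measurable T3" "integrable T3 (\<lambda>x. (norm (f x))^2)"
  using assms by (auto simp: L2_def)

lemma L2_integrable:
  fixes f :: "real^3 \<Rightarrow> 'a::{banach, second_countable_topology}"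
  assumes "f \<in> L2"
  shows "integrable T3 f"
proof (rule Bochner_Integration.integrable_bound)
  show "integrable T3 (\<lambda>x. 1 + (norm (f x))^2)"
    using L2D[OF assms] integrable_T3_bounded[of "\<lambda>_. 1::real" 1] by auto
  show "f \<in> borel_measurable T3" by (rule L2D[OF assms])
  have "n \<le> 1 + n^2" if "0 \<le> n" for n :: real
    using that self_le_power[of n 2] by (cases "n \<le> 1") (auto intro: order_trans add_increasing2)
  then show "AE x in T3. norm (f x) \<le> norm (1 + (norm (f x))^2)" by simp
qed

lemma L2_comparison:
  fixes f :: "real^3 \<Rightarrow> 'a::{banach, second_countable_topology}"
  assumes "f \<in> borel_measurable T3" "integrable T3 g" "\<And>x. (norm (f x))^2 \<le> g x"
  shows "f \<in> L2"
proof -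
  have "integrable T3 (\<lambda>x. (norm (f x))^2)"
  proof (rule Bochner_Integration.integrable_bound[OF assms(2)])
    show "(\<lambda>x. (norm (f x))^2) \<in> borel_measurable T3" using assms(1) by measurable
    show "AE x in T3. norm ((norm (f x))^2) \<le> norm (g x)"
      using assms(3) by (auto intro!: AE_I2 order_trans[OF _ abs_ge_self])
  qed
  with assms(1) show ?thesis by (simp add: L2_def)
qed

lemma L2_add:
  fixes f g :: "real^3 \<Rightarrow> 'a::{banach, second_countable_topology}"
  assumes f: "f \<in> L2" and g: "g \<in> L2"
  shows "(\<lambda>x. f x + g x) \<in> L2"
proof (rule L2_comparison)
  show "(\<lambda>x. f x + g x) \<in> borel_measurable T3" using L2D(1)[OF f] L2D(1)[OF g] by measurable
  show "integrable T3 (\<lambda>x. 2 * (norm (f x))^2 + 2 * (norm (g x))^2)"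
    using L2D(2)[OF f] L2D(2)[OF g] by auto
  fix x
  have "(norm (f x + g x))^2 \<le> (norm (f x) + norm (g x))^2" by (intro power_mono norm_triangle_ineq) auto
  also have "\<dots> \<le> 2 * (norm (f x))^2 + 2 * (norm (g x))^2"
    using sum_squares_bound[of "norm (f x)" "norm (g x)"] by (simp add: power2_sum)
  finally show "(norm (f x + g x))^2 \<le> 2 * (norm (f x))^2 + 2 * (norm (g x))^2" .
qed

lemma L2_bounded_image:
  fixes f :: "real^3 \<Rightarrow> 'a::{banach, second_countable_topology}" and h :: "real^3 \<Rightarrow> 'b::{banach, second_countable_topology}"
  assumes f: "f \<in> L2" and h: "h \<in> borel_measurable T3" and le: "\<And>x. norm (h x) \<le> B * norm (f x)"
  shows "h \<in> L2"
proof (rule L2_comparison[OF h])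
  show "integrable T3 (\<lambda>x. B^2 * (norm (f x))^2)" using L2D(2)[OF f] by auto
  fix x show "(norm (h x))^2 \<le> B^2 * (norm (f x))^2"
    using power_mono[OF le[of x], of 2] by (simp add: power_mult_distrib)
qed

lemma L2_scaleR:
  fixes f :: "real^3 \<Rightarrow> 'a::{banach, second_countable_topology}"
  assumes f: "f \<in> L2"
  shows "(\<lambda>x. t *\<^sub>R f x) \<in> L2"
proof (rule L2_bounded_image[OF f, of _ "\<bar>t\<bar>"])
  show "(\<lambda>x. t *\<^sub>R f x) \<in> borel_measurable T3" using L2D(1)[OF f] by measurable
qed simp

lemma L2_diff:
  fixes f g :: "real^3 \<Rightarrow> 'a::{banach, second_countable_topology}"
  assumes f: "f \<in> L2" and g: "g \<in> L2"
  shows "(\<lambda>x. f x - g x) \<in> L2"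
  using L2_add[OF f L2_scaleR[OF g, of "-1"]] by simp

lemma L2_sum:
  fixes f :: "'i \<Rightarrow> real^3 \<Rightarrow> 'a::{banach, second_countable_topology}"
  assumes "\<And>i. i \<in> I \<Longrightarrow> f i \<in> L2"
  shows "(\<lambda>x. \<Sum>i\<in>I. f i x) \<in> L2"
proof -
  have 0: "(\<lambda>x. 0) \<in> (L2 :: (real^3 \<Rightarrow> 'a) set)" by (simp add: L2_def)
  show ?thesis using assms
    by (induction I rule: infinite_finite_induct) (simp_all add: 0 L2_add)
qed

lemma L2_bounded:
  fixes f :: "real^3 \<Rightarrow> 'a::{banach, second_countable_topology}"
  assumes "f \<in> borel_measurable T3" "\<And>x. norm (f x) \<le> B"
  shows "f \<in> L2"
proof (rule L2_comparison[OF assms(1)])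
  show "integrable T3 (\<lambda>x. B^2)" by (rule integrable_T3_bounded[of _ "B^2"]) auto
  show "(norm (f x))^2 \<le> B^2" for x using power_mono[OF assms(2), of x 2] by simp
qed

lemma L2_mult_integrable:
  fixes f g :: "real^3 \<Rightarrow> 'a::{real_normed_field, banach, second_countable_topology}"
  assumes f: "f \<in> L2" and g: "g \<in> L2"
  shows "integrable T3 (\<lambda>x. f x * g x)"
proof (rule Bochner_Integration.integrable_bound)
  show "integrable T3 (\<lambda>x. (norm (f x))^2 + (norm (g x))^2)" using L2D(2)[OF f] L2D(2)[OF g] by auto
  show "(\<lambda>x. f x * g x) \<in> borel_measurable T3" using L2D(1)[OF f] L2D(1)[OF g] by measurable
  have "norm (f x * g x) \<le> (norm (f x))^2 + (norm (g x))^2" for x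
  proof -
    have "0 \<le> norm (f x) * norm (g x)" by simp
    then show ?thesis using sum_squares_bound[of "norm (f x)" "norm (g x)"] unfolding norm_mult by linarith
  qed
  then show "AE x in T3. norm (f x * g x) \<le> norm ((norm (f x))^2 + (norm (g x))^2)"
    by (auto intro!: AE_I2 order_trans[OF _ abs_ge_self])
qed

subsection \<open>Characters and Fourier coefficients\<close>

definition char :: "int^3 \<Rightarrow> real^3 \<Rightarrow> complex" where
  "char k x = cis (freq k \<bullet> x)"

definition cf :: "(real^3 \<Rightarrow> complex) \<Rightarrow> int^3 \<Rightarrow> complex" where
  "cf f k = (LINT x|T3. f x * char (- k) x)"

lemma fourier_coeff_cf: "fourier_coeff g k = cf (\<lambda>x. complex_of_real (g x)) k"
  by (simp add: fourier_coeff_def cf_def char_def freq_minus)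

lemma norm_char [simp]: "norm (char k x) = 1"
  by (simp add: char_def)

lemma char_mult: "char j x * char k x = char (j + k) x"
  by (simp add: char_def freq_add inner_add_left cis_mult)

lemma cnj_char: "cnj (char k x) = char (- k) x"
  by (simp add: char_def freq_minus cis_cnj)

lemma char_0 [simp]: "char 0 x = 1"
  by (simp add: char_def)

lemma continuous_char: "continuous_on S (char k)"
  unfolding char_def cis_conv_exp by (intro continuous_intros)

lemma measurable_char: "char k \<in> borel_measurable T3"
  by (rule borel_measurable_T3I[OF continuous_char])

lemma L2_char: "char k \<in> L2"
  by (rule L2_bounded[of _ 1]) (auto simp: measurable_char)

lemma char_mult_integrable:
  assumes "integrable T3 f"
  shows "integrable T3 (\<lambda>x. f x * char k x)"
  by (rule Bochner_Integration.integrable_bound[OF assms])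
     (use borel_measurable_integrable[OF assms] measurable_char[of k] in \<open>auto simp: norm_mult intro!: borel_measurable_times\<close>)

lemma integral_circle:
  "(LBINT t. indicator {0..1} t *\<^sub>R cis (2 * pi * real_of_int n * t)) = (if n = 0 then 1 else 0)"
proof (cases "n = 0")
  case True
  then show ?thesis by simp
next
  case False
  define c where "c = 2 * pi * real_of_int n"
  have c: "c \<noteq> 0" using False by (simp add: c_def)
  have "(LBINT t. indicator {0..1} t *\<^sub>R cis (c * t)) = - \<i> / c * cis (c * 1) - - \<i> / c * cis (c * 0)"
  proof (rule integral_FTC_Icc)
    fix t :: real
    show "((\<lambda>t. - \<i> / c * cis (c * t)) has_vector_derivative cis (c * t)) (at t within {0..1})"
      unfolding cis_conv_exp using c
      by (auto intro!: derivative_eq_intros has_vector_derivative_real_field simp: has_real_derivative_iff_has_vector_derivative[symmetric])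
  qed (auto simp: cis_conv_exp intro!: continuous_intros)
  also have "cis (c * 1) = cis (c * 0)"
    using cis_multiple_2pi[of "real_of_int n"] by (simp add: c_def mult.assoc)
  finally show ?thesis using False by (simp add: c_def)
qed

lemma integral_char: "(LINT x|T3. char k x) = (if k = 0 then 1 else 0)"
proof -
  have fin: "finite (Basis :: (real^3) set)" by simp
  define g where "g b t = indicator {0..1} t *\<^sub>R cis ((freq k \<bullet> b) * t)" for b :: "real^3" and t :: real
  have cont: "continuous_on UNIV (\<lambda>t. cis (c * t))" for c :: real
    unfolding cis_conv_exp by (intro continuous_intros)
  have ig: "integrable lborel (g b)" for b
    unfolding g_def by (intro borel_integrable_compact continuous_on_subset[OF cont]) auto
  have bm: "char k \<in> borel_measurable borel"
    by (rule borel_measurable_continuous_onI[OF continuous_char])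
  have bm2: "(\<lambda>x. indicator (cbox 0 1) x *\<^sub>R char k x) \<in> borel_measurable borel"
    using bm by (intro borel_measurable_scaleR borel_measurable_indicator) auto
  interpret product_sigma_finite "\<lambda>_::real^3. lborel::real measure" by standard
  have "(LINT x|T3. char k x) = (LINT x|lborel. indicator (cbox 0 1) x *\<^sub>R char k x)"
    using bm bm2 by (subst integral_restrict_space) (simp, intro integral_completion, simp)
  also have "\<dots> = (\<integral>f. (indicator (cbox 0 1) (\<Sum>b\<in>Basis. f b *\<^sub>R b) *\<^sub>R char k (\<Sum>b\<in>Basis. f b *\<^sub>R b)) \<partial>(\<Pi>\<^sub>M b\<in>(Basis :: (real^3) set). lborel))"
    using bm bm2 by (subst lborel_eq, intro integral_distr) measurable
  also have "\<dots> = (\<integral>f. (\<Prod>b\<in>Basis. g b (f b)) \<partial>(\<Pi>\<^sub>M b\<in>(Basis :: (real^3) set). lborel))"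
  proof (rule arg_cong[where f = "integral\<^sup>L _"], rule ext)
    fix f :: "real^3 \<Rightarrow> real"
    define x where "x = (\<Sum>b\<in>Basis. f b *\<^sub>R b)"
    have xb: "x \<bullet> b = f b" if "b \<in> Basis" for b
      using that by (simp add: x_def inner_sum_left inner_Basis if_distrib sum.delta cong: if_cong)
    have "x \<in> cbox 0 1 \<longleftrightarrow> (\<forall>b\<in>Basis. 0 \<le> x \<bullet> b \<and> x \<bullet> b \<le> 1)"
      by (simp add: mem_box Basis_vec_def inner_axis)
    then have mem: "x \<in> cbox 0 1 \<longleftrightarrow> (\<forall>b\<in>Basis. f b \<in> {0..1})" using xb by simp
    have "(indicator (cbox 0 1) x :: real) = (\<Prod>b\<in>Basis. indicator {0..1} (f b))"
    proof (cases "x \<in> cbox 0 1")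
      case True
      then have "f b \<in> {0..1}" if "b \<in> Basis" for b
        using that by (simp add: mem)
      with True show ?thesis by (simp add: prod.neutral)
    next
      case False
      then obtain b where b: "b \<in> Basis" "f b \<notin> {0..1}"
        using mem by auto
      then have "(\<Prod>b\<in>Basis. indicator {0..1} (f b) :: real) = 0"
        by (intro prod_zero bexI[of _ b]) auto
      with False show ?thesis by simp
    qed
    moreover have "char k x = (\<Prod>b\<in>Basis. cis ((freq k \<bullet> b) * f b))"
    proof -
      have "freq k \<bullet> x = (\<Sum>b\<in>Basis. (freq k \<bullet> b) * f b)"
        unfolding x_def inner_sum_right by (simp add: mult.commute)
      then show ?thesis
        by (simp add: char_def cis_conv_exp sum_distrib_left exp_sum)
    qed
    ultimately show "indicator (cbox 0 1) x *\<^sub>R char k x = (\<Prod>b\<in>Basis. g b (f b))"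
      by (simp add: g_def scaleR_conv_of_real prod.distrib)
  qed
  also have "\<dots> = (\<Prod>b\<in>Basis. LINT t|lborel. g b t)"
    using ig by (intro product_integral_prod) auto
  also have "\<dots> = (\<Prod>i\<in>UNIV. LINT t|lborel. g (axis i 1) t)"
  proof -
    have B: "(Basis :: (real^3) set) = (\<lambda>i. axis i 1) ` UNIV" by (auto simp: Basis_vec_def)
    have "prod h (Basis :: (real^3) set) = (\<Prod>i\<in>UNIV. h (axis i 1))" for h :: "real^3 \<Rightarrow> complex"
      by (subst B, subst prod.reindex) (auto simp: inj_on_def axis_eq_axis)
    then show ?thesis .
  qed
  also have "\<dots> = (\<Prod>i\<in>UNIV. if k $ i = 0 then 1 else 0)"
    unfolding g_def by (intro prod.cong) (simp_all add: inner_axis freq_def integral_circle)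
  also have "\<dots> = (if k = 0 then 1 else 0)"
    by (auto simp: vec_eq_iff intro!: prod.neutral)
  finally show ?thesis .
qed

lemma cf_char: "cf (char j) k = (if j = k then 1 else 0)"
  unfolding cf_def char_mult integral_char by auto

lemma cf_mult_char: "cf (\<lambda>x. f x * char j x) k = cf f (k - j)"
  by (simp add: cf_def mult.assoc char_mult)

lemma cf_add: "integrable T3 f \<Longrightarrow> integrable T3 g \<Longrightarrow> cf (\<lambda>x. f x + g x) k = cf f k + cf g k"
  unfolding cf_def by (simp add: distrib_right char_mult_integrable Bochner_Integration.integral_add)

lemma cf_diff: "integrable T3 f \<Longrightarrow> integrable T3 g \<Longrightarrow> cf (\<lambda>x. f x - g x) k = cf f k - cf g k"
  unfolding cf_def by (simp add: left_diff_distrib char_mult_integrable Bochner_Integration.integral_diff)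

lemma cf_cmult: "cf (\<lambda>x. c * f x) k = c * cf f k"
  by (simp add: cf_def mult.assoc)

lemma cf_sum: "(\<And>i. i \<in> I \<Longrightarrow> integrable T3 (f i)) \<Longrightarrow> cf (\<lambda>x. \<Sum>i\<in>I. f i x) k = (\<Sum>i\<in>I. cf (f i) k)"
  unfolding cf_def by (simp add: sum_distrib_right char_mult_integrable Bochner_Integration.integral_sum)

lemma cf_cnj: "cf (\<lambda>x. cnj (f x)) k = cnj (cf f (- k))"
proof -
  have eq: "(\<lambda>x. cnj (f x) * char (- k) x) = (\<lambda>x. cnj (f x * char (- (- k)) x))"
    by (simp add: cnj_char)
  show ?thesis unfolding cf_def eq by (rule integral_bounded_linear'[OF bounded_linear_cnj bounded_linear_cnj]) simp
qed

subsection \<open>Completeness of the characters\<close>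

text \<open>A factor \<open>p\<close> is stable if multiplication by it preserves the vanishing of all Fourier
  coefficients. Stable factors form an algebra containing \<open>cos (2 \<pi> x\<^sub>i)\<close> and \<open>sin (2 \<pi> x\<^sub>i)\<close>, hence
  all polynomials in these; uniform limits then give all continuous functions on the torus.\<close>

definition stable_factor :: "(real^3 \<Rightarrow> real) \<Rightarrow> bool" where
  "stable_factor p \<longleftrightarrow> p \<in> borel_measurable T3 \<and> (\<exists>B. \<forall>x. \<bar>p x\<bar> \<le> B) \<and>
    (\<forall>F. integrable T3 F \<longrightarrow> (\<forall>k. cf F k = 0) \<longrightarrow> (\<forall>k. cf (\<lambda>x. F x * of_real (p x)) k = 0))"

lemma integrable_mult_bounded:
  fixes F :: "real^3 \<Rightarrow> complex"
  assumes F: "integrable T3 F" and p: "p \<in> borel_measurable T3" "\<And>x. \<bar>p x\<bar> \<le> B"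
  shows "integrable T3 (\<lambda>x. F x * complex_of_real (p x))"
proof (rule Bochner_Integration.integrable_bound)
  show "integrable T3 (\<lambda>x. B * norm (F x))" using F by auto
  show "(\<lambda>x. F x * complex_of_real (p x)) \<in> borel_measurable T3"
    using borel_measurable_integrable[OF F] p(1) by measurable
  have "0 \<le> B" using p(2)[of 0] by linarith
  then show "AE x in T3. norm (F x * complex_of_real (p x)) \<le> norm (B * norm (F x))"
    using p(2) by (auto simp: norm_mult mult.commute intro!: AE_I2 mult_right_mono)
qed

lemma stable_factor_const: "stable_factor (\<lambda>x. c)"
proof -
  have "cf (\<lambda>x. F x * of_real c) k = of_real c * cf F k" for F k
    using cf_cmult[of "of_real c" F k] by (simp add: mult.commute)
  then show ?thesis by (auto simp: stable_factor_def)
qed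

lemma stable_factor_add:
  assumes "stable_factor p" "stable_factor q"
  shows "stable_factor (\<lambda>x. p x + q x)"
proof -
  obtain A B where AB: "\<And>x. \<bar>p x\<bar> \<le> A" "\<And>x. \<bar>q x\<bar> \<le> B" using assms by (auto simp: stable_factor_def)
  have m: "p \<in> borel_measurable T3" "q \<in> borel_measurable T3" using assms by (auto simp: stable_factor_def)
  have "cf (\<lambda>x. F x * of_real (p x + q x)) k = 0" if F: "integrable T3 F" "\<forall>k. cf F k = 0" for F k
  proof -
    have "cf (\<lambda>x. F x * of_real (p x) + F x * of_real (q x)) k = cf (\<lambda>x. F x * of_real (p x)) k + cf (\<lambda>x. F x * of_real (q x)) k"
      by (intro cf_add integrable_mult_bounded[OF F(1) m(1) AB(1)] integrable_mult_bounded[OF F(1) m(2) AB(2)])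
    then show ?thesis using F assms by (simp add: stable_factor_def distrib_left)
  qed
  moreover have "\<bar>p x + q x\<bar> \<le> A + B" for x using AB[of x] by linarith
  ultimately show ?thesis using m unfolding stable_factor_def by (intro conjI exI[of _ "A + B"]) auto
qed

lemma stable_factor_mult:
  assumes "stable_factor p" "stable_factor q"
  shows "stable_factor (\<lambda>x. p x * q x)"
proof -
  obtain A B where AB: "\<And>x. \<bar>p x\<bar> \<le> A" "\<And>x. \<bar>q x\<bar> \<le> B" using assms by (auto simp: stable_factor_def)
  have m: "p \<in> borel_measurable T3" "q \<in> borel_measurable T3" using assms by (auto simp: stable_factor_def)
  have "cf (\<lambda>x. F x * of_real (p x * q x)) k = 0" if F: "integrable T3 F" "\<forall>k. cf F k = 0" for F k
  proof -
    have "integrable T3 (\<lambda>x. F x * of_real (p x))" by (rule integrable_mult_bounded[OF F(1) m(1) AB(1)])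
    moreover have "\<forall>k. cf (\<lambda>x. F x * of_real (p x)) k = 0" using F assms(1) by (simp add: stable_factor_def)
    ultimately have "cf (\<lambda>x. F x * of_real (p x) * of_real (q x)) k = 0"
      using assms(2) unfolding stable_factor_def by blast
    then show ?thesis by (simp add: mult.assoc)
  qed
  moreover have "\<bar>p x * q x\<bar> \<le> A * B" for x
    unfolding abs_mult using AB[of x] by (intro mult_mono) auto
  ultimately show ?thesis using m unfolding stable_factor_def by (intro conjI exI[of _ "A * B"]) auto
qed

lemma stable_factor_sum: "(\<And>i. i \<in> I \<Longrightarrow> stable_factor (p i)) \<Longrightarrow> stable_factor (\<lambda>x. \<Sum>i\<in>I. p i x)"
  by (induction I rule: infinite_finite_induct) (simp_all add: stable_factor_const stable_factor_add)

lemma stable_factor_cos_sin: "stable_factor (\<lambda>x. cos (freq k \<bullet> x))" "stable_factor (\<lambda>x. sin (freq k \<bullet> x))"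
proof -
  have e: "complex_of_real (cos (freq k \<bullet> x)) = (1/2) * char k x + (1/2) * char (- k) x"
    "complex_of_real (sin (freq k \<bullet> x)) = (- \<i> / 2) * char k x + (\<i> / 2) * char (- k) x" for x
    by (auto simp: char_def freq_minus complex_eq_iff)
  have z: "cf (\<lambda>x. F x * (a * char k x + b * char (- k) x)) j = 0" if F: "integrable T3 F" "\<forall>k. cf F k = 0" for F a b j
  proof -
    have "cf (\<lambda>x. a * (F x * char k x) + b * (F x * char (- k) x)) j = 0"
      using F char_mult_integrable[OF F(1)] by (subst cf_add) (auto simp: cf_cmult cf_mult_char)
    moreover have "(\<lambda>x. a * (F x * char k x) + b * (F x * char (- k) x)) = (\<lambda>x. F x * (a * char k x + b * char (- k) x))"
      by (auto simp: algebra_simps)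
    ultimately show ?thesis by simp
  qed
  have m: "(\<lambda>x. cos (freq k \<bullet> x)) \<in> borel_measurable T3" "(\<lambda>x. sin (freq k \<bullet> x)) \<in> borel_measurable T3"
    by (auto intro!: borel_measurable_T3I continuous_intros)
  show "stable_factor (\<lambda>x. cos (freq k \<bullet> x))"
    unfolding stable_factor_def e using m by (intro conjI exI[of _ 1] allI impI z) auto
  show "stable_factor (\<lambda>x. sin (freq k \<bullet> x))"
    unfolding stable_factor_def e using m by (intro conjI exI[of _ 1] allI impI z) auto
qed

definition circles :: "real^3 \<Rightarrow> complex^3" where
  "circles x = (\<chi> i. cis (2 * pi * x $ i))"

lemma stable_factor_polynomial:
  assumes "real_polynomial_function g"
  shows "stable_factor (\<lambda>x. g (circles x))"
  using assms
proof (induction rule: real_polynomial_function.induct)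
  case (linear f)
  have fr: "freq (axis i 1) \<bullet> x = 2 * pi * x $ i" for i x
  proof -
    have "freq (axis i 1) = (2 * pi) *\<^sub>R axis i 1" by (auto simp: freq_def vec_eq_iff axis_def)
    then show ?thesis by (simp add: inner_axis')
  qed
  have "f (circles x) = (\<Sum>i\<in>UNIV. cos (freq (axis i 1) \<bullet> x) * f (axis i 1) + sin (freq (axis i 1) \<bullet> x) * f (axis i \<i>))" for x
  proof -
    interpret f: bounded_linear f by fact
    have "circles x = (\<Sum>i\<in>UNIV. cos (freq (axis i 1) \<bullet> x) *\<^sub>R axis i 1 + sin (freq (axis i 1) \<bullet> x) *\<^sub>R axis i \<i>)"
    proof (subst vec_eq_iff, intro allI)
      fix j
      have "(\<Sum>i\<in>UNIV. cos (freq (axis i 1) \<bullet> x) *\<^sub>R axis i 1 + sin (freq (axis i 1) \<bullet> x) *\<^sub>R axis i \<i>) $ j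
        = (\<Sum>i\<in>UNIV. if i = j then cis (2 * pi * x $ i) else 0)"
        unfolding sum_component fr by (intro sum.cong) (auto simp: axis_def complex_eq_iff)
      then show "circles x $ j = (\<Sum>i\<in>UNIV. cos (freq (axis i 1) \<bullet> x) *\<^sub>R axis i 1 + sin (freq (axis i 1) \<bullet> x) *\<^sub>R axis i \<i>) $ j"
        by (simp add: circles_def)
    qed
    then show ?thesis by (simp add: f.sum f.add f.scaleR)
  qed
  then show ?case
    by (simp only:) (intro stable_factor_sum stable_factor_add stable_factor_mult stable_factor_cos_sin stable_factor_const)
qed (simp_all add: stable_factor_const stable_factor_add stable_factor_mult)

lemma continuous_circles: "continuous_on S circles"
  unfolding circles_def cis_conv_exp by (intro continuous_on_vec_lambda continuous_intros)

text \<open>Stone--Weierstrass on the compact image of the cube: polynomials in the coordinates of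
  \<open>circles x\<close> are uniformly dense in the continuous functions there.\<close>

lemma integral_continuous_zero:
  assumes F: "integrable T3 F" "\<And>k. cf F k = 0" and G: "continuous_on UNIV (G :: complex^3 \<Rightarrow> real)"
  shows "(LINT x|T3. F x * complex_of_real (G (circles x))) = 0"
proof -
  define S where "S = circles ` cbox 0 1"
  have S: "compact S" unfolding S_def by (intro compact_continuous_image continuous_circles) simp
  define I where "I = (LINT x|T3. norm (F x))"
  have I: "0 \<le> I" unfolding I_def by (intro integral_nonneg_AE) auto
  have "norm (LINT x|T3. F x * complex_of_real (G (circles x))) \<le> e * I" if e: "e > 0" for e
  proof -
    obtain g where g: "real_polynomial_function g" "\<And>y. y \<in> S \<Longrightarrow> \<bar>G y - g y\<bar> < e"
      using Stone_Weierstrass_real_polynomial_function[OF S continuous_on_subset[OF G subset_UNIV] e] by blast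
    have st: "stable_factor (\<lambda>x. g (circles x))" by (rule stable_factor_polynomial[OF g(1)])
    then obtain B where B: "\<And>x. \<bar>g (circles x)\<bar> \<le> B" by (auto simp: stable_factor_def)
    have m: "(\<lambda>x. g (circles x)) \<in> borel_measurable T3" using st by (auto simp: stable_factor_def)
    have ig: "integrable T3 (\<lambda>x. F x * complex_of_real (g (circles x)))"
      by (rule integrable_mult_bounded[OF F(1) m B])
    have "cf (\<lambda>x. F x * complex_of_real (g (circles x))) 0 = 0"
      using st F unfolding stable_factor_def by blast
    then have z: "(LINT x|T3. F x * complex_of_real (g (circles x))) = 0" by (simp add: cf_def)
    have mG: "(\<lambda>x. G (circles x)) \<in> borel_measurable T3"
      by (intro borel_measurable_T3I continuous_on_compose2[OF G continuous_circles]) auto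
    have d: "norm (F x * complex_of_real (G (circles x)) - F x * complex_of_real (g (circles x))) \<le> e * norm (F x)"
      if "x \<in> cbox 0 1" for x
    proof -
      have "\<bar>G (circles x) - g (circles x)\<bar> \<le> e" using g(2)[of "circles x"] that by (simp add: S_def)
      then have "norm (F x) * \<bar>G (circles x) - g (circles x)\<bar> \<le> norm (F x) * e" by (rule mult_left_mono) simp
      then show ?thesis
        by (simp add: right_diff_distrib[symmetric] norm_mult of_real_diff[symmetric] mult.commute del: of_real_diff)
    qed
    have iD: "integrable T3 (\<lambda>x. F x * complex_of_real (G (circles x)) - F x * complex_of_real (g (circles x)))"
    proof (rule Bochner_Integration.integrable_bound)
      show "integrable T3 (\<lambda>x. e * norm (F x))" using F by auto
      show "(\<lambda>x. F x * complex_of_real (G (circles x)) - F x * complex_of_real (g (circles x))) \<in> borel_measurable T3"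
        using borel_measurable_integrable[OF F(1)] mG m by measurable
      show "AE x in T3. norm (F x * complex_of_real (G (circles x)) - F x * complex_of_real (g (circles x))) \<le> norm (e * norm (F x))"
        by (rule AE_I2) (use d e in auto)
    qed
    have "integrable T3 (\<lambda>x. (F x * complex_of_real (G (circles x)) - F x * complex_of_real (g (circles x))) + F x * complex_of_real (g (circles x)))"
      by (intro Bochner_Integration.integrable_add iD ig)
    then have iG: "integrable T3 (\<lambda>x. F x * complex_of_real (G (circles x)))" by simp
    have "norm (LINT x|T3. F x * complex_of_real (G (circles x))) =
        norm (LINT x|T3. F x * complex_of_real (G (circles x)) - F x * complex_of_real (g (circles x)))"
      by (simp add: Bochner_Integration.integral_diff[OF iG ig] z)
    also have "\<dots> \<le> (LINT x|T3. norm (F x * complex_of_real (G (circles x)) - F x * complex_of_real (g (circles x))))"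
      by (rule integral_norm_bound)
    also have "\<dots> \<le> (LINT x|T3. e * norm (F x))"
      by (rule integral_mono) (use iD F d in auto)
    also have "\<dots> = e * I" by (simp add: I_def)
    finally show ?thesis .
  qed
  then have "norm (LINT x|T3. F x * complex_of_real (G (circles x))) \<le> 0 + e" if "e > 0" for e
    using that I mult_left_mono[of I "I + 1" "e / (I + 1)"]
    by (smt (verit, ccfv_SIG) divide_pos_pos nonzero_eq_divide_eq)
  then have "norm (LINT x|T3. F x * complex_of_real (G (circles x))) \<le> 0" by (rule field_le_epsilon)
  then show ?thesis by simp
qed

text \<open>On the circle, the arc over \<open>(a, b)\<close> is a half plane section, so its indicator is a limit of
  continuous functions of \<open>cis (2 \<pi> t)\<close>.\<close>

lemma arc_approximation:
  fixes a b :: real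
  obtains \<psi> :: "nat \<Rightarrow> complex \<Rightarrow> real" where "\<And>n. continuous_on UNIV (\<psi> n)" "\<And>n z. 0 \<le> \<psi> n z" "\<And>n z. \<psi> n z \<le> 1"
    "\<And>t. 0 < t \<Longrightarrow> t < 1 \<Longrightarrow> (\<lambda>n. \<psi> n (cis (2 * pi * t))) \<longlonglongrightarrow> indicator {a<..<b} t"
proof -
  define a' b' where "a' = max 0 a" and "b' = min 1 b"
  show thesis
  proof (cases "a' < b'")
    case False
    show thesis
    proof (rule that[of "\<lambda>_ _. 0"])
      fix t :: real assume "0 < t" "t < 1"
      then have "t \<notin> {a<..<b}" using False by (auto simp: a'_def b'_def)
      then show "(\<lambda>n. 0) \<longlonglongrightarrow> (indicator {a<..<b} t :: real)" by simp
    qed auto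
  next
    case True
    define \<delta> where "\<delta> = pi * (b' - a')"
    have ab: "0 \<le> a'" "b' \<le> 1" by (auto simp: a'_def b'_def)
    have \<delta>: "0 < \<delta>" "\<delta> \<le> pi" using True ab by (auto simp: \<delta>_def mult_left_le)
    define w where "w = cis (pi * (a' + b'))"
    define \<psi> where "\<psi> n z = min 1 (real n * max 0 (Re (z * cnj w) - cos \<delta>))" for n z
    show thesis
    proof (rule that[of \<psi>])
      show "continuous_on UNIV (\<psi> n)" for n unfolding \<psi>_def by (intro continuous_intros)
      show "0 \<le> \<psi> n z" "\<psi> n z \<le> 1" for n z by (auto simp: \<psi>_def)
      fix t :: real assume t: "0 < t" "t < 1"
      define \<theta> where "\<theta> = 2 * pi * t - pi * (a' + b')"
      have re: "Re (cis (2 * pi * t) * cnj w) = cos \<theta>"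
        by (simp add: w_def cis_cnj cis_mult \<theta>_def cis.sel(1))
      show "(\<lambda>n. \<psi> n (cis (2 * pi * t))) \<longlonglongrightarrow> indicator {a<..<b} t"
      proof (cases "t \<in> {a<..<b}")
        case inside: True
        then have "a' < t" "t < b'" using t by (auto simp: a'_def b'_def)
        then have "pi * a' < pi * t" "pi * t < pi * b'" by simp_all
        then have "\<bar>\<theta>\<bar> < \<delta>" unfolding \<theta>_def \<delta>_def distrib_left right_diff_distrib by linarith
        then have "cos \<delta> < cos \<bar>\<theta>\<bar>" using \<delta> by (intro cos_monotone_0_pi) auto
        then have d: "0 < cos \<theta> - cos \<delta>" by simp
        obtain n0 :: nat where n0: "1 / (cos \<theta> - cos \<delta>) \<le> real n0" using real_arch_simple by blast
        have "\<psi> n (cis (2 * pi * t)) = 1" if "n \<ge> n0" for n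
        proof -
          have "1 \<le> real n0 * (cos \<theta> - cos \<delta>)" using n0 d by (simp add: divide_le_eq)
          also have "\<dots> \<le> real n * (cos \<theta> - cos \<delta>)" using d that by (intro mult_right_mono) auto
          finally show ?thesis using d unfolding \<psi>_def re by simp
        qed
        then have "\<forall>\<^sub>F n in sequentially. \<psi> n (cis (2 * pi * t)) = 1" by (auto simp: eventually_sequentially)
        then show ?thesis using inside by (simp add: tendsto_eventually)
      next
        case False
        then have "t \<le> a' \<or> b' \<le> t" using t by (auto simp: a'_def b'_def)
        then have "pi * t \<le> pi * a' \<or> pi * b' \<le> pi * t" by simp
        then have 1: "\<delta> \<le> \<bar>\<theta>\<bar>" unfolding \<theta>_def \<delta>_def distrib_left right_diff_distrib by linarith
        have "pi * t \<le> pi" "0 \<le> pi * a'" "pi * b' \<le> pi" "0 \<le> pi * t" using t ab by (simp_all add: mult_left_le)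
        then have 2: "\<bar>\<theta>\<bar> \<le> 2 * pi - \<delta>" unfolding \<theta>_def \<delta>_def distrib_left right_diff_distrib by linarith
        have "cos \<bar>\<theta>\<bar> \<le> cos \<delta>"
        proof (cases "\<bar>\<theta>\<bar> \<le> pi")
          case True
          then show ?thesis using 1 \<delta> by (intro cos_monotone_0_pi_le) auto
        next
          case False
          have "cos \<bar>\<theta>\<bar> = cos (2 * pi - \<bar>\<theta>\<bar>)" by (simp add: cos_diff)
          also have "\<dots> \<le> cos \<delta>" using False 2 \<delta> by (intro cos_monotone_0_pi_le) auto
          finally show ?thesis .
        qed
        then have "\<psi> n (cis (2 * pi * t)) = 0" for n unfolding \<psi>_def re by simp
        then show ?thesis using False by simp
      qed
    qed
  qed
qed

lemma AE_T3_interior: "AE x in T3. x \<in> box 0 1"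
proof -
  have "cbox (0::real^3) 1 - box 0 1 \<in> null_sets lebesgue"
    using negligible_frontier_interval[of "0::real^3" 1] by (simp add: negligible_iff_null_sets)
  then have "AE x in lebesgue. x \<notin> cbox (0::real^3) 1 - box 0 1" by (rule AE_not_in)
  then have "AE x in lebesgue. x \<in> cbox (0::real^3) 1 \<longrightarrow> x \<in> box 0 1" by eventually_elim auto
  then show ?thesis
    by (subst AE_restrict_space_iff) auto
qed

text \<open>Products of three arc functions approximate the indicator of a box in the open cube,
  boundedly and pointwise, and dominated convergence applies.\<close>

lemma integral_box_zero:
  assumes F: "integrable T3 F" "\<And>k. cf F k = 0"
  shows "(LINT x|T3. indicator (box a b) x *\<^sub>R F x) = 0"
proof -
  have "\<forall>i. \<exists>\<psi>. (\<forall>n. continuous_on UNIV (\<psi> n)) \<and> (\<forall>n z. 0 \<le> \<psi> n z \<and> \<psi> n z \<le> 1) \<and>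
    (\<forall>t. 0 < t \<longrightarrow> t < 1 \<longrightarrow> (\<lambda>n::nat. \<psi> n (cis (2 * pi * t)) :: real) \<longlonglongrightarrow> indicator {a $ i<..<b $ i} t)"
    using arc_approximation by metis
  then obtain \<psi> :: "3 \<Rightarrow> nat \<Rightarrow> complex \<Rightarrow> real" where \<psi>: "\<And>i n. continuous_on UNIV (\<psi> i n)" "\<And>i n z. 0 \<le> \<psi> i n z \<and> \<psi> i n z \<le> 1"
    "\<And>i t. 0 < t \<Longrightarrow> t < 1 \<Longrightarrow> (\<lambda>n. \<psi> i n (cis (2 * pi * t))) \<longlonglongrightarrow> indicator {a $ i<..<b $ i} t" by metis
  define G where "G n y = (\<Prod>i\<in>UNIV. \<psi> i n (y $ i))" for n and y :: "complex^3"
  have G: "continuous_on UNIV (G n)" for n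
    unfolding G_def by (intro continuous_on_prod continuous_on_compose2[OF \<psi>(1)] continuous_intros) auto
  have G1: "0 \<le> G n y" "G n y \<le> 1" for n y
    unfolding G_def using \<psi>(2) by (auto intro!: prod_nonneg prod_le_1)
  have mG: "(\<lambda>x. G n (circles x)) \<in> borel_measurable T3" for n
    by (intro borel_measurable_T3I continuous_on_compose2[OF G continuous_circles]) auto
  have mF: "F \<in> borel_measurable T3" using F(1) by (rule borel_measurable_integrable)
  have mb: "box a b \<inter> cbox 0 1 \<in> sets T3" by (auto simp: sets_restrict_space)
  have "(\<lambda>n. LINT x|T3. F x * complex_of_real (G n (circles x))) \<longlonglongrightarrow> (LINT x|T3. indicator (box a b) x *\<^sub>R F x)"
  proof (rule integral_dominated_convergence[where w = "\<lambda>x. norm (F x)"])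
    have "box a b \<inter> space T3 \<in> sets T3" using mb by simp
    then show "(\<lambda>x. indicat_real (box a b) x *\<^sub>R F x) \<in> borel_measurable T3"
      using mF mb by (intro borel_measurable_scaleR borel_measurable_indicator') (auto simp: Int_def conj_commute)
    show "(\<lambda>x. F x * complex_of_real (G n (circles x))) \<in> borel_measurable T3" for n
      using mF mG[of n] by measurable
    show "integrable T3 (\<lambda>x. norm (F x))" using F(1) by auto
    show "AE x in T3. norm (F x * complex_of_real (G n (circles x))) \<le> norm (F x)" for n
      using G1[of n] by (auto simp: norm_mult mult_left_le intro!: AE_I2)
    show "AE x in T3. (\<lambda>n. F x * complex_of_real (G n (circles x))) \<longlonglongrightarrow> indicator (box a b) x *\<^sub>R F x"
      using AE_T3_interior
    proof eventually_elim
      case (elim x)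
      then have x: "0 < x $ i" "x $ i < 1" for i by (auto simp: mem_box_cart)
      have "(\<lambda>n. G n (circles x)) \<longlonglongrightarrow> (\<Prod>i\<in>UNIV. indicator {a $ i<..<b $ i} (x $ i))"
        unfolding G_def circles_def using x by (intro tendsto_prod) (simp add: \<psi>(3))
      also have "(\<Prod>i\<in>UNIV. indicator {a $ i<..<b $ i} (x $ i)) = (indicator (box a b) x :: real)"
        by (auto simp: indicator_def mem_box_cart intro!: prod.neutral)
      finally have "(\<lambda>n. F x * complex_of_real (G n (circles x))) \<longlonglongrightarrow> F x * complex_of_real (indicator (box a b) x)"
        by (intro tendsto_intros)
      then show ?case by (simp add: scaleR_conv_of_real mult.commute)
    qed
  qed
  moreover have "(LINT x|T3. F x * complex_of_real (G n (circles x))) = 0" for n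
    by (rule integral_continuous_zero[OF F G])
  ultimately show ?thesis by (simp add: LIMSEQ_const_iff)
qed

text \<open>A function whose integrals over all open boxes vanish is zero almost everywhere: the
  sets over which the integral vanishes form a Dynkin system containing the boxes.\<close>

lemma AE_zero_if_box_integrals_zero:
  fixes f :: "real^3 \<Rightarrow> real"
  assumes f: "integrable lebesgue f" and tot: "integral\<^sup>L lebesgue f = 0"
    and box: "\<And>a b. (LINT x:box a b|lebesgue. f x) = 0"
  shows "AE x in lebesgue. f x = 0"
proof -
  have si: "set_integrable lebesgue A f" if "A \<in> sets lebesgue" for A
    unfolding set_integrable_def using f that by (rule integrable_mult_indicator[rotated])
  have borel: "(LINT x:A|lebesgue. f x) = 0" if "A \<in> sets borel" for A
  proof -
    have A: "A \<in> sigma_sets UNIV (range (\<lambda>(a, b). box a b))"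
      using that by (simp add: borel_eq_box)
    have st: "Int_stable (range (\<lambda>(a, b :: real^3). box a b))"
      by (auto simp: Int_stable_def box_Int_box)
    have sub: "range (\<lambda>(a, b :: real^3). box a b) \<subseteq> Pow UNIV" by simp
    from st sub A show ?thesis
    proof (induction A rule: sigma_sets_induct_disjoint)
      case (compl A)
      then have A: "A \<in> sets lebesgue" using sets_completionI_sets[of A lborel] by (simp add: borel_eq_box)
      have "(LINT x:UNIV - A|lebesgue. f x) = (LINT x|lebesgue. f x - indicator A x *\<^sub>R f x)"
        unfolding set_lebesgue_integral_def by (intro Bochner_Integration.integral_cong) (auto simp: indicator_def)
      also have "\<dots> = integral\<^sup>L lebesgue f - (LINT x:A|lebesgue. f x)"
        unfolding set_lebesgue_integral_def using f si[OF A]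
        by (intro Bochner_Integration.integral_diff) (auto simp: set_integrable_def)
      finally show ?case using compl tot by simp
    next
      case (union A)
      have A: "A i \<in> sets lebesgue" for i
      proof -
        have "A i \<in> sigma_sets UNIV (range (\<lambda>(a, b). box a b))" using union(2) by blast
        then show ?thesis using sets_completionI_sets[of "A i" lborel] by (simp add: borel_eq_box)
      qed
      have "(LINT x:(\<Union>i. A i)|lebesgue. f x) = (\<Sum>i. (LINT x:A i|lebesgue. f x))"
        using A union(1) by (intro lebesgue_integral_countable_add si) (auto simp: disjoint_family_on_def)
      then show ?case using union by simp
    next
      case (basic A)
      then show ?case using box by auto
    next
      case empty
      then show ?case by (simp add: set_lebesgue_integral_def)
    qed
  qed
  have "(LINT x:A|lebesgue. f x) = (LINT x:A|lebesgue. 0)" if Al: "A \<in> sets lebesgue" for A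
  proof -
    obtain S N N' where S: "A = S \<union> N" "N \<subseteq> N'" "N' \<in> null_sets lborel" "S \<in> sets lborel"
      using sets_completionE[OF Al] by metis
    have "N' \<in> null_sets lebesgue" using S(3) by (rule null_sets_completionI)
    then have "AE x in lebesgue. x \<notin> N'" by (rule AE_not_in)
    then have "AE x in lebesgue. indicator A x *\<^sub>R f x = indicator S x *\<^sub>R f x"
      by eventually_elim (use S in \<open>auto simp: indicator_def\<close>)
    then have "(LINT x:A|lebesgue. f x) = (LINT x:S|lebesgue. f x)"
      unfolding set_lebesgue_integral_def using f si[OF Al] si[of S] S(4)
      by (intro integral_cong_AE) (auto simp: set_integrable_def)
    then show ?thesis using borel[of S] S(4) by (simp add: set_lebesgue_integral_def)
  qed
  then show ?thesis
    by (intro density_unique_real f) auto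
qed

theorem fourier_unique:
  assumes F: "integrable T3 F" "\<And>k. cf F k = 0"
  shows "AE x in T3. F x = 0"
proof -
  define F' where "F' x = indicator (cbox 0 1) x *\<^sub>R F x" for x :: "real^3"
  have F': "integrable lebesgue F'"
    using F(1) unfolding F'_def by (subst (asm) integrable_restrict_space) auto
  have box: "(LINT x|lebesgue. indicator (box a b) x *\<^sub>R F' x) = 0" for a b
  proof -
    have "(LINT x|T3. indicator (box a b) x *\<^sub>R F x) = (LINT x|lebesgue. indicator (cbox 0 1) x *\<^sub>R (indicator (box a b) x *\<^sub>R F x))"
      by (rule integral_restrict_space) simp
    also have "\<dots> = (LINT x|lebesgue. indicator (box a b) x *\<^sub>R F' x)"
      by (simp add: F'_def mult.commute)
    finally show ?thesis using integral_box_zero[OF F] by simp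
  qed
  have tot: "integral\<^sup>L lebesgue F' = 0"
    unfolding F'_def using F(2)[of 0] by (subst integral_restrict_space[symmetric]) (auto simp: cf_def)
  have bi: "integrable lebesgue (\<lambda>x. indicator (box a b) x *\<^sub>R F' x)" for a b
    by (rule integrable_mult_indicator[OF _ F']) simp
  have "AE x in lebesgue. Re (F' x) = 0"
  proof (rule AE_zero_if_box_integrals_zero)
    show "integrable lebesgue (\<lambda>x. Re (F' x))" using F' by (rule integrable_Re)
    show "(LINT x|lebesgue. Re (F' x)) = 0" using integral_Re[OF F'] tot by simp
    show "(LINT x:box a b|lebesgue. Re (F' x)) = 0" for a b
      using integral_Re[OF bi[of a b]] box[of a b] by (simp add: set_lebesgue_integral_def)
  qed
  moreover have "AE x in lebesgue. Im (F' x) = 0"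
  proof (rule AE_zero_if_box_integrals_zero)
    show "integrable lebesgue (\<lambda>x. Im (F' x))" using F' by (rule integrable_Im)
    show "(LINT x|lebesgue. Im (F' x)) = 0" using integral_Im[OF F'] tot by simp
    show "(LINT x:box a b|lebesgue. Im (F' x)) = 0" for a b
      using integral_Im[OF bi[of a b]] box[of a b] by (simp add: set_lebesgue_integral_def)
  qed
  ultimately have "AE x in lebesgue. x \<in> cbox 0 1 \<longrightarrow> F x = 0"
    by eventually_elim (auto simp: F'_def complex_eq_iff)
  then show ?thesis by (subst AE_restrict_space_iff) auto
qed

subsection \<open>Bessel, Riesz--Fischer and Parseval\<close>

definition trig :: "(int^3 \<Rightarrow> complex) \<Rightarrow> (int^3) set \<Rightarrow> real^3 \<Rightarrow> complex" where
  "trig c F x = (\<Sum>k\<in>F. c k * char k x)"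

lemma L2_cmult: "f \<in> L2 \<Longrightarrow> (\<lambda>x. c * f x) \<in> L2" for f :: "real^3 \<Rightarrow> complex"
  by (rule L2_bounded_image[of f _ "cmod c"]) (auto simp: norm_mult dest!: L2D(1))

lemma L2_cnj: "f \<in> L2 \<Longrightarrow> (\<lambda>x. cnj (f x)) \<in> L2" for f :: "real^3 \<Rightarrow> complex"
  by (rule L2_bounded_image[of f _ 1]) (auto dest!: L2D(1) intro: borel_measurable_continuous_on[where f = cnj] continuous_intros)

lemma L2_trig: "trig c F \<in> L2"
  unfolding trig_def by (intro L2_sum L2_cmult L2_char)

lemma cf_trig:
  assumes "finite F"
  shows "cf (trig c F) k = (if k \<in> F then c k else 0)"
proof -
  have "cf (trig c F) k = (\<Sum>j\<in>F. cf (\<lambda>x. c j * char j x) k)"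
    unfolding trig_def by (intro cf_sum L2_integrable L2_cmult L2_char)
  also have "\<dots> = (\<Sum>j\<in>F. if j = k then c j else 0)"
    by (intro sum.cong) (auto simp: cf_cmult cf_char)
  finally show ?thesis using assms by simp
qed

lemma inner_trig:
  assumes f: "f \<in> L2"
  shows "(LINT x|T3. f x * cnj (trig c F x)) = (\<Sum>k\<in>F. cf f k * cnj (c k))"
proof -
  have "(LINT x|T3. f x * cnj (trig c F x)) = (LINT x|T3. (\<Sum>k\<in>F. cnj (c k) * (f x * char (- k) x)))"
    by (simp add: trig_def cnj_char sum_distrib_left mult_ac)
  also have "\<dots> = (\<Sum>k\<in>F. LINT x|T3. cnj (c k) * (f x * char (- k) x))"
    by (intro Bochner_Integration.integral_sum integrable_mult_right char_mult_integrable L2_integrable[OF f])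
  finally show ?thesis by (simp add: cf_def mult.commute)
qed

lemma norm_square_complex: "complex_of_real ((norm z)^2) = z * cnj z" for z :: complex
  by (simp add: complex_norm_square[symmetric])

lemma L2_energy_complex:
  fixes f :: "real^3 \<Rightarrow> complex"
  shows "complex_of_real (LINT x|T3. (norm (f x))^2) = (LINT x|T3. f x * cnj (f x))"
  unfolding norm_square_complex[symmetric] by (simp del: of_real_power)

lemma energy_trig:
  assumes "finite F"
  shows "(LINT x|T3. (norm (trig c F x))^2) = (\<Sum>k\<in>F. (norm (c k))^2)"
proof -
  have "complex_of_real (LINT x|T3. (norm (trig c F x))^2) = (\<Sum>k\<in>F. cf (trig c F) k * cnj (c k))"
    unfolding L2_energy_complex by (rule inner_trig[OF L2_trig])
  also have "\<dots> = complex_of_real (\<Sum>k\<in>F. (norm (c k))^2)"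
    by (simp add: cf_trig[OF assms] norm_square_complex del: of_real_power)
  finally show ?thesis by (simp only: of_real_eq_iff)
qed

lemma bessel:
  assumes f: "f \<in> L2" and F: "finite F"
  shows "(\<Sum>k\<in>F. (norm (cf f k))^2) \<le> (LINT x|T3. (norm (f x))^2)"
proof -
  define S where "S = trig (cf f) F"
  have S: "S \<in> L2" unfolding S_def by (rule L2_trig)
  have i: "integrable T3 (\<lambda>x. a x * cnj (b x))" if "a \<in> L2" "b \<in> L2" for a b :: "real^3 \<Rightarrow> complex"
    by (intro L2_mult_integrable L2_cnj that)
  have fS: "(LINT x|T3. f x * cnj (S x)) = complex_of_real (\<Sum>k\<in>F. (norm (cf f k))^2)"
    unfolding S_def inner_trig[OF f] by (simp add: norm_square_complex del: of_real_power)
  have "(LINT x|T3. S x * cnj (f x)) = cnj (LINT x|T3. f x * cnj (S x))"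
    by (subst Bochner_Integration.integral_cnj[symmetric]) (simp add: mult.commute)
  then have Sf: "(LINT x|T3. S x * cnj (f x)) = complex_of_real (\<Sum>k\<in>F. (norm (cf f k))^2)"
    unfolding fS by simp
  have SS: "(LINT x|T3. S x * cnj (S x)) = complex_of_real (\<Sum>k\<in>F. (norm (cf f k))^2)"
    unfolding L2_energy_complex[symmetric] S_def energy_trig[OF F] ..
  have "complex_of_real (LINT x|T3. (norm (f x - S x))^2) = (LINT x|T3. (f x - S x) * cnj (f x - S x))"
    by (rule L2_energy_complex)
  also have "\<dots> = (LINT x|T3. (f x * cnj (f x) - f x * cnj (S x)) - (S x * cnj (f x) - S x * cnj (S x)))"
    by (simp add: algebra_simps)
  also have "\<dots> = ((LINT x|T3. f x * cnj (f x)) - (LINT x|T3. f x * cnj (S x))) - ((LINT x|T3. S x * cnj (f x)) - (LINT x|T3. S x * cnj (S x)))"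
    by (simp only: Bochner_Integration.integral_diff Bochner_Integration.integrable_diff i f S)
  also have "\<dots> = complex_of_real ((LINT x|T3. (norm (f x))^2) - (\<Sum>k\<in>F. (norm (cf f k))^2))"
    unfolding fS Sf SS L2_energy_complex[symmetric] by simp
  finally have "(LINT x|T3. (norm (f x - S x))^2) = (LINT x|T3. (norm (f x))^2) - (\<Sum>k\<in>F. (norm (cf f k))^2)"
    by (simp only: of_real_eq_iff)
  moreover have "0 \<le> (LINT x|T3. (norm (f x - S x))^2)" by simp
  ultimately show ?thesis by simp
qed

lemma cf_is_l2:
  assumes f: "f \<in> L2"
  shows "is_l2 (\<lambda>k. norm (cf f k))" "(l2 (\<lambda>k. norm (cf f k)))^2 \<le> (LINT x|T3. (norm (f x))^2)"
proof -
  have 0: "0 \<le> (LINT x|T3. (norm (f x))^2)" by simp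
  have "(\<Sum>k\<in>F. (norm (cf f k))^2) \<le> (sqrt (LINT x|T3. (norm (f x))^2))^2" if "finite F" for F
    using bessel[OF f that] 0 by simp
  note s = is_l2I[OF this, OF _ real_sqrt_ge_zero[OF 0]]
  show "is_l2 (\<lambda>k. norm (cf f k))" by (rule s(1))
  have "(l2 (\<lambda>k. norm (cf f k)))^2 \<le> (sqrt (LINT x|T3. (norm (f x))^2))^2" by (intro power_mono s(2)) auto
  then show "(l2 (\<lambda>k. norm (cf f k)))^2 \<le> (LINT x|T3. (norm (f x))^2)" using 0 by simp
qed

text \<open>Partial sums over cubes whose tails decrease geometrically have absolutely summable increments
  almost everywhere; their pointwise sum is the desired function.\<close>

theorem riesz_fischer:
  fixes c :: "int^3 \<Rightarrow> complex"
  assumes c: "is_l2 (\<lambda>k. norm (c k))"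
  obtains f where "f \<in> L2" "\<And>k. cf f k = c k" "(LINT x|T3. (norm (f x))^2) \<le> (l2 (\<lambda>k. norm (c k)))^2"
proof -
  define L where "L = (l2 (\<lambda>k. norm (c k)))^2"
  have hs: "((\<lambda>k. (norm (c k))^2) has_sum L) UNIV"
    using c unfolding L_def l2_square is_l2_def by (rule has_sum_infsum)
  have "\<exists>N. \<forall>n\<ge>N. L - (\<Sum>k\<in>cube n. (norm (c k))^2) < (1/4) ^ i" for i :: nat
  proof -
    have "(\<lambda>n. L - (\<Sum>k\<in>cube n. (norm (c k))^2)) \<longlonglongrightarrow> L - L"
      by (intro tendsto_intros has_sum_cube_LIMSEQ hs)
    then have "\<forall>\<^sub>F n in sequentially. L - (\<Sum>k\<in>cube n. (norm (c k))^2) < (1/4) ^ i"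
      by (rule order_tendstoD) simp
    then show ?thesis by (simp add: eventually_sequentially)
  qed
  then obtain N where N: "\<And>i n. n \<ge> N i \<Longrightarrow> L - (\<Sum>k\<in>cube n. (norm (c k))^2) < (1/4) ^ i" by metis
  (* increasing, unbounded, and beyond the threshold N i *)
  define n where "n i = (\<Sum>m\<le>i. N m) + i" for i
  have nN: "N i \<le> n i" for i unfolding n_def using member_le_sum[of i "{..i}" N] by simp
  have ni: "i \<le> n i" for i by (simp add: n_def)
  have nS: "n i \<le> n (Suc i)" for i by (simp add: n_def)
  define g where "g i = trig c (cube (n i))" for i
  define d where "d i = trig c (cube (n (Suc i)) - cube (n i))" for i
  have gd: "g (Suc i) x = g i x + d i x" for i x
    unfolding g_def d_def trig_def
    using cube_mono[OF nS[of i]] by (subst sum.subset_diff[of "cube (n i)"]) auto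
  have gsum: "g m x = g 0 x + (\<Sum>i<m. d i x)" for m x
    by (induction m) (simp_all add: gd)
  have dL2: "d i \<in> L2" and gL2: "g i \<in> L2" for i unfolding d_def g_def by (rule L2_trig)+
  have dE: "(LINT x|T3. (norm (d i x))^2) \<le> (1/4) ^ i" for i
  proof -
    have "(LINT x|T3. (norm (d i x))^2) = (\<Sum>k\<in>cube (n (Suc i)) - cube (n i). (norm (c k))^2)"
      unfolding d_def by (rule energy_trig) simp
    also have "\<dots> = (\<Sum>k\<in>cube (n (Suc i)). (norm (c k))^2) - (\<Sum>k\<in>cube (n i). (norm (c k))^2)"
      using cube_mono[OF nS[of i]] by (simp add: sum_diff)
    also have "(\<Sum>k\<in>cube (n (Suc i)). (norm (c k))^2) \<le> L"
      by (rule finite_sum_le_has_sum[OF hs]) auto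
    also have "L - (\<Sum>k\<in>cube (n i). (norm (c k))^2) \<le> (1/4) ^ i" using N[OF nN[of i]] by simp
    finally show ?thesis by simp
  qed
  have dI: "(LINT x|T3. norm (d i x)) \<le> (1/2) ^ i" for i
  proof -
    have "(LINT x|T3. norm (d i x)) \<le> (LINT x|T3. (1/2) * (1/2) ^ i + (1/2) * 2 ^ i * (norm (d i x))^2)"
    proof (rule integral_mono)
      show "integrable T3 (\<lambda>x. norm (d i x))" using L2_integrable[OF dL2] by auto
      show "integrable T3 (\<lambda>x. (1/2) * (1/2) ^ i + (1/2) * 2 ^ i * (norm (d i x))^2)"
        using L2D(2)[OF dL2[of i]] integrable_T3_bounded[of "\<lambda>_. (1/2) * (1/2) ^ i :: real" "(1/2) * (1/2) ^ i"] by auto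
      fix x
      define q :: real where "q = 2 ^ i"
      have q: "q > 0" "(1/2) ^ i = 1 / q" by (auto simp: q_def power_one_over)
      have "0 \<le> (1 - q * norm (d i x))^2 / q" using q by simp
      also have "\<dots> = 1 / q - 2 * norm (d i x) + q * (norm (d i x))^2"
        using q by (simp add: power2_eq_square field_simps)
      finally show "norm (d i x) \<le> (1/2) * (1/2) ^ i + (1/2) * 2 ^ i * (norm (d i x))^2"
        unfolding q(2) q_def[symmetric] by simp
    qed
    also have "\<dots> = (1/2) * (1/2) ^ i + (1/2) * 2 ^ i * (LINT x|T3. (norm (d i x))^2)"
      using L2D(2)[OF dL2[of i]] integrable_T3_bounded[of "\<lambda>_. (1/2) * (1/2) ^ i :: real" "(1/2) * (1/2) ^ i"]
      by (subst Bochner_Integration.integral_add) auto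
    also have "\<dots> \<le> (1/2) * (1/2) ^ i + (1/2) * 2 ^ i * (1/4) ^ i"
      by (intro add_left_mono mult_left_mono dE) auto
    also have "(1/2) * 2 ^ i * (1/4 :: real) ^ i = (1/2) * (1/2) ^ i"
      by (simp add: power_mult_distrib[symmetric])
    finally show ?thesis by simp
  qed
  have sumI: "summable (\<lambda>i. LINT x|T3. norm (d i x))"
    by (rule summable_comparison_test'[OF summable_geometric[of "1/2::real"], of 0])
       (use dI in \<open>auto simp: integral_nonneg_AE\<close>)
  have AEs: "AE x in T3. summable (\<lambda>i. norm (d i x))"
  proof -
    have "(\<integral>\<^sup>+x. (\<Sum>i. ennreal (norm (d i x))) \<partial>T3) = (\<Sum>i. \<integral>\<^sup>+x. ennreal (norm (d i x)) \<partial>T3)"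
      using L2D(1)[OF dL2] by (intro nn_integral_suminf) measurable
    also have "\<dots> = (\<Sum>i. ennreal (LINT x|T3. norm (d i x)))"
      using L2_integrable[OF dL2] by (intro suminf_cong nn_integral_eq_integral) auto
    also have "\<dots> < \<infinity>"
      using sumI by (subst suminf_ennreal2) (auto simp: integral_nonneg_AE)
    finally have "AE x in T3. (\<Sum>i. ennreal (norm (d i x))) \<noteq> \<infinity>"
      using L2D(1)[OF dL2] by (intro nn_integral_noteq_infinite) auto
    then show ?thesis
      by eventually_elim (auto intro: summable_suminf_not_top)
  qed
  define f where "f x = g 0 x + (\<Sum>i. d i x)" for x
  have id: "integrable T3 (d i)" "integrable T3 (g i)" for i by (rule L2_integrable[OF dL2], rule L2_integrable[OF gL2])
  have isum: "integrable T3 (\<lambda>x. \<Sum>i. d i x)" by (rule integrable_suminf[OF id(1) AEs sumI])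
  have fint: "integrable T3 f" unfolding f_def by (intro Bochner_Integration.integrable_add id isum)
  have lim: "AE x in T3. (\<lambda>m. g m x) \<longlonglongrightarrow> f x"
    using AEs
  proof eventually_elim
    case (elim x)
    then have "(\<lambda>m. \<Sum>i<m. d i x) \<longlonglongrightarrow> (\<Sum>i. d i x)" by (rule summable_LIMSEQ[OF summable_norm_cancel])
    then have "(\<lambda>m. g 0 x + (\<Sum>i<m. d i x)) \<longlonglongrightarrow> f x" unfolding f_def by (intro tendsto_intros)
    moreover have "(\<lambda>m. g m x) = (\<lambda>m. g 0 x + (\<Sum>i<m. d i x))" by (rule ext) (rule gsum)
    ultimately show ?case by simp
  qed
  have coef: "cf f k = c k" for k
  proof -
    have s: "(\<lambda>i. LINT x|T3. d i x * char (- k) x) sums (LINT x|T3. (\<Sum>i. d i x * char (- k) x))"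
      using AEs sumI by (intro sums_integral char_mult_integrable id) (auto simp: norm_mult)
    have e: "AE x in T3. (\<Sum>i. d i x * char (- k) x) = (\<Sum>i. d i x) * char (- k) x"
      using AEs by eventually_elim (simp add: suminf_mult2[symmetric] summable_norm_cancel)
    have "(LINT x|T3. (\<Sum>i. d i x * char (- k) x)) = cf (\<lambda>x. \<Sum>i. d i x) k"
      unfolding cf_def
    proof (rule integral_cong_AE[OF _ _ e])
      show "(\<lambda>x. \<Sum>i. d i x * char (- k) x) \<in> borel_measurable T3"
        by (intro borel_measurable_suminf borel_measurable_integrable char_mult_integrable id)
      show "(\<lambda>x. (\<Sum>i. d i x) * char (- k) x) \<in> borel_measurable T3"
        by (intro borel_measurable_integrable char_mult_integrable isum)
    qed
    with s have "(\<lambda>i. cf (d i) k) sums cf (\<lambda>x. \<Sum>i. d i x) k" by (simp add: cf_def)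
    then have "(\<lambda>m. \<Sum>i<m. cf (d i) k) \<longlonglongrightarrow> cf (\<lambda>x. \<Sum>i. d i x) k" by (simp add: sums_def)
    then have "(\<lambda>m. cf (g 0) k + (\<Sum>i<m. cf (d i) k)) \<longlonglongrightarrow> cf (g 0) k + cf (\<lambda>x. \<Sum>i. d i x) k"
      by (intro tendsto_intros)
    also have "cf (g 0) k + cf (\<lambda>x. \<Sum>i. d i x) k = cf f k"
      unfolding f_def by (rule cf_add[symmetric, OF id(2) isum])
    also have "(\<lambda>m. cf (g 0) k + (\<Sum>i<m. cf (d i) k)) = (\<lambda>m. cf (g m) k)"
    proof
      fix m
      have "g m = (\<lambda>x. g 0 x + (\<Sum>i<m. d i x))" by (rule ext) (rule gsum)
      then have "cf (g m) k = cf (\<lambda>x. g 0 x + (\<Sum>i<m. d i x)) k" by (rule arg_cong[where f = "\<lambda>z. cf z k"])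
      also have "\<dots> = cf (g 0) k + cf (\<lambda>x. \<Sum>i<m. d i x) k"
        by (intro cf_add id Bochner_Integration.integrable_sum)
      also have "cf (\<lambda>x. \<Sum>i<m. d i x) k = (\<Sum>i<m. cf (d i) k)" by (intro cf_sum id)
      finally show "cf (g 0) k + (\<Sum>i<m. cf (d i) k) = cf (g m) k" by simp
    qed
    finally have 1: "(\<lambda>m. cf (g m) k) \<longlonglongrightarrow> cf f k" .
    obtain M where M: "\<And>n. n \<ge> M \<Longrightarrow> {k} \<subseteq> cube n" using finite_subset_cube[of "{k}"] by auto
    have "cf (g m) k = c k" if "m \<ge> M" for m
      using M[of "n m"] ni[of m] that by (simp add: g_def cf_trig)
    then have "(\<lambda>m. cf (g m) k) \<longlonglongrightarrow> c k"
      by (intro tendsto_eventually) (auto simp: eventually_sequentially)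
    with 1 show ?thesis by (rule LIMSEQ_unique)
  qed
  have fm: "f \<in> borel_measurable T3" using fint by (rule borel_measurable_integrable)
  have bound: "(\<integral>\<^sup>+x. ennreal ((norm (f x))^2) \<partial>T3) \<le> ennreal L"
  proof -
    have "(\<integral>\<^sup>+x. ennreal ((norm (f x))^2) \<partial>T3) = (\<integral>\<^sup>+x. liminf (\<lambda>m. ennreal ((norm (g m x))^2)) \<partial>T3)"
    proof (rule nn_integral_cong_AE)
      show "AE x in T3. ennreal ((norm (f x))^2) = liminf (\<lambda>m. ennreal ((norm (g m x))^2))"
        using lim
      proof eventually_elim
        case (elim x)
        have "(\<lambda>m. ennreal ((norm (g m x))^2)) \<longlonglongrightarrow> ennreal ((norm (f x))^2)"
          by (intro tendsto_intros elim)
        then show ?case by (intro lim_imp_Liminf[symmetric]) auto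
      qed
    qed
    also have "\<dots> \<le> liminf (\<lambda>m. \<integral>\<^sup>+x. ennreal ((norm (g m x))^2) \<partial>T3)"
      using L2D(1)[OF gL2] by (intro nn_integral_liminf) measurable
    also have "\<dots> \<le> ennreal L"
    proof (rule Liminf_le)
      have "(\<integral>\<^sup>+x. ennreal ((norm (g m x))^2) \<partial>T3) \<le> ennreal L" for m
      proof -
        have "(\<integral>\<^sup>+x. ennreal ((norm (g m x))^2) \<partial>T3) = ennreal (LINT x|T3. (norm (g m x))^2)"
          using L2D(2)[OF gL2] by (intro nn_integral_eq_integral) auto
        also have "(LINT x|T3. (norm (g m x))^2) = (\<Sum>k\<in>cube (n m). (norm (c k))^2)"
          unfolding g_def by (rule energy_trig) simp
        also have "ennreal \<dots> \<le> ennreal L"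
          by (intro ennreal_leI finite_sum_le_has_sum[OF hs]) auto
        finally show ?thesis .
      qed
      then show "\<forall>\<^sub>F m in sequentially. (\<integral>\<^sup>+x. ennreal ((norm (g m x))^2) \<partial>T3) \<le> ennreal L" by simp
    qed simp
    finally show ?thesis .
  qed
  have L0: "0 \<le> L" by (simp add: L_def)
  have i2: "integrable T3 (\<lambda>x. (norm (f x))^2)"
  proof (rule integrableI_bounded)
    show "(\<lambda>x. (norm (f x))^2) \<in> borel_measurable T3" using fm by measurable
    show "(\<integral>\<^sup>+x. ennreal (norm ((norm (f x))^2)) \<partial>T3) < \<infinity>"
      using bound by (simp add: order_le_less_trans)
  qed
  have "ennreal (LINT x|T3. (norm (f x))^2) \<le> ennreal L"
    using bound by (subst nn_integral_eq_integral[symmetric, OF i2]) auto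
  then have "(LINT x|T3. (norm (f x))^2) \<le> L" using L0 by (simp add: ennreal_le_iff)
  moreover have "f \<in> L2" using fm i2 by (simp add: L2_def)
  ultimately show thesis using coef that by (auto simp: L_def)
qed

lemma L2_unique:
  fixes f g :: "real^3 \<Rightarrow> complex"
  assumes "f \<in> L2" "g \<in> L2" "\<And>k. cf f k = cf g k"
  shows "AE x in T3. f x = g x"
proof -
  have "AE x in T3. f x - g x = 0"
  proof (rule fourier_unique)
    show "integrable T3 (\<lambda>x. f x - g x)" by (intro Bochner_Integration.integrable_diff L2_integrable assms)
    show "cf (\<lambda>x. f x - g x) k = 0" for k
      by (subst cf_diff) (simp_all add: L2_integrable assms)
  qed
  then show ?thesis by simp
qed

lemma parseval_norm:
  fixes f :: "real^3 \<Rightarrow> complex"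
  assumes f: "f \<in> L2"
  shows "(LINT x|T3. (norm (f x))^2) = (l2 (\<lambda>k. norm (cf f k)))^2"
proof -
  obtain g where g: "g \<in> L2" "\<And>k. cf g k = cf f k" "(LINT x|T3. (norm (g x))^2) \<le> (l2 (\<lambda>k. norm (cf f k)))^2"
    using riesz_fischer[OF cf_is_l2(1)[OF f]] by metis
  have "AE x in T3. f x = g x" using f g by (intro L2_unique) auto
  then have "(LINT x|T3. (norm (f x))^2) = (LINT x|T3. (norm (g x))^2)"
    using L2D[OF f] L2D[OF g(1)] by (intro integral_cong_AE) auto
  with g(3) cf_is_l2(2)[OF f] show ?thesis by linarith
qed

lemma parseval_norm_has_sum:
  fixes f :: "real^3 \<Rightarrow> complex"
  assumes f: "f \<in> L2"
  shows "((\<lambda>k. complex_of_real ((norm (cf f k))^2)) has_sum complex_of_real (LINT x|T3. (norm (f x))^2)) UNIV"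
  unfolding parseval_norm[OF f] l2_square
  using cf_is_l2(1)[OF f] unfolding is_l2_def
  by (intro has_sum_of_real has_sum_infsum)

text \<open>Polarization extends Parseval from norms to inner products.\<close>

lemma complex_polarization:
  fixes a b :: complex
  shows "a * cnj b = (1/4) * complex_of_real ((norm (a + b))^2) + (-1/4) * complex_of_real ((norm (a + -1 * b))^2)
    + (\<i>/4) * complex_of_real ((norm (a + \<i> * b))^2) + (-\<i>/4) * complex_of_real ((norm (a + -\<i> * b))^2)"
  unfolding norm_square_complex by (simp add: algebra_simps)

theorem parseval:
  fixes f g :: "real^3 \<Rightarrow> complex"
  assumes f: "f \<in> L2" and g: "g \<in> L2"
  shows "((\<lambda>k. cf f k * cnj (cf g k)) has_sum (LINT x|T3. f x * cnj (g x))) UNIV"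
proof -
  define P where "P w = (\<lambda>x. f x + w * g x)" for w
  have P: "P w \<in> L2" for w unfolding P_def by (intro L2_add L2_cmult f g)
  have cP: "cf (P w) k = cf f k + w * cf g k" for w k
    unfolding P_def by (subst cf_add) (auto simp: cf_cmult intro!: L2_integrable L2_cmult f g)
  define N where "N w = complex_of_real (LINT x|T3. (norm (P w x))^2)" for w
  have hN: "((\<lambda>k. complex_of_real ((norm (cf f k + w * cf g k))^2)) has_sum N w) UNIV" for w
    using parseval_norm_has_sum[OF P[of w]] by (simp add: cP N_def)
  have "((\<lambda>k. cf f k * cnj (cf g k)) has_sum ((1/4) * N 1 + (-1/4) * N (-1) + (\<i>/4) * N \<i> + (-\<i>/4) * N (-\<i>))) UNIV"
    unfolding complex_polarization[of "cf f _" "cf g _"]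
    using hN[of 1] by (intro has_sum_add has_sum_cmult_right hN) simp
  moreover have "(LINT x|T3. f x * cnj (g x)) = (1/4) * N 1 + (-1/4) * N (-1) + (\<i>/4) * N \<i> + (-\<i>/4) * N (-\<i>)"
  proof -
    have i: "integrable T3 (\<lambda>x. complex_of_real ((norm (P w x))^2))" for w
      using L2D(2)[OF P[of w]] by (rule integrable_of_real)
    have "(LINT x|T3. f x * cnj (g x)) = (LINT x|T3. (1/4) * complex_of_real ((norm (P 1 x))^2) + (-1/4) * complex_of_real ((norm (P (-1) x))^2)
      + (\<i>/4) * complex_of_real ((norm (P \<i> x))^2) + (-\<i>/4) * complex_of_real ((norm (P (-\<i>) x))^2))"
      by (subst complex_polarization) (simp add: P_def)
    also have "\<dots> = (1/4) * N 1 + (-1/4) * N (-1) + (\<i>/4) * N \<i> + (-\<i>/4) * N (-\<i>)"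
      unfolding N_def
      by (simp only: integral_complex_of_real Bochner_Integration.integral_add Bochner_Integration.integrable_add integrable_mult_right integral_mult_right_zero i)
    finally show ?thesis .
  qed
  ultimately show ?thesis by simp
qed

subsection \<open>Real functions and vector fields\<close>

lemma L2_of_real: "g \<in> L2 \<Longrightarrow> (\<lambda>x. complex_of_real (g x)) \<in> L2" for g :: "real^3 \<Rightarrow> real"
  by (rule L2_bounded_image[of g _ 1]) (auto dest: L2D(1))

lemma fourier_coeff_minus: "fourier_coeff g (- k) = cnj (fourier_coeff g k)"
  unfolding fourier_coeff_cf using cf_cnj[of "\<lambda>x. complex_of_real (g x)" "- k"] by simp

lemma fourier_coeff_add:
  "f \<in> L2 \<Longrightarrow> g \<in> L2 \<Longrightarrow> fourier_coeff (\<lambda>x. f x + g x) k = fourier_coeff f k + fourier_coeff g k"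
  unfolding fourier_coeff_cf by (simp add: cf_add L2_integrable L2_of_real)

lemma fourier_coeff_cmult: "fourier_coeff (\<lambda>x. c * f x) k = of_real c * fourier_coeff f k"
  unfolding fourier_coeff_cf by (simp add: cf_cmult)

lemma fourier_coeff_sum:
  "(\<And>i. i \<in> I \<Longrightarrow> f i \<in> L2) \<Longrightarrow> fourier_coeff (\<lambda>x. \<Sum>i\<in>I. f i x) k = (\<Sum>i\<in>I. fourier_coeff (f i) k)"
  unfolding fourier_coeff_cf by (simp add: cf_sum L2_integrable L2_of_real)

lemma fourier_coeff_diff:
  "f \<in> L2 \<Longrightarrow> g \<in> L2 \<Longrightarrow> fourier_coeff (\<lambda>x. f x - g x) k = fourier_coeff f k - fourier_coeff g k"
  unfolding fourier_coeff_cf by (simp add: cf_diff L2_integrable L2_of_real)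

lemma real_L2_unique:
  assumes "f \<in> L2" "g \<in> L2" "\<And>k. fourier_coeff f k = fourier_coeff g k"
  shows "AE x in T3. f x = (g x :: real)"
  using L2_unique[OF L2_of_real[OF assms(1)] L2_of_real[OF assms(2)]] assms(3)
  by (simp add: fourier_coeff_cf)

text \<open>The symmetry of the coefficients makes the real part of the complex solution a
  solution.\<close>

lemma real_riesz_fischer:
  assumes c: "is_l2 (\<lambda>k. norm (c k))" and sym: "\<And>k. c (- k) = cnj (c k)"
  obtains h :: "real^3 \<Rightarrow> real" where "h \<in> L2" "\<And>k. fourier_coeff h k = c k"
proof -
  obtain f where f: "f \<in> L2" "\<And>k. cf f k = c k" using riesz_fischer[OF c] by metis
  have "(\<lambda>x. Re (f x)) \<in> L2"
    by (rule L2_bounded_image[OF f(1), of _ 1]) (use L2D(1)[OF f(1)] abs_Re_le_cmod in \<open>auto\<close>)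
  moreover have "fourier_coeff (\<lambda>x. Re (f x)) k = c k" for k
  proof -
    have e: "complex_of_real (Re z) = (1/2) * z + (1/2) * cnj z" for z by (simp add: complex_eq_iff)
    have "fourier_coeff (\<lambda>x. Re (f x)) k = (1/2) * cf f k + (1/2) * cnj (cf f (- k))"
    proof -
      have "cf (\<lambda>x. (1/2) * f x + (1/2) * cnj (f x)) k = cf (\<lambda>x. (1/2) * f x) k + cf (\<lambda>x. (1/2) * cnj (f x)) k"
        by (intro cf_add L2_integrable L2_cmult L2_cnj f(1))
      then show ?thesis unfolding fourier_coeff_cf e cf_cmult cf_cnj .
    qed
    then show ?thesis by (simp add: f sym)
  qed
  ultimately show thesis by (rule that)
qed

lemma real_parseval:
  assumes f: "f \<in> L2" and g: "g \<in> L2"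
  shows "((\<lambda>k. fourier_coeff f k \<bullet> fourier_coeff g k) has_sum (LINT x|T3. f x * g x)) UNIV"
proof -
  have "((\<lambda>k. fourier_coeff f k * cnj (fourier_coeff g k)) has_sum (LINT x|T3. complex_of_real (f x * g x))) UNIV"
    using parseval[OF L2_of_real[OF f] L2_of_real[OF g]] by (simp add: fourier_coeff_cf)
  from has_sum_Re[OF this[unfolded integral_complex_of_real]] show ?thesis unfolding inner_complex by simp
qed

text \<open>Parseval for \<open>f\<close> and the modulated function \<open>g * char k\<close>.\<close>

lemma fourier_coeff_mult:
  assumes f: "f \<in> L2" and g: "g \<in> L2"
  shows "((\<lambda>j. fourier_coeff f j * fourier_coeff g (k - j)) has_sum fourier_coeff (\<lambda>x. f x * g x) k) UNIV"
proof -
  define h where "h x = complex_of_real (g x) * char k x" for x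
  have h: "h \<in> L2" unfolding h_def
    by (rule L2_bounded_image[OF L2_of_real[OF g], of _ 1])
       (use L2D(1)[OF L2_of_real[OF g]] measurable_char[of k] in \<open>auto simp: norm_mult intro!: borel_measurable_times\<close>)
  have "cnj (cf h j) = fourier_coeff g (k - j)" for j
  proof -
    have "cf h j = fourier_coeff g (- (k - j))" unfolding h_def cf_mult_char fourier_coeff_cf by simp
    then show ?thesis unfolding fourier_coeff_minus by simp
  qed
  moreover have "(LINT x|T3. complex_of_real (f x) * cnj (h x)) = fourier_coeff (\<lambda>x. f x * g x) k"
    unfolding fourier_coeff_cf cf_def by (simp add: h_def cnj_char mult.assoc)
  ultimately show ?thesis
    using parseval[OF L2_of_real[OF f] h] by (simp add: fourier_coeff_cf)
qed

lemma L2_component: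
  fixes u :: "real^3 \<Rightarrow> 'a::euclidean_space^'n"
  assumes "u \<in> L2"
  shows "(\<lambda>x. u x $ i) \<in> L2"
proof (rule L2_bounded_image[OF assms, of _ 1])
  show "(\<lambda>x. u x $ i) \<in> borel_measurable T3"
    by (rule borel_measurable_continuous_on[OF _ L2D(1)[OF assms]]) (intro continuous_intros)
  show "norm (u x $ i) \<le> 1 * norm (u x)" for x using Finite_Cartesian_Product.norm_nth_le[of "u x" i] by simp
qed

lemma L2_vecI:
  fixes u :: "real^3 \<Rightarrow> 'a::euclidean_space^'n"
  assumes "\<And>i. (\<lambda>x. u x $ i) \<in> L2"
  shows "u \<in> L2"
proof -
  have "(\<lambda>x. axis i (u x $ i)) \<in> L2" for i
  proof (rule L2_bounded_image[OF assms[of i], of _ 1])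
    have "continuous_on UNIV (axis i :: 'a \<Rightarrow> 'a^'n)"
      unfolding axis_def
    proof (rule continuous_on_vec_lambda)
      fix j show "continuous_on UNIV (\<lambda>x::'a. if j = i then x else 0)" by (cases "j = i") auto
    qed
    then show "(\<lambda>x. axis i (u x $ i)) \<in> borel_measurable T3"
      by (rule borel_measurable_continuous_on[OF _ L2D(1)[OF assms[of i]]])
    show "norm (axis i (u x $ i) :: 'a^'n) \<le> 1 * norm (u x $ i)" for x
    proof -
      have "(\<Sum>j\<in>UNIV. (norm (if j = i then u x $ i else 0))^2) = (\<Sum>j\<in>UNIV. if j = i then (norm (u x $ i))^2 else 0)"
        by (intro sum.cong) auto
      then show ?thesis by (simp add: norm_vec_def L2_set_def axis_def)
    qed
  qed
  then have "(\<lambda>x. \<Sum>i\<in>UNIV. axis i (u x $ i)) \<in> L2" by (intro L2_sum)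
  moreover have "(\<Sum>i\<in>UNIV. axis i (u x $ i)) = u x" for x
    by (auto simp: vec_eq_iff sum_component axis_def if_distrib sum.delta cong: if_cong)
  ultimately show ?thesis by simp
qed

definition vcoef :: "(real^3 \<Rightarrow> real^3) \<Rightarrow> int^3 \<Rightarrow> complex^3" where
  "vcoef u k = (\<chi> i. fourier_coeff (\<lambda>x. u x $ i) k)"

lemma vcoef_minus: "vcoef u (- k) = vcnj (vcoef u k)"
  by (simp add: vcoef_def vcnj_def fourier_coeff_minus)

lemma vcoef_diff: "u \<in> L2 \<Longrightarrow> v \<in> L2 \<Longrightarrow> vcoef (\<lambda>x. u x - v x) k = vcoef u k - vcoef v k"
  by (simp add: vcoef_def vec_eq_iff fourier_coeff_diff L2_component)

lemma vcoef_scaleR: "vcoef (\<lambda>x. t *\<^sub>R u x) k = t *\<^sub>R vcoef u k"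
  by (simp add: vcoef_def vec_eq_iff fourier_coeff_cmult scaleR_conv_of_real[where 'a = complex])

lemma norm_vcoef_square: "(norm (vcoef u k))^2 = (\<Sum>i\<in>UNIV. (cmod (fourier_coeff (\<lambda>x. u x $ i) k))^2)"
  by (simp add: norm_vec_def L2_set_def vcoef_def sum_nonneg)

lemma has_sum_finite_sum:
  fixes f :: "'i \<Rightarrow> 'a \<Rightarrow> 'b::topological_comm_monoid_add"
  assumes "finite I" "\<And>i. i \<in> I \<Longrightarrow> (f i has_sum s i) A"
  shows "((\<lambda>x. \<Sum>i\<in>I. f i x) has_sum (\<Sum>i\<in>I. s i)) A"
  using assms by (induction I rule: finite_induct) (simp_all add: has_sum_add)

lemma L2_inner_has_sum:
  assumes u: "u \<in> L2" and v: "v \<in> L2"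
  shows "((\<lambda>k. vcoef u k \<bullet> vcoef v k) has_sum L2_inner u v) UNIV"
proof -
  have "((\<lambda>k. \<Sum>i\<in>UNIV. fourier_coeff (\<lambda>x. u x $ i) k \<bullet> fourier_coeff (\<lambda>x. v x $ i) k) has_sum
      (\<Sum>i\<in>UNIV. LINT x|T3. u x $ i * v x $ i)) UNIV"
    by (intro has_sum_finite_sum real_parseval L2_component u v) simp
  moreover have "(\<Sum>i\<in>UNIV. LINT x|T3. u x $ i * v x $ i) = L2_inner u v"
    unfolding L2_inner_def inner_vec_def inner_real_def
    by (intro Bochner_Integration.integral_sum[symmetric] L2_mult_integrable L2_component u v)
  ultimately show ?thesis by (simp add: inner_vec_def vcoef_def)
qed

lemma vcoef_is_l2:
  assumes u: "u \<in> L2"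
  shows "is_l2 (\<lambda>k. norm (vcoef u k))"
  using L2_inner_has_sum[OF u u] unfolding is_l2_def
  by (simp add: power2_norm_eq_inner has_sum_imp_summable)

lemma L2_norm_vcoef:
  assumes u: "u \<in> L2"
  shows "L2_norm u = l2 (\<lambda>k. norm (vcoef u k))"
proof -
  have "(LINT x|T3. (norm (u x))^2) = L2_inner u u"
    by (simp add: L2_inner_def power2_norm_eq_inner)
  also have "\<dots> = infsum (\<lambda>k. (norm (vcoef u k))^2) UNIV"
    using L2_inner_has_sum[OF u u] by (simp add: power2_norm_eq_inner has_sum_iff)
  finally show ?thesis by (simp add: L2_norm_def l2_def)
qed

lemma vcoef_unique:
  assumes "u \<in> L2" "v \<in> L2" "\<And>k. vcoef u k = vcoef v k"
  shows "AE x in T3. u x = v x"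
proof -
  have "AE x in T3. u x $ i = v x $ i" for i
    using assms by (intro real_L2_unique L2_component) (auto simp: vcoef_def vec_eq_iff)
  then have "AE x in T3. \<forall>i\<in>UNIV. u x $ i = v x $ i" by (subst AE_ball_countable) auto
  then show ?thesis by eventually_elim (simp add: vec_eq_iff)
qed

lemma vcoef_cong_AE:
  assumes "u \<in> L2" "v \<in> L2" "AE x in T3. u x = v x"
  shows "vcoef u k = vcoef v k"
proof -
  have "fourier_coeff (\<lambda>x. u x $ i) k = fourier_coeff (\<lambda>x. v x $ i) k" for i
  proof -
    have "AE x in T3. complex_of_real (u x $ i) * char (- k) x = complex_of_real (v x $ i) * char (- k) x"
      using assms(3) by eventually_elim simp
    then show ?thesis unfolding fourier_coeff_cf cf_def
      using char_mult_integrable[OF L2_integrable[OF L2_of_real[OF L2_component[OF assms(1)]]], of i "- k"]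
        char_mult_integrable[OF L2_integrable[OF L2_of_real[OF L2_component[OF assms(2)]]], of i "- k"]
      by (intro integral_cong_AE) (auto dest: borel_measurable_integrable)
  qed
  then show ?thesis by (simp add: vcoef_def)
qed

text \<open>The coefficients determine the field up to null sets, so any choice of a representative will do.\<close>

definition synth :: "(int^3 \<Rightarrow> complex^3) \<Rightarrow> real^3 \<Rightarrow> real^3" where
  "synth c = (SOME u. u \<in> L2 \<and> (\<forall>k. vcoef u k = c k))"

lemma synth:
  assumes c: "is_l2 (\<lambda>k. norm (c k))" and sym: "\<And>k. c (- k) = vcnj (c k)"
  shows "synth c \<in> L2" "vcoef (synth c) k = c k"
proof -
  have "\<exists>h. h \<in> L2 \<and> (\<forall>k. fourier_coeff h k = c k $ i)" for i
  proof -
    have "is_l2 (\<lambda>k. norm (c k $ i))"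
      by (rule is_l2_comparison(1)[OF c]) (simp add: Finite_Cartesian_Product.norm_nth_le)
    then show ?thesis by (rule real_riesz_fischer) (auto simp: sym vcnj_def)
  qed
  then obtain h where h: "\<And>i. h i \<in> L2" "\<And>i k. fourier_coeff (h i) k = c k $ i" by metis
  have "(\<lambda>x. \<chi> i. h i x) \<in> L2 \<and> (\<forall>k. vcoef (\<lambda>x. \<chi> i. h i x) k = c k)"
    by (auto intro!: L2_vecI simp: h vcoef_def vec_eq_iff)
  then have "synth c \<in> L2 \<and> (\<forall>k. vcoef (synth c) k = c k)"
    unfolding synth_def by (rule someI[where P = "\<lambda>u. u \<in> L2 \<and> (\<forall>k. vcoef u k = c k)"])
  then show "synth c \<in> L2" "vcoef (synth c) k = c k" by auto
qed

subsection \<open>Multipliers and Sobolev norms\<close>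

lemma fourier_mult_spec:
  assumes s: "is_l2 (\<lambda>k. norm (m k * fourier_coeff g k))" and m: "\<And>k. m (- k) = cnj (m k)"
  shows "fourier_mult m g \<in> L2" "fourier_coeff (fourier_mult m g) k = m k * fourier_coeff g k"
proof -
  obtain h where "h \<in> L2" "\<And>k. fourier_coeff h k = m k * fourier_coeff g k"
    by (rule real_riesz_fischer[OF s]) (auto simp: m fourier_coeff_minus)
  then have "is_multiplied m g h" by (simp add: is_multiplied_def)
  then have "is_multiplied m g (fourier_mult m g)" unfolding fourier_mult_def by (rule someI[where P = "is_multiplied m g"])
  then show "fourier_mult m g \<in> L2" "fourier_coeff (fourier_mult m g) k = m k * fourier_coeff g k"
    by (auto simp: is_multiplied_def)
qed

lemma vec_mult_spec:
  assumes s: "is_l2 (\<lambda>k. norm (m k *s vcoef u k))" and m: "\<And>k. m (- k) = cnj (m k)"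
  shows "vec_mult m u \<in> L2" "vcoef (vec_mult m u) k = m k *s vcoef u k"
proof -
  have "is_l2 (\<lambda>k. norm (m k * fourier_coeff (\<lambda>x. u x $ i) k))" for i
  proof (rule is_l2_comparison(1)[OF s])
    show "\<bar>norm (m k * fourier_coeff (\<lambda>x. u x $ i) k)\<bar> \<le> norm (m k *s vcoef u k)" for k
      using Finite_Cartesian_Product.norm_nth_le[of "m k *s vcoef u k" i] by (simp add: vcoef_def)
  qed
  note f = fourier_mult_spec[OF this m]
  show "vec_mult m u \<in> L2" by (rule L2_vecI) (simp add: vec_mult_def f)
  show "vcoef (vec_mult m u) k = m k *s vcoef u k" by (simp add: vec_mult_def vcoef_def f vec_eq_iff)
qed

lemma sobolev_term_vcoef: "sobolev_term s u k = (1 + (kn k)^2) powr s * (norm (vcoef u k))^2"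
  by (simp add: sobolev_term_def norm_vcoef_square)

lemma one_plus_square_pos: "0 < 1 + (x::real)^2"
  by (rule add_pos_nonneg) auto

lemma sobolev_term_1: "sobolev_term 1 u k = (vweight 1 k * norm (vcoef u k))^2"
  using one_plus_square_pos[of "kn k"] by (simp add: sobolev_term_vcoef power_mult_distrib vweight_square)

lemma sobolev_norm_1: "sobolev_norm 1 u = l2 (\<lambda>k. vweight 1 k * norm (vcoef u k))"
  by (simp add: sobolev_norm_def l2_def sobolev_term_1[abs_def])

lemma sobolev_1_iff: "u \<in> sobolev 1 \<longleftrightarrow> u \<in> L2 \<and> is_l2 (\<lambda>k. vweight 1 k * norm (vcoef u k))"
  by (simp add: sobolev_def is_l2_def sobolev_term_1[abs_def])

section \<open>The function spaces and operators on the Fourier side\<close>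

subsection \<open>Trigonometric polynomials\<close>

definition cos_coeff :: "int^3 \<Rightarrow> int^3 \<Rightarrow> complex" where
  "cos_coeff k l = (if k = l then 1/2 else 0) + (if - k = l then 1/2 else 0)"

definition sin_coeff :: "int^3 \<Rightarrow> int^3 \<Rightarrow> complex" where
  "sin_coeff k l = (if k = l then - \<i> / 2 else 0) + (if - k = l then \<i> / 2 else 0)"

lemma L2_cos_sin: "(\<lambda>x. cos (freq k \<bullet> x)) \<in> L2" "(\<lambda>x. sin (freq k \<bullet> x)) \<in> L2"
  by (rule L2_bounded[of _ 1]; auto intro!: borel_measurable_T3I continuous_intros)+

lemma fourier_coeff_cos_sin:
  "fourier_coeff (\<lambda>x. cos (freq k \<bullet> x)) l = cos_coeff k l"
  "fourier_coeff (\<lambda>x. sin (freq k \<bullet> x)) l = sin_coeff k l"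
proof -
  have e: "complex_of_real (cos (freq k \<bullet> x)) = (1/2) * char k x + (1/2) * char (- k) x"
    "complex_of_real (sin (freq k \<bullet> x)) = (- \<i> / 2) * char k x + (\<i> / 2) * char (- k) x" for x
    by (auto simp: char_def freq_minus complex_eq_iff)
  have c: "cf (\<lambda>x. a * char k x + b * char (- k) x) l = a * cf (char k) l + b * cf (char (- k)) l" for a b
  proof -
    have "cf (\<lambda>x. a * char k x + b * char (- k) x) l = cf (\<lambda>x. a * char k x) l + cf (\<lambda>x. b * char (- k) x) l"
      by (intro cf_add L2_integrable L2_cmult L2_char)
    then show ?thesis by (simp only: cf_cmult)
  qed
  show "fourier_coeff (\<lambda>x. cos (freq k \<bullet> x)) l = cos_coeff k l"
    "fourier_coeff (\<lambda>x. sin (freq k \<bullet> x)) l = sin_coeff k l"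
    unfolding fourier_coeff_cf e c cf_char cos_coeff_def sin_coeff_def by auto
qed

lemma fourier_coeff_trig_real:
  fixes p q :: "int^3 \<Rightarrow> real"
  shows "(\<lambda>x. \<Sum>k\<in>K. cos (freq k \<bullet> x) * p k + sin (freq k \<bullet> x) * q k) \<in> L2"
    "fourier_coeff (\<lambda>x. \<Sum>k\<in>K. cos (freq k \<bullet> x) * p k + sin (freq k \<bullet> x) * q k) l
      = (\<Sum>k\<in>K. cos_coeff k l * of_real (p k) + sin_coeff k l * of_real (q k))"
proof -
  have m: "(\<lambda>x. cos (freq k \<bullet> x) * p k) \<in> L2" "(\<lambda>x. sin (freq k \<bullet> x) * q k) \<in> L2" for k
    using L2_scaleR[OF L2_cos_sin(1), of "p k" k] L2_scaleR[OF L2_cos_sin(2), of "q k" k]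
    by (simp_all add: mult.commute)
  show "(\<lambda>x. \<Sum>k\<in>K. cos (freq k \<bullet> x) * p k + sin (freq k \<bullet> x) * q k) \<in> L2"
    by (intro L2_sum L2_add m)
  have c: "fourier_coeff (\<lambda>x. cos (freq k \<bullet> x) * p k) l = cos_coeff k l * of_real (p k)"
    "fourier_coeff (\<lambda>x. sin (freq k \<bullet> x) * q k) l = sin_coeff k l * of_real (q k)" for k
    using fourier_coeff_cmult[of "p k" "\<lambda>x. cos (freq k \<bullet> x)" l] fourier_coeff_cmult[of "q k" "\<lambda>x. sin (freq k \<bullet> x)" l]
    by (simp_all add: fourier_coeff_cos_sin mult.commute)
  have "fourier_coeff (\<lambda>x. \<Sum>k\<in>K. cos (freq k \<bullet> x) * p k + sin (freq k \<bullet> x) * q k) l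
      = (\<Sum>k\<in>K. fourier_coeff (\<lambda>x. cos (freq k \<bullet> x) * p k + sin (freq k \<bullet> x) * q k) l)"
    by (intro fourier_coeff_sum L2_add m)
  also have "\<dots> = (\<Sum>k\<in>K. cos_coeff k l * of_real (p k) + sin_coeff k l * of_real (q k))"
    by (intro sum.cong refl) (simp only: fourier_coeff_add[OF m] c)
  finally show "fourier_coeff (\<lambda>x. \<Sum>k\<in>K. cos (freq k \<bullet> x) * p k + sin (freq k \<bullet> x) * q k) l
      = (\<Sum>k\<in>K. cos_coeff k l * of_real (p k) + sin_coeff k l * of_real (q k))" .
qed

lemma cdot_cvec_inner [simp]: "cdot x (cvec a) = of_real (x \<bullet> a)"
  by (simp add: cdot_def cvec_def inner_vec_def)

lemma cdot_sum: "cdot x (\<Sum>k\<in>K. a k) = (\<Sum>k\<in>K. cdot x (a k))"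
  by (induction K rule: infinite_finite_induct) (simp_all add: cdot_add)

definition trig_field :: "(int^3) set \<Rightarrow> (int^3 \<Rightarrow> real^3) \<Rightarrow> (int^3 \<Rightarrow> real^3) \<Rightarrow> real^3 \<Rightarrow> real^3" where
  "trig_field K a b x = (\<Sum>k\<in>K. cos (freq k \<bullet> x) *\<^sub>R a k + sin (freq k \<bullet> x) *\<^sub>R b k)"

lemma trig_field_L2: "trig_field K a b \<in> L2"
  by (rule L2_vecI) (simp add: trig_field_def fourier_coeff_trig_real(1))

lemma vcoef_trig_field:
  "vcoef (trig_field K a b) l = (\<Sum>k\<in>K. cos_coeff k l *s cvec (a k) + sin_coeff k l *s cvec (b k))"
  by (simp add: vcoef_def vec_eq_iff trig_field_def fourier_coeff_trig_real(2) cvec_def)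

lemma trig_field_bounded: "norm (trig_field K a b x) \<le> (\<Sum>k\<in>K. norm (a k) + norm (b k))"
  unfolding trig_field_def
proof (rule order_trans[OF norm_sum sum_mono])
  fix k
  have "norm (cos (freq k \<bullet> x) *\<^sub>R a k + sin (freq k \<bullet> x) *\<^sub>R b k) \<le> \<bar>cos (freq k \<bullet> x)\<bar> * norm (a k) + \<bar>sin (freq k \<bullet> x)\<bar> * norm (b k)"
    by (rule order_trans[OF norm_triangle_ineq]) simp
  also have "\<dots> \<le> 1 * norm (a k) + 1 * norm (b k)"
    by (intro add_mono mult_right_mono abs_cos_le_one abs_sin_le_one) auto
  finally show "norm (cos (freq k \<bullet> x) *\<^sub>R a k + sin (freq k \<bullet> x) *\<^sub>R b k) \<le> norm (a k) + norm (b k)" by simp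
qed

lemma trig_field_divergence:
  "(\<Sum>j\<in>UNIV. frechet_derivative (trig_field K a b) (at x) (axis j 1) $ j)
    = (\<Sum>k\<in>K. cos (freq k \<bullet> x) * (freq k \<bullet> b k) + sin (freq k \<bullet> x) * (- (freq k \<bullet> a k)))"
proof -
  define D where "D h = (\<Sum>k\<in>K. (- (sin (freq k \<bullet> x)) * (freq k \<bullet> h)) *\<^sub>R a k + (cos (freq k \<bullet> x) * (freq k \<bullet> h)) *\<^sub>R b k)" for h
  have "(trig_field K a b has_derivative D) (at x)"
    unfolding trig_field_def[abs_def] D_def[abs_def]
    by (auto intro!: derivative_eq_intros sum.cong simp: mult_ac)
  then have "frechet_derivative (trig_field K a b) (at x) = D"
    by (rule frechet_derivative_at[symmetric])
  then have "(\<Sum>j\<in>UNIV. frechet_derivative (trig_field K a b) (at x) (axis j 1) $ j)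
      = (\<Sum>j\<in>UNIV. \<Sum>k\<in>K. cos (freq k \<bullet> x) * (freq k $ j * b k $ j) + sin (freq k \<bullet> x) * (- (freq k $ j * a k $ j)))"
    by (simp add: D_def inner_axis algebra_simps)
  also have "\<dots> = (\<Sum>k\<in>K. cos (freq k \<bullet> x) * (freq k \<bullet> b k) + sin (freq k \<bullet> x) * (- (freq k \<bullet> a k)))"
    by (subst sum.swap) (simp add: inner_vec_def sum.distrib sum_distrib_left sum_negf sum_subtractf)
  finally show ?thesis .
qed

lemma LINT_component_vcoef:
  assumes u: "u \<in> L2"
  shows "(LINT x|T3. u x) = 0 \<longleftrightarrow> vcoef u 0 = 0"
proof -
  have "vcoef u 0 $ i = complex_of_real ((LINT x|T3. u x) $ i)" for i
  proof -
    have "(LINT x|T3. u x $ i) = (LINT x|T3. u x) $ i"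
      by (rule integral_bounded_linear[OF bounded_linear_vec_nth L2_integrable[OF u]])
    then show ?thesis by (simp add: vcoef_def fourier_coeff_cf cf_def)
  qed
  then show ?thesis by (simp add: vec_eq_iff)
qed

lemma solenoidal_polysD:
  assumes "\<phi> \<in> solenoidal_polys"
  shows "\<phi> \<in> L2" "solenoidal_seq (vcoef \<phi>)" "finite {k. vcoef \<phi> k \<noteq> 0}" "\<exists>B. \<forall>x. norm (\<phi> x) \<le> B"
proof -
  obtain K a b where K: "finite K" and "\<forall>x. \<phi> x = trig_field K a b x"
    using assms unfolding solenoidal_polys_def trig_polys_def trig_field_def by blast
  then have \<phi>: "\<phi> = trig_field K a b" by auto
  show L: "\<phi> \<in> L2" unfolding \<phi> by (rule trig_field_L2)
  show "\<exists>B. \<forall>x. norm (\<phi> x) \<le> B" unfolding \<phi> using trig_field_bounded by blast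
  have "{k. vcoef \<phi> k \<noteq> 0} \<subseteq> K \<union> uminus ` K"
  proof
    fix l assume "l \<in> {k. vcoef \<phi> k \<noteq> 0}"
    then have "vcoef \<phi> l \<noteq> 0" by simp
    then obtain k where "k \<in> K" "cos_coeff k l *s cvec (a k) + sin_coeff k l *s cvec (b k) \<noteq> 0"
      unfolding \<phi> vcoef_trig_field using sum.not_neutral_contains_not_neutral by blast
    then have "k = l \<or> - k = l" by (auto simp: cos_coeff_def sin_coeff_def split: if_splits)
    with \<open>k \<in> K\<close> show "l \<in> K \<union> uminus ` K" by auto
  qed
  then show "finite {k. vcoef \<phi> k \<noteq> 0}" using K by (auto intro: finite_subset)
  have div: "(\<Sum>k\<in>K. cos (freq k \<bullet> x) * (freq k \<bullet> b k) + sin (freq k \<bullet> x) * (- (freq k \<bullet> a k))) = 0" for x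
    using assms unfolding solenoidal_polys_def \<phi> trig_field_divergence[symmetric] by simp
  have "cdot (freq l) (vcoef \<phi> l) = 0" for l
  proof -
    have "\<i> * cdot (freq l) (vcoef \<phi> l) = (\<Sum>k\<in>K. \<i> * cos_coeff k l * of_real (freq l \<bullet> a k) + \<i> * sin_coeff k l * of_real (freq l \<bullet> b k))"
      unfolding \<phi> vcoef_trig_field cdot_sum by (simp add: cdot_add sum_distrib_left algebra_simps)
    also have "\<dots> = (\<Sum>k\<in>K. cos_coeff k l * of_real (freq k \<bullet> b k) + sin_coeff k l * of_real (- (freq k \<bullet> a k)))"
    proof (rule sum.cong[OF refl])
      fix k :: "int^3"
      have ne: "- k \<noteq> k" if k0: "k \<noteq> 0"
      proof
        assume e: "- k = k"
        have "k $ i = 0" for i using arg_cong[OF e, of "\<lambda>v. v $ i"] by simp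
        then show False using k0 by (simp add: vec_eq_iff)
      qed
      show "\<i> * cos_coeff k l * of_real (freq l \<bullet> a k) + \<i> * sin_coeff k l * of_real (freq l \<bullet> b k)
          = cos_coeff k l * of_real (freq k \<bullet> b k) + sin_coeff k l * of_real (- (freq k \<bullet> a k))"
      proof (cases "k = 0")
        case True
        then show ?thesis by (cases "l = 0") (simp_all add: cos_coeff_def sin_coeff_def)
      next
        case False
        consider "l = k" | "l = - k" | "l \<noteq> k" "l \<noteq> - k" by blast
        then show ?thesis
        proof cases
          case 1 then show ?thesis using ne[OF False] by (simp add: cos_coeff_def sin_coeff_def)
        next
          case 2
          have "k \<noteq> - k" using ne[OF False] by metis
          with 2 show ?thesis by (simp add: cos_coeff_def sin_coeff_def freq_minus)
        next
          case 3
          then have "k \<noteq> l" "- k \<noteq> l" by auto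
          then show ?thesis by (simp add: cos_coeff_def sin_coeff_def)
        qed
      qed
    qed
    also have "\<dots> = fourier_coeff (\<lambda>x. 0) l"
      using fourier_coeff_trig_real(2)[of "\<lambda>k. freq k \<bullet> b k" "\<lambda>k. - (freq k \<bullet> a k)" K l] unfolding div by simp
    also have "\<dots> = 0" by (simp add: fourier_coeff_def)
    finally show ?thesis by simp
  qed
  moreover have "vcoef \<phi> 0 = 0"
    using assms LINT_component_vcoef[OF L] unfolding solenoidal_polys_def by simp
  ultimately show "solenoidal_seq (vcoef \<phi>)" by (simp add: solenoidal_seq_def vcoef_minus)
qed

text \<open>The real form of \<open>\<Sum>k\<in>K. c k * char k x\<close>: for a symmetric family the
  frequencies \<open>k\<close> and \<open>- k\<close> contribute complex conjugate terms.\<close>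

definition partial_sum :: "(int^3) set \<Rightarrow> (int^3 \<Rightarrow> complex^3) \<Rightarrow> real^3 \<Rightarrow> real^3" where
  "partial_sum K c = trig_field K (\<lambda>k. \<chi> i. Re (c k $ i)) (\<lambda>k. - (\<chi> i. Im (c k $ i)))"

lemma vcoef_partial_sum:
  assumes K: "finite K" "\<And>k. k \<in> K \<Longrightarrow> - k \<in> K" and c: "solenoidal_seq c"
  shows "vcoef (partial_sum K c) l = (if l \<in> K then c l else 0)"
proof -
  let ?a = "\<lambda>k. (\<chi> i. Re (c k $ i)) :: real^3" and ?b = "\<lambda>k. - (\<chi> i. Im (c k $ i)) :: real^3"
  have neg: "- k \<in> K \<longleftrightarrow> k \<in> K" for k using K(2)[of k] K(2)[of "-k"] by auto
  have half: "(1/2) *s cvec (?a k) + (- \<i>/2) *s cvec (?b k) = (1/2) *s c k"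
    "(1/2) *s cvec (?a k) + (\<i>/2) *s cvec (?b k) = (1/2) *s vcnj (c k)" for k
    by (simp_all add: vec_eq_iff cvec_def vcnj_def complex_eq_iff)
  have "cos_coeff k l *s cvec (?a k) + sin_coeff k l *s cvec (?b k)
      = (if k = l then (1/2) *s c k else 0) + (if k = - l then (1/2) *s vcnj (c k) else 0)" for k
  proof -
    have "cos_coeff k l *s cvec (?a k) + sin_coeff k l *s cvec (?b k)
      = (if k = l then (1/2) *s cvec (?a k) + (- \<i>/2) *s cvec (?b k) else 0) + (if - k = l then (1/2) *s cvec (?a k) + (\<i>/2) *s cvec (?b k) else 0)"
      by (cases "k = l"; cases "- k = l"; simp add: cos_coeff_def sin_coeff_def; simp add: vec_eq_iff algebra_simps)
    then show ?thesis unfolding half by (auto simp: minus_equation_iff)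
  qed
  then have "vcoef (partial_sum K c) l = (\<Sum>k\<in>K. (if k = l then (1/2) *s c k else 0) + (if k = - l then (1/2) *s vcnj (c k) else 0))"
    unfolding partial_sum_def vcoef_trig_field by simp
  also have "\<dots> = (if l \<in> K then (1/2) *s c l else 0) + (if - l \<in> K then (1/2) *s vcnj (c (- l)) else 0)"
    using K(1) by (simp add: sum.distrib)
  also have "\<dots> = (if l \<in> K then c l else 0)"
    unfolding solenoidal_seqD(3)[OF c] by (simp add: neg vec_eq_iff)
  finally show ?thesis .
qed

lemma partial_sum:
  assumes K: "finite K" "\<And>k. k \<in> K \<Longrightarrow> - k \<in> K" and c: "solenoidal_seq c"
  shows "partial_sum K c \<in> solenoidal_polys"
proof -
  let ?a = "\<lambda>k. (\<chi> i. Re (c k $ i)) :: real^3" and ?b = "\<lambda>k. - (\<chi> i. Im (c k $ i)) :: real^3"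
  have "cdot (freq k) (c k) = of_real (freq k \<bullet> ?a k) - \<i> * of_real (freq k \<bullet> ?b k)" for k
    by (simp add: cdot_def inner_vec_def complex_eq_iff sum_negf)
  then have z: "freq k \<bullet> ?a k = 0" "freq k \<bullet> ?b k = 0" for k
    using solenoidal_seqD(2)[OF c, of k] by (auto simp: complex_eq_iff)
  have "(LINT x|T3. partial_sum K c x) = 0"
  proof -
    have L: "partial_sum K c \<in> L2" unfolding partial_sum_def by (rule trig_field_L2)
    have "vcoef (partial_sum K c) 0 = 0"
      by (simp add: vcoef_partial_sum[OF K c] solenoidal_seqD(1)[OF c])
    then show ?thesis unfolding LINT_component_vcoef[OF L] .
  qed
  moreover have "partial_sum K c \<in> trig_polys"
    unfolding trig_polys_def mem_Collect_eq
    by (rule exI[of _ K], rule exI[of _ ?a], rule exI[of _ ?b]) (simp only: K(1) partial_sum_def trig_field_def simp_thms)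
  moreover have "(\<Sum>j\<in>UNIV. frechet_derivative (partial_sum K c) (at x) (axis j 1) $ j) = 0" for x
    unfolding partial_sum_def trig_field_divergence by (simp only: z) simp
  ultimately show "partial_sum K c \<in> solenoidal_polys"
    unfolding solenoidal_polys_def by simp
qed

subsection \<open>Identification with the phase space\<close>

text \<open>\<open>voigt_class \<alpha>\<close> is the space of solenoidal fields of mean zero with finite Voigt energy; it is
  \<open>H\<close> for \<open>\<alpha> = 0\<close> and \<open>V\<close> for \<open>\<alpha> > 0\<close>, and \<open>sf \<alpha>\<close> is its isometry onto the phase space.\<close>

definition voigt_class :: "real \<Rightarrow> (real^3 \<Rightarrow> real^3) \<Rightarrow> bool" where
  "voigt_class \<alpha> f \<longleftrightarrow> f \<in> L2 \<and> solenoidal_seq (vcoef f) \<and> is_l2 (\<lambda>k. vweight \<alpha> k * norm (vcoef f k))"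

definition sf :: "real \<Rightarrow> (real^3 \<Rightarrow> real^3) \<Rightarrow> sfield" where
  "sf \<alpha> f = Abs_sfield (\<lambda>k. vweight \<alpha> k *\<^sub>R vcoef f k)"

lemma abs_vweight [simp]: "\<bar>vweight \<alpha> k\<bar> = vweight \<alpha> k"
  using vweight_pos[of \<alpha> k] by simp

lemma coeffs_sf:
  assumes "voigt_class \<alpha> f"
  shows "coeffs (sf \<alpha> f) = (\<lambda>k. vweight \<alpha> k *\<^sub>R vcoef f k)"
  unfolding sf_def
proof (rule coeffs_Abs)
  show "solenoidal_seq (\<lambda>k. vweight \<alpha> k *\<^sub>R vcoef f k)"
    using assms by (simp add: voigt_class_def solenoidal_seq_def)
  show "is_l2 (\<lambda>k. norm (vweight \<alpha> k *\<^sub>R vcoef f k))" using assms by (simp add: voigt_class_def)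
qed

lemma vfield_sf: "voigt_class \<alpha> f \<Longrightarrow> vfield \<alpha> (sf \<alpha> f) = vcoef f"
  by (simp add: fun_eq_iff vfield_def coeffs_sf)

lemma norm_sf: "voigt_class \<alpha> f \<Longrightarrow> norm (sf \<alpha> f) = l2 (\<lambda>k. vweight \<alpha> k * norm (vcoef f k))"
  unfolding norm_sfield_l2 by (simp add: coeffs_sf)

lemma norm_sf_1: "voigt_class 1 f \<Longrightarrow> norm (sf 1 f) = sobolev_norm 1 f"
  by (simp add: norm_sf sobolev_norm_1)

lemma inner_sf_has_sum:
  "voigt_class \<alpha> f \<Longrightarrow> voigt_class \<alpha> g \<Longrightarrow> ((\<lambda>k. (vweight \<alpha> k)^2 * (vcoef f k \<bullet> vcoef g k)) has_sum (sf \<alpha> f \<bullet> sf \<alpha> g)) UNIV"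
  using has_sum_infsum[OF inner_coeffs_summable[of "sf \<alpha> f" "sf \<alpha> g"]]
  by (simp add: inner_sfield_def coeffs_sf power2_eq_square mult.assoc)

lemma voigt_class_diff:
  assumes f: "voigt_class \<alpha> f" and g: "voigt_class \<alpha> g"
  shows "voigt_class \<alpha> (\<lambda>x. f x - g x)" "sf \<alpha> (\<lambda>x. f x - g x) = sf \<alpha> f - sf \<alpha> g"
proof -
  have L: "f \<in> L2" "g \<in> L2" using f g by (auto simp: voigt_class_def)
  have v: "vcoef (\<lambda>x. f x - g x) = (\<lambda>k. vcoef f k - vcoef g k)" using vcoef_diff[OF L] by auto
  have "norm (vweight \<alpha> k *\<^sub>R (vcoef f k - vcoef g k)) = norm (coeffs (sf \<alpha> f - sf \<alpha> g) k)" for k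
    using f g by (simp add: coeffs_minus coeffs_sf scaleR_diff_right[symmetric])
  then have "is_l2 (\<lambda>k. vweight \<alpha> k * norm (vcoef f k - vcoef g k))"
    using is_l2_coeffs[of "sf \<alpha> f - sf \<alpha> g"] by simp
  then show c: "voigt_class \<alpha> (\<lambda>x. f x - g x)"
    using f g L by (simp add: voigt_class_def v L2_diff solenoidal_seq_def cdot_diff)
  show "sf \<alpha> (\<lambda>x. f x - g x) = sf \<alpha> f - sf \<alpha> g"
    by (rule sfield_eqI) (simp add: coeffs_minus coeffs_sf f g c v scaleR_diff_right)
qed

lemma voigt_class_scaleR:
  assumes f: "voigt_class \<alpha> f"
  shows "voigt_class \<alpha> (\<lambda>x. t *\<^sub>R f x)" "sf \<alpha> (\<lambda>x. t *\<^sub>R f x) = t *\<^sub>R sf \<alpha> f"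
proof -
  have v: "vcoef (\<lambda>x. t *\<^sub>R f x) = (\<lambda>k. t *\<^sub>R vcoef f k)" using vcoef_scaleR by auto
  have "is_l2 (\<lambda>k. vweight \<alpha> k * norm (t *\<^sub>R vcoef f k))"
    using is_l2_cmult(1)[of "\<lambda>k. vweight \<alpha> k * norm (vcoef f k)" "\<bar>t\<bar>"] f by (simp add: voigt_class_def mult_ac)
  then show c: "voigt_class \<alpha> (\<lambda>x. t *\<^sub>R f x)"
    using f by (simp add: voigt_class_def v L2_scaleR solenoidal_seq_def)
  show "sf \<alpha> (\<lambda>x. t *\<^sub>R f x) = t *\<^sub>R sf \<alpha> f"
    by (rule sfield_eqI) (simp add: coeffs_scaleR coeffs_sf f c v)
qed

lemma vweight_comparison:
  assumes "0 < \<beta>"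
  shows "vweight \<alpha> k \<le> max 1 (\<bar>\<alpha>\<bar> / \<beta>) * vweight \<beta> k"
proof (rule power2_le_imp_le)
  define m where "m = max 1 (\<bar>\<alpha>\<bar> / \<beta>)"
  have m: "1 \<le> m" "\<bar>\<alpha>\<bar> \<le> m * \<beta>" using assms by (auto simp: m_def max_def divide_le_eq pos_divide_less_eq)
  have "\<alpha>^2 \<le> m^2 * \<beta>^2" using power_mono[OF m(2), of 2] by (simp add: power_mult_distrib)
  then have "\<alpha>^2 * (kn k)^2 \<le> m^2 * \<beta>^2 * (kn k)^2" by (rule mult_right_mono) simp
  moreover have "1 \<le> m^2" using m(1) by simp
  ultimately have "(vweight \<alpha> k)^2 \<le> m^2 * (vweight \<beta> k)^2" unfolding vweight_square by (simp add: algebra_simps)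
  then show "(vweight \<alpha> k)^2 \<le> (max 1 (\<bar>\<alpha>\<bar> / \<beta>) * vweight \<beta> k)^2" by (simp add: power_mult_distrib m_def)
  show "0 \<le> max 1 (\<bar>\<alpha>\<bar> / \<beta>) * vweight \<beta> k" using vweight_pos[of \<beta> k] by simp
qed

text \<open>All weights with a positive parameter are comparable, so they define the same space
  \<open>V\<close> with equivalent norms.\<close>

lemma voigt_class_change:
  assumes f: "voigt_class \<beta> f" and \<beta>: "0 < \<beta>"
  shows "voigt_class \<alpha> f" "norm (sf \<alpha> f) \<le> max 1 (\<bar>\<alpha>\<bar> / \<beta>) * norm (sf \<beta> f)"
proof -
  have s: "is_l2 (\<lambda>k. vweight \<beta> k * norm (vcoef f k))" using f by (simp add: voigt_class_def)
  have le: "\<bar>vweight \<alpha> k * norm (vcoef f k)\<bar> \<le> max 1 (\<bar>\<alpha>\<bar> / \<beta>) * (vweight \<beta> k * norm (vcoef f k))" for k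
    using mult_right_mono[OF vweight_comparison[OF \<beta>, of \<alpha> k], of "norm (vcoef f k)"] vweight_pos[of \<alpha> k]
    by (simp add: mult.assoc)
  note c = is_l2_cmult[OF s, of "max 1 (\<bar>\<alpha>\<bar> / \<beta>)"]
  note l = is_l2_comparison[OF c(1) le]
  show v: "voigt_class \<alpha> f" using f l(1) by (simp add: voigt_class_def)
  show "norm (sf \<alpha> f) \<le> max 1 (\<bar>\<alpha>\<bar> / \<beta>) * norm (sf \<beta> f)"
    using l(2) unfolding norm_sf[OF v] norm_sf[OF f] c(2) by simp
qed

lemma solenoidal_polys_voigt_class:
  assumes "\<phi> \<in> solenoidal_polys"
  shows "voigt_class \<alpha> \<phi>"
  unfolding voigt_class_def
  by (intro conjI solenoidal_polysD[OF assms] finite_support_is_l2(1)[OF solenoidal_polysD(3)[OF assms]]) simp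

lemma partial_sum_galerkin:
  assumes f: "voigt_class \<alpha> f"
  shows "partial_sum (cube N) (vcoef f) \<in> solenoidal_polys" "sf \<alpha> (partial_sum (cube N) (vcoef f)) = galerkin N (sf \<alpha> f)"
proof -
  have c: "solenoidal_seq (vcoef f)" using f by (simp add: voigt_class_def)
  show s: "partial_sum (cube N) (vcoef f) \<in> solenoidal_polys" by (rule partial_sum[OF finite_cube _ c]) simp
  have v: "vcoef (partial_sum (cube N) (vcoef f)) l = (if l \<in> cube N then vcoef f l else 0)" for l
    by (rule vcoef_partial_sum[OF finite_cube _ c]) simp
  show "sf \<alpha> (partial_sum (cube N) (vcoef f)) = galerkin N (sf \<alpha> f)"
    by (rule sfield_eqI) (simp add: coeffs_galerkin coeffs_sf[OF f] coeffs_sf[OF solenoidal_polys_voigt_class[OF s]] v)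
qed

text \<open>Every Fourier coefficient depends continuously on the field, so the linear constraints on the
  coefficients survive limits.\<close>

lemma solenoidal_if_approximable:
  assumes f: "f \<in> L2" "is_l2 (\<lambda>k. vweight \<alpha> k * norm (vcoef f k))"
    and ap: "\<And>e. 0 < e \<Longrightarrow> \<exists>\<phi>\<in>solenoidal_polys. l2 (\<lambda>k. vweight \<alpha> k * norm (vcoef (\<lambda>x. f x - \<phi> x) k)) < e"
  shows "voigt_class \<alpha> f"
proof -
  have near: "\<exists>\<phi>\<in>solenoidal_polys. norm (vcoef f k - vcoef \<phi> k) < e" if e: "0 < e" for e k
  proof -
    obtain \<phi> where \<phi>: "\<phi> \<in> solenoidal_polys" "l2 (\<lambda>k. vweight \<alpha> k * norm (vcoef (\<lambda>x. f x - \<phi> x) k)) < e"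
      using ap[OF e] by blast
    have vd: "vcoef (\<lambda>x. f x - \<phi> x) k = vcoef f k - vcoef \<phi> k" for k
      by (rule vcoef_diff[OF f(1) solenoidal_polysD(1)[OF \<phi>(1)]])
    have s\<phi>: "is_l2 (\<lambda>k. vweight \<alpha> k * norm (vcoef \<phi> k))"
      using solenoidal_polys_voigt_class[OF \<phi>(1), of \<alpha>] by (simp add: voigt_class_def)
    have "is_l2 (\<lambda>k. vweight \<alpha> k * norm (vcoef (\<lambda>x. f x - \<phi> x) k))"
    proof (rule is_l2_comparison(1)[OF is_l2_add[OF f(2) s\<phi>]])
      fix k
      have "vweight \<alpha> k * norm (vcoef f k - vcoef \<phi> k) \<le> vweight \<alpha> k * (norm (vcoef f k) + norm (vcoef \<phi> k))"
        using vweight_pos[of \<alpha> k] by (intro mult_left_mono norm_triangle_ineq4) auto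
      then show "\<bar>vweight \<alpha> k * norm (vcoef (\<lambda>x. f x - \<phi> x) k)\<bar> \<le> vweight \<alpha> k * norm (vcoef f k) + vweight \<alpha> k * norm (vcoef \<phi> k)"
        using vweight_pos[of \<alpha> k] by (simp add: vd distrib_left abs_mult)
    qed
    from sum_squares_le_l2[OF this, of "{k}"]
    have "(vweight \<alpha> k * norm (vcoef f k - vcoef \<phi> k))^2 \<le> (l2 (\<lambda>k. vweight \<alpha> k * norm (vcoef (\<lambda>x. f x - \<phi> x) k)))^2" by (simp add: vd)
    then have "vweight \<alpha> k * norm (vcoef f k - vcoef \<phi> k) \<le> l2 (\<lambda>k. vweight \<alpha> k * norm (vcoef (\<lambda>x. f x - \<phi> x) k))"
      by (rule power2_le_imp_le) simp
    moreover have "1 * norm (vcoef f k - vcoef \<phi> k) \<le> vweight \<alpha> k * norm (vcoef f k - vcoef \<phi> k)"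
      by (intro mult_right_mono vweight_ge_1) auto
    ultimately show ?thesis using \<phi> by (intro bexI[of _ \<phi>]) auto
  qed
  have "norm (vcoef f 0) \<le> 0 + e" if "0 < e" for e
    using near[OF that, of 0] solenoidal_seqD(1)[OF solenoidal_polysD(2)] by force
  then have 0: "vcoef f 0 = 0" using field_le_epsilon[of "norm (vcoef f 0)" 0] by simp
  have "norm (cdot (freq k) (vcoef f k)) \<le> 0 + e" if e: "0 < e" for e k
  proof -
    have k1: "0 < kn k + 1" by (rule add_nonneg_pos) auto
    obtain \<phi> where \<phi>: "\<phi> \<in> solenoidal_polys" "norm (vcoef f k - vcoef \<phi> k) < e / (kn k + 1)"
      using near[of "e / (kn k + 1)" k] e k1 by auto
    have "cdot (freq k) (vcoef f k) = cdot (freq k) (vcoef f k - vcoef \<phi> k)"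
      using solenoidal_seqD(2)[OF solenoidal_polysD(2)[OF \<phi>(1)], of k] by (simp add: cdot_diff)
    also have "norm \<dots> \<le> kn k * norm (vcoef f k - vcoef \<phi> k)" by (rule norm_cdot_le)
    also have "\<dots> \<le> (kn k + 1) * (e / (kn k + 1))" using \<phi>(2) k1 by (intro mult_mono) auto
    also have "\<dots> = e" using k1 by simp
    finally show ?thesis by simp
  qed
  then have "cdot (freq k) (vcoef f k) = 0" for k
    using field_le_epsilon[of "norm (cdot (freq k) (vcoef f k))" 0] by simp
  with 0 f show ?thesis by (simp add: voigt_class_def solenoidal_seq_def vcoef_minus)
qed

lemma partial_sum_dense:
  assumes f: "voigt_class \<alpha> f" and e: "0 < e"
  shows "\<exists>\<phi>\<in>solenoidal_polys. l2 (\<lambda>k. vweight \<alpha> k * norm (vcoef (\<lambda>x. f x - \<phi> x) k)) < e"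
proof -
  obtain N where N: "norm (galerkin N (sf \<alpha> f) - sf \<alpha> f) < e"
    using tendstoD[OF galerkin_LIMSEQ[of "sf \<alpha> f"] e] by (auto simp: eventually_sequentially dist_norm)
  note p = partial_sum_galerkin[OF f, of N]
  have "norm (sf \<alpha> (\<lambda>x. f x - partial_sum (cube N) (vcoef f) x)) < e"
    using N by (simp add: voigt_class_diff(2)[OF f solenoidal_polys_voigt_class[OF p(1)]] p(2) norm_minus_commute)
  then show ?thesis
    using norm_sf[OF voigt_class_diff(1)[OF f solenoidal_polys_voigt_class[OF p(1)]]] p(1) by auto
qed

lemma V_space_iff: "f \<in> V_space \<longleftrightarrow> voigt_class 1 f"
  using solenoidal_if_approximable[of f 1] partial_sum_dense[of 1 f]
  by (auto simp: V_space_def sobolev_1_iff sobolev_norm_1 voigt_class_def)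

lemma vweight_0 [simp]: "vweight 0 k = 1"
  by (simp add: vweight_def)

lemma H_space_iff: "f \<in> H_space \<longleftrightarrow> voigt_class 0 f"
proof
  assume f: "f \<in> H_space"
  then have L: "f \<in> L2" by (simp add: H_space_def)
  show "voigt_class 0 f"
  proof (rule solenoidal_if_approximable[OF L])
    show "is_l2 (\<lambda>k. vweight 0 k * norm (vcoef f k))" using vcoef_is_l2[OF L] by simp
    fix e :: real assume "0 < e"
    then obtain \<phi> where \<phi>: "\<phi> \<in> solenoidal_polys" "L2_norm (\<lambda>x. f x - \<phi> x) < e" using f by (auto simp: H_space_def)
    then show "\<exists>\<phi>\<in>solenoidal_polys. l2 (\<lambda>k. vweight 0 k * norm (vcoef (\<lambda>x. f x - \<phi> x) k)) < e"
      using L2_norm_vcoef[OF L2_diff[OF L solenoidal_polysD(1)[OF \<phi>(1)]]] by auto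
  qed
next
  assume f: "voigt_class 0 f"
  then have L: "f \<in> L2" by (simp add: voigt_class_def)
  have "\<exists>\<phi>\<in>solenoidal_polys. L2_norm (\<lambda>x. f x - \<phi> x) < e" if "0 < e" for e
    using partial_sum_dense[OF f that] L2_norm_vcoef[OF L2_diff[OF L solenoidal_polysD(1)]] by auto
  with L show "f \<in> H_space" by (simp add: H_space_def)
qed

lemma voigt_class_0_iff: "voigt_class 0 f \<longleftrightarrow> f \<in> L2 \<and> solenoidal_seq (vcoef f)"
  using vcoef_is_l2[of f] by (auto simp: voigt_class_def)

subsection \<open>The Leray projection and the Stokes operator\<close>

lemma L2_inner_eq: "u \<in> L2 \<Longrightarrow> v \<in> L2 \<Longrightarrow> L2_inner u v = infsum (\<lambda>k. vcoef u k \<bullet> vcoef v k) UNIV"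
  using L2_inner_has_sum[of u v] by (simp add: has_sum_iff)

text \<open>The field with projected coefficients satisfies the defining orthogonality relation. Two
  fields that satisfy it differ by an element of \<open>H\<close> that is orthogonal to
  \<open>H\<close>.\<close>

lemma leray:
  assumes f: "f \<in> L2"
  shows "voigt_class 0 (leray f)" "vcoef (leray f) k = lproj k (vcoef f k)"
proof -
  define c where "c k = lproj k (vcoef f k)" for k
  have ssc: "is_l2 (\<lambda>k. norm (c k))"
    by (rule is_l2_comparison(1)[OF vcoef_is_l2[OF f]]) (simp add: c_def norm_lproj_le)
  have sym: "c (- k) = vcnj (c k)" for k by (simp add: c_def vcoef_minus lproj_vcnj)
  define g0 where "g0 = synth c"
  have g0: "g0 \<in> L2" "\<And>k. vcoef g0 k = c k" unfolding g0_def by (rule synth[OF ssc sym])+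
  have g0H: "voigt_class 0 g0"
    unfolding voigt_class_0_iff solenoidal_seq_def using g0 sym by (simp add: c_def[abs_def])
  have orth: "L2_inner (\<lambda>x. f x - g x) h = infsum (\<lambda>k. (c k - vcoef g k) \<bullet> vcoef h k) UNIV"
    if g: "g \<in> L2" and h: "voigt_class 0 h" for g h
  proof -
    have hL: "h \<in> L2" "solenoidal_seq (vcoef h)" using h by (auto simp: voigt_class_0_iff)
    have "L2_inner (\<lambda>x. f x - g x) h = infsum (\<lambda>k. (vcoef f k - vcoef g k) \<bullet> vcoef h k) UNIV"
      unfolding L2_inner_eq[OF L2_diff[OF f g] hL(1)] vcoef_diff[OF f g] ..
    also have "\<dots> = infsum (\<lambda>k. (c k - vcoef g k) \<bullet> vcoef h k) UNIV"
    proof (rule infsum_cong)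
      fix k
      have "c k \<bullet> vcoef h k = vcoef f k \<bullet> vcoef h k"
        unfolding c_def using solenoidal_seqD[OF hL(2)] by (intro inner_lproj) auto
      then show "(vcoef f k - vcoef g k) \<bullet> vcoef h k = (c k - vcoef g k) \<bullet> vcoef h k"
        by (simp add: inner_diff_left)
    qed
    finally show ?thesis .
  qed
  define P where "P g \<longleftrightarrow> g \<in> H_space \<and> (\<forall>h\<in>H_space. L2_inner (\<lambda>x. f x - g x) h = 0)" for g
  have "P g0"
    unfolding P_def using g0H orth[OF g0(1)] by (auto simp: H_space_iff g0(2))
  then have "P (SOME g. P g)" by (rule someI[of P])
  moreover have "leray f = (SOME g. P g)" by (simp add: leray_def P_def)
  ultimately have PL: "P (leray f)" by simp
  then show H: "voigt_class 0 (leray f)" by (simp add: P_def H_space_iff)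
  then have L: "leray f \<in> L2" by (simp add: voigt_class_def)
  note d = voigt_class_diff[OF g0H H]
  have dv: "vcoef (\<lambda>x. g0 x - leray f x) k = c k - vcoef (leray f) k" for k
    by (simp add: vcoef_diff[OF g0(1) L] g0(2))
  have "0 = infsum (\<lambda>k. (c k - vcoef (leray f) k) \<bullet> vcoef (\<lambda>x. g0 x - leray f x) k) UNIV"
    using PL orth[OF L d(1)] d(1) unfolding P_def by (simp add: H_space_iff)
  also have "\<dots> = (norm (sf 0 (\<lambda>x. g0 x - leray f x)))^2"
    unfolding norm_sfield_square dv coeffs_sf[OF d(1)] by (simp add: dv power2_norm_eq_inner)
  finally have "sf 0 (\<lambda>x. g0 x - leray f x) = 0" by simp
  then have "coeffs (sf 0 (\<lambda>x. g0 x - leray f x)) k = 0" by (simp add: coeffs_zero)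
  then show "vcoef (leray f) k = lproj k (vcoef f k)"
    by (simp add: coeffs_sf[OF d(1)] dv c_def)
qed

lemma stokes_domain_vcoef:
  assumes "\<phi> \<in> stokes_domain"
  shows "voigt_class 1 \<phi>" "voigt_class 0 (stokes \<phi>)" "vcoef (stokes \<phi>) k = (kn k)^2 *\<^sub>R vcoef \<phi> k"
proof -
  show V: "voigt_class 1 \<phi>" using assms by (simp add: stokes_domain_def V_space_iff)
  then have sol: "solenoidal_seq (vcoef \<phi>)" by (simp add: voigt_class_def)
  have s2: "(\<lambda>k. (1 + (kn k)^2) powr 2 * (norm (vcoef \<phi> k))^2) summable_on UNIV"
    using assms by (simp add: stokes_domain_def sobolev_def sobolev_term_vcoef[abs_def])
  define m where "m k = - complex_of_real ((kn k)^2)" for k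
  have "is_l2 (\<lambda>k. norm (m k *s vcoef \<phi> k))"
    unfolding is_l2_def
  proof (rule summable_on_comparison_test[OF s2])
    fix k
    have "((kn k)^2)^2 \<le> (1 + (kn k)^2)^2" by (intro power_mono) auto
    also have "\<dots> = (1 + (kn k)^2) powr 2"
      using one_plus_square_pos[of "kn k"] powr_realpow[of "1 + (kn k)^2" 2] by simp
    finally show "(norm (m k *s vcoef \<phi> k))^2 \<le> (1 + (kn k)^2) powr 2 * (norm (vcoef \<phi> k))^2"
      by (simp add: m_def norm_cscale power_mult_distrib mult_right_mono norm_power del: of_real_power)
  qed simp
  then have l: "laplace \<phi> \<in> L2" "\<And>k. vcoef (laplace \<phi>) k = m k *s vcoef \<phi> k"
    using vec_mult_spec[of m \<phi>] unfolding laplace_def m_def by auto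
  have nl: "(\<lambda>x. - laplace \<phi> x) \<in> L2" using L2_scaleR[OF l(1), of "-1"] by simp
  have v: "vcoef (\<lambda>x. - laplace \<phi> x) k = (kn k)^2 *\<^sub>R vcoef \<phi> k" for k
    using vcoef_scaleR[of "-1" "laplace \<phi>" k] by (simp add: l(2) m_def vec_eq_iff scaleR_conv_of_real[where 'a = complex])
  show "voigt_class 0 (stokes \<phi>)" unfolding stokes_def by (rule leray[OF nl])
  show "vcoef (stokes \<phi>) k = (kn k)^2 *\<^sub>R vcoef \<phi> k"
    unfolding stokes_def leray(2)[OF nl] v
    using solenoidal_seqD[OF sol] by (cases "k = 0") (simp_all add: lproj_id)
qed

lemma solenoidal_polys_stokes_domain:
  assumes "\<phi> \<in> solenoidal_polys"
  shows "\<phi> \<in> stokes_domain"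
proof -
  have "sobolev_term 2 \<phi> summable_on UNIV"
    unfolding sobolev_term_vcoef[abs_def]
    by (rule finite_nonzero_values_imp_summable_on)
       (rule finite_subset[OF _ solenoidal_polysD(3)[OF assms]], auto)
  then show ?thesis
    using solenoidal_polysD(1)[OF assms] solenoidal_polys_voigt_class[OF assms, of 1]
    by (simp add: stokes_domain_def V_space_iff sobolev_def)
qed

lemma H1_tendsto_iff:
  assumes "\<And>n. voigt_class 1 (\<phi> n)" "voigt_class 1 w"
  shows "H1_tendsto \<phi> w \<longleftrightarrow> (\<lambda>n. sf 1 (\<phi> n)) \<longlonglongrightarrow> sf 1 w"
proof -
  have "sobolev_norm 1 (\<lambda>x. \<phi> n x - w x) = norm (sf 1 (\<phi> n) - sf 1 w)" for n
    using norm_sf_1[OF voigt_class_diff(1)[OF assms(1)[of n] assms(2)]] voigt_class_diff(2)[OF assms(1)[of n] assms(2)] by simp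
  then show ?thesis unfolding H1_tendsto_def by (simp add: tendsto_norm_zero_iff LIM_zero_iff)
qed

lemma H1_approximation:
  assumes "voigt_class 1 w"
  obtains \<phi> where "\<And>n. \<phi> n \<in> solenoidal_polys" "H1_tendsto \<phi> w"
proof -
  define \<phi> where "\<phi> n = partial_sum (cube n) (vcoef w)" for n
  have p: "\<phi> n \<in> solenoidal_polys" for n unfolding \<phi>_def by (rule partial_sum_galerkin[OF assms])
  have "H1_tendsto \<phi> w"
    unfolding H1_tendsto_iff[OF solenoidal_polys_voigt_class[OF p] assms]
    unfolding \<phi>_def partial_sum_galerkin(2)[OF assms] by (rule galerkin_LIMSEQ)
  with p show thesis by (rule that)
qed

lemma L2_inner_sf_0: "voigt_class 0 u \<Longrightarrow> voigt_class 0 v \<Longrightarrow> L2_inner u v = sf 0 u \<bullet> sf 0 v"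
  using inner_sf_has_sum[of 0 u v] L2_inner_eq[of u v] by (simp add: voigt_class_def has_sum_iff)

text \<open>On the domain of the Stokes operator the pairing is \<open>\<Sum>k. \<bar>k\<bar>\<^sup>2
  (\<phi>\<^sub>k \<bullet> v\<^sub>k)\<close>, which is continuous in the norm of \<open>V\<close>. The
  partial sums of the Fourier series of \<open>w\<close> show that approximating sequences exist, hence
  that the limit is unique.\<close>

lemma stokes_dual_eq:
  assumes w: "voigt_class 1 w" and v: "voigt_class 1 v"
  shows "stokes_dual w v = sf 1 w \<bullet> sf 1 v - L2_inner w v"
proof -
  have v0: "voigt_class 0 v" and w0: "voigt_class 0 w" using voigt_class_change(1)[of 1 _ 0] v w by auto
  have vL: "v \<in> L2" using v by (simp add: voigt_class_def)
  have val: "L2_inner (stokes \<phi>) v = sf 1 \<phi> \<bullet> sf 1 v - L2_inner \<phi> v" if "\<phi> \<in> stokes_domain" for \<phi>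
  proof -
    note s = stokes_domain_vcoef[OF that]
    have L: "\<phi> \<in> L2" "stokes \<phi> \<in> L2" using s by (auto simp: voigt_class_def)
    have "((\<lambda>k. (vweight 1 k)^2 * (vcoef \<phi> k \<bullet> vcoef v k) + - (vcoef \<phi> k \<bullet> vcoef v k)) has_sum (sf 1 \<phi> \<bullet> sf 1 v + - L2_inner \<phi> v)) UNIV"
      by (intro has_sum_add has_sum_uminusI inner_sf_has_sum s v L2_inner_has_sum L vL)
    moreover have "(\<lambda>k. (vweight 1 k)^2 * (vcoef \<phi> k \<bullet> vcoef v k) + - (vcoef \<phi> k \<bullet> vcoef v k)) = (\<lambda>k. vcoef (stokes \<phi>) k \<bullet> vcoef v k)"
      by (simp add: s(3) vweight_square algebra_simps)
    ultimately have "((\<lambda>k. vcoef (stokes \<phi>) k \<bullet> vcoef v k) has_sum (sf 1 \<phi> \<bullet> sf 1 v + - L2_inner \<phi> v)) UNIV"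
      by (simp only:)
    from has_sum_unique[OF L2_inner_has_sum[OF L(2) vL] this] show ?thesis by simp
  qed
  have lim: "(\<lambda>n. L2_inner (stokes (\<phi> n)) v) \<longlonglongrightarrow> sf 1 w \<bullet> sf 1 v - L2_inner w v"
    if \<phi>: "\<forall>n. \<phi> n \<in> stokes_domain" and t: "H1_tendsto \<phi> w" for \<phi>
  proof -
    have V: "voigt_class 1 (\<phi> n)" for n using stokes_domain_vcoef(1) \<phi> by blast
    have V0: "voigt_class 0 (\<phi> n)" for n using voigt_class_change(1)[OF V] by simp
    have t1: "(\<lambda>n. sf 1 (\<phi> n)) \<longlonglongrightarrow> sf 1 w" using t H1_tendsto_iff[OF V w] by simp
    have t0: "(\<lambda>n. sf 0 (\<phi> n)) \<longlonglongrightarrow> sf 0 w"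
    proof -
      have "norm (sf 0 (\<phi> n) - sf 0 w) \<le> norm (sf 1 (\<phi> n) - sf 1 w)" for n
        using voigt_class_change(2)[OF voigt_class_diff(1)[OF V[of n] w], of 0]
        by (simp add: voigt_class_diff(2)[OF V w] voigt_class_diff(2)[OF V0 w0])
      moreover have "(\<lambda>n. norm (sf 1 (\<phi> n) - sf 1 w)) \<longlonglongrightarrow> 0"
        using t1 by (simp add: tendsto_norm_zero_iff LIM_zero_iff)
      ultimately have "(\<lambda>n. sf 0 (\<phi> n) - sf 0 w) \<longlonglongrightarrow> 0"
        by (rule Lim_null_comparison[OF always_eventually[OF allI]])
      then show ?thesis by (rule LIM_zero_cancel)
    qed
    have "L2_inner (stokes (\<phi> n)) v = sf 1 (\<phi> n) \<bullet> sf 1 v - sf 0 (\<phi> n) \<bullet> sf 0 v" for n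
      using val \<phi> L2_inner_sf_0[OF V0 v0] by simp
    moreover have "L2_inner w v = sf 0 w \<bullet> sf 0 v" by (rule L2_inner_sf_0[OF w0 v0])
    ultimately show ?thesis by (simp only:) (intro tendsto_intros t1 t0)
  qed
  obtain \<phi>0 where \<phi>0: "\<And>n. \<phi>0 n \<in> solenoidal_polys" "H1_tendsto \<phi>0 w" using H1_approximation[OF w] by metis
  have d0: "\<forall>n. \<phi>0 n \<in> stokes_domain" using \<phi>0(1) solenoidal_polys_stokes_domain by blast
  show ?thesis
    unfolding stokes_dual_def
  proof (rule the_equality)
    show "\<forall>\<phi>. (\<forall>n. \<phi> n \<in> stokes_domain) \<longrightarrow> H1_tendsto \<phi> w \<longrightarrow> (\<lambda>n. L2_inner (stokes (\<phi> n)) v) \<longlonglongrightarrow> sf 1 w \<bullet> sf 1 v - L2_inner w v"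
      by (intro allI impI) (rule lim)
    fix l assume "\<forall>\<phi>. (\<forall>n. \<phi> n \<in> stokes_domain) \<longrightarrow> H1_tendsto \<phi> w \<longrightarrow> (\<lambda>n. L2_inner (stokes (\<phi> n)) v) \<longlonglongrightarrow> l"
    from this[rule_format, OF d0[rule_format] \<phi>0(2)] have "(\<lambda>n. L2_inner (stokes (\<phi>0 n)) v) \<longlonglongrightarrow> l" .
    then show "l = sf 1 w \<bullet> sf 1 v - L2_inner w v" using lim[OF d0 \<phi>0(2)] by (rule LIMSEQ_unique)
  qed
qed

text \<open>The linear part of the equation acts on Fourier coefficients by \<open>(vweight \<alpha> k)\<^sup>2\<close>, which the phase space
  distributes evenly over its two arguments.\<close>

lemma voigt_form:
  assumes \<alpha>: "0 < \<alpha>" and d: "voigt_class 1 d" and v: "voigt_class 1 v"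
  shows "L2_inner d v + \<alpha>^2 * stokes_dual d v = sf \<alpha> d \<bullet> sf \<alpha> v"
proof -
  have a: "voigt_class \<alpha> d" "voigt_class \<alpha> v" using voigt_class_change(1)[of 1] d v by auto
  have L: "d \<in> L2" "v \<in> L2" using d v by (auto simp: voigt_class_def)
  have "((\<lambda>k. (1 - \<alpha>^2) * (vcoef d k \<bullet> vcoef v k) + \<alpha>^2 * ((vweight 1 k)^2 * (vcoef d k \<bullet> vcoef v k))) has_sum
      ((1 - \<alpha>^2) * L2_inner d v + \<alpha>^2 * (sf 1 d \<bullet> sf 1 v))) UNIV"
    by (intro has_sum_add has_sum_cmult_right inner_sf_has_sum d v L2_inner_has_sum L)
  moreover have "(\<lambda>k. (1 - \<alpha>^2) * (vcoef d k \<bullet> vcoef v k) + \<alpha>^2 * ((vweight 1 k)^2 * (vcoef d k \<bullet> vcoef v k)))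
      = (\<lambda>k. (vweight \<alpha> k)^2 * (vcoef d k \<bullet> vcoef v k))"
    by (simp add: vweight_square algebra_simps)
  ultimately have "((\<lambda>k. (vweight \<alpha> k)^2 * (vcoef d k \<bullet> vcoef v k)) has_sum
      ((1 - \<alpha>^2) * L2_inner d v + \<alpha>^2 * (sf 1 d \<bullet> sf 1 v))) UNIV"
    by (simp only:)
  from has_sum_unique[OF inner_sf_has_sum[OF a] this]
  have "sf \<alpha> d \<bullet> sf \<alpha> v = (1 - \<alpha>^2) * L2_inner d v + \<alpha>^2 * (sf 1 d \<bullet> sf 1 v)" .
  then show ?thesis by (simp add: stokes_dual_eq[OF d v] algebra_simps)
qed

subsection \<open>The advection term\<close>

text \<open>The absolutely convergent Fourier series has the same coefficients as \<open>u\<close> and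
  therefore represents it almost everywhere.\<close>

lemma AE_bounded_if_coeffs_summable:
  fixes u :: "real^3 \<Rightarrow> real"
  assumes u: "u \<in> L2" and s: "(\<lambda>k. norm (fourier_coeff u k)) summable_on UNIV"
  shows "AE x in T3. \<bar>u x\<bar> \<le> infsum (\<lambda>k. norm (fourier_coeff u k)) UNIV"
proof -
  define c where "c k = fourier_coeff u k" for k
  define B where "B = infsum (\<lambda>k. norm (c k)) UNIV"
  define S where "S x = infsum (\<lambda>k. c k * char k x) UNIV" for x
  have sx: "(\<lambda>k. norm (c k * char k x)) summable_on UNIV" for x using s by (simp add: norm_mult c_def)
  have lim: "(\<lambda>N. trig c (cube N) x) \<longlonglongrightarrow> S x" for x
    unfolding trig_def S_def by (rule has_sum_cube_LIMSEQ[OF has_sum_infsum[OF abs_summable_summable[OF sx]]])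
  have mt: "trig c F \<in> borel_measurable T3" for F by (rule L2D(1)[OF L2_trig])
  have mS: "S \<in> borel_measurable T3" by (rule borel_measurable_LIMSEQ_metric[OF mt]) (rule lim)
  have SB: "norm (S x) \<le> B" for x
    unfolding S_def B_def using norm_infsum_bound[OF sx[of x]] by (simp add: norm_mult)
  have tB: "norm (trig c (cube N) x) \<le> B" for N x
  proof -
    have "norm (trig c (cube N) x) \<le> (\<Sum>k\<in>cube N. norm (c k))"
      unfolding trig_def by (rule order_trans[OF norm_sum]) (simp add: norm_mult)
    also have "\<dots> \<le> B" unfolding B_def using s by (intro finite_sum_le_infsum) (auto simp: c_def)
    finally show ?thesis .
  qed
  have SL: "S \<in> L2" by (rule L2_bounded[OF mS SB])
  have "cf S k = c k" for k
  proof -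
    have "(\<lambda>N. LINT x|T3. trig c (cube N) x * char (- k) x) \<longlonglongrightarrow> (LINT x|T3. S x * char (- k) x)"
    proof (rule integral_dominated_convergence[where w = "\<lambda>_. B"])
      show "(\<lambda>x. S x * char (- k) x) \<in> borel_measurable T3" "(\<lambda>x. trig c (cube N) x * char (- k) x) \<in> borel_measurable T3" for N
        by (intro borel_measurable_times mS mt measurable_char)+
      show "integrable T3 (\<lambda>_. B)" by (rule integrable_T3_bounded[of _ "\<bar>B\<bar>"]) auto
      show "AE x in T3. (\<lambda>N. trig c (cube N) x * char (- k) x) \<longlonglongrightarrow> S x * char (- k) x"
        by (intro AE_I2 tendsto_intros lim)
      show "AE x in T3. norm (trig c (cube N) x * char (- k) x) \<le> B" for N
        by (intro AE_I2) (simp add: norm_mult tB)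
    qed
    then have 1: "(\<lambda>N. cf (trig c (cube N)) k) \<longlonglongrightarrow> cf S k" by (simp add: cf_def)
    obtain M where M: "\<And>n. n \<ge> M \<Longrightarrow> {k} \<subseteq> cube n" using finite_subset_cube[of "{k}"] by auto
    have "cf (trig c (cube N)) k = c k" if "N \<ge> M" for N using M[OF that] by (simp add: cf_trig)
    then have "(\<lambda>N. cf (trig c (cube N)) k) \<longlonglongrightarrow> c k"
      by (intro tendsto_eventually) (auto simp: eventually_sequentially)
    with 1 show ?thesis by (rule LIMSEQ_unique)
  qed
  then have "AE x in T3. complex_of_real (u x) = S x"
    by (intro L2_unique L2_of_real u SL) (simp add: c_def fourier_coeff_cf)
  then have "AE x in T3. \<bar>u x\<bar> \<le> B"
  proof eventually_elim
    case (elim x)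
    then show ?case using SB[of x] norm_of_real[of "u x", where 'a = complex] by (simp del: norm_of_real)
  qed
  then show ?thesis by (simp add: B_def c_def)
qed

lemma AE_bounded_component:
  assumes u: "u \<in> L2" and s: "(\<lambda>k. norm (vcoef u k)) summable_on UNIV"
  shows "\<exists>B. AE x in T3. \<bar>u x $ i\<bar> \<le> B"
proof -
  have "(\<lambda>k. norm (fourier_coeff (\<lambda>x. u x $ i) k)) summable_on UNIV"
    by (rule summable_on_comparison_test[OF s])
       (use Finite_Cartesian_Product.norm_nth_le[of "vcoef u _" i] in \<open>auto simp: vcoef_def\<close>)
  from AE_bounded_if_coeffs_summable[OF L2_component[OF u] this] show ?thesis by blast
qed

lemma L2_mult_AE_bounded:
  fixes f g :: "real^3 \<Rightarrow> real"
  assumes f: "f \<in> L2" and g: "g \<in> borel_measurable T3" and B: "AE x in T3. \<bar>g x\<bar> \<le> B"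
  shows "(\<lambda>x. f x * g x) \<in> L2"
proof -
  have m: "(\<lambda>x. f x * g x) \<in> borel_measurable T3" using L2D(1)[OF f] g by measurable
  have "integrable T3 (\<lambda>x. (norm (f x * g x))^2)"
  proof (rule Bochner_Integration.integrable_bound)
    show "integrable T3 (\<lambda>x. B^2 * (norm (f x))^2)" using L2D(2)[OF f] by auto
    show "(\<lambda>x. (norm (f x * g x))^2) \<in> borel_measurable T3" using m by measurable
    show "AE x in T3. norm ((norm (f x * g x))^2) \<le> norm (B^2 * (norm (f x))^2)"
      using B
    proof eventually_elim
      case (elim x)
      then have "(g x)^2 \<le> B^2" using power_mono[of "\<bar>g x\<bar>" B 2] by simp
      then have "(f x)^2 * (g x)^2 \<le> (f x)^2 * B^2" by (rule mult_left_mono) simp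
      then show ?case by (simp add: power_mult_distrib abs_mult mult.commute)
    qed
  qed
  with m show ?thesis by (simp add: L2_def)
qed

lemma grad_coeffs:
  assumes s: "is_l2 (\<lambda>k. kn k * norm (vcoef u k))"
  shows "(\<lambda>x. grad u x $ i $ j) \<in> L2" "fourier_coeff (\<lambda>x. grad u x $ i $ j) k = \<i> * of_real (freq k $ j) * vcoef u k $ i"
proof -
  have "is_l2 (\<lambda>k. norm (\<i> * of_real (freq k $ j) * fourier_coeff (\<lambda>y. u y $ i) k))"
  proof (rule is_l2_comparison(1)[OF s])
    fix k
    have "\<bar>freq k $ j\<bar> * norm (vcoef u k $ i) \<le> kn k * norm (vcoef u k)"
      by (intro mult_mono component_le_norm_cart Finite_Cartesian_Product.norm_nth_le) auto
    then show "\<bar>norm (\<i> * of_real (freq k $ j) * fourier_coeff (\<lambda>y. u y $ i) k)\<bar> \<le> kn k * norm (vcoef u k)"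
      by (simp add: norm_mult vcoef_def)
  qed
  from fourier_mult_spec[OF this]
  show "(\<lambda>x. grad u x $ i $ j) \<in> L2" "fourier_coeff (\<lambda>x. grad u x $ i $ j) k = \<i> * of_real (freq k $ j) * vcoef u k $ i"
    by (simp_all add: grad_def vcoef_def freq_minus)
qed

text \<open>Bounded components of the advecting field keep the product in \<open>L\<^sup>2\<close>, and
  the Fourier coefficients of a product are convolutions.\<close>

lemma advection:
  assumes w1: "w1 \<in> L2" and b: "\<And>i. \<exists>B. AE x in T3. \<bar>w1 x $ i\<bar> \<le> B"
    and w2: "w2 \<in> L2" and s: "is_l2 (\<lambda>k. kn k * norm (vcoef w2 k))"
  shows "voigt_class 0 (advection w1 w2)" "vcoef (advection w1 w2) k = lproj k (advec (vcoef w1) (vcoef w2) k)"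
proof -
  define g where "g i j x = grad w2 x $ i $ j" for i j x
  have g: "g i j \<in> L2" "fourier_coeff (g i j) k = \<i> * of_real (freq k $ j) * vcoef w2 k $ i" for i j k
    using grad_coeffs[OF s] unfolding g_def by auto
  have comp: "(grad w2 x *v w1 x) $ i = (\<Sum>j\<in>UNIV. w1 x $ j * g i j x)" for x i
    by (simp add: matrix_vector_mult_def g_def mult.commute)
  have pL: "(\<lambda>x. w1 x $ j * g i j x) \<in> L2" for i j
  proof -
    obtain B where "AE x in T3. \<bar>w1 x $ j\<bar> \<le> B" using b by blast
    from L2_mult_AE_bounded[OF g(1) L2D(1)[OF L2_component[OF w1]] this, of i j]
    show ?thesis by (simp add: mult.commute)
  qed
  have fL: "(\<lambda>x. grad w2 x *v w1 x) \<in> L2"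
    by (rule L2_vecI) (simp only: comp, intro L2_sum pL)
  have v: "vcoef (\<lambda>x. grad w2 x *v w1 x) k = advec (vcoef w1) (vcoef w2) k" for k
  proof (subst vec_eq_iff, intro allI)
    fix i
    have "((\<lambda>l. \<Sum>j\<in>UNIV. fourier_coeff (\<lambda>x. w1 x $ j) l * fourier_coeff (g i j) (k - l)) has_sum
        (\<Sum>j\<in>UNIV. fourier_coeff (\<lambda>x. w1 x $ j * g i j x) k)) UNIV"
      by (intro has_sum_finite_sum fourier_coeff_mult L2_component w1 g) simp
    moreover have "(\<Sum>j\<in>UNIV. fourier_coeff (\<lambda>x. w1 x $ j) l * fourier_coeff (g i j) (k - l)) = transport (vcoef w1) (vcoef w2) k l $ i" for l
      by (simp add: g(2) transport_def cdot_def vcoef_def sum_distrib_left sum_distrib_right mult_ac)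
    moreover have "(\<Sum>j\<in>UNIV. fourier_coeff (\<lambda>x. w1 x $ j * g i j x) k) = vcoef (\<lambda>x. grad w2 x *v w1 x) k $ i"
      by (simp add: vcoef_def comp fourier_coeff_sum[OF pL])
    ultimately have "((\<lambda>l. transport (vcoef w1) (vcoef w2) k l $ i) has_sum vcoef (\<lambda>x. grad w2 x *v w1 x) k $ i) UNIV" by simp
    moreover have "((\<lambda>l. transport (vcoef w1) (vcoef w2) k l $ i) has_sum advec (vcoef w1) (vcoef w2) k $ i) UNIV"
      unfolding advec_def
      by (intro has_sum_bounded_linear[OF bounded_linear_vec_nth] has_sum_infsum transport_summable vcoef_is_l2 w1 s)
    ultimately show "vcoef (\<lambda>x. grad w2 x *v w1 x) k $ i = advec (vcoef w1) (vcoef w2) k $ i"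
      by (rule has_sum_unique)
  qed
  show "voigt_class 0 (advection w1 w2)" unfolding advection_def by (rule leray[OF fL])
  show "vcoef (advection w1 w2) k = lproj k (advec (vcoef w1) (vcoef w2) k)"
    unfolding advection_def leray(2)[OF fL] v ..
qed

lemma L2_inner_advection_poly:
  assumes \<phi>: "\<phi> \<in> solenoidal_polys" and \<psi>: "\<psi> \<in> solenoidal_polys" and v: "voigt_class 1 v"
  shows "L2_inner (advection \<phi> \<psi>) v = - (voigt_op 1 (sf 1 \<phi>) (sf 1 \<psi>) \<bullet> sf 1 v)"
proof -
  have one: "(0::real) < 1" by simp
  note p = solenoidal_polys_voigt_class[OF \<phi>, of 1] solenoidal_polys_voigt_class[OF \<psi>, of 1]
  obtain B where B: "\<And>x. norm (\<phi> x) \<le> B" using solenoidal_polysD(4)[OF \<phi>] by blast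
  have b: "\<exists>B. AE x in T3. \<bar>\<phi> x $ i\<bar> \<le> B" for i
    using order_trans[OF component_le_norm_cart B] by (intro exI[of _ B] AE_I2) blast
  have ss: "is_l2 (\<lambda>k. norm (vcoef \<phi> k))" "is_l2 (\<lambda>k. kn k * norm (vcoef \<psi> k))"
    using vfield_summable[OF one, of "sf 1 \<phi>"] vfield_summable[OF one, of "sf 1 \<psi>"] by (simp_all add: vfield_sf p)
  note a = advection[OF solenoidal_polysD(1)[OF \<phi>] b solenoidal_polysD(1)[OF \<psi>] ss(2)]
  have L: "advection \<phi> \<psi> \<in> L2" "v \<in> L2" "solenoidal_seq (vcoef v)" using a(1) v by (auto simp: voigt_class_def)
  have "L2_inner (advection \<phi> \<psi>) v = infsum (\<lambda>k. advec (vcoef \<phi>) (vcoef \<psi>) k \<bullet> vcoef v k) UNIV"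
    unfolding L2_inner_eq[OF L(1,2)] a(2)
    using solenoidal_seqD[OF L(3)] by (intro infsum_cong inner_lproj) auto
  also have "\<dots> = trilinear (vcoef \<phi>) (vcoef \<psi>) (vcoef v)"
    using p v by (intro trilinear_eq_advec ss transport_bound_summable[OF one]) (auto simp: voigt_class_def)
  also have "\<dots> = - (voigt_op 1 (sf 1 \<phi>) (sf 1 \<psi>) \<bullet> sf 1 v)"
    using inner_voigt_op[OF one, of "sf 1 \<phi>" "sf 1 \<psi>" "sf 1 v"] by (simp add: vfield_sf p v)
  finally show ?thesis .
qed

text \<open>For trigonometric polynomials the pairing is the nonlinearity of the phase space, and bounded
  bilinear maps are continuous; density of the polynomials makes the limit unique.\<close>

lemma advection_dual_eq:
  assumes w1: "voigt_class 1 w1" and w2: "voigt_class 1 w2" and v: "voigt_class 1 v"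
  shows "advection_dual w1 w2 v = trilinear (vcoef w1) (vcoef w2) (vcoef v)"
proof -
  have one: "(0::real) < 1" by simp
  interpret bounded_bilinear "voigt_op 1" by (rule bounded_bilinear_voigt_op[OF one])
  define l where "l = - (voigt_op 1 (sf 1 w1) (sf 1 w2) \<bullet> sf 1 v)"
  have lim: "(\<lambda>n. L2_inner (advection (\<phi> n) (\<psi> n)) v) \<longlonglongrightarrow> l"
    if p: "\<forall>n. \<phi> n \<in> solenoidal_polys" "\<forall>n. \<psi> n \<in> solenoidal_polys" and t: "H1_tendsto \<phi> w1" "H1_tendsto \<psi> w2" for \<phi> \<psi>
  proof -
    have "(\<lambda>n. sf 1 (\<phi> n)) \<longlonglongrightarrow> sf 1 w1" "(\<lambda>n. sf 1 (\<psi> n)) \<longlonglongrightarrow> sf 1 w2"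
      using t H1_tendsto_iff[OF solenoidal_polys_voigt_class[OF p(1)[rule_format]] w1]
        H1_tendsto_iff[OF solenoidal_polys_voigt_class[OF p(2)[rule_format]] w2] by auto
    then have "(\<lambda>n. - (voigt_op 1 (sf 1 (\<phi> n)) (sf 1 (\<psi> n)) \<bullet> sf 1 v)) \<longlonglongrightarrow> l"
      unfolding l_def by (intro tendsto_intros tendsto)
    then show ?thesis using L2_inner_advection_poly[OF _ _ v] p by simp
  qed
  obtain \<phi>0 where \<phi>0: "\<And>n. \<phi>0 n \<in> solenoidal_polys" "H1_tendsto \<phi>0 w1" using H1_approximation[OF w1] by metis
  obtain \<psi>0 where \<psi>0: "\<And>n. \<psi>0 n \<in> solenoidal_polys" "H1_tendsto \<psi>0 w2" using H1_approximation[OF w2] by metis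
  have "advection_dual w1 w2 v = l"
    unfolding advection_dual_def
  proof (rule the_equality)
    show "\<forall>\<phi> \<psi>. (\<forall>n. \<phi> n \<in> solenoidal_polys) \<longrightarrow> (\<forall>n. \<psi> n \<in> solenoidal_polys) \<longrightarrow> H1_tendsto \<phi> w1 \<longrightarrow> H1_tendsto \<psi> w2 \<longrightarrow>
      (\<lambda>n. L2_inner (advection (\<phi> n) (\<psi> n)) v) \<longlonglongrightarrow> l"
      by (intro allI impI) (rule lim, assumption+)
    fix l' assume "\<forall>\<phi> \<psi>. (\<forall>n. \<phi> n \<in> solenoidal_polys) \<longrightarrow> (\<forall>n. \<psi> n \<in> solenoidal_polys) \<longrightarrow> H1_tendsto \<phi> w1 \<longrightarrow> H1_tendsto \<psi> w2 \<longrightarrow>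
      (\<lambda>n. L2_inner (advection (\<phi> n) (\<psi> n)) v) \<longlonglongrightarrow> l'"
    from this[rule_format, OF \<phi>0(1) \<psi>0(1) \<phi>0(2) \<psi>0(2)]
    have "(\<lambda>n. L2_inner (advection (\<phi>0 n) (\<psi>0 n)) v) \<longlonglongrightarrow> l'" .
    moreover have "(\<lambda>n. L2_inner (advection (\<phi>0 n) (\<psi>0 n)) v) \<longlonglongrightarrow> l" using \<phi>0 \<psi>0 by (intro lim) auto
    ultimately show "l' = l" by (rule LIMSEQ_unique)
  qed
  then show ?thesis
    using inner_voigt_op[OF one, of "sf 1 w1" "sf 1 w2" "sf 1 v"] by (simp add: l_def vfield_sf w1 w2 v)
qed

lemma advection_dual_voigt_op:
  assumes \<alpha>: "0 < \<alpha>" and u: "voigt_class 1 u" and v: "voigt_class 1 v"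
  shows "advection_dual u u v = - (voigt_op \<alpha> (sf \<alpha> u) (sf \<alpha> u) \<bullet> sf \<alpha> v)"
proof -
  have a: "voigt_class \<alpha> u" "voigt_class \<alpha> v" using voigt_class_change(1)[of 1] u v by auto
  show ?thesis
    unfolding advection_dual_eq[OF u u v] inner_voigt_op[OF \<alpha>] vfield_sf[OF a(1)] vfield_sf[OF a(2)] by simp
qed

subsection \<open>Solutions are orbits of the quadratic flow\<close>

definition velocity :: "real \<Rightarrow> sfield \<Rightarrow> real^3 \<Rightarrow> real^3" where
  "velocity \<alpha> b = synth (vfield \<alpha> b)"

lemma velocity:
  assumes \<alpha>: "0 < \<alpha>"
  shows "vcoef (velocity \<alpha> b) = vfield \<alpha> b" "voigt_class \<beta> (velocity \<alpha> b)" "sf \<alpha> (velocity \<alpha> b) = b"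
proof -
  have s: "is_l2 (\<lambda>k. norm (vfield \<alpha> b k))" by (rule vfield_summable(1)[OF \<alpha>])
  have sym: "vfield \<alpha> b (- k) = vcnj (vfield \<alpha> b k)" for k
    using solenoidal_vfield[of \<alpha> b] by (simp add: solenoidal_seq_def)
  note y = synth[OF s sym, folded velocity_def]
  show v: "vcoef (velocity \<alpha> b) = vfield \<alpha> b" using y(2) by auto
  have c: "voigt_class \<alpha> (velocity \<alpha> b)"
    unfolding voigt_class_def v using y(1) solenoidal_vfield[of \<alpha> b] is_l2_vfield(1) by auto
  then show "voigt_class \<beta> (velocity \<alpha> b)" by (rule voigt_class_change(1)[OF _ \<alpha>])
  show "sf \<alpha> (velocity \<alpha> b) = b" by (rule sfield_eqI) (simp add: coeffs_sf[OF c] v vweight_vfield)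
qed

lemma sobolev_norm_1_tendsto_0_iff:
  assumes \<alpha>: "0 < \<alpha>" and f: "\<And>s. voigt_class 1 (f s)"
  shows "((\<lambda>s. sobolev_norm 1 (f s)) \<longlongrightarrow> 0) F \<longleftrightarrow> ((\<lambda>s. sf \<alpha> (f s)) \<longlongrightarrow> 0) F"
proof
  have le: "norm (sf \<alpha> (f s)) \<le> max 1 \<alpha> * sobolev_norm 1 (f s)" for s
    using voigt_class_change(2)[OF f[of s], of \<alpha>] \<alpha> by (simp add: norm_sf_1[OF f])
  have ge: "norm (sobolev_norm 1 (f s)) \<le> max 1 (1 / \<alpha>) * norm (sf \<alpha> (f s))" for s
    using voigt_class_change(2)[OF voigt_class_change(1)[OF f[of s], of \<alpha>], of 1] \<alpha> by (simp flip: norm_sf_1[OF f])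
  show "((\<lambda>s. sf \<alpha> (f s)) \<longlongrightarrow> 0) F" if l: "((\<lambda>s. sobolev_norm 1 (f s)) \<longlongrightarrow> 0) F"
    by (rule Lim_null_comparison[OF always_eventually[OF allI[OF le]]]) (use tendsto_mult_right_zero[OF l] in simp)
  show "((\<lambda>s. sobolev_norm 1 (f s)) \<longlongrightarrow> 0) F" if l: "((\<lambda>s. sf \<alpha> (f s)) \<longlongrightarrow> 0) F"
    by (rule Lim_null_comparison[OF always_eventually[OF allI[OF ge]]])
       (use tendsto_mult_right_zero[OF tendsto_norm_zero[OF l]] in simp)
qed

lemma has_vector_derivative_iff_quotient:
  "(b has_vector_derivative d) (at t) \<longleftrightarrow> ((\<lambda>s. (b s - b t) /\<^sub>R (s - t) - d) \<longlongrightarrow> 0) (at t)"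
proof -
  have eq: "norm ((b s - b t) - (s - t) *\<^sub>R d) / norm (s - t) = norm ((b s - b t) /\<^sub>R (s - t) - d)" if "s \<noteq> t" for s
  proof -
    have "(b s - b t) /\<^sub>R (s - t) - d = inverse (s - t) *\<^sub>R ((b s - b t) - (s - t) *\<^sub>R d)"
      using that by (simp add: scaleR_diff_right)
    then show ?thesis by (simp only: norm_scaleR) (simp add: divide_inverse abs_inverse mult.commute)
  qed
  have "(b has_vector_derivative d) (at t) \<longleftrightarrow> ((\<lambda>s. norm ((b s - b t) - (s - t) *\<^sub>R d) / norm (s - t)) \<longlongrightarrow> 0) (at t)"
    unfolding has_vector_derivative_def has_derivative_iff_norm by (simp add: bounded_linear_scaleR_left)
  also have "\<dots> \<longleftrightarrow> ((\<lambda>s. norm ((b s - b t) /\<^sub>R (s - t) - d)) \<longlongrightarrow> 0) (at t)"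
    by (rule filterlim_cong[OF refl refl]) (simp only: eventually_at_filter, intro always_eventually allI impI eq)
  finally show ?thesis by (simp add: tendsto_norm_zero_iff)
qed

text \<open>The norm of \<open>V\<close> and the norm of the phase space are equivalent, so both notions
  of a continuously differentiable curve agree.\<close>

lemma C1_V_iff:
  assumes \<alpha>: "0 < \<alpha>" and u: "\<And>t. voigt_class 1 (u t)" and du: "\<And>t. voigt_class 1 (du t)"
  shows "C1_V UNIV u du \<longleftrightarrow>
    (\<forall>t. ((\<lambda>s. sf \<alpha> (u s)) has_vector_derivative sf \<alpha> (du t)) (at t) \<and> ((\<lambda>s. sf \<alpha> (du s)) \<longlongrightarrow> sf \<alpha> (du t)) (at t))"
proof -
  note a = voigt_class_change(1)[OF u, of \<alpha>] voigt_class_change(1)[OF du, of \<alpha>]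
  have q: "voigt_class \<beta> (\<lambda>x. (u s x - u t x) /\<^sub>R (s - t) - du t x)"
    "sf \<beta> (\<lambda>x. (u s x - u t x) /\<^sub>R (s - t) - du t x) = (sf \<beta> (u s) - sf \<beta> (u t)) /\<^sub>R (s - t) - sf \<beta> (du t)"
    if v: "\<And>t. voigt_class \<beta> (u t)" "\<And>t. voigt_class \<beta> (du t)" for \<beta> s t
    using voigt_class_diff[OF voigt_class_scaleR(1)[OF voigt_class_diff(1)[OF v(1)[of s] v(1)[of t]], of "inverse (s - t)"] v(2)[of t]]
      voigt_class_scaleR(2)[OF voigt_class_diff(1)[OF v(1)[of s] v(1)[of t]], of "inverse (s - t)"]
      voigt_class_diff(2)[OF v(1)[of s] v(1)[of t]] by auto
  have q1: "((\<lambda>s. sobolev_norm 1 (\<lambda>x. (u s x - u t x) /\<^sub>R (s - t) - du t x)) \<longlongrightarrow> 0) (at t)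
      \<longleftrightarrow> ((\<lambda>s. sf \<alpha> (u s)) has_vector_derivative sf \<alpha> (du t)) (at t)" for t
    unfolding has_vector_derivative_iff_quotient
    by (subst sobolev_norm_1_tendsto_0_iff[OF \<alpha> q(1)[OF u du]]) (simp add: q(2)[OF a])
  have q2: "((\<lambda>s. sobolev_norm 1 (\<lambda>x. du s x - du t x)) \<longlongrightarrow> 0) (at t)
      \<longleftrightarrow> ((\<lambda>s. sf \<alpha> (du s)) \<longlongrightarrow> sf \<alpha> (du t)) (at t)" for t
    by (subst sobolev_norm_1_tendsto_0_iff[OF \<alpha> voigt_class_diff(1)[OF du du]])
       (simp add: voigt_class_diff(2)[OF a(2) a(2)] LIM_zero_iff)
  show ?thesis unfolding C1_V_def q1 q2 using u du by (simp add: V_space_iff)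
qed

text \<open>Testing the equation with every element of \<^term>\<open>V_space\<close> identifies the derivative, because these elements
  exhaust the phase space.\<close>

lemma voigt_equation_iff:
  assumes \<alpha>: "0 < \<alpha>" and u: "voigt_class 1 u" and d: "voigt_class 1 d"
  shows "(\<forall>v\<in>V_space. L2_inner d v + \<alpha>^2 * stokes_dual d v + advection_dual u u v = 0)
    \<longleftrightarrow> sf \<alpha> d = voigt_op \<alpha> (sf \<alpha> u) (sf \<alpha> u)"
proof -
  have eq: "L2_inner d v + \<alpha>^2 * stokes_dual d v + advection_dual u u v = (sf \<alpha> d - voigt_op \<alpha> (sf \<alpha> u) (sf \<alpha> u)) \<bullet> sf \<alpha> v"
    if "voigt_class 1 v" for v
    by (simp add: voigt_form[OF \<alpha> d that] advection_dual_voigt_op[OF \<alpha> u that] inner_diff_left)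
  show ?thesis
  proof
    assume h: "\<forall>v\<in>V_space. L2_inner d v + \<alpha>^2 * stokes_dual d v + advection_dual u u v = 0"
    define w where "w = sf \<alpha> d - voigt_op \<alpha> (sf \<alpha> u) (sf \<alpha> u)"
    have "velocity \<alpha> w \<in> V_space" by (simp add: V_space_iff velocity(2)[OF \<alpha>])
    with h have "w \<bullet> sf \<alpha> (velocity \<alpha> w) = 0" using eq[OF velocity(2)[OF \<alpha>], of w] by (simp add: w_def)
    then have "w = 0" by (simp add: velocity(3)[OF \<alpha>])
    then show "sf \<alpha> d = voigt_op \<alpha> (sf \<alpha> u) (sf \<alpha> u)" by (simp add: w_def)
  next
    assume "sf \<alpha> d = voigt_op \<alpha> (sf \<alpha> u) (sf \<alpha> u)"
    then show "\<forall>v\<in>V_space. L2_inner d v + \<alpha>^2 * stokes_dual d v + advection_dual u u v = 0"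
      using eq by (simp add: V_space_iff)
  qed
qed

lemma flow_of_solution:
  assumes \<alpha>: "0 < \<alpha>" and u0: "voigt_class 1 u0" and w: "euler_voigt_solution \<alpha> u0 (-\<infinity>) \<infinity> w"
  shows "voigt_class 1 (w t)" "quadratic_flow (voigt_op \<alpha>) (\<lambda>t. sf \<alpha> (w t))" "sf \<alpha> (w 0) = sf \<alpha> u0"
proof -
  have UN: "{t. -\<infinity> < ereal t \<and> ereal t < \<infinity>} = UNIV" by auto
  obtain dw where C: "C1_V UNIV w dw"
    and e: "\<And>t. \<forall>v\<in>V_space. L2_inner (dw t) v + \<alpha>^2 * stokes_dual (dw t) v + advection_dual (w t) (w t) v = 0"
    and i: "AE x in T3. w 0 x = u0 x"
    using w unfolding euler_voigt_solution_def UN by auto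
  have V: "voigt_class 1 (w t)" "voigt_class 1 (dw t)" for t using C by (auto simp: C1_V_def V_space_iff)
  then show "voigt_class 1 (w t)" by simp
  have "sf \<alpha> (dw t) = voigt_op \<alpha> (sf \<alpha> (w t)) (sf \<alpha> (w t))" for t using e voigt_equation_iff[OF \<alpha> V] by blast
  then show "quadratic_flow (voigt_op \<alpha>) (\<lambda>t. sf \<alpha> (w t))"
    using C unfolding C1_V_iff[OF \<alpha> V] quadratic_flow_def by simp
  have L: "w 0 \<in> L2" "u0 \<in> L2" using V u0 by (auto simp: voigt_class_def)
  show "sf \<alpha> (w 0) = sf \<alpha> u0" unfolding sf_def using vcoef_cong_AE[OF L i] by simp
qed

lemma solution_of_flow:
  assumes \<alpha>: "0 < \<alpha>" and u0: "voigt_class 1 u0" and b: "quadratic_flow (voigt_op \<alpha>) b" "b 0 = sf \<alpha> u0"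
  shows "euler_voigt_solution \<alpha> u0 (-\<infinity>) \<infinity> (\<lambda>t. velocity \<alpha> (b t))"
proof -
  interpret bounded_bilinear "voigt_op \<alpha>" by (rule bounded_bilinear_voigt_op[OF \<alpha>])
  have UN: "{t. -\<infinity> < ereal t \<and> ereal t < \<infinity>} = UNIV" by auto
  define d where "d t = velocity \<alpha> (voigt_op \<alpha> (b t) (b t))" for t
  note V = velocity(2)[OF \<alpha>]
  have der: "(b has_vector_derivative voigt_op \<alpha> (b t) (b t)) (at t)" for t using b(1) by (simp add: quadratic_flow_def)
  have c: "(b \<longlongrightarrow> b t) (at t)" for t
    using has_vector_derivative_continuous[OF der[of t]] by (simp add: isCont_def)
  have "C1_V UNIV (\<lambda>t. velocity \<alpha> (b t)) d"
    unfolding d_def C1_V_iff[OF \<alpha> V V] velocity(3)[OF \<alpha>] using der c by (auto intro!: tendsto)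
  moreover have "\<forall>v\<in>V_space. L2_inner (d t) v + \<alpha>^2 * stokes_dual (d t) v + advection_dual (velocity \<alpha> (b t)) (velocity \<alpha> (b t)) v = 0" for t
    unfolding d_def voigt_equation_iff[OF \<alpha> V V] velocity(3)[OF \<alpha>] ..
  moreover have "AE x in T3. velocity \<alpha> (b 0) x = u0 x"
  proof (rule vcoef_unique)
    show "velocity \<alpha> (b 0) \<in> L2" "u0 \<in> L2" using V[of 1] u0 by (auto simp: voigt_class_def)
    show "vcoef (velocity \<alpha> (b 0)) k = vcoef u0 k" for k
      using voigt_class_change(1)[OF u0, of \<alpha>] by (simp add: velocity(1)[OF \<alpha>] b(2) vfield_sf)
  qed
  ultimately show ?thesis unfolding euler_voigt_solution_def UN by blast
qed

theorem euler_voigt_solution_exists_unique: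
  assumes \<alpha>: "0 < \<alpha>" and u0: "voigt_class 1 u0"
  obtains b where "quadratic_flow (voigt_op \<alpha>) b" "b 0 = sf \<alpha> u0"
    "euler_voigt_solution \<alpha> u0 (-\<infinity>) \<infinity> (\<lambda>t. velocity \<alpha> (b t))"
    "\<And>w t. euler_voigt_solution \<alpha> u0 (-\<infinity>) \<infinity> w \<Longrightarrow> AE x in T3. w t x = velocity \<alpha> (b t) x"
proof -
  note Q = bounded_bilinear_voigt_op[OF \<alpha>] voigt_op_conservative[OF \<alpha>]
  obtain b where b: "quadratic_flow (voigt_op \<alpha>) b" "b 0 = sf \<alpha> u0" by (rule quadratic_flow_exists[OF Q])
  show thesis
  proof (rule that[OF b solution_of_flow[OF \<alpha> u0 b]])
    fix w t
    assume "euler_voigt_solution \<alpha> u0 (-\<infinity>) \<infinity> w"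
    note w = flow_of_solution[OF \<alpha> u0 this]
    have e: "sf \<alpha> (w t) = b t" by (rule quadratic_flow_unique[OF Q b(1) w(2)]) (simp add: w(3) b(2))
    show "AE x in T3. w t x = velocity \<alpha> (b t) x"
    proof (rule vcoef_unique)
      show "w t \<in> L2" "velocity \<alpha> (b t) \<in> L2" using w(1) velocity(2)[OF \<alpha>, of 1] by (auto simp: voigt_class_def)
      show "vcoef (w t) k = vcoef (velocity \<alpha> (b t)) k" for k
        using vfield_sf[OF voigt_class_change(1)[OF w(1)[of t], of \<alpha>]] by (simp add: velocity(1)[OF \<alpha>] e)
    qed
  qed
qed

subsection \<open>Gevrey classes in terms of Fourier coefficients\<close>

definition gevrey_mult :: "real \<Rightarrow> real \<Rightarrow> int^3 \<Rightarrow> real" where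
  "gevrey_mult q \<tau> k = kn k powr (2 * q) * exp (\<tau> * kn k)"

lemma gevrey_mult_nonneg: "0 \<le> gevrey_mult q \<tau> k"
  by (simp add: gevrey_mult_def)

lemma gevrey_symbol_eq: "gevrey_symbol q \<tau> k = of_real (gevrey_mult q \<tau> k)"
  by (simp add: gevrey_symbol_def gevrey_mult_def)

lemma gevrey_symbol_cscale: "gevrey_symbol q \<tau> k *s a = gevrey_mult q \<tau> k *\<^sub>R a"
  by (simp add: gevrey_symbol_eq vec_eq_iff scaleR_conv_of_real[where 'a = complex])

lemma gevrey_mult_even: "gevrey_mult q \<tau> (- k) = gevrey_mult q \<tau> k"
  by (simp add: gevrey_mult_def freq_minus)

lemma Aexp_spec:
  assumes "is_l2 (\<lambda>k. gevrey_mult q \<tau> k * norm (vcoef u k))"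
  shows "Aexp q \<tau> u \<in> L2" "vcoef (Aexp q \<tau> u) k = gevrey_mult q \<tau> k *\<^sub>R vcoef u k"
    "L2_norm (Aexp q \<tau> u) = l2 (\<lambda>k. gevrey_mult q \<tau> k * norm (vcoef u k))"
proof -
  have s: "is_l2 (\<lambda>k. norm (gevrey_symbol q \<tau> k *s vcoef u k))"
    using assms by (simp add: gevrey_symbol_cscale gevrey_mult_nonneg)
  have e: "gevrey_symbol q \<tau> (- k) = cnj (gevrey_symbol q \<tau> k)" for k
    by (simp add: gevrey_symbol_eq gevrey_mult_even)
  note m = vec_mult_spec[OF s e]
  show "Aexp q \<tau> u \<in> L2" by (rule m)
  show v: "vcoef (Aexp q \<tau> u) k = gevrey_mult q \<tau> k *\<^sub>R vcoef u k" for k by (simp add: m(2) gevrey_symbol_cscale)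
  show "L2_norm (Aexp q \<tau> u) = l2 (\<lambda>k. gevrey_mult q \<tau> k * norm (vcoef u k))"
    by (simp add: L2_norm_vcoef[OF m(1)] v gevrey_mult_nonneg)
qed

text \<open>Membership in the Sobolev space of order \<open>2 q\<close> is implied because \<open>1 +
  \<bar>k\<bar>\<^sup>2 \<le> 2 \<bar>k\<bar>\<^sup>2\<close> at nonzero frequencies and the mean
  vanishes.\<close>

lemma gevrey_iff:
  assumes q: "0 \<le> q" and \<tau>: "0 \<le> \<tau>"
  shows "u \<in> gevrey q \<tau> \<longleftrightarrow> voigt_class 1 u \<and> is_l2 (\<lambda>k. gevrey_mult q \<tau> k * norm (vcoef u k))"
proof
  assume "u \<in> gevrey q \<tau>"
  then obtain w where V: "voigt_class 1 u" and w: "w \<in> L2"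
    and m: "\<And>i. is_multiplied (gevrey_symbol q \<tau>) (\<lambda>x. u x $ i) (\<lambda>x. w x $ i)"
    by (auto simp: gevrey_def V_space_iff)
  have "vcoef w k = gevrey_mult q \<tau> k *\<^sub>R vcoef u k" for k
    unfolding gevrey_symbol_cscale[symmetric] using m by (simp add: vec_eq_iff vcoef_def is_multiplied_def)
  then show "voigt_class 1 u \<and> is_l2 (\<lambda>k. gevrey_mult q \<tau> k * norm (vcoef u k))"
    using V vcoef_is_l2[OF w] by (simp add: gevrey_mult_nonneg)
next
  assume "voigt_class 1 u \<and> is_l2 (\<lambda>k. gevrey_mult q \<tau> k * norm (vcoef u k))"
  then have V: "voigt_class 1 u" and s: "is_l2 (\<lambda>k. gevrey_mult q \<tau> k * norm (vcoef u k))" by auto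
  have L: "u \<in> L2" and z: "vcoef u 0 = 0" using V by (auto simp: voigt_class_def dest: solenoidal_seqD)
  have "sobolev_term (2 * q) u summable_on UNIV"
    unfolding sobolev_term_vcoef[abs_def]
  proof (rule summable_on_comparison_test)
    show "(\<lambda>k. 2 powr (2 * q) * (gevrey_mult q \<tau> k * norm (vcoef u k))^2) summable_on UNIV"
      using s unfolding is_l2_def by (rule summable_on_cmult_right)
    fix k :: "int^3"
    show "(1 + (kn k)^2) powr (2 * q) * (norm (vcoef u k))^2 \<le> 2 powr (2 * q) * (gevrey_mult q \<tau> k * norm (vcoef u k))^2"
    proof (cases "k = 0")
      case False
      then have k1: "1 \<le> kn k" by (rule kn_ge_1)
      have "(1 + (kn k)^2) powr (2 * q) \<le> (2 * (kn k)^2) powr (2 * q)"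
        using k1 q by (intro powr_mono2) (auto simp: one_le_power)
      also have "\<dots> = 2 powr (2 * q) * (kn k powr (2 * q))^2"
        using k1 by (simp add: powr_mult power2_eq_square)
      also have "\<dots> \<le> 2 powr (2 * q) * (gevrey_mult q \<tau> k)^2"
        unfolding gevrey_mult_def using \<tau> by (intro mult_left_mono power_mono mult_right_le_one_le) (auto simp: mult_le_cancel_left1)
      finally show ?thesis by (simp add: power_mult_distrib mult_right_mono mult.assoc[symmetric])
    qed (simp add: z)
  qed auto
  then have "u \<in> sobolev (2 * q)" using L by (simp add: sobolev_def)
  moreover have "is_multiplied (gevrey_symbol q \<tau>) (\<lambda>x. u x $ i) (\<lambda>x. Aexp q \<tau> u x $ i)" for i
  proof -
    have "fourier_coeff (\<lambda>x. Aexp q \<tau> u x $ i) k = gevrey_symbol q \<tau> k * fourier_coeff (\<lambda>x. u x $ i) k" for k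
    proof -
      have "fourier_coeff (\<lambda>x. Aexp q \<tau> u x $ i) k = vcoef (Aexp q \<tau> u) k $ i" by (simp add: vcoef_def)
      also have "\<dots> = (gevrey_symbol q \<tau> k *s vcoef u k) $ i" by (simp only: Aexp_spec(2)[OF s] gevrey_symbol_cscale)
      finally show ?thesis by (simp add: vcoef_def)
    qed
    then show ?thesis
      unfolding is_multiplied_def using L2_component[OF Aexp_spec(1)[OF s]] by simp
  qed
  ultimately show "u \<in> gevrey q \<tau>"
    using V Aexp_spec(1)[OF s] by (auto simp: gevrey_def V_space_iff)
qed

lemma gevrey_mult_mono:
  assumes "q' \<le> q" "\<tau>' \<le> \<tau>" "k \<noteq> 0"
  shows "gevrey_mult q' \<tau>' k \<le> gevrey_mult q \<tau> k"
  unfolding gevrey_mult_def using assms kn_ge_1[OF assms(3)]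
  by (intro mult_mono[of "kn k powr _"] powr_mono) (auto intro!: mult_right_mono)

lemma gevrey_summable:
  assumes u: "u \<in> gevrey q \<tau>" and q: "0 \<le> q" "q' \<le> q" and \<tau>: "0 \<le> \<tau>" "\<tau>' \<le> \<tau>"
  shows "is_l2 (\<lambda>k. gevrey_mult q' \<tau>' k * norm (vcoef u k))"
proof -
  have V: "voigt_class 1 u" and s: "is_l2 (\<lambda>k. gevrey_mult q \<tau> k * norm (vcoef u k))"
    using u gevrey_iff[OF q(1) \<tau>(1)] by auto
  then have z: "vcoef u 0 = 0" by (auto simp: voigt_class_def dest: solenoidal_seqD)
  show ?thesis
  proof (rule is_l2_comparison(1)[OF s])
    fix k :: "int^3"
    show "\<bar>gevrey_mult q' \<tau>' k * norm (vcoef u k)\<bar> \<le> gevrey_mult q \<tau> k * norm (vcoef u k)"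
      using gevrey_mult_mono[OF q(2) \<tau>(2), of k]
      by (cases "k = 0") (simp_all add: z abs_mult gevrey_mult_nonneg mult_right_mono)
  qed
qed

lemma gevrey_mult_nat:
  assumes "0 < r"
  shows "gevrey_mult (real r / 2) \<tau> k = kn k ^ r * exp (\<tau> * kn k)"
    "gevrey_mult (real r / 2 + 1/4) \<tau> k = kn k ^ r * sqrt (kn k) * exp (\<tau> * kn k)"
    "gevrey_mult ((real r + 1) / 2) \<tau> k = kn k ^ r * kn k * exp (\<tau> * kn k)"
proof -
  have p: "kn k powr real r = kn k ^ r" using assms by (simp add: powr_realpow')
  show "gevrey_mult (real r / 2) \<tau> k = kn k ^ r * exp (\<tau> * kn k)" by (simp add: gevrey_mult_def p)
  have "kn k powr (2 * (real r / 2 + 1/4)) = kn k powr real r * kn k powr (1/2)"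
    by (simp add: powr_add[symmetric])
  then show "gevrey_mult (real r / 2 + 1/4) \<tau> k = kn k ^ r * sqrt (kn k) * exp (\<tau> * kn k)"
    by (simp add: gevrey_mult_def p powr_half_sqrt)
  have "2 * ((real r + 1) / 2) = real r + 1" by simp
  then have "kn k powr (2 * ((real r + 1) / 2)) = kn k powr real r * kn k powr 1"
    by (simp only: powr_add)
  then show "gevrey_mult ((real r + 1) / 2) \<tau> k = kn k ^ r * kn k * exp (\<tau> * kn k)"
    by (simp add: gevrey_mult_def p)
qed

lemma L2_norm_matrix_rows:
  fixes G :: "real^3 \<Rightarrow> real^3^3"
  assumes "\<And>i. (\<lambda>x. G x $ i) \<in> L2"
  shows "(L2_norm G)^2 = (\<Sum>i\<in>UNIV. (L2_norm (\<lambda>x. G x $ i))^2)"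
proof -
  have "(LINT x|T3. (norm (G x))^2) = (LINT x|T3. (\<Sum>i\<in>UNIV. (norm (G x $ i))^2))"
    by (simp add: norm_vec_def[where 'b = 3] L2_set_def sum_nonneg)
  also have "\<dots> = (\<Sum>i\<in>UNIV. LINT x|T3. (norm (G x $ i))^2)"
    by (intro Bochner_Integration.integral_sum L2D(2) assms)
  finally show ?thesis by (simp add: L2_norm_def sum_nonneg Bochner_Integration.integral_nonneg)
qed

lemma L2_norm_Aexp_grad:
  assumes u: "is_l2 (\<lambda>k. kn k * norm (vcoef u k))"
    and s: "is_l2 (\<lambda>k. gevrey_mult q \<tau> k * (kn k * norm (vcoef u k)))"
  shows "(L2_norm (Aexp_mat q \<tau> (grad u)))^2 = (l2 (\<lambda>k. gevrey_mult q \<tau> k * (kn k * norm (vcoef u k))))^2"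
proof -
  have g: "vcoef (\<lambda>x. grad u x $ i) k = (\<chi> j. \<i> * of_real (freq k $ j) * vcoef u k $ i)" for i k
    by (simp add: vcoef_def[of "\<lambda>x. grad u x $ i"] grad_coeffs(2)[OF u])
  have ng: "norm (vcoef (\<lambda>x. grad u x $ i) k) = kn k * cmod (vcoef u k $ i)" for i k
    by (simp add: g norm_vec_def[of "\<chi> j. \<i> * of_real (freq k $ j) * vcoef u k $ i"] norm_mult L2_set_left_distrib[symmetric])
       (simp add: norm_vec_def L2_set_def)
  define f where "f i k = gevrey_mult q \<tau> k * (kn k * cmod (vcoef u k $ i))" for i k
  have sf: "is_l2 (f i)" for i
    by (rule is_l2_comparison(1)[OF s])
       (simp add: f_def abs_mult gevrey_mult_nonneg mult_left_mono Finite_Cartesian_Product.norm_nth_le)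
  have row: "Aexp q \<tau> (\<lambda>x. grad u x $ i) \<in> L2" "L2_norm (Aexp q \<tau> (\<lambda>x. grad u x $ i)) = l2 (f i)" for i
    using Aexp_spec(1,3)[of q \<tau> "\<lambda>x. grad u x $ i"] sf[of i] unfolding ng f_def by blast+
  have comp: "(\<lambda>x. Aexp_mat q \<tau> (grad u) x $ i) = Aexp q \<tau> (\<lambda>x. grad u x $ i)" for i
    by (simp add: mat_mult_def)
  have "(L2_norm (Aexp_mat q \<tau> (grad u)))^2 = (\<Sum>i\<in>UNIV. infsum (\<lambda>k. (f i k)^2) UNIV)"
    by (subst L2_norm_matrix_rows) (simp_all only: comp row l2_square)
  also have "\<dots> = infsum (\<lambda>k. \<Sum>i\<in>UNIV. (f i k)^2) UNIV"
  proof -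
    have "((\<lambda>k. \<Sum>i\<in>UNIV. (f i k)^2) has_sum (\<Sum>i\<in>UNIV. infsum (\<lambda>k. (f i k)^2) UNIV)) UNIV"
      by (intro has_sum_finite_sum has_sum_infsum) (use sf in \<open>auto simp: is_l2_def\<close>)
    then show ?thesis by (simp add: has_sum_iff)
  qed
  also have "\<dots> = infsum (\<lambda>k. (gevrey_mult q \<tau> k * (kn k * norm (vcoef u k)))^2) UNIV"
    by (intro infsum_cong)
       (simp add: f_def power_mult_distrib sum_distrib_left[symmetric] norm_vec_def[of "vcoef u _"] L2_set_def sum_nonneg)
  finally show ?thesis by (simp only: l2_square)
qed

text \<open>The two parts of the energy combine to the squared weight \<open>1 + \<alpha>\<^sup>2
  \<bar>k\<bar>\<^sup>2\<close> that relates the velocity to its phase space element.\<close>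

lemma voigt_energy_eq:
  assumes u: "u \<in> gevrey ((real r + 1) / 2) \<tau>" and r: "0 < r" and \<tau>: "0 \<le> \<tau>"
  shows "is_l2 (\<lambda>k. gevrey_weight r \<tau> (kn k) * norm (coeffs (sf \<alpha> u) k))"
    "voigt_energy \<alpha> (real r) \<tau> u = (l2 (\<lambda>k. gevrey_weight r \<tau> (kn k) * norm (coeffs (sf \<alpha> u) k)))^2"
proof -
  have q: "0 \<le> (real r + 1) / 2" by simp
  have V: "voigt_class 1 u" using u gevrey_iff[OF q \<tau>] by blast
  have Va: "voigt_class \<alpha> u" by (rule voigt_class_change(1)[OF V]) simp
  let ?G = "\<lambda>k. gevrey_weight r \<tau> (kn k)"
  have G: "gevrey_mult (real r / 2) \<tau> = ?G" by (simp add: fun_eq_iff gevrey_mult_nat[OF r] gevrey_weight_def)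
  have s0: "is_l2 (\<lambda>k. ?G k * norm (vcoef u k))"
    using gevrey_summable[OF u q _ \<tau> order_refl, of "real r / 2"] by (simp add: G)
  have s1: "is_l2 (\<lambda>k. ?G k * (kn k * norm (vcoef u k)))"
    using gevrey_summable[OF u q order_refl \<tau> order_refl] by (simp add: gevrey_mult_nat[OF r] gevrey_weight_def mult_ac)
  have k1: "is_l2 (\<lambda>k. kn k * norm (vcoef u k))"
    using gevrey_summable[OF u q _ \<tau> \<tau>, of "1/2"] by (simp add: gevrey_mult_def)
  have eq: "(?G k * norm (coeffs (sf \<alpha> u) k))^2 = \<alpha>^2 * (?G k * (kn k * norm (vcoef u k)))^2 + (?G k * norm (vcoef u k))^2" for k
    by (simp add: coeffs_sf[OF Va] power_mult_distrib vweight_square algebra_simps)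
  have sums: "(\<lambda>k. \<alpha>^2 * (?G k * (kn k * norm (vcoef u k)))^2) summable_on UNIV" "(\<lambda>k. (?G k * norm (vcoef u k))^2) summable_on UNIV"
    using s0 s1 unfolding is_l2_def by (auto intro: summable_on_cmult_right)
  show "is_l2 (\<lambda>k. ?G k * norm (coeffs (sf \<alpha> u) k))"
    unfolding is_l2_def eq using sums by (rule summable_on_add)
  have "voigt_energy \<alpha> (real r) \<tau> u = \<alpha>^2 * infsum (\<lambda>k. (?G k * (kn k * norm (vcoef u k)))^2) UNIV + infsum (\<lambda>k. (?G k * norm (vcoef u k))^2) UNIV"
    unfolding voigt_energy_def using L2_norm_Aexp_grad[OF k1, of "real r / 2" \<tau>] Aexp_spec(3)[of "real r / 2" \<tau> u] s0 s1
    by (simp add: G l2_square)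
  also have "\<dots> = infsum (\<lambda>k. (?G k * norm (coeffs (sf \<alpha> u) k))^2) UNIV"
    unfolding eq using sums by (simp add: infsum_add infsum_cmult_right')
  finally show "voigt_energy \<alpha> (real r) \<tau> u = (l2 (\<lambda>k. ?G k * norm (coeffs (sf \<alpha> u) k)))^2"
    by (simp only: l2_square)
qed

subsection \<open>The commutator estimate for vector fields\<close>

text \<open>\<open>\<bar>k\<bar>\<^sup>r \<le> 2\<^sup>r (\<bar>j\<bar>\<^sup>r + \<bar>k -
  j\<bar>\<^sup>r)\<close> puts the top order on one of the two fields, and the other one is summed in
  \<open>\<ell>\<^sup>1\<close>. By duality this shows that the
  Gevrey multiplier maps the advection term into \<open>L\<^sup>2\<close>, so that Parseval applies to the pairing in the
  commutator estimate.\<close>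

lemma transport_gevrey_bound:
  fixes p q c :: "int^3 \<Rightarrow> real"
  assumes p: "\<And>k. 0 \<le> p k" "p 0 = 0" and q: "\<And>k. 0 \<le> q k" "q 0 = 0" and r: "4 \<le> r" and \<tau>: "0 \<le> \<tau>"
    and sp: "is_l2 (\<lambda>k. kn k ^ r * exp (\<tau> * kn k) * p k)"
    and sq: "is_l2 (\<lambda>k. kn k ^ r * kn k * exp (\<tau> * kn k) * q k)"
  shows "(\<lambda>k. p k) summable_on UNIV"
    "\<exists>B\<ge>0. \<forall>c. (\<forall>k. 0 \<le> c k) \<longrightarrow> is_l2 c \<longrightarrow>
      (\<lambda>(k, j). p j * (kn (k - j) * q (k - j)) * (gevrey_weight r \<tau> (kn k) * c k)) summable_on UNIV \<and>
      infsum (\<lambda>(k, j). p j * (kn (k - j) * q (k - j)) * (gevrey_weight r \<tau> (kn k) * c k)) UNIV \<le> B * l2 c"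
proof -
  define e where "e k = exp (\<tau> * kn k)" for k
  have e1: "1 \<le> e k" for k using \<tau> by (simp add: e_def)
  have e0: "0 \<le> e k" for k using e1[of k] by linarith
  have sq': "is_l2 (\<lambda>k. kn k ^ r * exp (\<tau> * kn k) * q k)"
  proof (rule is_l2_comparison(1)[OF sq])
    fix k :: "int^3"
    have "kn k ^ r * exp (\<tau> * kn k) * q k * 1 \<le> kn k ^ r * exp (\<tau> * kn k) * q k * kn k"
    proof (cases "k = 0")
      case False
      show ?thesis by (rule mult_left_mono[OF kn_ge_1[OF False]]) (simp add: q(1))
    qed (simp add: q)
    then show "\<bar>kn k ^ r * exp (\<tau> * kn k) * q k\<bar> \<le> kn k ^ r * kn k * exp (\<tau> * kn k) * q k"
      using q(1)[of k] by (simp add: abs_mult mult_ac)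
  qed
  define a1 where "a1 k = kn k ^ r * e k * p k" for k
  define b1 where "b1 k = kn k * (e k * q k)" for k
  define a2 where "a2 k = e k * p k" for k
  define b2 where "b2 k = kn k ^ r * kn k * e k * q k" for k
  have nn: "0 \<le> a1 k" "0 \<le> b1 k" "0 \<le> a2 k" "0 \<le> b2 k" for k
    using p(1)[of k] q(1)[of k] e0[of k] by (auto simp: a1_def b1_def a2_def b2_def)
  have sa1: "is_l2 a1" and sb2: "is_l2 b2"
    using sp sq by (simp_all add: a1_def b2_def e_def[abs_def] cong: is_l2_def)
  have l1: "b1 summable_on UNIV"
  proof (rule summable_on_comparison_test[OF gevrey_l1_bound(1)[OF q r sq']])
    fix k :: "int^3"
    show "b1 k \<le> kn k * sqrt (kn k) * (exp (\<tau> * kn k) * q k)"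
      using q nn(2)[of k] kn_ge_1[of k]
      by (cases "k = 0") (simp_all add: b1_def e_def mult_right_mono mult_le_cancel_left1)
  qed (rule nn)
  have l2: "a2 summable_on UNIV"
  proof (rule summable_on_comparison_test[OF gevrey_l1_bound(1)[OF p r sp]])
    fix k :: "int^3"
    have "1 * 1 \<le> kn k * sqrt (kn k)" if "k \<noteq> 0" using kn_ge_1[OF that] by (intro mult_mono) auto
    then show "a2 k \<le> kn k * sqrt (kn k) * (exp (\<tau> * kn k) * p k)"
      using p nn(3)[of k] mult_right_mono[of 1 "kn k * sqrt (kn k)" "a2 k"]
      by (cases "k = 0") (simp_all add: a2_def e_def)
  qed (rule nn)
  show "(\<lambda>k. p k) summable_on UNIV"
  proof (rule summable_on_comparison_test[OF l2])
    show "p k \<le> a2 k" for k using mult_right_mono[OF e1[of k] p(1)[of k]] by (simp add: a2_def)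
  qed (rule p)
  define B where "B = 2 ^ r * (infsum b1 UNIV * l2 a1 + infsum a2 UNIV * l2 b2)"
  have B: "0 \<le> B" unfolding B_def by (intro mult_nonneg_nonneg add_nonneg_nonneg infsum_nonneg l2_nonneg nn) auto
  have "(\<lambda>(k, j). p j * (kn (k - j) * q (k - j)) * (gevrey_weight r \<tau> (kn k) * c k)) summable_on UNIV \<and>
      infsum (\<lambda>(k, j). p j * (kn (k - j) * q (k - j)) * (gevrey_weight r \<tau> (kn k) * c k)) UNIV \<le> B * l2 c"
    if c: "\<forall>k. 0 \<le> c k" "is_l2 c" for c
  proof -
    let ?F = "\<lambda>(k, j). p j * (kn (k - j) * q (k - j)) * (gevrey_weight r \<tau> (kn k) * c k)"
    let ?T1 = "\<lambda>(k, j). a1 j * b1 (k - j) * c k" and ?T2 = "\<lambda>(k, j). a2 j * b2 (k - j) * c k"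
    note T1 = trilinear_l2_l1_l2[OF l1 nn(2) sa1 c(2)] and T2 = trilinear_l1_l2_l2[OF l2 nn(3) sb2 c(2)]
    have F0: "0 \<le> ?F x" for x using p q c(1) by (cases x) (auto simp: gevrey_weight_def)
    have le: "?F x \<le> 2 ^ r * (?T1 x + ?T2 x)" for x
    proof (cases x)
      case (Pair k j)
      let ?K = "kn k" and ?J = "kn j" and ?M = "kn (k - j)"
      have "?K ^ r \<le> (?J + ?M) ^ r" by (intro power_mono kn_triangle) auto
      also have "\<dots> \<le> 2 ^ r * (?J ^ r + ?M ^ r)" by (rule power_sum_le) auto
      finally have 1: "?K ^ r \<le> 2 ^ r * (?J ^ r + ?M ^ r)" .
      have "e k \<le> e j * e (k - j)"
        using mult_left_mono[OF kn_triangle(1)[of k j] \<tau>] by (simp add: e_def exp_add[symmetric] distrib_left)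
      then have W: "gevrey_weight r \<tau> ?K \<le> 2 ^ r * (?J ^ r + ?M ^ r) * (e j * e (k - j))"
        unfolding gevrey_weight_def e_def[symmetric] using 1 e0 by (intro mult_mono) auto
      have "?F x = (p j * (?M * q (k - j)) * c k) * gevrey_weight r \<tau> ?K" by (simp add: Pair mult_ac)
      also have "\<dots> \<le> (p j * (?M * q (k - j)) * c k) * (2 ^ r * (?J ^ r + ?M ^ r) * (e j * e (k - j)))"
        using p(1) q(1) c(1) by (intro mult_left_mono[OF W]) auto
      also have "\<dots> = 2 ^ r * (?T1 x + ?T2 x)"
        by (simp add: Pair a1_def b1_def a2_def b2_def algebra_simps)
      finally show ?thesis .
    qed
    have s: "(\<lambda>x. 2 ^ r * (?T1 x + ?T2 x)) summable_on UNIV"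
      by (intro summable_on_cmult_right summable_on_add T1(1) T2(1))
    have sF: "?F summable_on UNIV" by (rule summable_on_comparison_test[OF s le F0])
    have "infsum ?F UNIV \<le> infsum (\<lambda>x. 2 ^ r * (?T1 x + ?T2 x)) UNIV" by (rule infsum_mono[OF sF s le])
    also have "\<dots> = 2 ^ r * (infsum ?T1 UNIV + infsum ?T2 UNIV)"
      by (simp only: infsum_cmult_right' infsum_add[OF T1(1) T2(1)])
    also have "\<dots> \<le> 2 ^ r * (infsum b1 UNIV * l2 a1 * l2 c + infsum a2 UNIV * l2 b2 * l2 c)"
      by (intro mult_left_mono add_mono T1(2) T2(2)) auto
    also have "\<dots> = B * l2 c" by (simp add: B_def algebra_simps)
    finally show ?thesis using sF by blast
  qed
  then show "\<exists>B\<ge>0. \<forall>c. (\<forall>k. 0 \<le> c k) \<longrightarrow> is_l2 c \<longrightarrow>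
      (\<lambda>(k, j). p j * (kn (k - j) * q (k - j)) * (gevrey_weight r \<tau> (kn k) * c k)) summable_on UNIV \<and>
      infsum (\<lambda>(k, j). p j * (kn (k - j) * q (k - j)) * (gevrey_weight r \<tau> (kn k) * c k)) UNIV \<le> B * l2 c"
    using B by (intro exI[of _ B]) blast
qed

text \<open>The pairing in the estimate is the trilinear form with the squared weight on the last argument.  Its
  antisymmetry in the last two arguments leaves only the commutator of the weight with the transport.\<close>

theorem commutator_estimate:
  assumes r: "4 \<le> r"
  shows "commutator_estimate (real r) (commutator_const1 r) (commutator_const2 r)"
  unfolding commutator_estimate_def
proof (intro allI ballI impI)
  fix \<tau> :: real and \<psi> \<phi> :: "real^3 \<Rightarrow> real^3"
  assume \<tau>: "0 \<le> \<tau>" and g\<psi>: "\<psi> \<in> gevrey (real r / 2 + 1/4) \<tau>" and g\<phi>: "\<phi> \<in> gevrey (real r / 2 + 1/2) \<tau>"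
  have r0: "0 < r" using r by simp
  have half: "real r / 2 + 1/2 = (real r + 1) / 2" by (simp add: field_simps)
  define p where "p k = norm (vcoef \<psi> k)" for k
  define q where "q k = norm (vcoef \<phi> k)" for k
  define W where "W k = gevrey_weight r \<tau> (kn k)" for k
  have V: "voigt_class 1 \<psi>" "voigt_class 1 \<phi>"
    using g\<psi> g\<phi> gevrey_iff[of "real r / 2 + 1/4" \<tau>] gevrey_iff[of "real r / 2 + 1/2" \<tau>] \<tau> by auto
  then have L: "\<psi> \<in> L2" "\<phi> \<in> L2" and sol: "solenoidal_seq (vcoef \<psi>)" "solenoidal_seq (vcoef \<phi>)"
    by (auto simp: voigt_class_def)
  have pq: "0 \<le> p k" "0 \<le> q k" "p 0 = 0" "q 0 = 0" for k
    using solenoidal_seqD[OF sol(1)] solenoidal_seqD[OF sol(2)] by (auto simp: p_def q_def)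
  have W0: "0 \<le> W k" for k by (simp add: W_def gevrey_weight_def)
  have Weven: "W (- k) = W k" for k by (simp add: W_def freq_minus)
  have mW: "gevrey_mult (real r / 2) \<tau> = W"
    by (simp add: fun_eq_iff gevrey_mult_nat[OF r0] W_def gevrey_weight_def)
  note G\<psi> = gevrey_summable[OF g\<psi> _ _ \<tau>, folded p_def] and G\<phi> = gevrey_summable[OF g\<phi> _ _ \<tau>, folded q_def]
  have sp: "is_l2 (\<lambda>k. kn k ^ r * exp (\<tau> * kn k) * p k)" "is_l2 (\<lambda>k. kn k ^ r * sqrt (kn k) * exp (\<tau> * kn k) * p k)"
    using G\<psi>[of "real r / 2" \<tau>] G\<psi>[of "real r / 2 + 1/4" \<tau>] by (simp_all add: gevrey_mult_nat[OF r0])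
  have sq: "is_l2 (\<lambda>k. kn k ^ r * exp (\<tau> * kn k) * q k)" "is_l2 (\<lambda>k. kn k ^ r * sqrt (kn k) * exp (\<tau> * kn k) * q k)"
    using G\<phi>[of "real r / 2" \<tau>] G\<phi>[of "real r / 2 + 1/4" \<tau>] by (simp_all add: gevrey_mult_nat[OF r0])
  have "is_l2 (\<lambda>k. gevrey_mult ((real r + 1) / 2) \<tau> k * q k)"
    by (rule G\<phi>) (simp_all only: half order_refl, simp)
  then have sq3: "is_l2 (\<lambda>k. kn k ^ r * kn k * exp (\<tau> * kn k) * q k)"
    by (simp only: gevrey_mult_nat[OF r0])
  have sp0: "is_l2 (\<lambda>k. gevrey_mult (real r / 2) 0 k * p k)"
    using G\<psi>[of "real r / 2" 0] \<tau> by simp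
  have sq0: "is_l2 (\<lambda>k. gevrey_mult (real r / 2) 0 k * q k)"
    using G\<phi>[of "real r / 2" 0] \<tau> by simp
  have k1: "is_l2 (\<lambda>k. kn k * norm (vcoef \<phi> k))"
    using G\<phi>[of "1/2" 0] \<tau> by (simp add: gevrey_mult_def q_def)
  note k0 = vcoef_is_l2[OF L(1)]
  have tb: "transport_bound (vcoef \<psi>) (vcoef \<phi>) k j = p j * (kn (k - j) * q (k - j))" for k j
    by (simp add: p_def q_def)
  note d = transport_gevrey_bound[OF pq(1,3,2,4) r \<tau> sp(1) sq3, folded W_def]
  obtain B where B: "0 \<le> B" and dual': "\<forall>c. (\<forall>k. 0 \<le> c k) \<longrightarrow> is_l2 c \<longrightarrow>
      (\<lambda>(k, j). p j * (kn (k - j) * q (k - j)) * (W k * c k)) summable_on UNIV \<and>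
      infsum (\<lambda>(k, j). p j * (kn (k - j) * q (k - j)) * (W k * c k)) UNIV \<le> B * l2 c"
    using d(2) by (elim exE conjE) (rule that, assumption+)
  note dual = dual'[rule_format]
  have b: "\<exists>B. AE x in T3. \<bar>\<psi> x $ i\<bar> \<le> B" for i
    by (rule AE_bounded_component[OF L(1)]) (use d(1) in \<open>simp add: p_def\<close>)
  note A = advection[OF L(1) b L(2) k1]
  have AL: "advection \<psi> \<phi> \<in> L2" using A(1) by (simp add: voigt_class_def)
  have sW: "is_l2 (\<lambda>k. W k * norm (advec (vcoef \<psi>) (vcoef \<phi>) k))"
    by (rule advec_is_l2(1)[OF k0 k1 B W0]) (simp only: tb, rule dual, auto)
  have sA: "is_l2 (\<lambda>k. W k * norm (vcoef (advection \<psi> \<phi>) k))"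
    by (rule is_l2_comparison(1)[OF sW]) (simp add: A(2) W0 mult_left_mono norm_lproj_le)
  have sWq: "is_l2 (\<lambda>k. W k * q k)" using sq(1) by (simp add: W_def gevrey_weight_def)
  note eA = Aexp_spec[of "real r / 2" \<tau> "advection \<psi> \<phi>", unfolded mW, OF sA]
  note e\<phi> = Aexp_spec[of "real r / 2" \<tau> \<phi>, unfolded mW, folded q_def, OF sWq]
  let ?\<eta> = "\<lambda>k. (W k)^2 *\<^sub>R vcoef \<phi> k"
  have s1: "(\<lambda>(k, j). transport_bound (vcoef \<psi>) (vcoef \<phi>) k j * norm (?\<eta> k)) summable_on UNIV"
  proof -
    have "(\<lambda>(k, j). p j * (kn (k - j) * q (k - j)) * (W k * (W k * q k))) summable_on UNIV"
      using dual[OF _ sWq] W0 pq by simp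
    moreover have "W k * (W k * q k) = norm (?\<eta> k)" for k by (simp add: q_def power2_eq_square)
    ultimately show ?thesis by (simp only: tb)
  qed
  have "L2_inner (Aexp (real r / 2) \<tau> (advection \<psi> \<phi>)) (Aexp (real r / 2) \<tau> \<phi>)
      = infsum (\<lambda>k. advec (vcoef \<psi>) (vcoef \<phi>) k \<bullet> ?\<eta> k) UNIV"
    unfolding L2_inner_eq[OF eA(1) e\<phi>(1)]
  proof (rule infsum_cong)
    fix k
    have "lproj k (advec (vcoef \<psi>) (vcoef \<phi>) k) \<bullet> vcoef \<phi> k = advec (vcoef \<psi>) (vcoef \<phi>) k \<bullet> vcoef \<phi> k"
      using solenoidal_seqD[OF sol(2)] by (intro inner_lproj) auto
    then show "vcoef (Aexp (real r / 2) \<tau> (advection \<psi> \<phi>)) k \<bullet> vcoef (Aexp (real r / 2) \<tau> \<phi>) k = advec (vcoef \<psi>) (vcoef \<phi>) k \<bullet> ?\<eta> k"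
      by (simp add: eA(2) e\<phi>(2) A(2) power2_eq_square)
  qed
  also have "\<dots> = trilinear (vcoef \<psi>) (vcoef \<phi>) ?\<eta>" by (rule trilinear_eq_advec(1)[OF k0 k1 s1])
  finally have inner: "L2_inner (Aexp (real r / 2) \<tau> (advection \<psi> \<phi>)) (Aexp (real r / 2) \<tau> \<phi>) = trilinear (vcoef \<psi>) (vcoef \<phi>) ?\<eta>" .
  note C = gevrey_commutator_sum[OF pq(1,3,2,4) r \<tau> sp(2) sq(2), folded W_def]
  define c where "c = commutator_const r * lattice_const (5/2)"
  let ?F = "\<lambda>(k, j). transport_bound (vcoef \<psi>) (vcoef \<phi>) k j * norm (vcoef \<phi> k) * \<bar>W k * (W k - W (k - j))\<bar>"
  have F: "?F = (\<lambda>(k, j). p j * (kn (k - j) * q (k - j)) * q k * (W k * \<bar>W k - W (k - j)\<bar>))"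
    by (simp only: tb q_def abs_mult abs_of_nonneg[OF W0])
  have s2: "?F summable_on UNIV" unfolding F by (rule C(1))
  have n: "L2_norm (Aexp (real r / 2) 0 \<psi>) = gnorm r 0 p" "L2_norm (Aexp (real r / 2) 0 \<phi>) = gnorm r 0 q"
    "L2_norm (Aexp (real r / 2) \<tau> \<psi>) = gnorm r \<tau> p" "L2_norm (Aexp (real r / 2) \<tau> \<phi>) = gnorm r \<tau> q"
    "L2_norm (Aexp (real r / 2 + 1/4) \<tau> \<psi>) = gnorm_half r \<tau> p" "L2_norm (Aexp (real r / 2 + 1/4) \<tau> \<phi>) = gnorm_half r \<tau> q"
    using sp sq sp0 sq0
    by (simp_all add: Aexp_spec(3) p_def q_def gnorm_def gnorm_half_def gevrey_mult_nat[OF r0])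
  have nn: "0 \<le> gnorm r t f" "0 \<le> gnorm_half r t f" for t f by (auto simp: gnorm_def gnorm_half_def l2_nonneg)
  have cc: "2 * c \<le> commutator_const1 r" "4 * c \<le> commutator_const2 r"
    using commutator_consts(1)[of r] by (simp_all add: c_def commutator_const1_def commutator_const2_def)
  have "\<bar>trilinear (vcoef \<psi>) (vcoef \<phi>) ?\<eta>\<bar> \<le> infsum ?F UNIV"
    by (rule trilinear_commutator[OF sol(1) vcoef_minus Weven s1 s2])
  also have "\<dots> \<le> (2 * c) * gnorm r 0 p * (gnorm r 0 q)^2
      + \<tau> * (4 * c) * (gnorm r \<tau> p * (gnorm_half r \<tau> q)^2 + gnorm_half r \<tau> p * gnorm r \<tau> q * gnorm_half r \<tau> q)"
    unfolding F c_def by (rule C(2))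
  also have "\<dots> \<le> commutator_const1 r * gnorm r 0 p * (gnorm r 0 q)^2
      + \<tau> * commutator_const2 r * (gnorm r \<tau> p * (gnorm_half r \<tau> q)^2 + gnorm_half r \<tau> p * gnorm r \<tau> q * gnorm_half r \<tau> q)"
    using cc nn \<tau> by (intro add_mono mult_right_mono mult_left_mono add_nonneg_nonneg mult_nonneg_nonneg) auto
  finally show "\<bar>L2_inner (Aexp (real r / 2) \<tau> (advection \<psi> \<phi>)) (Aexp (real r / 2) \<tau> \<phi>)\<bar>
      \<le> commutator_const1 r * L2_norm (Aexp (real r / 2) 0 \<psi>) * (L2_norm (Aexp (real r / 2) 0 \<phi>))^2
        + \<tau> * commutator_const2 r *
          (L2_norm (Aexp (real r / 2) \<tau> \<psi>) * (L2_norm (Aexp (real r / 2 + 1/4) \<tau> \<phi>))^2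
           + L2_norm (Aexp (real r / 2 + 1/4) \<tau> \<psi>) * L2_norm (Aexp (real r / 2) \<tau> \<phi>)
             * L2_norm (Aexp (real r / 2 + 1/4) \<tau> \<phi>))"
    unfolding inner n .
qed

subsection \<open>Gevrey regularity of the Euler--Voigt flow\<close>

text \<open>The Voigt weight accounts for the additional derivative.\<close>

lemma velocity_gevrey:
  assumes \<alpha>: "0 < \<alpha>" and r: "0 < r" and \<tau>: "0 \<le> \<tau>"
    and s: "is_l2 (\<lambda>k. gevrey_weight r \<tau> (kn k) * norm (coeffs b k))"
  shows "velocity \<alpha> b \<in> gevrey ((real r + 1) / 2) \<tau>"
proof -
  have "is_l2 (\<lambda>k. gevrey_mult ((real r + 1) / 2) \<tau> k * norm (vfield \<alpha> b k))"
  proof (rule is_l2_comparison(1)[OF is_l2_cmult(1)[OF s, of "1 / \<alpha>"]])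
    fix k
    have "kn k * norm (vfield \<alpha> b k) \<le> (vweight \<alpha> k / \<alpha>) * norm (vfield \<alpha> b k)"
      by (intro mult_right_mono kn_le_vweight[OF \<alpha>]) auto
    also have "\<dots> = 1 / \<alpha> * norm (coeffs b k)" by (simp add: norm_vfield)
    finally have "gevrey_weight r \<tau> (kn k) * (kn k * norm (vfield \<alpha> b k)) \<le> gevrey_weight r \<tau> (kn k) * (1 / \<alpha> * norm (coeffs b k))"
      by (rule mult_left_mono) (simp add: gevrey_weight_def)
    then show "\<bar>gevrey_mult ((real r + 1) / 2) \<tau> k * norm (vfield \<alpha> b k)\<bar> \<le> 1 / \<alpha> * (gevrey_weight r \<tau> (kn k) * norm (coeffs b k))"
      by (simp add: gevrey_mult_nat[OF r] gevrey_weight_def abs_mult mult_ac)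
  qed
  then show ?thesis
    using \<tau> by (subst gevrey_iff) (simp_all add: velocity[OF \<alpha>])
qed

text \<open>The growth constant may depend on the data only through the Sobolev norm of order
  \<open>r\<close>; this is enough since \<open>\<bar>k\<bar>\<^bsup>2(r-1)\<^esup> (1 + \<alpha>\<^sup>2
  \<bar>k\<bar>\<^sup>2) \<le> (1 + \<alpha>\<^sup>2) (1 +
  \<bar>k\<bar>\<^sup>2)\<^sup>r\<close>.\<close>

lemma initial_bounds:
  fixes \<alpha> :: real
  assumes u: "u \<in> gevrey ((real r + 1) / 2) \<sigma>" and r: "0 < r" and \<sigma>: "0 \<le> \<sigma>"
  defines "M \<equiv> (1 + \<alpha>^2) * (sobolev_norm (real r) u)^2"
  shows "(norm (sf \<alpha> u))^2 \<le> M" "is_l2 (\<lambda>k. kn k ^ (r - 1) * norm (coeffs (sf \<alpha> u) k))"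
    "(l2 (\<lambda>k. kn k ^ (r - 1) * norm (coeffs (sf \<alpha> u) k)))^2 \<le> M"
proof -
  have V: "voigt_class 1 u" using u gevrey_iff[of "(real r + 1) / 2" \<sigma>] \<sigma> by simp
  have Va: "voigt_class \<alpha> u" by (rule voigt_class_change(1)[OF V]) simp
  have e: "2 * ((real r + 1) / 2) = real r + 1" by simp
  have pw: "(1 + (kn k)^2) powr real r = (1 + (kn k)^2) ^ r" for k
    using one_plus_square_pos[of "kn k"] by (simp add: powr_realpow)
  have "sobolev_term (real r + 1) u summable_on UNIV" using u unfolding gevrey_def sobolev_def e by blast
  then have s: "sobolev_term (real r) u summable_on UNIV"
  proof (rule summable_on_comparison_test)
    show "sobolev_term (real r) u k \<le> sobolev_term (real r + 1) u k" for k
      unfolding sobolev_term_vcoef by (intro mult_right_mono powr_mono) auto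
  qed (simp add: sobolev_term_vcoef)
  have nu: "(sobolev_norm (real r) u)^2 = infsum (sobolev_term (real r) u) UNIV"
    unfolding sobolev_norm_def by (rule real_sqrt_pow2) (simp add: infsum_nonneg sobolev_term_vcoef)
  have key: "is_l2 (\<lambda>k. kn k ^ n * norm (coeffs (sf \<alpha> u) k)) \<and> (l2 (\<lambda>k. kn k ^ n * norm (coeffs (sf \<alpha> u) k)))^2 \<le> M"
    if n: "n \<le> r - 1" for n
  proof -
    have le: "(kn k ^ n * norm (coeffs (sf \<alpha> u) k))^2 \<le> (1 + \<alpha>^2) * sobolev_term (real r) u k" for k
    proof -
      have "(kn k ^ n)^2 = ((kn k)^2) ^ n" by (simp add: power_mult[symmetric] mult.commute)
      also have "\<dots> \<le> (1 + (kn k)^2) ^ n" by (rule power_mono) auto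
      also have "\<dots> \<le> (1 + (kn k)^2) ^ (r - 1)" using n by (intro power_increasing) auto
      finally have 1: "(kn k ^ n)^2 \<le> (1 + (kn k)^2) ^ (r - 1)" .
      have 2: "(vweight \<alpha> k)^2 \<le> (1 + \<alpha>^2) * (1 + (kn k)^2)" by (simp add: vweight_square algebra_simps)
      have "(kn k ^ n)^2 * (vweight \<alpha> k)^2 \<le> (1 + (kn k)^2) ^ (r - 1) * ((1 + \<alpha>^2) * (1 + (kn k)^2))"
        by (intro mult_mono 1 2) auto
      also have "\<dots> = (1 + \<alpha>^2) * (1 + (kn k)^2) ^ r" using r by (cases r) (simp_all add: mult_ac)
      finally have "(kn k ^ n)^2 * (vweight \<alpha> k)^2 * (norm (vcoef u k))^2 \<le> (1 + \<alpha>^2) * (1 + (kn k)^2) ^ r * (norm (vcoef u k))^2"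
        by (rule mult_right_mono) auto
      then show ?thesis by (simp add: coeffs_sf[OF Va] sobolev_term_vcoef pw power_mult_distrib mult.assoc)
    qed
    have S: "(\<lambda>k. (1 + \<alpha>^2) * sobolev_term (real r) u k) summable_on UNIV" using s by (rule summable_on_cmult_right)
    have ss: "(\<lambda>k. (kn k ^ n * norm (coeffs (sf \<alpha> u) k))^2) summable_on UNIV"
      by (rule summable_on_comparison_test[OF S le]) auto
    have "infsum (\<lambda>k. (kn k ^ n * norm (coeffs (sf \<alpha> u) k))^2) UNIV \<le> infsum (\<lambda>k. (1 + \<alpha>^2) * sobolev_term (real r) u k) UNIV"
      by (rule infsum_mono[OF ss S le])
    also have "\<dots> = M" by (simp only: M_def nu infsum_cmult_right')
    finally show ?thesis using ss by (simp add: is_l2_def l2_square)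
  qed
  show "(norm (sf \<alpha> u))^2 \<le> M" using key[of 0] by (simp add: norm_sfield_l2)
  show "is_l2 (\<lambda>k. kn k ^ (r - 1) * norm (coeffs (sf \<alpha> u) k))" "(l2 (\<lambda>k. kn k ^ (r - 1) * norm (coeffs (sf \<alpha> u) k)))^2 \<le> M"
    using key[of "r - 1"] by auto
qed

lemma gevrey_radius_eq:
  "gevrey_radius r \<kappa> \<sigma> E \<bar>t\<bar> = \<sigma> * exp (- commutator_const2 r * integral {0..\<bar>t\<bar>}
    (\<lambda>t. sqrt (1 + E + 2 * commutator_const1 r * integral {0..\<bar>t\<bar>} (\<lambda>s. \<kappa> s ^ 3))))"
proof -
  have "integral {0..\<bar>t\<bar>} (\<lambda>s. sqrt (1 + gevrey_budget r \<kappa> E s))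
      = integral {0..\<bar>t\<bar>} (\<lambda>t. sqrt (1 + E + 2 * commutator_const1 r * integral {0..\<bar>t\<bar>} (\<lambda>s. \<kappa> s ^ 3)))"
    by (rule integral_cong) (simp add: gevrey_budget_def primitive_nonneg_eq add.assoc)
  then show ?thesis by (simp add: gevrey_radius_def primitive_nonneg_eq)
qed

lemma gevrey_solution:
  fixes \<alpha> \<sigma> :: real and \<kappa> \<tau> :: "real \<Rightarrow> real"
  assumes \<alpha>: "0 < \<alpha>" and r: "4 \<le> r" "0 < r"
    and \<sigma>: "0 \<le> \<sigma>" and u_in: "u_in \<in> gevrey ((real r + 1) / 2) \<sigma>"
    and \<kappa>: "\<kappa> = (\<lambda>\<xi>. bound_const \<alpha> r ((1 + \<alpha>^2) * (sobolev_norm (real r) u_in)^2) * (1 + \<bar>\<xi>\<bar>) powr bound_exponent r)"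
    and \<tau>: "\<And>t. \<tau> t = gevrey_radius r \<kappa> \<sigma> (voigt_energy \<alpha> (real r) \<sigma> u_in) \<bar>t\<bar>"
  shows "\<exists>u. euler_voigt_solution \<alpha> u_in (-\<infinity>) \<infinity> u \<and>
    (\<forall>w. euler_voigt_solution \<alpha> u_in (-\<infinity>) \<infinity> w \<longrightarrow> (\<forall>t. AE x in T3. w t x = u t x)) \<and>
    (\<forall>t. L2_norm (Aexp (real r / 2) 0 (u t)) \<le> \<kappa> t \<and>
         u t \<in> gevrey ((real r + 1) / 2) (\<tau> t) \<and>
         voigt_energy \<alpha> (real r) (\<tau> t) (u t)
           \<le> voigt_energy \<alpha> (real r) \<sigma> u_in + 2 * commutator_const1 r * integral {0..\<bar>t\<bar>} (\<lambda>\<xi>. \<kappa> \<xi> ^ 3))"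
proof -
  define E where "E = voigt_energy \<alpha> (real r) \<sigma> u_in"
  have u0: "voigt_class 1 u_in" using u_in gevrey_iff[of "(real r + 1) / 2" \<sigma>] \<sigma> by simp
  obtain b where b: "quadratic_flow (voigt_op \<alpha>) b" "b 0 = sf \<alpha> u_in"
    and sol: "euler_voigt_solution \<alpha> u_in (-\<infinity>) \<infinity> (\<lambda>t. velocity \<alpha> (b t))"
    and uni: "\<And>w t. euler_voigt_solution \<alpha> u_in (-\<infinity>) \<infinity> w \<Longrightarrow> AE x in T3. w t x = velocity \<alpha> (b t) x"
    by (rule euler_voigt_solution_exists_unique[OF \<alpha> u0]) (rule that, assumption+)
  note i = initial_bounds[OF u_in r(2) \<sigma>, of \<alpha>]
  note e0 = voigt_energy_eq[OF u_in r(2) \<sigma>, of \<alpha>]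
  note est = voigt_flow_estimates[OF \<alpha> r(1) b(1), unfolded b(2), OF i \<sigma> e0(1) e0(2)[symmetric],
      folded \<kappa>]
  have \<tau>0: "0 \<le> \<tau> t" for t using \<sigma> by (simp add: \<tau> gevrey_radius_def)
  have bounds: "L2_norm (Aexp (real r / 2) 0 (velocity \<alpha> (b t))) \<le> \<kappa> t \<and>
      velocity \<alpha> (b t) \<in> gevrey ((real r + 1) / 2) (\<tau> t) \<and>
      voigt_energy \<alpha> (real r) (\<tau> t) (velocity \<alpha> (b t)) \<le> E + 2 * commutator_const1 r * integral {0..\<bar>t\<bar>} (\<lambda>\<xi>. \<kappa> \<xi> ^ 3)" for t
  proof (intro conjI)
    show g: "velocity \<alpha> (b t) \<in> gevrey ((real r + 1) / 2) (\<tau> t)"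
      by (rule velocity_gevrey[OF \<alpha> r(2) \<tau>0]) (use est(2)[of t] in \<open>simp add: \<tau>\<close>)
    have s: "is_l2 (\<lambda>k. gevrey_mult (real r / 2) 0 k * norm (vcoef (velocity \<alpha> (b t)) k))"
      by (rule gevrey_summable[OF g _ _ \<tau>0 \<tau>0]) auto
    show "L2_norm (Aexp (real r / 2) 0 (velocity \<alpha> (b t))) \<le> \<kappa> t"
      using est(1)[of t] unfolding Aexp_spec(3)[OF s] by (simp add: gevrey_mult_nat[OF r(2)] velocity(1)[OF \<alpha>] \<kappa>)
    show "voigt_energy \<alpha> (real r) (\<tau> t) (velocity \<alpha> (b t)) \<le> E + 2 * commutator_const1 r * integral {0..\<bar>t\<bar>} (\<lambda>\<xi>. \<kappa> \<xi> ^ 3)"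
      using est(3)[of t] unfolding voigt_energy_eq(2)[OF g r(2) \<tau>0] velocity(3)[OF \<alpha>]
      by (simp add: \<tau> E_def gevrey_budget_def primitive_nonneg_eq)
  qed
  show ?thesis
    by (rule exI[of _ "\<lambda>t. velocity \<alpha> (b t)"], intro conjI allI impI sol uni)
      (use bounds in \<open>simp_all add: E_def\<close>)
qed

theorem theorem4p2:
  fixes r :: nat
  assumes "r > 3"
  shows "\<exists>c1>0. \<exists>c2>0. commutator_estimate (real r) c1 c2 \<and>
    (\<forall>\<alpha>>0. \<exists>C::real \<Rightarrow> real. (\<forall>\<nu>. C \<nu> > 0) \<and>
      (\<forall>\<sigma>\<ge>0. \<forall>u_in\<in>gevrey ((real r + 1) / 2) \<sigma>.
        let p = 5 * (3/2) ^ (r - 3) - 1 :: real;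
            \<kappa> = (\<lambda>\<xi>::real. C (sobolev_norm (real r) u_in) * (1 + \<bar>\<xi>\<bar>) powr p);
            h = (\<lambda>t::real. sqrt (1 + voigt_energy \<alpha> (real r) \<sigma> u_in
                              + 2 * c1 * integral {0..\<bar>t\<bar>} (\<lambda>\<theta>. \<kappa> \<theta> ^ 3)));
            \<tau> = (\<lambda>t::real. \<sigma> * exp (- c2 * integral {0..\<bar>t\<bar>} h))
        in \<exists>u. euler_voigt_solution \<alpha> u_in (-\<infinity>) \<infinity> u \<and>
             (\<forall>w. euler_voigt_solution \<alpha> u_in (-\<infinity>) \<infinity> w \<longrightarrow>
                  (\<forall>t. AE x in T3. w t x = u t x)) \<and>
             (\<forall>t. L2_norm (Aexp (real r / 2) 0 (u t)) \<le> \<kappa> t \<and>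
                  u t \<in> gevrey ((real r + 1) / 2) (\<tau> t) \<and>
                  voigt_energy \<alpha> (real r) (\<tau> t) (u t)
                    \<le> voigt_energy \<alpha> (real r) \<sigma> u_in
                       + 2 * c1 * integral {0..\<bar>t\<bar>} (\<lambda>\<xi>. \<kappa> \<xi> ^ 3))))"
proof -
  have r: "4 \<le> r" "0 < r" using assms by auto
  define C where "C \<alpha> \<nu> = bound_const \<alpha> r ((1 + \<alpha>^2) * \<nu>^2)" for \<alpha> \<nu>
  have C: "0 < C \<alpha> \<nu>" if "0 < \<alpha>" for \<alpha> \<nu> unfolding C_def by (rule bound_const_pos[OF that])
  note main = gevrey_solution[OF _ r, folded C_def]
  show ?thesis
    by (rule exI[of _ "commutator_const1 r"], rule conjI[OF commutator_consts(2)],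
        rule exI[of _ "commutator_const2 r"], rule conjI[OF commutator_consts(3)],
        rule conjI[OF commutator_estimate[OF r(1)]], intro allI impI, rule exI, rule conjI, rule allI, erule C,
        intro allI impI ballI, unfold Let_def, rule main, assumption+)
       (simp_all only: bound_exponent_def gevrey_radius_eq)
qed

end
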